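(* Let $n\ge 2$, let $\Theta(0)\in S_{n-1}\subset\mathbb{R}^n$ be a fixed point, and let $(\Theta^{(k)},B^{(k)})$, $k=1,2,\ldots$, be independent and identically distributed, where $B^{(k)}$ is an $n$-dimensional Brownian motion and $\Theta^{(k)}$ is the Brownian motion in the unit sphere $S_{n-1}$ started at $\Theta^{(k)}_0=\Theta(0)$ and solving $$\Theta^{(k)}_t=\Theta(0)+\int_0^t\sigma^{0,1}(\Theta^{(k)}_s)\cdot dB^{(k)}_s-\frac{n-1}{2}\int_0^t \Theta^{(k)}_s\,ds ,\qquad t\ge 0 .$$ For $K\ge1$ and $t\ge0$ put $$M^K_t=\frac{1}{\sqrt K}\sum_{k=1}^K\int_0^t\sigma^{0,1}(\Theta^{(k)}_s)\cdot dB^{(k)}_s,\qquad Z^K_t=\frac{1}{\sqrt K}\sum_{k=1}^K\left(\Theta^{(k)}_t-E[\Theta^{(k)}_t]\right).$$ Then: (a) The sequence of martingales $(M^K_t,t\ge0)$ converges in law, as $K\to\infty$, towards $$M^{(\infty)}_t=\sqrt{1-\frac1n}\left\{\Theta(0)\int_0^t\sqrt{1-e^{-ns}}\,d\beta_s+\int_0^t\sqrt{1+\frac{e^{-ns}}{n-1}}\,dB'_s\right\},\qquad t\ge 0,$$ where $(\beta_s,s\ge0)$ is a one-dimensional Brownian motion, $(B'_s,s\ge0)$ is an $(n-1)$-dimensional Brownian motion taking values in the hyperplane of $\mathbb{R}^n$ orthogonal to $\Theta(0)$, and $B'$ is independent of $\beta$. (b) Consequently, $(Z^K_t,t\ge0)$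 converges in law, as $K\to\infty$, towards $$Z^{(\infty)}_t=\exp\left(-\frac{n-1}{2}t\right)\int_0^t\exp\left(\frac{n-1}{2}s\right)dM^{(\infty)}_s,\qquad t\ge0.$$
   Context: $S_{n-1}=\{x\in\mathbb{R}^n:|x|=1\}$. For $x\in S_{n-1}$, $\sigma^{0,1}(x)$ is the $n\times n$ matrix $(\delta_{i,j}-x_ix_j)_{i,j\le n}$, i.e. the orthogonal projection onto the hyperplane orthogonal to $x$. Convergence in law is that of continuous $\mathbb{R}^n$-valued processes indexed by $t\ge0$ (on $C([0,\infty),\mathbb{R}^n)$ with the topology of uniform convergence on compact sets). *)

theory Defs
  imports "HOL-Probability.Probability"
begin

text \<open>Processes are functions \<open>X t \<omega>\<close> of a real time \<open>t\<close> of which only the values for \<open>t \<ge> 0\<close>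
  matter; \<open>path_space\<close> is the set of continuous functions on \<open>{0..}\<close>, extended by \<open>undefined\<close>, and
  \<open>trajectory\<close> cuts the negative times off.\<close>

definition path_space :: "(real \<Rightarrow> 'e::metric_space) set" where
  "path_space = {f \<in> extensional {0..}. continuous_on {0..} f}"

definition path_topology :: "(real \<Rightarrow> 'e::metric_space) topology" where
  "path_topology = topology (\<lambda>U. U \<subseteq> path_space \<and>
     (\<forall>f\<in>U. \<exists>T\<ge>0. \<exists>\<epsilon>>0. \<forall>g\<in>path_space. (\<forall>t\<in>{0..T}. dist (g t) (f t) < \<epsilon>) \<longrightarrow> g \<in> U))"

lemma openin_path_topology:
  "openin path_topology U \<longleftrightarrow> U \<subseteq> (path_space :: (real \<Rightarrow> 'e::metric_space) set) \<and>
     (\<forall>f\<in>U. \<exists>T\<ge>0. \<exists>\<epsilon>>0. \<forall>g\<in>path_space. (\<forall>t\<in>{0..T}. dist (g t) (f t) < \<epsilon>) \<longrightarrow> g \<in> U)"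
  (is "_ \<longleftrightarrow> ?P U")
proof -
  have int: "?P (U \<inter> V)" if U: "?P U" and V: "?P V" for U V
  proof (intro conjI ballI)
    show "U \<inter> V \<subseteq> path_space" using U by blast
    fix f assume f: "f \<in> U \<inter> V"
    obtain S d where 1: "S \<ge> 0" "d > 0"
      "\<And>g. g \<in> path_space \<Longrightarrow> (\<forall>t\<in>{0..S}. dist (g t) (f t) < d) \<Longrightarrow> g \<in> U"
      using U f by (metis IntD1)
    obtain T e where 2: "T \<ge> 0" "e > 0"
      "\<And>g. g \<in> path_space \<Longrightarrow> (\<forall>t\<in>{0..T}. dist (g t) (f t) < e) \<Longrightarrow> g \<in> V"
      using V f by (metis IntD2)
    have "\<forall>g\<in>path_space. (\<forall>t\<in>{0..max S T}. dist (g t) (f t) < min d e) \<longrightarrow> g \<in> U \<inter> V"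
      using 1(3) 2(3) by (simp add: le_max_iff_disj)
    moreover have "max S T \<ge> 0" "min d e > 0" using 1 2 by auto
    ultimately show "\<exists>T\<ge>0. \<exists>\<epsilon>>0. \<forall>g\<in>path_space.
        (\<forall>t\<in>{0..T}. dist (g t) (f t) < \<epsilon>) \<longrightarrow> g \<in> U \<inter> V"
      by blast
  qed
  have un: "?P (\<Union>\<U>)" if "\<forall>U\<in>\<U>. ?P U" for \<U>
  proof (intro conjI ballI)
    show "\<Union>\<U> \<subseteq> path_space" using that by blast
    fix f assume "f \<in> \<Union>\<U>"
    then obtain U where U: "U \<in> \<U>" "f \<in> U" by blast
    have "?P U" using that U(1) by (rule bspec)
    then obtain T e where "T \<ge> 0" "e > 0"
      "\<forall>g\<in>path_space. (\<forall>t\<in>{0..T}. dist (g t) (f t) < e) \<longrightarrow> g \<in> U"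
      using U(2) by fast
    then show "\<exists>T\<ge>0. \<exists>\<epsilon>>0. \<forall>g\<in>path_space. (\<forall>t\<in>{0..T}. dist (g t) (f t) < \<epsilon>) \<longrightarrow> g \<in> \<Union>\<U>"
      using U by blast
  qed
  have "istopology ?P"
    unfolding istopology_def
  proof (rule conjI)
    show "\<forall>S T. ?P S \<longrightarrow> ?P T \<longrightarrow> ?P (S \<inter> T)" using int by presburger
    show "\<forall>\<K>. (\<forall>K\<in>\<K>. ?P K) \<longrightarrow> ?P (\<Union>\<K>)" using un by presburger
  qed
  then show ?thesis
    unfolding path_topology_def by (simp only: topology_inverse')
qed

lemma topspace_path_topology: "topspace path_topology = path_space"
proof -
  have "openin path_topology path_space"
    unfolding openin_path_topology by (auto intro!: exI[of _ "0::real"] exI[of _ "1::real"])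
  then show ?thesis
    using openin_path_topology openin_subset openin_topspace by (metis subset_antisym)
qed

definition path_borel :: "(real \<Rightarrow> 'e::metric_space) measure" where
  "path_borel = sigma path_space {U. openin path_topology U}"

definition trajectory :: "(real \<Rightarrow> 'w \<Rightarrow> 'e) \<Rightarrow> 'w \<Rightarrow> (real \<Rightarrow> 'e)" where
  "trajectory X \<omega> = (\<lambda>t\<in>{0..}. X t \<omega>)"

definition law :: "'w measure \<Rightarrow> (real \<Rightarrow> 'w \<Rightarrow> 'e::metric_space) \<Rightarrow> (real \<Rightarrow> 'e) measure" where
  "law M X = distr M path_borel (trajectory X)"

text \<open>The measurability clauses say that the processes are random elements of the path space;
  without them the push-forward measures in \<open>law\<close> would be meaningless.\<close>

definition converges_in_law ::
  "'w measure \<Rightarrow> (nat \<Rightarrow> real \<Rightarrow> 'w \<Rightarrow> 'e::metric_space) \<Rightarrow> 'v measure \<Rightarrow> (real \<Rightarrow> 'v \<Rightarrow> 'e) \<Rightarrow> bool"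
where
  "converges_in_law M X N Y \<longleftrightarrow>
     (\<forall>K. trajectory (X K) \<in> measurable M path_borel) \<and>
     trajectory Y \<in> measurable N path_borel \<and>
     (\<forall>\<phi>. continuous_map path_topology euclideanreal \<phi> \<longrightarrow>
          (\<exists>C. \<forall>f\<in>path_space. \<bar>\<phi> f\<bar> \<le> C) \<longrightarrow>
          (\<lambda>K. \<integral>f. \<phi> f \<partial>law M (X K)) \<longlonglongrightarrow> (\<integral>f. \<phi> f \<partial>law N Y))"

definition filtered_by :: "'w measure \<Rightarrow> (real \<Rightarrow> 'w measure) \<Rightarrow> bool" where
  "filtered_by M F \<longleftrightarrow> filtration (space M) F \<and> (\<forall>t. subalgebra M (F t))"

definition adapted :: "(real \<Rightarrow> 'w measure) \<Rightarrow> (real \<Rightarrow> 'w \<Rightarrow> 'e::topological_space) \<Rightarrow> bool" where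
  "adapted F X \<longleftrightarrow> (\<forall>t\<ge>0. X t \<in> borel_measurable (F t))"

definition continuous_process :: "'w measure \<Rightarrow> (real \<Rightarrow> 'w \<Rightarrow> 'e::topological_space) \<Rightarrow> bool" where
  "continuous_process M X \<longleftrightarrow>
     (\<forall>t\<ge>0. X t \<in> borel_measurable M) \<and> (\<forall>\<omega>\<in>space M. continuous_on {0..} (\<lambda>t. X t \<omega>))"

text \<open>Standard Brownian motion with values in a linear subspace \<open>V\<close>, of dimension \<open>dim V\<close>, with
  respect to the filtration \<open>F\<close>: the increment over \<open>[s,t]\<close> is independent of \<open>F s\<close> and
  centred Gaussian on \<open>V\<close> with covariance \<open>(t - s) Id\<^sub>V\<close>, i.e. its component along every unit vector
  of \<open>V\<close> has the law \<open>N(0, t - s)\<close>.  (The second parameter of \<open>normal_density\<close> is the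
  standard deviation.)\<close>

definition brownian_motion ::
  "'w measure \<Rightarrow> (real \<Rightarrow> 'w measure) \<Rightarrow> 'e::euclidean_space set \<Rightarrow> (real \<Rightarrow> 'w \<Rightarrow> 'e) \<Rightarrow> bool"
where
  "brownian_motion M F V W \<longleftrightarrow>
     filtered_by M F \<and> adapted F W \<and> continuous_process M W \<and>
     (\<forall>\<omega>\<in>space M. \<forall>t\<ge>0. W t \<omega> \<in> V) \<and>
     (AE \<omega> in M. W 0 \<omega> = 0) \<and>
     (\<forall>s t. 0 \<le> s \<and> s < t \<longrightarrow>
        prob_space.indep_set M (sets (F s))
          (sets (vimage_algebra (space M) (\<lambda>\<omega>. W t \<omega> - W s \<omega>) borel)) \<and>
        (\<forall>u\<in>V. norm u = 1 \<longrightarrow>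
           distributed M lborel (\<lambda>\<omega>. u \<bullet> (W t \<omega> - W s \<omega>)) (normal_density 0 (sqrt (t - s)))))"

text \<open>Elementary predictable processes
  \<open>\<Sum>i<p. \<xi> i \<cdot> 1\<close> on \<open>{\<tau> i<..\<tau> (Suc i)}\<close>, and their integrals.  The product of a value of the
  integrand with an increment of the integrator is a parameter \<open>pr\<close>: below it is
  scalar multiplication or matrix-vector multiplication.\<close>

definition elementary ::
  "'w measure \<Rightarrow> (real \<Rightarrow> 'w measure) \<Rightarrow> nat \<Rightarrow> (nat \<Rightarrow> real) \<Rightarrow> (nat \<Rightarrow> 'w \<Rightarrow> 'h::real_normed_vector) \<Rightarrow> bool"
where
  "elementary M F p \<tau> \<xi> \<longleftrightarrow> 0 \<le> \<tau> 0 \<and>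
     (\<forall>i<p. \<tau> i \<le> \<tau> (Suc i) \<and> \<xi> i \<in> borel_measurable (F (\<tau> i)) \<and>
            (\<exists>C. \<forall>\<omega>\<in>space M. norm (\<xi> i \<omega>) \<le> C))"

definition elementary_process ::
  "nat \<Rightarrow> (nat \<Rightarrow> real) \<Rightarrow> (nat \<Rightarrow> 'w \<Rightarrow> 'h::real_normed_vector) \<Rightarrow> real \<Rightarrow> 'w \<Rightarrow> 'h"
where
  "elementary_process p \<tau> \<xi> s \<omega> = (\<Sum>i<p. indicator {\<tau> i<..\<tau> (Suc i)} s *\<^sub>R \<xi> i \<omega>)"

definition elementary_integral ::
  "('h \<Rightarrow> 'x \<Rightarrow> 'y) \<Rightarrow> nat \<Rightarrow> (nat \<Rightarrow> real) \<Rightarrow> (nat \<Rightarrow> 'w \<Rightarrow> 'h) \<Rightarrow>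
   (real \<Rightarrow> 'w \<Rightarrow> 'x::real_normed_vector) \<Rightarrow> real \<Rightarrow> 'w \<Rightarrow> 'y::real_normed_vector"
where
  "elementary_integral pr p \<tau> \<xi> X t \<omega> =
     (\<Sum>i<p. pr (\<xi> i \<omega>) (X (min (\<tau> (Suc i)) t) \<omega> - X (min (\<tau> i) t) \<omega>))"

text \<open>Convergence in probability, uniformly on compact time sets.  Time \<open>0\<close> is left out because
  elementary processes vanish there.  In all uses the processes \<open>Y m - X\<close> are left-continuous
  on \<open>{0<..}\<close> and measurable, so that the events below are measurable.\<close>

definition ucp_tendsto ::
  "'w measure \<Rightarrow> (nat \<Rightarrow> real \<Rightarrow> 'w \<Rightarrow> 'e::real_normed_vector) \<Rightarrow> (real \<Rightarrow> 'w \<Rightarrow> 'e) \<Rightarrow> bool"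
where
  "ucp_tendsto M Y X \<longleftrightarrow>
     (\<forall>T>0. \<forall>\<epsilon>>0.
        (\<lambda>m. measure M {\<omega> \<in> space M. \<exists>s\<in>{0<..T}. norm (Y m s \<omega> - X s \<omega>) > \<epsilon>}) \<longlonglongrightarrow> 0)"

text \<open>\<open>I\<close> is (a continuous version of) \<open>\<integral> H dX\<close> for a continuous adapted integrand
  \<open>H\<close>: the value at \<open>H\<close> of the ucp-continuous extension of the elementary integral.  Such an
  \<open>H\<close> is always the ucp-limit of elementary processes, so \<open>I\<close> is unique up to
  indistinguishability; it exists whenever \<open>X\<close> is a continuous semimartingale.  \<open>I\<close> is only required
  to be measurable, because the filtration need not contain the null sets.\<close>

definition stochastic_integral ::
  "'w measure \<Rightarrow> (real \<Rightarrow> 'w measure) \<Rightarrow> ('h \<Rightarrow> 'x \<Rightarrow> 'y) \<Rightarrow> (real \<Rightarrow> 'w \<Rightarrow> 'h::euclidean_space) \<Rightarrow>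
   (real \<Rightarrow> 'w \<Rightarrow> 'x::euclidean_space) \<Rightarrow> (real \<Rightarrow> 'w \<Rightarrow> 'y::euclidean_space) \<Rightarrow> bool"
where
  "stochastic_integral M F pr H X I \<longleftrightarrow>
     filtered_by M F \<and> adapted F H \<and> continuous_process M H \<and>
     continuous_process M X \<and> continuous_process M I \<and>
     (\<forall>p \<tau> \<xi>.
        (\<forall>m. elementary M F (p m) (\<tau> m) (\<xi> m)) \<longrightarrow>
        ucp_tendsto M (\<lambda>m. elementary_process (p m) (\<tau> m) (\<xi> m)) H \<longrightarrow>
        ucp_tendsto M (\<lambda>m. elementary_integral pr (p m) (\<tau> m) (\<xi> m) X) I)"

definition sigma01 :: "real^'n \<Rightarrow> real^'n^'n" where
  "sigma01 x = (\<chi> i j. (if i = j then 1 else 0) - x $ i * x $ j)"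

text \<open>\<open>\<Theta>\<close> is Brownian motion in the unit sphere driven by the Brownian motion \<open>B\<close>, with
  \<open>I = \<integral> sigma01 \<Theta> \<cdot> dB\<close>.\<close>

definition sphere_brownian_motion ::
  "'w measure \<Rightarrow> (real \<Rightarrow> 'w measure) \<Rightarrow> real^'n \<Rightarrow> (real \<Rightarrow> 'w \<Rightarrow> real^'n) \<Rightarrow>
   (real \<Rightarrow> 'w \<Rightarrow> real^'n) \<Rightarrow> (real \<Rightarrow> 'w \<Rightarrow> real^'n) \<Rightarrow> bool"
where
  "sphere_brownian_motion M F \<Theta>0 B I \<Theta> \<longleftrightarrow>
     brownian_motion M F UNIV B \<and>
     adapted F \<Theta> \<and> continuous_process M \<Theta> \<and>
     (AE \<omega> in M. \<forall>t\<ge>0. \<Theta> t \<omega> \<in> sphere 0 1) \<and>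
     stochastic_integral M F (*v) (\<lambda>t \<omega>. sigma01 (\<Theta> t \<omega>)) B I \<and>
     (AE \<omega> in M. \<forall>t\<ge>0. \<Theta> t \<omega> =
        \<Theta>0 + I t \<omega> - ((real CARD('n) - 1) / 2) *\<^sub>R integral {0..t} (\<lambda>s. \<Theta> s \<omega>))"

end

theory Submission
  imports Defs
begin

text \<open>The equation makes \<open>I = \<Theta> - \<Theta>0 + c \<integral> \<Theta>\<close> locally bounded, so the elementary integrals, which converge to \<open>I\<close>
  uniformly in probability and have bounded fourth moments, converge in \<open>L\<^sup>2\<close>; first, second and fourth
  moments of \<open>I\<close> follow from those of Gaussian increments. In direction \<open>w\<close> the variance of \<open>I\<close> grows at rate
  \<open>|w|\<^sup>2 - E (w \<bullet> \<Theta> t)\<^sup>2\<close>, where \<open>E (w \<bullet> \<Theta> t)\<^sup>2 = |w|\<^sup>2 / n + exp (- n t) ((w \<bullet> \<Theta>0)\<^sup>2 - |w|\<^sup>2 / n)\<close>; this is also the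
  rate of the Gaussian process \<open>Minf\<close>. The central limit theorem therefore gives convergence of the
  characteristic functions of the increments of \<open>MK\<close>, and fourth moments of order \<open>|t - s|\<^sup>2\<close> give tightness
  by dyadic chaining. For (b), subtracting expectations in the equation shows that \<open>\<Theta> - E \<Theta>\<close> solves
  \<open>Y = I - c \<integral> Y\<close>, hence \<open>ZK\<close> is a continuous function of the path \<open>MK\<close>, and summation by parts identifies
  the image of \<open>Minf\<close> under this function with \<open>exp (- c t) Q t\<close>.\<close>

section \<open>Moments of Brownian sums\<close>

text \<open>The coefficients of \<open>Minf\<close> are those that make the variance rates agree:
  for a unit vector \<open>u\<close> and \<open>n = CARD('n)\<close>,
  \<open>1 - E (u \<bullet> \<Theta> s)^2\<close> equals
  \<open>(1 - 1/n) * (1 - exp (- n s))\<close> if \<open>u = \<Theta>0\<close>, and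
  \<open>(1 - 1/n) * (1 + exp (- n s) / (n - 1))\<close> if \<open>u\<close> is orthogonal to
  \<open>\<Theta>0\<close>.

  The obstacle is that \<open>stochastic_integral\<close> is given only as a limit in probability,
  which carries no moments. On the sphere the equation bounds the increments of \<open>I\<close>
  almost surely, and this restores them. \<open>J\<close> and \<open>L\<close> have no such bound,
  but their integrands are deterministic, so characteristic functions, which do survive limits in
  probability, are enough; accordingly the convergence criterion asks moment bounds of the
  approximating sequence only.

  All computations are made at dyadic times, whose grids refine each other, and reach other times by
  continuity of paths. Independence and equality of laws are given for the pairs
  \<open>(\<Theta> k, B k)\<close>, not for \<open>I k\<close>; they transfer because the equation
  expresses \<open>I k\<close> through the path of \<open>\<Theta> k\<close>.\<close>

definition normal_moment :: "nat \<Rightarrow> real \<Rightarrow> real" where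
  "normal_moment k h = (\<integral>x. normal_density 0 (sqrt h) x * x ^ k \<partial>lborel)"

lemma integrable_normal_moment_power:
  assumes "h > 0"
  shows "integrable lborel (\<lambda>x. normal_density 0 (sqrt h) x * x ^ k)"
  using integrable_normal_moment[of "sqrt h" 0 k] assms by simp

lemma normal_moment_simps:
  assumes h: "h > 0"
  shows "normal_moment 1 h = 0" "normal_moment 2 h = h" "normal_moment 3 h = 0" "normal_moment 4 h = 3 * h\<^sup>2"
proof -
  have p: "sqrt h > 0" using h by simp
  show "normal_moment 1 h = 0" "normal_moment 3 h = 0"
    using integral_normal_moment_odd[OF p, of 0 0] integral_normal_moment_odd[OF p, of 0 1]
    by (simp_all add: normal_moment_def numeral_3_eq_3)
  show "normal_moment 2 h = h"
    using integral_normal_moment_even[OF p, of 0 1] h by (simp add: normal_moment_def)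
  show "normal_moment 4 h = 3 * h\<^sup>2"
    using integral_normal_moment_even[OF p, of 0 2] h
    by (simp add: normal_moment_def fact_numeral power2_eq_square field_simps)
qed

section \<open>Brownian increments and the past\<close>

lemma brownian_motionD:
  assumes "brownian_motion M F V W"
  shows "filtered_by M F" "adapted F W" "continuous_process M W"
    "\<And>\<omega> t. \<omega> \<in> space M \<Longrightarrow> t \<ge> 0 \<Longrightarrow> W t \<omega> \<in> V"
    "AE \<omega> in M. W 0 \<omega> = 0"
    "\<And>s t. 0 \<le> s \<Longrightarrow> s < t \<Longrightarrow> prob_space.indep_set M (sets (F s))
          (sets (vimage_algebra (space M) (\<lambda>\<omega>. W t \<omega> - W s \<omega>) borel))"
    "\<And>s t u. 0 \<le> s \<Longrightarrow> s < t \<Longrightarrow> u \<in> V \<Longrightarrow> norm u = 1 \<Longrightarrow>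
       distributed M lborel (\<lambda>\<omega>. u \<bullet> (W t \<omega> - W s \<omega>)) (normal_density 0 (sqrt (t - s)))"
  using assms by (simp_all add: brownian_motion_def)

lemma filtered_by_measurable:
  assumes "filtered_by M F" "X \<in> measurable (F s) N"
  shows "X \<in> measurable M N"
  using assms measurable_from_subalg unfolding filtered_by_def by metis

lemma filtered_by_mono:
  assumes "filtered_by M F" "X \<in> measurable (F s) N" "s \<le> t"
  shows "X \<in> measurable (F t) N"
proof -
  have "sets (F s) \<subseteq> sets (F t)" "space (F s) = space M" "space (F t) = space M"
    using assms unfolding filtered_by_def filtration_def subalgebra_def by auto
  then show ?thesis using assms(2) unfolding measurable_def by auto
qed

text \<open>Independence passes to smaller families of events, and the events generated by
  \<open>X\<close> and \<open>Y\<close> lie in \<open>A\<close> and \<open>B\<close>. This turns the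
  independence of sigma-algebras, in which \<open>brownian_motion\<close> and the relation of
  \<open>\<beta>\<close> and \<open>B'\<close> are stated, into \<open>indep_var\<close> with its
  product rule for expectations.\<close>

lemma (in prob_space) indep_var_of_indep_set:
  assumes I: "indep_set (sets A) (sets B)" and sp: "space A = space M" "space B = space M"
    and X: "X \<in> measurable A N" and Y: "Y \<in> measurable B N'"
  shows "indep_var N X N' Y"
proof -
  have ev: "sets A \<subseteq> events" "sets B \<subseteq> events" using indep_setD_ev1[OF I] indep_setD_ev2[OF I] by auto
  have "{X -` S \<inter> space M |S. S \<in> sets N} \<subseteq> sets A" using X sp by (auto simp: measurable_def)
  then have 1: "sigma_sets (space M) {X -` S \<inter> space M |S. S \<in> sets N} \<subseteq> sets A"
    using sets.sigma_sets_subset[of _ A] by (simp add: sp)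
  have "{Y -` S \<inter> space M |S. S \<in> sets N'} \<subseteq> sets B" using Y sp by (auto simp: measurable_def)
  then have 2: "sigma_sets (space M) {Y -` S \<inter> space M |S. S \<in> sets N'} \<subseteq> sets B"
    using sets.sigma_sets_subset[of _ B] by (simp add: sp)
  have "indep_set (sigma_sets (space M) {X -` S \<inter> space M |S. S \<in> sets N})
     (sigma_sets (space M) {Y -` S \<inter> space M |S. S \<in> sets N'})"
    unfolding indep_set_def
  proof (rule indep_sets_mono_sets[OF I[unfolded indep_set_def]])
    fix i :: bool
    show "case_bool (sigma_sets (space M) {X -` S \<inter> space M |S. S \<in> sets N})
       (sigma_sets (space M) {Y -` S \<inter> space M |S. S \<in> sets N'}) i \<subseteq> case_bool (sets A) (sets B) i"
      using 1 2 by (cases i) simp_all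
  qed
  moreover have "X \<in> measurable M N" "Y \<in> measurable M N'"
    using X Y ev sp by (auto simp: measurable_def)
  ultimately show ?thesis unfolding indep_var_eq by (intro conjI)
qed

lemma indep_increment:
  fixes W :: "real \<Rightarrow> 'w \<Rightarrow> 'e::euclidean_space"
  assumes "prob_space M" "brownian_motion M F V W" "0 \<le> s" "s < t" "Z \<in> measurable (F s) N"
    and f: "f \<in> measurable borel N'"
  shows "prob_space.indep_var M N Z N' (\<lambda>\<omega>. f (W t \<omega> - W s \<omega>))"
proof -
  interpret prob_space M by fact
  note bm = brownian_motionD[OF assms(2)]
  define D where "D = (\<lambda>\<omega>. W t \<omega> - W s \<omega>)"
  have m: "Z \<in> measurable (F s) N" by fact
  have sp: "space (F s) = space M" using bm(1) by (simp add: filtered_by_def filtration_def)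
  have D: "D \<in> measurable (vimage_algebra (space M) D borel) borel"
    by (rule measurable_vimage_algebra1) simp
  have "indep_var N Z N' (\<lambda>\<omega>. f (D \<omega>))"
    using bm(6)[OF assms(3,4)] unfolding D_def[symmetric]
    by (rule indep_var_of_indep_set) (use sp m measurable_compose[OF D f] in auto)
  then show ?thesis by (simp add: D_def)
qed

text \<open>\<open>brownian_motion\<close> fixes the law of the increment along unit vectors only; a
  nonzero \<open>v\<close> is rescaled to one, and \<open>v = 0\<close> is trivial. The absolute
  moment is recorded because it supplies the integrability in the Fubini argument of
  \<open>increment_moment\<close>.\<close>

lemma increment_scalar_moment:
  fixes W :: "real \<Rightarrow> 'w \<Rightarrow> 'e::euclidean_space"
  assumes "prob_space M" and bm: "brownian_motion M F V W" and st: "0 \<le> s" "s < t"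
    and V: "subspace V" and v: "v \<in> V"
    and k: "k > 0"
  shows "integrable M (\<lambda>\<omega>. (v \<bullet> (W t \<omega> - W s \<omega>)) ^ k)"
    "(\<integral>\<omega>. (v \<bullet> (W t \<omega> - W s \<omega>)) ^ k \<partial>M) = norm v ^ k * normal_moment k (t - s)"
    "(\<integral>\<omega>. norm ((v \<bullet> (W t \<omega> - W s \<omega>)) ^ k) \<partial>M)
       = norm v ^ k * (\<integral>x. normal_density 0 (sqrt (t - s)) x * \<bar>x\<bar> ^ k \<partial>lborel)"
proof -
  interpret prob_space M by fact
  have "integrable M (\<lambda>\<omega>. (v \<bullet> (W t \<omega> - W s \<omega>)) ^ k) \<and>
    (\<integral>\<omega>. (v \<bullet> (W t \<omega> - W s \<omega>)) ^ k \<partial>M) = norm v ^ k * normal_moment k (t - s) \<and>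
    (\<integral>\<omega>. norm ((v \<bullet> (W t \<omega> - W s \<omega>)) ^ k) \<partial>M)
       = norm v ^ k * (\<integral>x. normal_density 0 (sqrt (t - s)) x * \<bar>x\<bar> ^ k \<partial>lborel)"
  proof (cases "v = 0")
    case True
    then show ?thesis using k by simp
  next
    case False
    define u where "u = (1 / norm v) *\<^sub>R v"
    have u: "u \<in> V" "norm u = 1" and vu: "v = norm v *\<^sub>R u"
      using False v V by (auto simp: u_def subspace_scale)
    note D = brownian_motionD(7)[OF bm st u]
    have eq: "v \<bullet> (W t \<omega> - W s \<omega>) = norm v * (u \<bullet> (W t \<omega> - W s \<omega>))" for \<omega>
      by (subst vu) simp
    have I: "integrable M (\<lambda>\<omega>. (u \<bullet> (W t \<omega> - W s \<omega>)) ^ k)"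
      by (subst distributed_integrable[OF D, of "\<lambda>x. x^k", symmetric])
        (use integrable_normal_moment_power st in auto)
    have E: "(\<integral>\<omega>. (u \<bullet> (W t \<omega> - W s \<omega>)) ^ k \<partial>M) = normal_moment k (t - s)"
      unfolding normal_moment_def
      by (subst distributed_integral[OF D, of "\<lambda>x. x^k", symmetric]) auto
    have A: "(\<integral>\<omega>. \<bar>u \<bullet> (W t \<omega> - W s \<omega>)\<bar> ^ k \<partial>M)
       = (\<integral>x. normal_density 0 (sqrt (t - s)) x * \<bar>x\<bar> ^ k \<partial>lborel)"
      by (subst distributed_integral[OF D, of "\<lambda>x. \<bar>x\<bar>^k", symmetric]) auto
    show ?thesis
      unfolding eq by (simp add: power_mult_distrib I E A abs_mult power_abs[symmetric])
        (simp add: A power_abs)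
  qed
  then show "integrable M (\<lambda>\<omega>. (v \<bullet> (W t \<omega> - W s \<omega>)) ^ k)"
    "(\<integral>\<omega>. (v \<bullet> (W t \<omega> - W s \<omega>)) ^ k \<partial>M) = norm v ^ k * normal_moment k (t - s)"
    "(\<integral>\<omega>. norm ((v \<bullet> (W t \<omega> - W s \<omega>)) ^ k) \<partial>M)
       = norm v ^ k * (\<integral>x. normal_density 0 (sqrt (t - s)) x * \<bar>x\<bar> ^ k \<partial>lborel)"
    by blast+
qed

text \<open>\<open>Y\<close> and \<open>a\<close> are known at time \<open>s\<close>, hence
  independent of the increment: the joint law is a product measure, and Fubini integrates the
  increment first, with the coefficients frozen, where \<open>increment_scalar_moment\<close>
  applies.\<close>

lemma increment_moment:
  fixes W :: "real \<Rightarrow> 'w \<Rightarrow> 'e::euclidean_space"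
  assumes M: "prob_space M" and bm: "brownian_motion M F V W" and st: "0 \<le> s" "s < t"
    and V: "subspace V"
    and a: "a \<in> borel_measurable (F s)" "\<And>\<omega>. \<omega> \<in> space M \<Longrightarrow> a \<omega> \<in> V"
    and Y: "Y \<in> borel_measurable (F s)" "integrable M (\<lambda>\<omega>. Y \<omega> * norm (a \<omega>) ^ k)"
    and k: "k > 0"
  shows "integrable M (\<lambda>\<omega>. Y \<omega> * (a \<omega> \<bullet> (W t \<omega> - W s \<omega>)) ^ k)"
    "(\<integral>\<omega>. Y \<omega> * (a \<omega> \<bullet> (W t \<omega> - W s \<omega>)) ^ k \<partial>M)
       = (\<integral>\<omega>. Y \<omega> * norm (a \<omega>) ^ k \<partial>M) * normal_moment k (t - s)"
proof -
  interpret prob_space M by fact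
  define Z where "Z = (\<lambda>\<omega>. (Y \<omega>, a \<omega>))"
  have Zm: "Z \<in> measurable (F s) (borel \<Otimes>\<^sub>M borel)"
    unfolding Z_def using a(1) Y(1) by measurable
  \<comment> \<open>\<open>indep_var\<close> compares variables of one type, so the increment is
    given a dummy first component.\<close>
  define E where "E = (\<lambda>\<omega>. (0::real, W t \<omega> - W s \<omega>))"
  have iv: "indep_var (borel \<Otimes>\<^sub>M borel) Z (borel \<Otimes>\<^sub>M borel) E"
    unfolding E_def by (rule indep_increment[OF M bm st Zm]) simp
  have [measurable]: "Z \<in> measurable M (borel \<Otimes>\<^sub>M borel)" "E \<in> measurable M (borel \<Otimes>\<^sub>M borel)"
    using indep_var_rv1[OF iv] indep_var_rv2[OF iv] by auto
  have [measurable]: "Y \<in> borel_measurable M" "a \<in> borel_measurable M"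
    using filtered_by_measurable[OF brownian_motionD(1)[OF bm]] a(1) Y(1) by auto
  let ?P = "distr M (borel \<Otimes>\<^sub>M borel) Z" and ?Q = "distr M (borel \<Otimes>\<^sub>M borel) E"
  have eq: "?P \<Otimes>\<^sub>M ?Q = distr M ((borel \<Otimes>\<^sub>M borel) \<Otimes>\<^sub>M (borel \<Otimes>\<^sub>M borel)) (\<lambda>\<omega>. (Z \<omega>, E \<omega>))"
    using iv unfolding indep_var_distribution_eq by blast
  interpret P: prob_space ?P by (rule prob_space_distr) simp
  interpret Q: prob_space ?Q by (rule prob_space_distr) simp
  interpret PQ: pair_sigma_finite ?P ?Q ..
  define f where "f = (\<lambda>(z::real \<times> 'e, d::real \<times> 'e). fst z * (snd z \<bullet> snd d) ^ k)"
  have fm[measurable]: "f \<in> borel_measurable ((borel \<Otimes>\<^sub>M borel) \<Otimes>\<^sub>M (borel \<Otimes>\<^sub>M borel))"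
    unfolding f_def by measurable
  define c where "c = (\<integral>x. normal_density 0 (sqrt (t - s)) x * \<bar>x\<bar> ^ k \<partial>lborel)"
  have fint: "integrable ?Q (\<lambda>d. f ((y, v), d))" if "v \<in> V" for y v
    using increment_scalar_moment(1)[OF M bm st V that k]
    by (subst integrable_distr_eq, simp, simp) (simp add: f_def E_def)
  have fE: "(\<integral>d. f ((y, v), d) \<partial>?Q) = y * norm v ^ k * normal_moment k (t - s)" if "v \<in> V" for y v
    using increment_scalar_moment(2)[OF M bm st V that k]
    by (subst integral_distr, simp, simp) (simp add: f_def E_def)
  have fA: "(\<integral>d. norm (f ((y, v), d)) \<partial>?Q) = \<bar>y\<bar> * norm v ^ k * c" if "v \<in> V" for y v
    using increment_scalar_moment(3)[OF M bm st V that k]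
    by (subst integral_distr, simp, simp) (simp add: f_def c_def E_def abs_mult)
  \<comment> \<open>The inner integrals are known for directions in \<open>V\<close> only. A
    subspace of a Euclidean space is closed, hence Borel, so the law of \<open>a\<close> is carried
    by \<open>V\<close>.\<close>
  have AV: "AE z in ?P. snd z \<in> V"
  proof -
    have [measurable]: "V \<in> sets borel" using closed_subspace[OF V] by simp
    show ?thesis using a(2) by (subst AE_distr_iff) (auto simp: Z_def)
  qed
  have PQi: "integrable (?P \<Otimes>\<^sub>M ?Q) f"
  proof (rule PQ.Fubini_integrable)
    show "f \<in> borel_measurable (?P \<Otimes>\<^sub>M ?Q)" by simp
    have "integrable M (\<lambda>\<omega>. norm (Y \<omega> * norm (a \<omega>) ^ k) * c)"
      using Y(2) by (intro integrable_mult_left integrable_norm)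
    then have i1: "integrable ?P (\<lambda>z. \<bar>fst z\<bar> * norm (snd z) ^ k * c)"
      by (subst integrable_distr_eq) (auto simp: Z_def abs_mult power_abs)
    show "integrable ?P (\<lambda>z. \<integral>d. norm (f (z, d)) \<partial>?Q)"
      by (rule integrable_cong_AE_imp[OF i1])
        (use AV fA in \<open>auto simp: abs_mult\<close>)
    show "AE z in ?P. integrable ?Q (\<lambda>d. f (z, d))"
      using AV fint by auto
  qed
  then show "integrable M (\<lambda>\<omega>. Y \<omega> * (a \<omega> \<bullet> (W t \<omega> - W s \<omega>)) ^ k)"
    unfolding eq by (subst (asm) integrable_distr_eq) (simp_all add: f_def, simp add: Z_def E_def)
  have "(\<integral>\<omega>. Y \<omega> * (a \<omega> \<bullet> (W t \<omega> - W s \<omega>)) ^ k \<partial>M) = integral\<^sup>L (?P \<Otimes>\<^sub>M ?Q) f"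
    unfolding eq by (subst integral_distr, simp, simp) (simp add: f_def Z_def E_def)
  also have "\<dots> = (\<integral>z. (\<integral>d. f (z, d) \<partial>?Q) \<partial>?P)"
    by (rule PQ.integral_fst'[OF PQi, symmetric])
  also have "\<dots> = (\<integral>z. fst z * norm (snd z) ^ k * normal_moment k (t - s) \<partial>?P)"
    by (rule integral_cong_AE) (use AV fE in auto)
  also have "\<dots> = (\<integral>\<omega>. Y \<omega> * norm (a \<omega>) ^ k \<partial>M) * normal_moment k (t - s)"
    by (subst integral_distr) (auto simp: Z_def)
  finally show "(\<integral>\<omega>. Y \<omega> * (a \<omega> \<bullet> (W t \<omega> - W s \<omega>)) ^ k \<partial>M)
       = (\<integral>\<omega>. Y \<omega> * norm (a \<omega>) ^ k \<partial>M) * normal_moment k (t - s)" .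
qed

lemma char_increment:
  fixes W :: "real \<Rightarrow> 'w \<Rightarrow> 'e::euclidean_space"
  assumes "prob_space M" and bm: "brownian_motion M F V W" and st: "0 \<le> s" "s < t"
    and V: "subspace V" and v: "v \<in> V"
  shows "(CLINT \<omega>|M. iexp (v \<bullet> (W t \<omega> - W s \<omega>))) = exp (- ((t - s) * (norm v)\<^sup>2 / 2))"
proof (cases "v = 0")
  case True
  then show ?thesis using prob_space.prob_space[OF assms(1)] by simp
next
  case False
  interpret prob_space M by fact
  define u where "u = (1 / norm v) *\<^sub>R v"
  have u: "u \<in> V" "norm u = 1" and vu: "v = norm v *\<^sub>R u"
    using False v V by (auto simp: u_def subspace_scale)
  define h where "h = sqrt (t - s)"
  have h: "h > 0" using st by (simp add: h_def)
  define G where "G = (\<lambda>\<omega>. (u \<bullet> (W t \<omega> - W s \<omega>)) / h)"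
  have "distributed M lborel (\<lambda>\<omega>. u \<bullet> (W t \<omega> - W s \<omega>)) (normal_density 0 h)"
    using brownian_motionD(7)[OF bm st u] by (simp add: h_def)
  then have D: "distributed M lborel G std_normal_density"
    using normal_standard_normal_convert[OF h, of "\<lambda>\<omega>. u \<bullet> (W t \<omega> - W s \<omega>)" 0]
    by (simp add: G_def)
  have [measurable]: "G \<in> borel_measurable M"
    using distributed_measurable[OF D] by simp
  have "distr M borel G = std_normal_distribution"
    using distributed_distr_eq_density[OF D] by (simp add: distr_cong[of M M borel lborel])
  then have "char (distr M borel G) (norm v * h) = exp (- ((norm v * h)\<^sup>2) / 2)"
    by (simp add: char_std_normal_distribution)
  moreover have "char (distr M borel G) (norm v * h) = (CLINT \<omega>|M. iexp (norm v * h * G \<omega>))"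
    unfolding char_def by (subst integral_distr) auto
  moreover have "norm v * h * G \<omega> = v \<bullet> (W t \<omega> - W s \<omega>)" for \<omega>
    using h by (subst (2) vu) (simp add: G_def)
  then have "(CLINT \<omega>|M. iexp (norm v * h * G \<omega>)) = (CLINT \<omega>|M. iexp (v \<bullet> (W t \<omega> - W s \<omega>)))"
    by (simp only:)
  moreover have "- ((norm v * h)\<^sup>2) / 2 = - ((t - s) * (norm v)\<^sup>2 / 2)"
    using st by (simp add: power_mult_distrib h_def)
  ultimately show ?thesis by (simp only: of_real_eq_iff)
qed

section \<open>Sums of Brownian increments with coefficients known at the left end\<close>

locale brownian_sum = prob_space M for M :: "'w measure" +
  fixes F :: "real \<Rightarrow> 'w measure" and V :: "'e::euclidean_space set" and W :: "real \<Rightarrow> 'w \<Rightarrow> 'e"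
    and \<tau> :: "nat \<Rightarrow> real" and a :: "nat \<Rightarrow> 'w \<Rightarrow> 'e" and c :: "nat \<Rightarrow> real"
  assumes bm: "brownian_motion M F V W"
    and V: "subspace V"
    and \<tau>0: "\<tau> 0 \<ge> 0" and \<tau>_less: "\<And>i. \<tau> i < \<tau> (Suc i)"
    and a_meas: "\<And>i. a i \<in> borel_measurable (F (\<tau> i))"
    and a_in: "\<And>i \<omega>. \<omega> \<in> space M \<Longrightarrow> a i \<omega> \<in> V"
    and a_bound: "\<And>i \<omega>. \<omega> \<in> space M \<Longrightarrow> norm (a i \<omega>) \<le> c i"
begin

definition S :: "nat \<Rightarrow> 'w \<Rightarrow> real" where
  "S q \<omega> = (\<Sum>i<q. a i \<omega> \<bullet> (W (\<tau> (Suc i)) \<omega> - W (\<tau> i) \<omega>))"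

lemma \<tau>_mono: "i \<le> j \<Longrightarrow> \<tau> i \<le> \<tau> j"
  by (rule lift_Suc_mono_le[of \<tau>]) (use \<tau>_less less_imp_le in auto)

lemma \<tau>_nonneg: "\<tau> i \<ge> 0"
  using \<tau>_mono[of 0 i] \<tau>0 by simp

lemma S_Suc: "S (Suc q) \<omega> = S q \<omega> + a q \<omega> \<bullet> (W (\<tau> (Suc q)) \<omega> - W (\<tau> q) \<omega>)"
  by (simp add: S_def)

lemma S_measurable_F: "S q \<in> borel_measurable (F (\<tau> q))"
proof -
  note f = brownian_motionD(1)[OF bm]
  have "(\<lambda>\<omega>. a i \<omega> \<bullet> (W (\<tau> (Suc i)) \<omega> - W (\<tau> i) \<omega>)) \<in> borel_measurable (F (\<tau> q))" if "i < q" for i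
  proof -
    have "W (\<tau> i) \<in> borel_measurable (F (\<tau> i))" "W (\<tau> (Suc i)) \<in> borel_measurable (F (\<tau> (Suc i)))"
      using brownian_motionD(2)[OF bm] \<tau>_nonneg by (auto simp: adapted_def)
    then have [measurable]: "W (\<tau> i) \<in> borel_measurable (F (\<tau> q))"
      "W (\<tau> (Suc i)) \<in> borel_measurable (F (\<tau> q))" "a i \<in> borel_measurable (F (\<tau> q))"
      using filtered_by_mono[OF f _ \<tau>_mono[of i q]] filtered_by_mono[OF f _ \<tau>_mono[of "Suc i" q]]
        a_meas[of i] that by auto
    show ?thesis by measurable
  qed
  then show ?thesis unfolding S_def[abs_def] by (intro borel_measurable_sum) auto
qed

lemma S_measurable [measurable]: "S q \<in> borel_measurable M"
  using filtered_by_measurable[OF brownian_motionD(1)[OF bm] S_measurable_F] .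

lemma a_measurable [measurable]: "a q \<in> borel_measurable M"
  using filtered_by_measurable[OF brownian_motionD(1)[OF bm] a_meas] .

lemma c_nonneg: "c q \<ge> 0"
proof -
  obtain \<omega> where "\<omega> \<in> space M" using not_empty by blast
  then show ?thesis using a_bound[of \<omega> q] norm_ge_zero[of "a q \<omega>"] by linarith
qed

lemma integrable_mult_norm_a:
  assumes "integrable M Y"
  shows "integrable M (\<lambda>\<omega>. Y \<omega> * norm (a q \<omega>) ^ k)"
proof (rule Bochner_Integration.integrable_bound)
  show "integrable M (\<lambda>\<omega>. norm (Y \<omega>) * c q ^ k)"
    using assms by simp
  show "(\<lambda>\<omega>. Y \<omega> * norm (a q \<omega>) ^ k) \<in> borel_measurable M"
    using assms by simp
  show "AE \<omega> in M. norm (Y \<omega> * norm (a q \<omega>) ^ k) \<le> norm (norm (Y \<omega>) * c q ^ k)"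
  proof (rule AE_I2)
    fix \<omega> assume "\<omega> \<in> space M"
    then have 1: "norm (a q \<omega>) ^ k \<le> c q ^ k"
      using a_bound by (intro power_mono) auto
    moreover have "0 \<le> norm (a q \<omega>) ^ k" by simp
    ultimately show "norm (Y \<omega> * norm (a q \<omega>) ^ k) \<le> norm (norm (Y \<omega>) * c q ^ k)"
      using c_nonneg[of q] by (simp add: abs_mult power_abs mult_left_mono)
  qed
qed

lemma power_le_one_plus_fourth:
  fixes x :: real assumes "k \<le> 4" shows "\<bar>x ^ k\<bar> \<le> 1 + x ^ 4"
proof (cases "\<bar>x\<bar> \<le> 1")
  case True
  then have "\<bar>x ^ k\<bar> \<le> 1" by (simp add: power_abs power_le_one)
  moreover have "x ^ 4 \<ge> 0" by simp
  ultimately show ?thesis by linarith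
next
  case False
  then have "\<bar>x\<bar> ^ k \<le> \<bar>x\<bar> ^ 4" using assms by (intro power_increasing) auto
  then show ?thesis by (simp add: power_abs power_even_abs_numeral)
qed

text \<open>All claims go through one induction: when the last increment \<open>x\<close> is split
  off, \<open>increment_moment\<close> kills the terms odd in \<open>x\<close>, and those even in
  \<open>x\<close> are estimated by the previous moments. The constant 3 is the fourth moment of the
  standard normal law, and the bound reproduces itself because
  \<open>3 T^2 + 6 T c^2 h + 3 c^4 h^2 = 3 (T + c^2 h)^2\<close>.\<close>

lemma S_moments:
  "integrable M (\<lambda>\<omega>. S q \<omega> ^ 4)"
  "(\<integral>\<omega>. S q \<omega> \<partial>M) = 0"
  "(\<integral>\<omega>. (S q \<omega>)\<^sup>2 \<partial>M) = (\<Sum>i<q. (\<tau> (Suc i) - \<tau> i) * (\<integral>\<omega>. (norm (a i \<omega>))\<^sup>2 \<partial>M))"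
  "(\<integral>\<omega>. (S q \<omega>)\<^sup>2 \<partial>M) \<le> (\<Sum>i<q. (c i)\<^sup>2 * (\<tau> (Suc i) - \<tau> i))"
  "(\<integral>\<omega>. S q \<omega> ^ 4 \<partial>M) \<le> 3 * (\<Sum>i<q. (c i)\<^sup>2 * (\<tau> (Suc i) - \<tau> i))\<^sup>2"
proof (induction q)
  case 0
  { case 1 then show ?case by (simp add: S_def) }
  { case 2 then show ?case by (simp add: S_def) }
  { case 3 then show ?case by (simp add: S_def) }
  { case 4 then show ?case by (simp add: S_def) }
  { case 5 then show ?case by (simp add: S_def) }
next
  case (Suc q)
  define x where "x = (\<lambda>\<omega>. a q \<omega> \<bullet> (W (\<tau> (Suc q)) \<omega> - W (\<tau> q) \<omega>))"
  define h where "h = \<tau> (Suc q) - \<tau> q"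
  have h: "h > 0" using \<tau>_less by (simp add: h_def)
  define T where "T = (\<Sum>i<q. (c i)\<^sup>2 * (\<tau> (Suc i) - \<tau> i))"
  have i4: "integrable M (\<lambda>\<omega>. S q \<omega> ^ 4)" by (rule Suc)
  have ik: "integrable M (\<lambda>\<omega>. S q \<omega> ^ k)" if "k \<le> 4" for k
  proof (rule Bochner_Integration.integrable_bound)
    show "integrable M (\<lambda>\<omega>. 1 + S q \<omega> ^ 4)" using i4 by simp
    show "AE \<omega> in M. norm (S q \<omega> ^ k) \<le> norm (1 + S q \<omega> ^ 4)"
      using power_le_one_plus_fourth[OF that] by (auto intro: order_trans)
  qed simp
  have Y: "(\<lambda>\<omega>. S q \<omega> ^ j) \<in> borel_measurable (F (\<tau> q))" for j
    using S_measurable_F by simp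
  have mom: "integrable M (\<lambda>\<omega>. S q \<omega> ^ j * x \<omega> ^ k)"
    "(\<integral>\<omega>. S q \<omega> ^ j * x \<omega> ^ k \<partial>M) = (\<integral>\<omega>. S q \<omega> ^ j * norm (a q \<omega>) ^ k \<partial>M) * normal_moment k h"
    if "j \<le> 4" "k > 0" for j k
    using increment_moment[OF prob_space_axioms bm \<tau>_nonneg \<tau>_less V a_meas a_in Y
      integrable_mult_norm_a[OF ik[OF that(1)]] that(2)] unfolding x_def h_def by auto
  have na: "integrable M (\<lambda>\<omega>. S q \<omega> ^ j * norm (a q \<omega>) ^ k)" if "j \<le> 4" for j k
    using integrable_mult_norm_a[OF ik] that by blast
  have S': "S (Suc q) \<omega> = S q \<omega> + x \<omega>" for \<omega> by (simp add: S_Suc x_def)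
  \<comment> \<open>Trivial powers are kept so that each mixed term has the form required by
    \<open>mom\<close>.\<close>
  have e2: "(S (Suc q) \<omega>)\<^sup>2 = S q \<omega> ^ 2 * x \<omega> ^ 0 + 2 * (S q \<omega> ^ 1 * x \<omega> ^ 1) + S q \<omega> ^ 0 * x \<omega> ^ 2" for \<omega>
    by (simp add: S' power2_eq_square algebra_simps)
  have e4: "S (Suc q) \<omega> ^ 4 = S q \<omega> ^ 4 + 4 * (S q \<omega> ^ 3 * x \<omega> ^ 1) + 6 * (S q \<omega> ^ 2 * x \<omega> ^ 2)
     + 4 * (S q \<omega> ^ 1 * x \<omega> ^ 3) + S q \<omega> ^ 0 * x \<omega> ^ 4" for \<omega>
    by (simp add: S' power4_eq_xxxx power2_eq_square power3_eq_cube algebra_simps)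
  note mom31 = mom[of 3 1] and mom22 = mom[of 2 2] and mom13 = mom[of 1 3] and mom04 = mom[of 0 4]
    and mom11 = mom[of 1 1] and mom02 = mom[of 0 2] and mom01 = mom[of 0 1]
  note nm = normal_moment_simps[OF h]
  { case 1 show ?case unfolding e4
      using mom31(1) mom22(1) mom13(1) mom04(1) i4 by simp }
  { case 2 show ?case unfolding S'
      using mom01 ik[of 1] Suc(2) nm(1) by simp }
  have E2: "(\<integral>\<omega>. (S (Suc q) \<omega>)\<^sup>2 \<partial>M) = (\<integral>\<omega>. (S q \<omega>)\<^sup>2 \<partial>M) + h * (\<integral>\<omega>. (norm (a q \<omega>))\<^sup>2 \<partial>M)"
    unfolding e2 using mom11 mom02 ik[of 2] nm by simp
  { case 3 show ?case unfolding E2 using Suc(3) by (simp add: h_def) }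
  have ca: "(\<integral>\<omega>. Y \<omega> * norm (a q \<omega>) ^ k \<partial>M) \<le> (\<integral>\<omega>. Y \<omega> \<partial>M) * c q ^ k"
    if "integrable M Y" "\<And>\<omega>. Y \<omega> \<ge> 0" for Y k
  proof -
    have "(\<integral>\<omega>. Y \<omega> * norm (a q \<omega>) ^ k \<partial>M) \<le> (\<integral>\<omega>. Y \<omega> * c q ^ k \<partial>M)"
      using that a_bound by (intro integral_mono integrable_mult_norm_a integrable_mult_left mult_left_mono power_mono) auto
    then show ?thesis by simp
  qed
  have E2': "(\<integral>\<omega>. (S q \<omega>)\<^sup>2 \<partial>M) \<le> T" using Suc(4) by (simp add: T_def)
  have n2: "(\<integral>\<omega>. (norm (a q \<omega>))\<^sup>2 \<partial>M) \<le> (c q)\<^sup>2"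
    using ca[of "\<lambda>_. 1" 2] prob_space by simp
  have n4: "(\<integral>\<omega>. (norm (a q \<omega>))^4 \<partial>M) \<le> (c q)^4"
    using ca[of "\<lambda>_. 1" 4] prob_space by simp
  have n22: "(\<integral>\<omega>. (S q \<omega>)\<^sup>2 * (norm (a q \<omega>))\<^sup>2 \<partial>M) \<le> T * (c q)\<^sup>2"
    using ca[of "\<lambda>\<omega>. (S q \<omega>)\<^sup>2" 2] ik[of 2] mult_right_mono[OF E2', of "(c q)\<^sup>2"] by force
  { case 4 show ?case unfolding E2 using add_mono[OF E2' mult_left_mono[OF n2 less_imp_le[OF h]]] by (simp add: T_def h_def mult.commute) }
  have "(\<integral>\<omega>. S (Suc q) \<omega> ^ 4 \<partial>M) = (\<integral>\<omega>. S q \<omega> ^ 4 \<partial>M)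
     + 6 * ((\<integral>\<omega>. (S q \<omega>)\<^sup>2 * (norm (a q \<omega>))\<^sup>2 \<partial>M) * h) + (\<integral>\<omega>. (norm (a q \<omega>))^4 \<partial>M) * (3 * h\<^sup>2)"
    unfolding e4 using mom31 mom22 mom13 mom04 i4 nm by simp
  also have "\<dots> \<le> 3 * T\<^sup>2 + 6 * (T * (c q)\<^sup>2 * h) + (c q)^4 * (3 * h\<^sup>2)"
    using Suc(5) n22 n4 h by (intro add_mono mult_left_mono mult_right_mono) (auto simp: T_def)
  also have "\<dots> = 3 * (T + (c q)\<^sup>2 * h)\<^sup>2"
    by (simp add: power4_eq_xxxx power2_eq_square algebra_simps)
  finally have E4: "(\<integral>\<omega>. S (Suc q) \<omega> ^ 4 \<partial>M) \<le> 3 * (T + (c q)\<^sup>2 * h)\<^sup>2" .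
  { case 5 show ?case using E4 by (simp add: T_def h_def) }
qed

text \<open>The exponential of the first \<open>q\<close> terms is known at time
  \<open>\<tau> q\<close>, hence independent of the next increment, and the characteristic functions
  multiply.\<close>

lemma char_S:
  assumes det: "\<And>i \<omega>. a i \<omega> = b i"
  shows "(CLINT \<omega>|M. iexp (S q \<omega>)) = exp (- ((\<Sum>i<q. (\<tau> (Suc i) - \<tau> i) * (norm (b i))\<^sup>2) / 2))"
proof (induction q)
  case 0
  then show ?case by (simp add: S_def prob_space)
next
  case (Suc q)
  define D where "D = (\<lambda>\<omega>. W (\<tau> (Suc q)) \<omega> - W (\<tau> q) \<omega>)"
  obtain \<omega>0 where "\<omega>0 \<in> space M" using not_empty by blast
  then have bV: "b q \<in> V" using a_in[of \<omega>0 q] det by simp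
  have "(\<lambda>\<omega>. iexp (S q \<omega>)) \<in> borel_measurable (F (\<tau> q))"
    using S_measurable_F[of q] by measurable
  from indep_increment[OF prob_space_axioms bm \<tau>_nonneg \<tau>_less this, of "\<lambda>d. iexp (b q \<bullet> d)" borel]
  have iv: "indep_var borel (\<lambda>\<omega>. iexp (S q \<omega>)) borel (\<lambda>\<omega>. iexp (b q \<bullet> D \<omega>))"
    by (simp add: D_def)
  have i1: "integrable M (\<lambda>\<omega>. iexp (S q \<omega>))" "integrable M (\<lambda>\<omega>. iexp (b q \<bullet> D \<omega>))"
    using indep_var_rv1[OF iv] indep_var_rv2[OF iv]
    by (auto intro!: integrable_const_bound[where B = 1])
  have "(CLINT \<omega>|M. iexp (S (Suc q) \<omega>)) = (CLINT \<omega>|M. iexp (S q \<omega>) * iexp (b q \<bullet> D \<omega>))"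
    by (simp add: S_Suc det D_def exp_add[symmetric] distrib_left)
  also have "\<dots> = (CLINT \<omega>|M. iexp (S q \<omega>)) * (CLINT \<omega>|M. iexp (b q \<bullet> D \<omega>))"
    by (rule indep_var_lebesgue_integral[OF iv i1])
  also have "(CLINT \<omega>|M. iexp (b q \<bullet> D \<omega>)) = exp (- ((\<tau> (Suc q) - \<tau> q) * (norm (b q))\<^sup>2 / 2))"
    unfolding D_def by (rule char_increment[OF prob_space_axioms bm \<tau>_nonneg \<tau>_less V bV])
  finally show ?case
    unfolding Suc by (simp add: exp_of_real exp_add[symmetric] add_divide_distrib del: of_real_exp of_real_add flip: of_real_mult)
qed

end

section \<open>Convergence uniformly in probability\<close>

text \<open>Almost sure, locally uniform convergence implies convergence in probability, by
  dominated convergence for the indicators of the bad events.\<close>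

lemma ucp_tendsto_pathwise:
  assumes "prob_space M"
    and "AE \<omega> in M. \<forall>T>0. \<forall>\<epsilon>>0. \<forall>\<^sub>F m in sequentially. \<forall>s\<in>{0<..T}. norm (Y m s \<omega> - X s \<omega>) \<le> \<epsilon>"
  shows "ucp_tendsto M Y X"
  unfolding ucp_tendsto_def
proof (intro allI impI)
  interpret prob_space M by fact
  fix T \<epsilon> :: real assume T: "T > 0" "\<epsilon> > 0"
  define A where "A m = {\<omega> \<in> space M. \<exists>s\<in>{0<..T}. norm (Y m s \<omega> - X s \<omega>) > \<epsilon>}" for m
  \<comment> \<open>A non-measurable set has measure \<open>0\<close> by convention.\<close>
  define B where "B m = (if A m \<in> sets M then A m else {})" for m
  have AB: "measure M (A m) = measure M (B m)" for m
    by (simp add: B_def measure_notin_sets)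
  have [measurable]: "B m \<in> sets M" for m by (simp add: B_def)
  have "(\<lambda>m. \<integral>\<omega>. indicator (B m) \<omega> \<partial>M) \<longlonglongrightarrow> (\<integral>\<omega>. 0 \<partial>M :: real)"
  proof (rule integral_dominated_convergence[where w = "\<lambda>_. 1"])
    show "AE \<omega> in M. (\<lambda>m. indicator (B m) \<omega> :: real) \<longlonglongrightarrow> 0"
      using assms(2)
    proof eventually_elim
      case (elim \<omega>)
      have "\<forall>\<^sub>F m in sequentially. \<forall>s\<in>{0<..T}. norm (Y m s \<omega> - X s \<omega>) \<le> \<epsilon>"
        using elim T by blast
      then have "\<forall>\<^sub>F m in sequentially. indicator (B m) \<omega> = (0::real)"
        by eventually_elim (auto simp: B_def A_def indicator_def not_less)
      then show ?case by (rule tendsto_eventually)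
    qed
  qed (auto simp: indicator_def)
  then show "(\<lambda>m. measure M {\<omega> \<in> space M. \<exists>s\<in>{0<..T}. norm (Y m s \<omega> - X s \<omega>) > \<epsilon>}) \<longlonglongrightarrow> 0"
    using AB by (simp add: A_def)
qed

section \<open>Dyadic grids and elementary processes on them\<close>

definition grid :: "nat \<Rightarrow> nat \<Rightarrow> real" where
  "grid m i = real i / 2 ^ m"

lemma grid_nonneg [simp]: "grid m i \<ge> 0"
  by (simp add: grid_def)

lemma grid_0 [simp]: "grid m 0 = 0"
  by (simp add: grid_def)

lemma grid_less_Suc: "grid m i < grid m (Suc i)"
  by (simp add: grid_def divide_strict_right_mono)

lemma grid_le_iff [simp]: "grid m i \<le> grid m j \<longleftrightarrow> i \<le> j"
  by (simp add: grid_def divide_le_cancel)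

lemma grid_less_iff [simp]: "grid m i < grid m j \<longleftrightarrow> i < j"
  by (simp add: grid_def divide_less_cancel)

lemma grid_Suc_diff: "grid m (Suc i) - grid m i = 1 / 2 ^ m"
  by (simp add: grid_def diff_divide_distrib[symmetric])

text \<open>Each grid is contained in all finer ones; coarse increments are therefore exact sums of
  fine ones.\<close>

lemma grid_refine: "j \<le> m \<Longrightarrow> grid j b = grid m (b * 2 ^ (m - j))"
  by (simp add: grid_def power_diff[symmetric] field_simps power_add[symmetric])

lemma grid_cell:
  assumes "s > 0"
  obtains i where "grid m i < s" "s \<le> grid m (Suc i)"
proof -
  define i where "i = nat (\<lceil>s * 2 ^ m\<rceil> - 1)"
  have p: "\<lceil>s * 2 ^ m\<rceil> \<ge> 1" using assms by (simp add: less_ceiling_iff Int.int_one_le_iff_zero_less)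
  then have r: "real i = of_int \<lceil>s * 2 ^ m\<rceil> - 1" by (simp add: i_def)
  have "real i < s * 2 ^ m" "s * 2 ^ m \<le> real i + 1" unfolding r by linarith+
  then have "grid m i < s" "s \<le> grid m (Suc i)" by (simp_all add: grid_def field_simps)
  then show ?thesis using that by blast
qed

lemma elementary_process_grid:
  assumes "grid m i < s" "s \<le> grid m (Suc i)" "i < p"
  shows "elementary_process p (grid m) \<xi> s \<omega> = \<xi> i \<omega>"
proof -
  have "indicator {grid m j<..grid m (Suc j)} s = (if j = i then 1 else (0::real))" for j
  proof (cases j i rule: linorder_cases)
    case less
    then have "grid m (Suc j) \<le> grid m i" by simp
    then show ?thesis using assms less by (auto simp: indicator_def simp del: grid_le_iff)
  next
    case greater
    then have "grid m (Suc i) \<le> grid m j" by simp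
    then show ?thesis using assms greater by (auto simp: indicator_def simp del: grid_le_iff)
  qed (use assms in auto)
  then have "elementary_process p (grid m) \<xi> s \<omega> = (\<Sum>j<p. if j = i then \<xi> i \<omega> else 0)"
    unfolding elementary_process_def by (intro sum.cong) auto
  then show ?thesis using assms(3) by simp
qed

text \<open>The first \<open>m * 2 ^ m\<close> cells of level \<open>m\<close> cover
  \<open>{0<..m}\<close>, so as \<open>m\<close> grows the mesh shrinks and every \<open>T\<close>
  is passed. Sampling at the left end of a cell keeps the process predictable; uniform continuity on
  \<open>{0..T}\<close> controls the error.\<close>

lemma elementary_process_grid_uniform:
  assumes H: "continuous_on {0..} (\<lambda>t. H t \<omega>)" and \<xi>: "\<And>m i. \<xi> m i \<omega> = H (grid m i) \<omega>"
    and T: "T > 0" and \<epsilon>: "\<epsilon> > 0"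
  shows "\<forall>\<^sub>F m in sequentially. \<forall>s\<in>{0<..T}.
     norm (elementary_process (m * 2 ^ m) (grid m) (\<xi> m) s \<omega> - H s \<omega>) \<le> \<epsilon>"
proof -
  have "uniformly_continuous_on {0..T} (\<lambda>t. H t \<omega>)"
    by (rule compact_uniformly_continuous) (use continuous_on_subset[OF H] in auto)
  then obtain d where d: "d > 0" "\<And>s t. s \<in> {0..T} \<Longrightarrow> t \<in> {0..T} \<Longrightarrow> dist s t < d \<Longrightarrow> dist (H s \<omega>) (H t \<omega>) < \<epsilon>"
    using \<epsilon> unfolding uniformly_continuous_on_def by metis
  have "(\<lambda>m. (1/2::real) ^ m) \<longlonglongrightarrow> 0" by (rule LIMSEQ_power_zero) simp
  then have "\<forall>\<^sub>F m in sequentially. (1/2::real) ^ m < d" using d(1) by (rule order_tendstoD)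
  moreover have "\<forall>\<^sub>F m in sequentially. T \<le> real m"
    using filterlim_real_sequentially by (auto simp: filterlim_at_top)
  ultimately show ?thesis
  proof eventually_elim
    case (elim m)
    show ?case
    proof
      fix s assume s: "s \<in> {0<..T}"
      then obtain i where i: "grid m i < s" "s \<le> grid m (Suc i)" using grid_cell[of s m] by auto
      have "grid m i < grid m (m * 2 ^ m)"
        using i s elim by (simp add: grid_def[of m "m * 2 ^ m"])
      then have "i < m * 2 ^ m" by simp
      then have eq: "elementary_process (m * 2 ^ m) (grid m) (\<xi> m) s \<omega> = H (grid m i) \<omega>"
        using elementary_process_grid[OF i, of "m * 2 ^ m" "\<xi> m" \<omega>] \<xi>[of m i] by metis
      have "dist (grid m i) s < d"
        using i elim grid_Suc_diff[of m i] by (simp add: dist_real_def power_divide)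
      then have "dist (H (grid m i) \<omega>) (H s \<omega>) < \<epsilon>"
        using i s d(2)[of "grid m i" s] grid_nonneg[of m i] by auto
      then show "norm (elementary_process (m * 2 ^ m) (grid m) (\<xi> m) s \<omega> - H s \<omega>) \<le> \<epsilon>"
        unfolding eq by (simp add: dist_norm)
    qed
  qed
qed

text \<open>By continuity an exceedance on \<open>S\<close> already happens on a countable dense
  subset, which makes the event measurable.\<close>

lemma measurable_exceeds:
  assumes "continuous_process M D" "S \<subseteq> {0..}"
  shows "{\<omega> \<in> space M. \<exists>s\<in>S. norm (D s \<omega> :: 'e::euclidean_space) > \<epsilon>} \<in> sets M"
proof -
  obtain C where C: "countable C" "C \<subseteq> S" "S \<subseteq> closure C" using separable[of S] by metis
  have "{\<omega> \<in> space M. \<exists>s\<in>S. norm (D s \<omega>) > \<epsilon>} = (\<Union>s\<in>C. {\<omega> \<in> space M. norm (D s \<omega>) > \<epsilon>})"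
  proof (intro equalityI subsetI)
    fix \<omega> assume "\<omega> \<in> {\<omega> \<in> space M. \<exists>s\<in>S. norm (D s \<omega>) > \<epsilon>}"
    then obtain s where w: "\<omega> \<in> space M" "s \<in> S" "norm (D s \<omega>) > \<epsilon>" by blast
    have "\<exists>c\<in>C. norm (D c \<omega>) > \<epsilon>"
    proof (rule ccontr)
      assume n: "\<not> ?thesis"
      have "continuous_on (closure C \<inter> {0..}) (\<lambda>t. norm (D t \<omega>))"
        using assms(1) w(1) by (auto simp: continuous_process_def intro!: continuous_on_norm intro: continuous_on_subset)
      moreover have "closure C \<inter> {0..} = closure C"
        using closure_minimal[of C "{0..}"] C(2) assms(2) by auto
      ultimately have co: "continuous_on (closure C) (\<lambda>t. norm (D t \<omega>))" by simp
      have "norm (D s \<omega>) \<le> \<epsilon>"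
        by (rule continuous_le_on_closure[OF co]) (use w(2) C(3) n in \<open>auto simp: not_less\<close>)
      then show False using w by simp
    qed
    then show "\<omega> \<in> (\<Union>s\<in>C. {\<omega> \<in> space M. norm (D s \<omega>) > \<epsilon>})" using w by blast
  qed (use C in auto)
  moreover have "{\<omega> \<in> space M. norm (D s \<omega>) > \<epsilon>} \<in> sets M" if "s \<in> C" for s
  proof -
    have [measurable]: "D s \<in> borel_measurable M"
      using assms C that by (auto simp: continuous_process_def)
    show ?thesis by measurable
  qed
  ultimately show ?thesis using C(1) by auto
qed

section \<open>Convergence in probability: characteristic functions and moments\<close>

definition converges_in_prob :: "'w measure \<Rightarrow> (nat \<Rightarrow> 'w \<Rightarrow> real) \<Rightarrow> ('w \<Rightarrow> real) \<Rightarrow> bool" where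
  "converges_in_prob M X Y \<longleftrightarrow>
     (\<forall>\<epsilon>>0. (\<lambda>m. measure M {\<omega> \<in> space M. \<epsilon> < \<bar>X m \<omega> - Y \<omega>\<bar>}) \<longlonglongrightarrow> 0)"

text \<open>Finitely many times lie in one compact interval, on which ucp convergence controls all
  terms at once. Time \<open>0\<close>, which \<open>ucp_tendsto\<close> leaves out, is recovered by
  continuity.\<close>

lemma ucp_tendsto_weighted_sum:
  fixes Y :: "nat \<Rightarrow> real \<Rightarrow> 'w \<Rightarrow> 'e::euclidean_space"
  assumes "prob_space M" and ucp: "ucp_tendsto M Y X"
    and Y: "\<And>m. continuous_process M (Y m)" and X: "continuous_process M X"
    and t: "\<And>i. i \<in> A \<Longrightarrow> t i \<ge> 0" and A: "finite A"
  shows "converges_in_prob M (\<lambda>m \<omega>. \<Sum>i\<in>A. w i \<bullet> Y m (t i) \<omega>) (\<lambda>\<omega>. \<Sum>i\<in>A. w i \<bullet> X (t i) \<omega>)"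
  unfolding converges_in_prob_def
proof (intro allI impI)
  interpret prob_space M by fact
  fix \<epsilon> :: real assume \<epsilon>: "\<epsilon> > 0"
  \<comment> \<open>\<open>T\<close> bounds every \<open>t i\<close> because the times are
    nonnegative. The summand 1, here and in \<open>c\<close> below, keeps both positive even if
    \<open>A\<close> is empty or all times or weights vanish.\<close>
  define T where "T = 1 + (\<Sum>i\<in>A. t i)"
  have tT: "t i \<le> T" if "i \<in> A" for i
    using member_le_sum[of i A t] t A that by (auto simp: T_def intro: add_increasing)
  have T: "T > 0" unfolding T_def using t by (intro add_pos_nonneg sum_nonneg) auto
  define c where "c = 1 + (\<Sum>i\<in>A. norm (w i))"
  have c: "c > 0" unfolding c_def by (intro add_pos_nonneg sum_nonneg) auto
  define \<delta> where "\<delta> = \<epsilon> / c"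
  have \<delta>: "\<delta> > 0" using \<epsilon> c by (simp add: \<delta>_def)
  define B where "B m = {\<omega> \<in> space M. \<exists>s\<in>{0<..T}. norm (Y m s \<omega> - X s \<omega>) > \<delta>}" for m
  have cp: "continuous_process M (\<lambda>s \<omega>. Y m s \<omega> - X s \<omega>)" for m
    using Y[of m] X by (auto simp: continuous_process_def intro!: continuous_on_diff borel_measurable_diff)
  have Bm: "B m \<in> sets M" for m
    unfolding B_def by (rule measurable_exceeds[OF cp]) auto
  have lim: "(\<lambda>m. measure M (B m)) \<longlonglongrightarrow> 0"
    using ucp T \<delta> by (simp add: ucp_tendsto_def B_def)
  have sub: "{\<omega> \<in> space M. \<epsilon> < \<bar>(\<Sum>i\<in>A. w i \<bullet> Y m (t i) \<omega>) - (\<Sum>i\<in>A. w i \<bullet> X (t i) \<omega>)\<bar>} \<subseteq> B m" for m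
  proof
    fix \<omega> assume "\<omega> \<in> {\<omega> \<in> space M. \<epsilon> < \<bar>(\<Sum>i\<in>A. w i \<bullet> Y m (t i) \<omega>) - (\<Sum>i\<in>A. w i \<bullet> X (t i) \<omega>)\<bar>}"
    then have w: "\<omega> \<in> space M" and gt: "\<epsilon> < \<bar>(\<Sum>i\<in>A. w i \<bullet> Y m (t i) \<omega>) - (\<Sum>i\<in>A. w i \<bullet> X (t i) \<omega>)\<bar>" by auto
    show "\<omega> \<in> B m"
    proof (rule ccontr)
      assume "\<omega> \<notin> B m"
      then have le: "norm (Y m s \<omega> - X s \<omega>) \<le> \<delta>" if "s \<in> {0<..T}" for s
        using w that by (auto simp: B_def not_less)
      have co: "continuous_on {0..T} (\<lambda>s. norm (Y m s \<omega> - X s \<omega>))"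
        using cp[of m] w by (auto simp: continuous_process_def intro!: continuous_on_norm intro: continuous_on_subset)
      have le': "norm (Y m s \<omega> - X s \<omega>) \<le> \<delta>" if "s \<in> {0..T}" for s
      proof -
        have cl: "closure {0<..T} = {0..T}" using T by (simp add: closure_greaterThanAtMost)
        show ?thesis
          by (rule continuous_le_on_closure[OF co[folded cl]]) (use le that cl in auto)
      qed
      have "\<bar>(\<Sum>i\<in>A. w i \<bullet> Y m (t i) \<omega>) - (\<Sum>i\<in>A. w i \<bullet> X (t i) \<omega>)\<bar>
         = \<bar>\<Sum>i\<in>A. w i \<bullet> (Y m (t i) \<omega> - X (t i) \<omega>)\<bar>"
        by (simp add: sum_subtractf inner_diff_right)
      also have "\<dots> \<le> (\<Sum>i\<in>A. norm (w i) * \<delta>)"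
        using le' t tT by (intro order_trans[OF sum_abs] sum_mono order_trans[OF Cauchy_Schwarz_ineq2] mult_left_mono) auto
      also have "\<dots> = (c - 1) * \<delta>" by (simp add: c_def sum_distrib_right)
      also have "\<dots> \<le> \<epsilon>" using \<delta> c by (simp add: \<delta>_def field_simps \<epsilon> less_imp_le)
      finally show False using gt by simp
    qed
  qed
  show "(\<lambda>m. measure M {\<omega> \<in> space M. \<epsilon> < \<bar>(\<Sum>i\<in>A. w i \<bullet> Y m (t i) \<omega>) - (\<Sum>i\<in>A. w i \<bullet> X (t i) \<omega>)\<bar>}) \<longlonglongrightarrow> 0"
    by (rule tendsto_sandwich[OF _ _ tendsto_const lim])
      (use finite_measure_mono[OF sub Bm] in auto)
qed

context prob_space
begin

text \<open>The distance of two points \<open>iexp x\<close> and \<open>iexp y\<close> is at most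
  \<open>\<bar>x - y\<bar>\<close> and at most 2; the first bound is used where the variables are
  within \<open>r / 4\<close>, the second on the remaining event of small probability.\<close>

lemma converges_in_prob_char:
  assumes [measurable]: "\<And>m. X m \<in> borel_measurable M" "Y \<in> borel_measurable M"
    and conv: "converges_in_prob M X Y"
  shows "(\<lambda>m. (CLINT \<omega>|M. iexp (X m \<omega>))) \<longlonglongrightarrow> (CLINT \<omega>|M. iexp (Y \<omega>))"
proof (rule LIMSEQ_I)
  fix r :: real assume r: "r > 0"
  define B where "B m = {\<omega> \<in> space M. r/4 < \<bar>X m \<omega> - Y \<omega>\<bar>}" for m
  have [measurable]: "B m \<in> sets M" for m unfolding B_def by measurable
  have [simp]: "integrable M (indicator (B m) :: _ \<Rightarrow> real)" for m
    by (rule integrable_real_indicator) (simp_all add: less_top[symmetric])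
  have "(\<lambda>m. measure M (B m)) \<longlonglongrightarrow> 0"
    using conv r unfolding converges_in_prob_def B_def by (meson divide_pos_pos zero_less_numeral)
  then have "\<forall>\<^sub>F m in sequentially. measure M (B m) < r / 4"
    using r by (intro order_tendstoD) auto
  then obtain m0 where m0: "\<And>m. m \<ge> m0 \<Longrightarrow> measure M (B m) < r / 4"
    by (auto simp: eventually_sequentially)
  have i: "complex_integrable M (\<lambda>\<omega>. iexp (Z \<omega>))" if "Z \<in> borel_measurable M" for Z :: "'a \<Rightarrow> real"
    using that by (intro integrable_const_bound[where B = 1]) auto
  have "norm ((CLINT \<omega>|M. iexp (X m \<omega>)) - (CLINT \<omega>|M. iexp (Y \<omega>))) < r" if m: "m \<ge> m0" for m
  proof -
    have "norm ((CLINT \<omega>|M. iexp (X m \<omega>)) - (CLINT \<omega>|M. iexp (Y \<omega>)))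
       = norm (CLINT \<omega>|M. iexp (X m \<omega>) - iexp (Y \<omega>))"
      by (simp add: i)
    also have "\<dots> \<le> (\<integral>\<omega>. norm (iexp (X m \<omega>) - iexp (Y \<omega>)) \<partial>M)"
      by (rule integral_norm_bound)
    also have "\<dots> \<le> (\<integral>\<omega>. r / 4 + 2 * indicator (B m) \<omega> \<partial>M)"
    proof (rule integral_mono)
      show "integrable M (\<lambda>\<omega>. cmod (iexp (X m \<omega>) - iexp (Y \<omega>)))" by (simp add: i)
      show "integrable M (\<lambda>\<omega>. r / 4 + 2 * indicator (B m) \<omega>)" by simp
      fix \<omega> assume w: "\<omega> \<in> space M"
      have e: "cmod (iexp (X m \<omega>) - iexp (Y \<omega>)) = cmod (iexp (X m \<omega> - Y \<omega>) - 1)"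
      proof -
        have "iexp (X m \<omega>) - iexp (Y \<omega>) = iexp (Y \<omega>) * (iexp (X m \<omega> - Y \<omega>) - 1)"
          by (simp add: algebra_simps exp_add[symmetric])
        then show ?thesis by (simp add: norm_mult)
      qed
      have 1: "cmod (iexp (X m \<omega> - Y \<omega>) - 1) \<le> \<bar>X m \<omega> - Y \<omega>\<bar>"
        using iexp_approx1[of "X m \<omega> - Y \<omega>" 0] by simp
      have 2: "cmod (iexp (X m \<omega> - Y \<omega>) - 1) \<le> 2"
        using norm_triangle_ineq4[of "iexp (X m \<omega> - Y \<omega>)" 1] by simp
      show "cmod (iexp (X m \<omega>) - iexp (Y \<omega>)) \<le> r / 4 + 2 * indicator (B m) \<omega>"
        unfolding e using 1 2 w r by (cases "\<omega> \<in> B m") (auto simp: B_def)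
    qed
    also have "\<dots> = r / 4 + 2 * measure M (B m)"
      by (simp add: prob_space)
    also have "\<dots> < r" using m0[OF m] r by simp
    finally show ?thesis .
  qed
  then show "\<exists>no. \<forall>m\<ge>no. norm ((CLINT \<omega>|M. iexp (X m \<omega>)) - (CLINT \<omega>|M. iexp (Y \<omega>))) < r"
    by blast
qed

lemma integrable_bounded_powers:
  fixes X :: "'a \<Rightarrow> real"
  assumes [measurable]: "X \<in> borel_measurable M" and "AE \<omega> in M. \<bar>X \<omega>\<bar> \<le> C"
  shows "integrable M (\<lambda>\<omega>. X \<omega> ^ k)"
proof (rule integrable_const_bound)
  show "AE \<omega> in M. norm (X \<omega> ^ k) \<le> C ^ k"
    using assms(2) by eventually_elim (simp add: power_abs power_mono)
qed simp

lemma integrable_fourth_powers: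
  fixes X :: "'a \<Rightarrow> real"
  assumes [measurable]: "X \<in> borel_measurable M" and "integrable M (\<lambda>\<omega>. X \<omega> ^ 4)"
  shows "integrable M X" "integrable M (\<lambda>\<omega>. (X \<omega>)\<^sup>2)"
proof -
  have 2: "x\<^sup>2 \<le> 1 + x ^ 4" and 1: "\<bar>x\<bar> \<le> 1 + x\<^sup>2" for x :: real
    using zero_le_power2[of "x\<^sup>2 - 1/2"] zero_le_power2[of "\<bar>x\<bar> - 1/2"]
    by (auto simp: power2_eq_square power4_eq_xxxx algebra_simps)
  have b: "\<bar>x\<bar> \<le> 2 + x ^ 4" for x :: real using 1[of x] 2[of x] by linarith
  have i: "integrable M (\<lambda>\<omega>. 2 + X \<omega> ^ 4)" using assms(2) by simp
  have "\<bar>x\<bar> \<le> \<bar>2 + x ^ 4\<bar>" "\<bar>x\<^sup>2\<bar> \<le> \<bar>2 + x ^ 4\<bar>" for x :: real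
    using b[of x] 2[of x] by auto
  then show "integrable M X" "integrable M (\<lambda>\<omega>. (X \<omega>)\<^sup>2)"
    by (auto intro!: Bochner_Integration.integrable_bound[OF i])
qed

text \<open>Bounded fourth moments make the squares uniformly integrable, which turns convergence in
  probability into convergence in mean square. The integrability of \<open>Y\<close> comes from its
  almost sure bound, yet the bound for its fourth moment does not involve \<open>C\<close>. The
  factor 8 is that of \<open>(x + y)^4 \<le> 8 (x^4 + y^4)\<close>, paid for splitting
  \<open>Y\<close> into \<open>X m\<close> and a small error.\<close>

lemma converges_in_prob_L2:
  assumes [measurable]: "\<And>m. X m \<in> borel_measurable M" "Y \<in> borel_measurable M"
    and conv: "converges_in_prob M X Y"
    and i4: "\<And>m. integrable M (\<lambda>\<omega>. X m \<omega> ^ 4)" and D: "\<And>m. (\<integral>\<omega>. X m \<omega> ^ 4 \<partial>M) \<le> D"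
    and Y: "AE \<omega> in M. \<bar>Y \<omega>\<bar> \<le> C"
  shows "(\<lambda>m. \<integral>\<omega>. (X m \<omega> - Y \<omega>)\<^sup>2 \<partial>M) \<longlonglongrightarrow> 0"
    "(\<integral>\<omega>. Y \<omega> ^ 4 \<partial>M) \<le> 8 * D"
proof -
  have four: "(x + y) ^ 4 \<le> 8 * (x ^ 4 + y ^ 4)" for x y :: real
  proof -
    have "(x + y)\<^sup>2 \<le> 2 * (x\<^sup>2 + y\<^sup>2)" using zero_le_power2[of "x - y"] by (simp add: power2_eq_square algebra_simps)
    then have "((x + y)\<^sup>2)\<^sup>2 \<le> (2 * (x\<^sup>2 + y\<^sup>2))\<^sup>2" by (intro power_mono) auto
    also have "\<dots> \<le> 8 * (x ^ 4 + y ^ 4)"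
      using zero_le_power2[of "x\<^sup>2 - y\<^sup>2"] by (simp add: power2_eq_square power4_eq_xxxx algebra_simps)
    finally show ?thesis by (simp add: power4_eq_xxxx power2_eq_square algebra_simps)
  qed
  have iY: "integrable M (\<lambda>\<omega>. Y \<omega> ^ k)" for k
    by (rule integrable_bounded_powers[OF _ Y]) simp
  have bnd: "(X m \<omega> - Y \<omega>) ^ 4 \<le> 8 * (X m \<omega> ^ 4 + Y \<omega> ^ 4)" for m \<omega>
    using four[of "X m \<omega>" "- Y \<omega>"] by simp
  have iXY: "integrable M (\<lambda>\<omega>. (X m \<omega> - Y \<omega>) ^ 4)" for m
    by (rule Bochner_Integration.integrable_bound[of _ "\<lambda>\<omega>. 8 * (X m \<omega> ^ 4 + Y \<omega> ^ 4)"])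
       (use i4 iY bnd in auto)
  define E where "E = 8 * (D + (\<integral>\<omega>. Y \<omega> ^ 4 \<partial>M)) + 1"
  have EXY: "(\<integral>\<omega>. (X m \<omega> - Y \<omega>) ^ 4 \<partial>M) \<le> E" for m
  proof -
    have "(\<integral>\<omega>. (X m \<omega> - Y \<omega>) ^ 4 \<partial>M) \<le> (\<integral>\<omega>. 8 * (X m \<omega> ^ 4 + Y \<omega> ^ 4) \<partial>M)"
      using iXY i4 iY bnd by (intro integral_mono) auto
    then show ?thesis using D[of m] i4 iY by (simp add: E_def)
  qed
  have E: "E > 0"
  proof -
    have "0 \<le> D + (\<integral>\<omega>. Y \<omega> ^ 4 \<partial>M)" using order_trans[OF _ D[of 0]] by simp
    then show ?thesis unfolding E_def by simp
  qed
  show "(\<lambda>m. \<integral>\<omega>. (X m \<omega> - Y \<omega>)\<^sup>2 \<partial>M) \<longlonglongrightarrow> 0"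
  proof (rule LIMSEQ_I)
    fix r :: real assume r: "r > 0"
    \<comment> \<open>With \<open>z\<close> the difference, \<open>z^2\<close> is at most
      \<open>\<epsilon>^2 = r / 4\<close> off \<open>B m\<close>, and at most
      \<open>\<delta> z^4 + 1 / \<delta>\<close> everywhere, by the inequality of arithmetic and
      geometric means. For this \<open>\<delta>\<close> the mean of \<open>\<delta> z^4\<close> is
      at most \<open>r / 4\<close>, and so is the contribution of \<open>1 / \<delta>\<close> once
      \<open>B m\<close> is small: together \<open>3 r / 4\<close>.\<close>
    define \<delta> where "\<delta> = r / (4 * E)"
    have \<delta>: "\<delta> > 0" using r E by (simp add: \<delta>_def)
    define \<epsilon> where "\<epsilon> = sqrt (r / 4)"
    have \<epsilon>: "\<epsilon> > 0" "\<epsilon>\<^sup>2 = r / 4" using r by (auto simp: \<epsilon>_def)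
    define B where "B m = {\<omega> \<in> space M. \<epsilon> < \<bar>X m \<omega> - Y \<omega>\<bar>}" for m
    have [measurable]: "B m \<in> sets M" for m unfolding B_def by measurable
    have [simp]: "integrable M (indicator (B m) :: _ \<Rightarrow> real)" for m
      by (rule integrable_real_indicator) (simp_all add: less_top[symmetric])
    have "(\<lambda>m. measure M (B m)) \<longlonglongrightarrow> 0"
      using conv \<epsilon> by (simp add: converges_in_prob_def B_def)
    then have "\<forall>\<^sub>F m in sequentially. measure M (B m) < r * \<delta> / 4"
      using r \<delta> by (intro order_tendstoD) auto
    then obtain m0 where m0: "\<And>m. m \<ge> m0 \<Longrightarrow> measure M (B m) < r * \<delta> / 4"
      by (auto simp: eventually_sequentially)
    have "norm ((\<integral>\<omega>. (X m \<omega> - Y \<omega>)\<^sup>2 \<partial>M) - 0) < r" if m: "m \<ge> m0" for m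
    proof -
      have "(\<integral>\<omega>. (X m \<omega> - Y \<omega>)\<^sup>2 \<partial>M) \<le> (\<integral>\<omega>. \<epsilon>\<^sup>2 + \<delta> * (X m \<omega> - Y \<omega>) ^ 4 + (1 / \<delta>) * indicator (B m) \<omega> \<partial>M)"
      proof (rule integral_mono)
        show "integrable M (\<lambda>\<omega>. (X m \<omega> - Y \<omega>)\<^sup>2)"
          by (rule integrable_fourth_powers(2)[OF _ iXY]) simp
        show "integrable M (\<lambda>\<omega>. \<epsilon>\<^sup>2 + \<delta> * (X m \<omega> - Y \<omega>) ^ 4 + (1 / \<delta>) * indicator (B m) \<omega>)"
          using iXY[of m] by simp
        fix \<omega> assume w: "\<omega> \<in> space M"
        define z where "z = X m \<omega> - Y \<omega>"
        show "(X m \<omega> - Y \<omega>)\<^sup>2 \<le> \<epsilon>\<^sup>2 + \<delta> * (X m \<omega> - Y \<omega>) ^ 4 + (1 / \<delta>) * indicator (B m) \<omega>"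
        proof (cases "\<omega> \<in> B m")
          case True
          have "0 \<le> \<delta> * (z\<^sup>2 - 1 / (2 * \<delta>))\<^sup>2" using \<delta> by simp
          also have "\<dots> = \<delta> * z ^ 4 - z\<^sup>2 + 1 / (4 * \<delta>)"
            using \<delta> by (simp add: power2_eq_square power4_eq_xxxx field_simps)
          finally have "z\<^sup>2 \<le> \<delta> * z ^ 4 + 1 / (4 * \<delta>)" by simp
          also have "1 / (4 * \<delta>) \<le> 1 / \<delta>" using \<delta> by (simp add: field_simps)
          finally show ?thesis using True by (simp add: z_def add.assoc) (smt (verit) zero_le_power2)
        next
          case False
          then have "\<bar>z\<bar> \<le> \<epsilon>" using w by (auto simp: B_def z_def)
          then have "z\<^sup>2 \<le> \<epsilon>\<^sup>2" using power_mono[of "\<bar>z\<bar>" \<epsilon> 2] by simp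
          moreover have "0 \<le> \<delta> * z ^ 4" using \<delta> by simp
          ultimately show ?thesis using False by (simp add: z_def)
        qed
      qed
      also have "\<dots> = r / 4 + \<delta> * (\<integral>\<omega>. (X m \<omega> - Y \<omega>) ^ 4 \<partial>M) + (1 / \<delta>) * measure M (B m)"
        using iXY[of m] \<epsilon> by (simp add: prob_space)
      also have "\<dots> \<le> r / 4 + \<delta> * E + (1 / \<delta>) * (r * \<delta> / 4)"
        using \<delta> EXY[of m] m0[OF m] by (intro add_mono mult_left_mono) auto
      also have "\<dots> < r" using r E \<delta> by (simp add: \<delta>_def)
      finally show ?thesis by simp
    qed
    then show "\<exists>no. \<forall>m\<ge>no. norm ((\<integral>\<omega>. (X m \<omega> - Y \<omega>)\<^sup>2 \<partial>M) - 0) < r" by blast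
  qed
  show "(\<integral>\<omega>. Y \<omega> ^ 4 \<partial>M) \<le> 8 * D"
  proof (rule field_le_epsilon)
    fix e :: real assume e: "e > 0"
    \<comment> \<open>\<open>8 \<epsilon>^4 = e / 2\<close>; the other half of \<open>e\<close> is
      spent on \<open>B m\<close>, where only the bound \<open>C\<close> is available.\<close>
    define \<epsilon> where "\<epsilon> = root 4 (e / 16)"
    have \<epsilon>: "\<epsilon> > 0" "\<epsilon> ^ 4 = e / 16" using e by (auto simp: \<epsilon>_def)
    define B where "B m = {\<omega> \<in> space M. \<epsilon> < \<bar>X m \<omega> - Y \<omega>\<bar>}" for m
    have [measurable]: "B m \<in> sets M" for m unfolding B_def by measurable
    have [simp]: "integrable M (indicator (B m) :: _ \<Rightarrow> real)" for m
      by (rule integrable_real_indicator) (simp_all add: less_top[symmetric])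
    have C: "C ^ 4 \<ge> 0" by simp
    have "(\<lambda>m. C ^ 4 * measure M (B m)) \<longlonglongrightarrow> C ^ 4 * 0"
      using conv \<epsilon> by (intro tendsto_intros) (simp add: converges_in_prob_def B_def)
    then have "\<forall>\<^sub>F m in sequentially. C ^ 4 * measure M (B m) < e / 2"
      using e by (intro order_tendstoD) auto
    then obtain m where m: "C ^ 4 * measure M (B m) < e / 2"
      by (auto simp: eventually_sequentially)
    have "(\<integral>\<omega>. Y \<omega> ^ 4 \<partial>M) \<le> (\<integral>\<omega>. 8 * (X m \<omega> ^ 4 + \<epsilon> ^ 4) + C ^ 4 * indicator (B m) \<omega> \<partial>M)"
    proof (rule integral_mono_AE)
      show "integrable M (\<lambda>\<omega>. Y \<omega> ^ 4)" by (rule iY)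
      show "integrable M (\<lambda>\<omega>. 8 * (X m \<omega> ^ 4 + \<epsilon> ^ 4) + C ^ 4 * indicator (B m) \<omega>)" using i4[of m] by simp
      show "AE \<omega> in M. Y \<omega> ^ 4 \<le> 8 * (X m \<omega> ^ 4 + \<epsilon> ^ 4) + C ^ 4 * indicator (B m) \<omega>"
        using Y AE_space
      proof eventually_elim
        case (elim \<omega>)
        show ?case
        proof (cases "\<omega> \<in> B m")
          case True
          have "\<bar>Y \<omega>\<bar> ^ 4 \<le> C ^ 4" using elim by (intro power_mono) auto
          then have "Y \<omega> ^ 4 \<le> C ^ 4" by simp
          moreover have "0 \<le> 8 * (X m \<omega> ^ 4 + \<epsilon> ^ 4)" by (intro mult_nonneg_nonneg add_nonneg_nonneg) auto
          moreover have "C ^ 4 * indicator (B m) \<omega> = C ^ 4" using True by simp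
          ultimately show ?thesis by linarith
        next
          case False
          then have "\<bar>Y \<omega> - X m \<omega>\<bar> ^ 4 \<le> \<epsilon> ^ 4" using elim by (intro power_mono) (auto simp: B_def)
          then have "(Y \<omega> - X m \<omega>) ^ 4 \<le> \<epsilon> ^ 4" by simp
          then show ?thesis using four[of "X m \<omega>" "Y \<omega> - X m \<omega>"] False by simp
        qed
      qed
    qed
    also have "\<dots> = 8 * (\<integral>\<omega>. X m \<omega> ^ 4 \<partial>M) + 8 * \<epsilon> ^ 4 + C ^ 4 * measure M (B m)"
      using i4[of m] by (simp add: prob_space)
    also have "\<dots> \<le> 8 * D + e / 2 + e / 2"
      using D[of m] m \<epsilon> by (intro add_mono) auto
    finally show "(\<integral>\<omega>. Y \<omega> ^ 4 \<partial>M) \<le> 8 * D + e" by simp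
  qed
qed

text \<open>\<open>key\<close> is Cauchy-Schwarz in the form of a weighted mean inequality: a
  bounded factor does not disturb mean-square convergence. It is used with \<open>Z\<close> for the
  first claim, and with \<open>Y\<close> itself for the cross term in the expansion of the square of
  \<open>X m = (X m - Y) + Y\<close>.\<close>

lemma L2_tendsto_moments:
  fixes X :: "nat \<Rightarrow> 'a \<Rightarrow> real"
  assumes [measurable]: "\<And>m. X m \<in> borel_measurable M" "Y \<in> borel_measurable M"
    and i4: "\<And>m. integrable M (\<lambda>\<omega>. X m \<omega> ^ 4)"
    and Y: "AE \<omega> in M. \<bar>Y \<omega>\<bar> \<le> C"
    and lim: "(\<lambda>m. \<integral>\<omega>. (X m \<omega> - Y \<omega>)\<^sup>2 \<partial>M) \<longlonglongrightarrow> 0"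
    and Z[measurable]: "Z \<in> borel_measurable M" and Zb: "AE \<omega> in M. \<bar>Z \<omega>\<bar> \<le> B"
  shows "(\<lambda>m. \<integral>\<omega>. Z \<omega> * X m \<omega> \<partial>M) \<longlonglongrightarrow> (\<integral>\<omega>. Z \<omega> * Y \<omega> \<partial>M)"
    "(\<lambda>m. \<integral>\<omega>. (X m \<omega>)\<^sup>2 \<partial>M) \<longlonglongrightarrow> (\<integral>\<omega>. (Y \<omega>)\<^sup>2 \<partial>M)"
proof -
  have iY: "integrable M (\<lambda>\<omega>. Y \<omega> ^ k)" for k
    by (rule integrable_bounded_powers[OF _ Y]) simp
  have iX: "integrable M (X m)" "integrable M (\<lambda>\<omega>. (X m \<omega>)\<^sup>2)" for m
    using integrable_fourth_powers[OF _ i4] by auto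
  have mult: "integrable M (\<lambda>\<omega>. U \<omega> * f \<omega>)" if "integrable M f" "AE \<omega> in M. \<bar>U \<omega>\<bar> \<le> K" "U \<in> borel_measurable M"
    for U f :: "'a \<Rightarrow> real" and K
  proof (rule Bochner_Integration.integrable_bound[of _ "\<lambda>\<omega>. K * f \<omega>"])
    show "AE \<omega> in M. norm (U \<omega> * f \<omega>) \<le> norm (K * f \<omega>)"
      using that(2) by eventually_elim (auto simp: abs_mult intro!: mult_right_mono)
  qed (use that in auto)
  have iY1: "integrable M Y" using iY[of 1] by simp
  have iD: "integrable M (\<lambda>\<omega>. (X m \<omega> - Y \<omega>)\<^sup>2)" for m
    using iX[of m] iY[of 2] mult[OF iX(1) Y, of m] by (simp add: power2_diff mult.assoc mult.commute[of "X m _"])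
  have key: "(\<lambda>m. \<integral>\<omega>. U \<omega> * (X m \<omega> - Y \<omega>) \<partial>M) \<longlonglongrightarrow> 0" if U: "AE \<omega> in M. \<bar>U \<omega>\<bar> \<le> K" "U \<in> borel_measurable M" for U K
  proof (rule LIMSEQ_I)
    fix r :: real assume r: "r > 0"
    \<comment> \<open>Half of \<open>r\<close> is meant for \<open>d * K^2\<close>, half for the
      mean square divided by \<open>d\<close>; the \<open>+ 1\<close> covers
      \<open>K = 0\<close>.\<close>
    define d where "d = r / (2 * (K\<^sup>2 + 1))"
    have d: "d > 0" using r by (simp add: d_def add_nonneg_pos)
    have "\<forall>\<^sub>F m in sequentially. (\<integral>\<omega>. (X m \<omega> - Y \<omega>)\<^sup>2 \<partial>M) < d * r / 2"
      using lim r d by (intro order_tendstoD) auto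
    then obtain m0 where m0: "\<And>m. m \<ge> m0 \<Longrightarrow> (\<integral>\<omega>. (X m \<omega> - Y \<omega>)\<^sup>2 \<partial>M) < d * r / 2"
      by (auto simp: eventually_sequentially)
    have "norm ((\<integral>\<omega>. U \<omega> * (X m \<omega> - Y \<omega>) \<partial>M) - 0) < r" if "m \<ge> m0" for m
    proof -
      have "norm (\<integral>\<omega>. U \<omega> * (X m \<omega> - Y \<omega>) \<partial>M) \<le> (\<integral>\<omega>. norm (U \<omega> * (X m \<omega> - Y \<omega>)) \<partial>M)"
        by (rule integral_norm_bound)
      also have "\<dots> \<le> (\<integral>\<omega>. d * K\<^sup>2 + (1 / d) * (X m \<omega> - Y \<omega>)\<^sup>2 \<partial>M)"
      proof (rule integral_mono_AE)
        show "integrable M (\<lambda>\<omega>. norm (U \<omega> * (X m \<omega> - Y \<omega>)))"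
          by (intro integrable_norm mult[OF _ U] Bochner_Integration.integrable_diff iX iY1)
        show "integrable M (\<lambda>\<omega>. d * K\<^sup>2 + (1 / d) * (X m \<omega> - Y \<omega>)\<^sup>2)" using iD by simp
        show "AE \<omega> in M. norm (U \<omega> * (X m \<omega> - Y \<omega>)) \<le> d * K\<^sup>2 + (1 / d) * (X m \<omega> - Y \<omega>)\<^sup>2"
          using U(1)
        proof eventually_elim
          case (elim \<omega>)
          define z where "z = \<bar>X m \<omega> - Y \<omega>\<bar>"
          have "0 \<le> d * (\<bar>U \<omega>\<bar> - z / d)\<^sup>2" using d by simp
          also have "\<dots> = d * (U \<omega>)\<^sup>2 - 2 * (\<bar>U \<omega>\<bar> * z) + (1 / d) * z\<^sup>2"
            using d by (simp add: power2_eq_square field_simps)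
          finally have "2 * (\<bar>U \<omega>\<bar> * z) \<le> d * (U \<omega>)\<^sup>2 + (1 / d) * z\<^sup>2" by simp
          moreover have "0 \<le> \<bar>U \<omega>\<bar> * z" by (simp add: z_def)
          moreover have "d * (U \<omega>)\<^sup>2 \<le> d * K\<^sup>2"
            using d power_mono[OF elim, of 2] by (intro mult_left_mono) auto
          ultimately have "\<bar>U \<omega>\<bar> * z \<le> d * K\<^sup>2 + (1 / d) * z\<^sup>2" by linarith
          then show ?case by (simp add: abs_mult z_def)
        qed
      qed
      also have "\<dots> = d * K\<^sup>2 + (1 / d) * (\<integral>\<omega>. (X m \<omega> - Y \<omega>)\<^sup>2 \<partial>M)"
        using iD by (simp add: prob_space)
      also have "\<dots> < d * K\<^sup>2 + (1 / d) * (d * r / 2)"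
        using m0[OF that] d by (intro add_strict_left_mono mult_strict_left_mono) auto
      also have "\<dots> \<le> d * (K\<^sup>2 + 1) + r / 2" using d by (simp add: algebra_simps)
      also have "d * (K\<^sup>2 + 1) = r / 2"
        unfolding d_def by (simp add: field_simps add_nonneg_eq_0_iff)
      finally show ?thesis by simp
    qed
    then show "\<exists>no. \<forall>m\<ge>no. norm ((\<integral>\<omega>. U \<omega> * (X m \<omega> - Y \<omega>) \<partial>M) - 0) < r" by blast
  qed
  have eq: "(\<integral>\<omega>. U \<omega> * (X m \<omega> - Y \<omega>) \<partial>M) = (\<integral>\<omega>. U \<omega> * X m \<omega> \<partial>M) - (\<integral>\<omega>. U \<omega> * Y \<omega> \<partial>M)"
    if "AE \<omega> in M. \<bar>U \<omega>\<bar> \<le> K" "U \<in> borel_measurable M" for U K m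
    using mult[OF iX(1) that] mult[OF iY1 that] by (simp add: right_diff_distrib)
  show "(\<lambda>m. \<integral>\<omega>. Z \<omega> * X m \<omega> \<partial>M) \<longlonglongrightarrow> (\<integral>\<omega>. Z \<omega> * Y \<omega> \<partial>M)"
    using key[OF Zb Z] unfolding eq[OF Zb Z] by (simp add: LIM_zero_iff)
  have "(\<integral>\<omega>. (X m \<omega>)\<^sup>2 \<partial>M) = (\<integral>\<omega>. (X m \<omega> - Y \<omega>)\<^sup>2 \<partial>M) + 2 * (\<integral>\<omega>. Y \<omega> * (X m \<omega> - Y \<omega>) \<partial>M) + (\<integral>\<omega>. (Y \<omega>)\<^sup>2 \<partial>M)" for m
  proof -
    have "(\<integral>\<omega>. (X m \<omega>)\<^sup>2 \<partial>M) = (\<integral>\<omega>. (X m \<omega> - Y \<omega>)\<^sup>2 + 2 * (Y \<omega> * (X m \<omega> - Y \<omega>)) + (Y \<omega>)\<^sup>2 \<partial>M)"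
      by (intro Bochner_Integration.integral_cong) (auto simp: power2_eq_square algebra_simps)
    moreover have "integrable M (\<lambda>\<omega>. Y \<omega> * (X m \<omega> - Y \<omega>))"
      by (intro mult[OF _ Y] Bochner_Integration.integrable_diff iX iY1) simp
    ultimately show ?thesis using iD iY[of 2] by simp
  qed
  moreover have "(\<lambda>m. (\<integral>\<omega>. (X m \<omega> - Y \<omega>)\<^sup>2 \<partial>M) + 2 * (\<integral>\<omega>. Y \<omega> * (X m \<omega> - Y \<omega>) \<partial>M) + (\<integral>\<omega>. (Y \<omega>)\<^sup>2 \<partial>M))
      \<longlonglongrightarrow> 0 + 2 * 0 + (\<integral>\<omega>. (Y \<omega>)\<^sup>2 \<partial>M)"
    by (intro tendsto_intros lim key[OF Y]) simp
  ultimately show "(\<lambda>m. \<integral>\<omega>. (X m \<omega>)\<^sup>2 \<partial>M) \<longlonglongrightarrow> (\<integral>\<omega>. (Y \<omega>)\<^sup>2 \<partial>M)" by simp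
qed

end

section \<open>Integrals against Brownian motion\<close>

text \<open>Linear functionals of finitely many dyadic increments. With arbitrary weights they
  determine the joint law through characteristic functions; with weights that vanish before an index
  and are constant afterwards they reduce to one increment.\<close>

definition grid_sum :: "nat \<Rightarrow> nat \<Rightarrow> (nat \<Rightarrow> 'e::real_inner) \<Rightarrow> (real \<Rightarrow> 'w \<Rightarrow> 'e) \<Rightarrow> 'w \<Rightarrow> real" where
  "grid_sum j p w Z \<omega> = (\<Sum>i<p. w i \<bullet> (Z (grid j (Suc i)) \<omega> - Z (grid j i) \<omega>))"

lemma grid_sum_measurable:
  assumes "continuous_process M (Z :: real \<Rightarrow> 'w \<Rightarrow> 'e::euclidean_space)"
  shows "grid_sum j p w Z \<in> borel_measurable M"
proof -
  have [measurable]: "Z (grid j i) \<in> borel_measurable M" for i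
    using assms by (simp add: continuous_process_def)
  show ?thesis unfolding grid_sum_def[abs_def] by measurable
qed

lemma ucp_tendsto_grid_sum:
  fixes Y :: "nat \<Rightarrow> real \<Rightarrow> 'w \<Rightarrow> 'e::euclidean_space"
  assumes "prob_space M" and ucp: "ucp_tendsto M Y X"
    and Y: "\<And>m. continuous_process M (Y m)" and X: "continuous_process M X"
  shows "converges_in_prob M (\<lambda>m. grid_sum j p w (Y m)) (grid_sum j p w X)"
proof -
  \<comment> \<open>Each increment becomes two signed evaluations, told apart by a boolean index, to
    fit \<open>ucp_tendsto_weighted_sum\<close>.\<close>
  have eq: "grid_sum j p w Z = (\<lambda>\<omega>. \<Sum>x\<in>{..<p} \<times> UNIV. (if snd x then w (fst x) else - w (fst x)) \<bullet>
     Z (if snd x then grid j (Suc (fst x)) else grid j (fst x)) \<omega>)" for Z :: "real \<Rightarrow> 'w \<Rightarrow> 'e"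
    unfolding grid_sum_def[abs_def]
    by (simp add: sum.cartesian_product' UNIV_bool inner_diff_right)
  show ?thesis
    unfolding eq by (rule ucp_tendsto_weighted_sum[OF assms]) auto
qed

lemma elementary_integral_grid:
  assumes "bounded_bilinear pr" "q \<le> p"
  shows "elementary_integral pr p (grid m) \<xi> X (grid m q) \<omega> =
     (\<Sum>i<q. pr (\<xi> i \<omega>) (X (grid m (Suc i)) \<omega> - X (grid m i) \<omega>))"
proof -
  interpret bounded_bilinear pr by fact
  have "elementary_integral pr p (grid m) \<xi> X (grid m q) \<omega> =
    (\<Sum>i<p. if i < q then pr (\<xi> i \<omega>) (X (grid m (Suc i)) \<omega> - X (grid m i) \<omega>) else 0)"
    unfolding elementary_integral_def
    by (intro sum.cong refl) (auto simp: min_def zero_right not_le not_less Suc_le_eq)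
  also have "\<dots> = (\<Sum>i\<in>{..<p} \<inter> {i. i < q}. pr (\<xi> i \<omega>) (X (grid m (Suc i)) \<omega> - X (grid m i) \<omega>))"
    by (simp add: sum.inter_restrict[symmetric] sum.If_cases)
  also have "{..<p} \<inter> {i. i < q} = {..<q}" using assms(2) by auto
  finally show ?thesis .
qed

lemma continuous_process_elementary_integral:
  assumes "bounded_bilinear pr" and X: "continuous_process M (X :: real \<Rightarrow> 'w \<Rightarrow> 'x::euclidean_space)"
    and \<xi>: "\<And>i. \<xi> i \<in> borel_measurable M"
  shows "continuous_process M (elementary_integral pr p (grid m)
     (\<xi> :: nat \<Rightarrow> 'w \<Rightarrow> 'h::euclidean_space) X :: real \<Rightarrow> 'w \<Rightarrow> 'y::euclidean_space)"
  unfolding continuous_process_def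
proof (intro conjI allI impI ballI)
  interpret bounded_bilinear pr by fact
  have cont: "continuous_on UNIV (\<lambda>x. pr (fst x) (snd x))"
    by (intro continuous_on continuous_intros)
  have pm: "(\<lambda>\<omega>. pr (f \<omega>) (g \<omega>)) \<in> borel_measurable M"
    if "f \<in> borel_measurable M" "g \<in> borel_measurable M" for f :: "'w \<Rightarrow> 'h" and g :: "'w \<Rightarrow> 'x"
    by (rule borel_measurable_continuous_Pair[OF that]) (use cont in simp)
  show "elementary_integral pr p (grid m) \<xi> X t \<in> borel_measurable M" if "t \<ge> 0" for t
  proof -
    have Xm: "X (min (grid m i) t) \<in> borel_measurable M" for i
      using X that by (simp add: continuous_process_def)
    show ?thesis
      unfolding elementary_integral_def[abs_def]
      by (intro borel_measurable_sum pm \<xi> borel_measurable_diff Xm)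
  qed
  fix \<omega> assume w: "\<omega> \<in> space M"
  have "continuous_on {0..} (\<lambda>t. X (min (grid m i) t) \<omega>)" for i
  proof -
    have "continuous_on {0..} ((\<lambda>t. X t \<omega>) \<circ> min (grid m i))"
      using X w by (intro continuous_on_compose continuous_intros)
        (auto simp: continuous_process_def intro: continuous_on_subset)
    then show ?thesis by (simp add: o_def)
  qed
  then show "continuous_on {0..} (\<lambda>t. elementary_integral pr p (grid m) \<xi> X t \<omega>)"
    unfolding elementary_integral_def
    by (intro continuous_intros continuous_on continuous_on_const)
qed

lemma stochastic_integralD:
  assumes "stochastic_integral M F pr H X I"
  shows "filtered_by M F" "adapted F H" "continuous_process M H" "continuous_process M X"
    "continuous_process M I"
  using assms by (auto simp: stochastic_integral_def)

lemma stochastic_integral_ucp: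
  assumes "stochastic_integral M F pr H X I" "\<And>m. elementary M F (p m) (\<tau> m) (\<xi> m)"
    "ucp_tendsto M (\<lambda>m. elementary_process (p m) (\<tau> m) (\<xi> m)) H"
  shows "ucp_tendsto M (\<lambda>m. elementary_integral pr (p m) (\<tau> m) (\<xi> m) X) I"
proof -
  have "\<forall>p \<tau> \<xi>. (\<forall>m. elementary M F (p m) (\<tau> m) (\<xi> m)) \<longrightarrow>
        ucp_tendsto M (\<lambda>m. elementary_process (p m) (\<tau> m) (\<xi> m)) H \<longrightarrow>
        ucp_tendsto M (\<lambda>m. elementary_integral pr (p m) (\<tau> m) (\<xi> m) X) I"
    using assms(1) unfolding stochastic_integral_def by (elim conjE)
  from this[rule_format, OF assms(2,3)] show ?thesis .
qed

text \<open>Of the arbitrary approximating sequences in \<open>stochastic_integral\<close> only the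
  dyadic one is used. The sampled values \<open>\<xi>\<close> may differ from \<open>H\<close> on a
  null set, because elementary integrands must be bounded at every point, whereas \<open>H\<close>
  may be bounded only almost surely.\<close>

lemma stochastic_integral_grid:
  fixes \<xi> :: "nat \<Rightarrow> nat \<Rightarrow> 'w \<Rightarrow> 'h::euclidean_space"
  assumes M: "prob_space M" and SI: "stochastic_integral M F pr H X I"
    and \<xi>: "\<And>m i. \<xi> m i \<in> borel_measurable (F (grid m i))"
    and bd: "\<And>m i. \<exists>C. \<forall>\<omega>\<in>space M. norm (\<xi> m i \<omega>) \<le> C"
    and eq: "AE \<omega> in M. \<forall>m i. \<xi> m i \<omega> = H (grid m i) \<omega>"
  shows "ucp_tendsto M (\<lambda>m. elementary_integral pr (m * 2 ^ m) (grid m) (\<xi> m) X) I"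
proof -
  have el: "elementary M F (m * 2 ^ m) (grid m) (\<xi> m)" for m
    unfolding elementary_def using \<xi> bd less_imp_le[OF grid_less_Suc] by simp
  have "ucp_tendsto M (\<lambda>m. elementary_process (m * 2 ^ m) (grid m) (\<xi> m)) H"
  proof (rule ucp_tendsto_pathwise[OF M])
    show "AE \<omega> in M. \<forall>T>0. \<forall>\<epsilon>>0. \<forall>\<^sub>F m in sequentially. \<forall>s\<in>{0<..T}.
      norm (elementary_process (m * 2 ^ m) (grid m) (\<xi> m) s \<omega> - H s \<omega>) \<le> \<epsilon>"
      using eq AE_space
    proof eventually_elim
      case (elim \<omega>)
      have co: "continuous_on {0..} (\<lambda>t. H t \<omega>)"
        using stochastic_integralD(3)[OF SI] elim by (simp add: continuous_process_def)
      have eq': "\<xi> m i \<omega> = H (grid m i) \<omega>" for m i using elim by blast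
      show ?case
        using elementary_process_grid_uniform[of H \<omega> \<xi>, OF co eq'] by blast
    qed
  qed
  with SI el show ?thesis
    by (rule stochastic_integral_ucp)
qed

text \<open>\<open>adj x\<close> is the adjoint of \<open>pr x\<close> on \<open>V\<close>, so that scalar products with elementary integrals become
  sums \<open>S\<close> as in \<open>brownian_sum\<close>. The integrand takes values in \<open>D\<close> only almost surely;
  \<open>cut\<close> makes it bounded everywhere, as elementary integrands must be.\<close>

locale brownian_integral = prob_space M for M :: "'w measure" +
  fixes F :: "real \<Rightarrow> 'w measure" and V :: "'x::euclidean_space set" and W :: "real \<Rightarrow> 'w \<Rightarrow> 'x"
    and pr :: "'h::euclidean_space \<Rightarrow> 'x \<Rightarrow> 'y::euclidean_space" and H :: "real \<Rightarrow> 'w \<Rightarrow> 'h"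
    and I :: "real \<Rightarrow> 'w \<Rightarrow> 'y" and adj :: "'h \<Rightarrow> 'y \<Rightarrow> 'x" and D :: "'h set" and K :: real
  assumes bm: "brownian_motion M F V W"
    and V: "subspace V"
    and SI: "stochastic_integral M F pr H W I"
    and pr: "bounded_bilinear pr"
    and adj_in: "\<And>x v. adj x v \<in> V"
    and adj: "\<And>x v y. y \<in> V \<Longrightarrow> v \<bullet> pr x y = adj x v \<bullet> y"
    and adj_meas: "\<And>v. (\<lambda>x. adj x v) \<in> borel_measurable borel"
    and D: "compact D" and HD: "AE \<omega> in M. \<forall>t\<ge>0. H t \<omega> \<in> D"
    and adj_bound: "\<And>x v. x \<in> D \<Longrightarrow> norm (adj x v) \<le> K * norm v"
    and adj_0: "\<And>v. adj 0 v = 0" and K: "K \<ge> 0"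
begin

definition cut :: "'h \<Rightarrow> 'h" where "cut x = (if x \<in> D then x else 0)"

definition approx :: "nat \<Rightarrow> real \<Rightarrow> 'w \<Rightarrow> 'y" where
  "approx m = elementary_integral pr (m * 2 ^ m) (grid m) (\<lambda>i \<omega>. cut (H (grid m i) \<omega>)) W"

text \<open>The coefficient of the \<open>l\<close>-th increment of \<open>W\<close> on the fine
  grid of level \<open>m\<close>, for weights given on the coarse grid of level \<open>j\<close>:
  \<open>l div 2 ^ (m - j)\<close> is the coarse cell that contains the fine cell
  \<open>l\<close>.\<close>

definition integrand :: "nat \<Rightarrow> nat \<Rightarrow> (nat \<Rightarrow> 'y) \<Rightarrow> nat \<Rightarrow> 'w \<Rightarrow> 'x" where
  "integrand j m w l \<omega> = adj (cut (H (grid m l) \<omega>)) (w (l div 2 ^ (m - j)))"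

lemma cut_measurable [measurable]: "cut \<in> borel_measurable borel"
proof -
  have [measurable]: "D \<in> sets borel" using compact_imp_closed[OF D] by simp
  show ?thesis unfolding cut_def[abs_def] by measurable
qed

lemma cut_H_measurable: "(\<lambda>\<omega>. cut (H (grid m i) \<omega>)) \<in> borel_measurable (F (grid m i))"
proof -
  have "H (grid m i) \<in> borel_measurable (F (grid m i))"
    using stochastic_integralD(2)[OF SI] by (simp add: adapted_def)
  from measurable_compose[OF this cut_measurable] show ?thesis .
qed

lemma cut_bounded: "\<exists>C. \<forall>\<omega>\<in>space M. norm (cut (H t \<omega>)) \<le> C"
proof -
  obtain C where C: "\<forall>x\<in>D. norm x \<le> C" using compact_imp_bounded[OF D] by (auto simp: bounded_iff)
  then have "norm (cut x) \<le> max C 0" for x by (auto simp: cut_def intro: order_trans)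
  then show ?thesis by blast
qed

lemma AE_cut: "AE \<omega> in M. \<forall>m i. cut (H (grid m i) \<omega>) = H (grid m i) \<omega>"
  using HD by eventually_elim (simp add: cut_def)

lemma approx_continuous: "continuous_process M (approx m)"
  unfolding approx_def
  using stochastic_integralD(4)[OF SI]
    filtered_by_measurable[OF stochastic_integralD(1)[OF SI] cut_H_measurable]
  by (intro continuous_process_elementary_integral pr) auto

lemma approx_converges:
  "converges_in_prob M (\<lambda>m. grid_sum j p w (approx m)) (grid_sum j p w I)"
proof (rule ucp_tendsto_grid_sum)
  show "ucp_tendsto M approx I"
    unfolding approx_def[abs_def]
    by (rule stochastic_integral_grid[OF prob_space_axioms SI, of "\<lambda>m i \<omega>. cut (H (grid m i) \<omega>)"])
      (use cut_H_measurable cut_bounded AE_cut in auto)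
qed (use prob_space_axioms approx_continuous stochastic_integralD(5)[OF SI] in auto)

lemma norm_integrand: "norm (integrand j m w l \<omega>) \<le> K * norm (w (l div 2 ^ (m - j)))"
  unfolding integrand_def cut_def using adj_bound adj_0 K by auto

lemma integrand_measurable: "integrand j m w l \<in> borel_measurable (F (grid m l))"
  unfolding integrand_def[abs_def]
  by (rule measurable_compose[OF cut_H_measurable adj_meas])

lemma brownian_sum_integrand:
  "brownian_sum M F V W (grid m) (integrand j m w) (\<lambda>l. K * norm (w (l div 2 ^ (m - j))))"
  by unfold_locales
    (use bm V grid_less_Suc integrand_measurable norm_integrand in \<open>auto simp: integrand_def adj_in\<close>)

text \<open>Every coarse increment of the elementary integral is the sum over its fine cells, and
  \<open>adj\<close> moves the weight to the side of \<open>W\<close>. By \<open>m \<ge> p\<close>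
  the elementary process, which stops at time \<open>m\<close>, reaches
  \<open>grid j p\<close>.\<close>

lemma grid_sum_approx:
  assumes m: "m \<ge> j" "m \<ge> p" and \<omega>: "\<omega> \<in> space M"
  shows "grid_sum j p w (approx m) \<omega> =
    (\<Sum>l<p * 2 ^ (m - j). integrand j m w l \<omega> \<bullet> (W (grid m (Suc l)) \<omega> - W (grid m l) \<omega>))"
proof -
  let ?k = "2 ^ (m - j) :: nat"
  let ?f = "\<lambda>l. pr (cut (H (grid m l) \<omega>)) (W (grid m (Suc l)) \<omega> - W (grid m l) \<omega>)"
  have WV: "W (grid m (Suc l)) \<omega> - W (grid m l) \<omega> \<in> V" for l
    using brownian_motionD(4)[OF bm \<omega>] V by (intro subspace_diff) auto
  have inc: "approx m (grid j (Suc i)) \<omega> - approx m (grid j i) \<omega> = (\<Sum>l\<in>{i * ?k..<i * ?k + ?k}. ?f l)"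
    if i: "i < p" for i
  proof -
    have le: "b * ?k \<le> m * 2 ^ m" if "b \<le> p" for b
    proof (rule mult_le_mono)
      show "b \<le> m" using that m by simp
      show "?k \<le> 2 ^ m" by (rule power_increasing) auto
    qed
    have e: "approx m (grid j b) \<omega> = (\<Sum>l<b * ?k. ?f l)" if "b \<le> p" for b
      unfolding approx_def grid_refine[OF m(1)]
      by (subst elementary_integral_grid[OF pr le[OF that]]) simp
    have "{..<Suc i * ?k} = {..<i * ?k} \<union> {i * ?k..<i * ?k + ?k}" by auto
    then have "(\<Sum>l<Suc i * ?k. ?f l) = (\<Sum>l<i * ?k. ?f l) + (\<Sum>l\<in>{i * ?k..<i * ?k + ?k}. ?f l)"
      by (simp add: sum.union_disjoint ivl_disj_int)
    then show ?thesis using e[of "Suc i"] e[of i] i by simp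
  qed
  have "grid_sum j p w (approx m) \<omega> = (\<Sum>i<p. \<Sum>l\<in>{i * ?k..<i * ?k + ?k}. w i \<bullet> ?f l)"
    unfolding grid_sum_def by (intro sum.cong) (auto simp: inc inner_sum_right)
  also have "\<dots> = (\<Sum>i<p. \<Sum>l\<in>{i * ?k..<i * ?k + ?k}. w (l div ?k) \<bullet> ?f l)"
  proof (intro sum.cong refl)
    fix i l assume "l \<in> {i * ?k..<i * ?k + ?k}"
    then have "l div ?k = i"
      by (intro div_nat_eqI) (auto simp: algebra_simps)
    then show "w i \<bullet> ?f l = w (l div ?k) \<bullet> ?f l" by simp
  qed
  also have "\<dots> = (\<Sum>l<p * ?k. w (l div ?k) \<bullet> ?f l)"
    by (rule sum.nat_group)
  also have "\<dots> = (\<Sum>l<p * ?k. integrand j m w l \<omega> \<bullet> (W (grid m (Suc l)) \<omega> - W (grid m l) \<omega>))"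
    unfolding integrand_def by (intro sum.cong refl adj WV)
  finally show ?thesis .
qed

text \<open>Riemann sum of level \<open>m\<close> for the time integral of the expectation of
  \<open>(norm (adj (H s) w))^2\<close>, that is, for the expected quadratic variation of the
  weighted sum.\<close>

definition quad :: "nat \<Rightarrow> nat \<Rightarrow> (nat \<Rightarrow> 'y) \<Rightarrow> nat \<Rightarrow> real" where
  "quad j p w m = (\<Sum>l<p * 2 ^ (m - j). (\<integral>\<omega>. (norm (integrand j m w l \<omega>))\<^sup>2 \<partial>M) / 2 ^ m)"

text \<open>The same time integral with the integrand replaced by its pointwise bound
  \<open>K * norm w\<close>.\<close>

definition weight_bound :: "nat \<Rightarrow> nat \<Rightarrow> (nat \<Rightarrow> 'y) \<Rightarrow> real" where
  "weight_bound j p w = K\<^sup>2 * (\<Sum>i<p. (norm (w i))\<^sup>2) / 2 ^ j"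

lemma weight_bound_eq:
  assumes "m \<ge> j"
  shows "(\<Sum>l<p * 2 ^ (m - j). (K * norm (w (l div 2 ^ (m - j))))\<^sup>2 * (grid m (Suc l) - grid m l)) = weight_bound j p w"
proof -
  let ?k = "2 ^ (m - j) :: nat"
  have "(\<Sum>l<p * ?k. (K * norm (w (l div ?k)))\<^sup>2 * (grid m (Suc l) - grid m l))
    = (\<Sum>i<p. \<Sum>l\<in>{i * ?k..<i * ?k + ?k}. (K * norm (w (l div ?k)))\<^sup>2 / 2 ^ m)"
    unfolding grid_Suc_diff sum.nat_group by simp
  also have "\<dots> = (\<Sum>i<p. \<Sum>l\<in>{i * ?k..<i * ?k + ?k}. (K * norm (w i))\<^sup>2 / 2 ^ m)"
  proof (intro sum.cong refl)
    fix i l assume "l \<in> {i * ?k..<i * ?k + ?k}"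
    then have "l div ?k = i"
      by (intro div_nat_eqI) (auto simp: algebra_simps)
    then show "(K * norm (w (l div ?k)))\<^sup>2 / 2 ^ m = (K * norm (w i))\<^sup>2 / 2 ^ m" by simp
  qed
  also have "\<dots> = (\<Sum>i<p. (K * norm (w i))\<^sup>2 / 2 ^ j)"
  proof (intro sum.cong refl)
    fix i
    have kk: "real ?k / 2 ^ m = 1 / 2 ^ j"
      using grid_refine[OF assms, of 1] by (simp add: grid_def)
    have "(\<Sum>l\<in>{i * ?k..<i * ?k + ?k}. (K * norm (w i))\<^sup>2 / 2 ^ m) = (K * norm (w i))\<^sup>2 * (real ?k / 2 ^ m)"
      by simp
    then show "(\<Sum>l\<in>{i * ?k..<i * ?k + ?k}. (K * norm (w i))\<^sup>2 / 2 ^ m) = (K * norm (w i))\<^sup>2 / 2 ^ j"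
      unfolding kk by simp
  qed
  finally show ?thesis
    by (simp add: weight_bound_def power_mult_distrib sum_distrib_left sum_divide_distrib)
qed

section \<open>Moments of Brownian integrals over dyadic times\<close>

lemma approx_moments:
  fixes j p m :: nat and w :: "nat \<Rightarrow> 'y"
  assumes m: "m \<ge> j" "m \<ge> p"
  defines "S \<equiv> grid_sum j p w (approx m)"
  shows "integrable M (\<lambda>\<omega>. S \<omega> ^ 4)" "(\<integral>\<omega>. S \<omega> \<partial>M) = 0"
    "(\<integral>\<omega>. (S \<omega>)\<^sup>2 \<partial>M) = quad j p w m" "quad j p w m \<le> weight_bound j p w"
    "(\<integral>\<omega>. S \<omega> ^ 4 \<partial>M) \<le> 3 * (weight_bound j p w)\<^sup>2"
proof -
  interpret B: brownian_sum M F V W "grid m" "integrand j m w" "\<lambda>l. K * norm (w (l div 2 ^ (m - j)))"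
    by (rule brownian_sum_integrand)
  let ?q = "p * 2 ^ (m - j)"
  have eq: "\<And>\<omega>. \<omega> \<in> space M \<Longrightarrow> S \<omega> = B.S ?q \<omega>"
    unfolding S_def B.S_def using grid_sum_approx[OF m] by blast
  have E: "(\<integral>\<omega>. f (S \<omega>) \<partial>M) = (\<integral>\<omega>. f (B.S ?q \<omega>) \<partial>M)" for f :: "real \<Rightarrow> real"
    by (intro Bochner_Integration.integral_cong) (auto simp: eq)
  show "integrable M (\<lambda>\<omega>. S \<omega> ^ 4)"
    using B.S_moments(1)[of ?q] eq by (simp cong: Bochner_Integration.integrable_cong)
  show "(\<integral>\<omega>. S \<omega> \<partial>M) = 0" using E[of "\<lambda>x. x"] B.S_moments(2) by simp
  show q: "(\<integral>\<omega>. (S \<omega>)\<^sup>2 \<partial>M) = quad j p w m"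
    unfolding E[of "\<lambda>x. x\<^sup>2"] B.S_moments(3) quad_def grid_Suc_diff by simp
  show "quad j p w m \<le> weight_bound j p w"
    unfolding q[symmetric] E[of "\<lambda>x. x\<^sup>2"] using B.S_moments(4)[of ?q] weight_bound_eq[OF m(1)] by simp
  show "(\<integral>\<omega>. S \<omega> ^ 4 \<partial>M) \<le> 3 * (weight_bound j p w)\<^sup>2"
    unfolding E[of "\<lambda>x. x^4"] using B.S_moments(5)[of ?q] weight_bound_eq[OF m(1)] by simp
qed

text \<open>The martingale property without conditional expectations: since the weights vanish
  before the time at which \<open>Y\<close> is known, \<open>Y\<close> can be absorbed into the
  coefficients, and the result is again a sum as in \<open>brownian_sum\<close>, with mean
  zero.\<close>

lemma approx_orthogonal:
  assumes m: "m \<ge> j" "m \<ge> p" and w0: "\<And>i. i < i0 \<Longrightarrow> w i = 0"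
    and Y: "Y \<in> borel_measurable (F (grid j i0))" and Yb: "\<And>\<omega>. \<omega> \<in> space M \<Longrightarrow> \<bar>Y \<omega>\<bar> \<le> C"
  shows "(\<integral>\<omega>. Y \<omega> * grid_sum j p w (approx m) \<omega> \<partial>M) = 0"
proof -
  let ?k = "2 ^ (m - j) :: nat"
  define a where "a l \<omega> = (if l < i0 * ?k then 0 else Y \<omega> *\<^sub>R integrand j m w l \<omega>)" for l \<omega>
  define c where "c l = C * (K * norm (w (l div ?k)))" for l
  obtain \<omega>0 where "\<omega>0 \<in> space M" using not_empty by blast
  then have C: "C \<ge> 0" using Yb[of \<omega>0] abs_ge_zero[of "Y \<omega>0"] by linarith
  interpret B: brownian_sum M F V W "grid m" a c
  proof unfold_locales
    show "a l \<in> borel_measurable (F (grid m l))" for l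
    proof (cases "l < i0 * ?k")
      case True
      then have "a l = (\<lambda>_. 0)" by (auto simp: a_def)
      then show ?thesis by simp
    next
      case False
      then have "grid j i0 \<le> grid m l" unfolding grid_refine[OF m(1)] by simp
      then have [measurable]: "Y \<in> borel_measurable (F (grid m l))"
        using filtered_by_mono[OF brownian_motionD(1)[OF bm] Y] by blast
      have [measurable]: "integrand j m w l \<in> borel_measurable (F (grid m l))" by (rule integrand_measurable)
      have "a l = (\<lambda>\<omega>. Y \<omega> *\<^sub>R integrand j m w l \<omega>)" using False by (auto simp: a_def)
      then show ?thesis by simp
    qed
    show "a l \<omega> \<in> V" for l \<omega>
      using V by (simp add: a_def subspace_0 subspace_scale integrand_def adj_in)
    show "norm (a l \<omega>) \<le> c l" if "\<omega> \<in> space M" for l \<omega>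
      using mult_mono[OF Yb[OF that] norm_integrand C norm_ge_zero] C K by (simp add: a_def c_def)
  qed (use bm V grid_less_Suc in auto)
  have "Y \<omega> * grid_sum j p w (approx m) \<omega> = B.S (p * ?k) \<omega>" if "\<omega> \<in> space M" for \<omega>
  proof -
    have "integrand j m w l \<omega> = 0" if "l < i0 * ?k" for l
    proof -
      have "l div ?k < i0" using that by (simp add: less_mult_imp_div_less)
      then have "norm (integrand j m w l \<omega>) \<le> 0" using norm_integrand[of j m w l \<omega>] w0 by simp
      then show ?thesis by simp
    qed
    then show ?thesis
      unfolding grid_sum_approx[OF m that] B.S_def sum_distrib_left
      by (intro sum.cong) (auto simp: a_def)
  qed
  then have "(\<integral>\<omega>. Y \<omega> * grid_sum j p w (approx m) \<omega> \<partial>M) = (\<integral>\<omega>. B.S (p * ?k) \<omega> \<partial>M)"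
    by (intro Bochner_Integration.integral_cong) auto
  then show ?thesis using B.S_moments(2) by simp
qed

text \<open>The passage to the limit. The bound \<open>bd\<close> upgrades convergence in
  probability to mean square, after which mean, variance and orthogonality are inherited from the
  approximations; 24 is \<open>8 * 3\<close>, from \<open>converges_in_prob_L2\<close> and
  \<open>S_moments\<close>.\<close>

lemma grid_sum_moments:
  assumes bd: "AE \<omega> in M. \<bar>grid_sum j p w I \<omega>\<bar> \<le> C"
  shows "(\<integral>\<omega>. grid_sum j p w I \<omega> \<partial>M) = 0"
    "quad j p w \<longlonglongrightarrow> (\<integral>\<omega>. (grid_sum j p w I \<omega>)\<^sup>2 \<partial>M)"
    "(\<integral>\<omega>. (grid_sum j p w I \<omega>)\<^sup>2 \<partial>M) \<le> weight_bound j p w"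
    "(\<integral>\<omega>. grid_sum j p w I \<omega> ^ 4 \<partial>M) \<le> 24 * (weight_bound j p w)\<^sup>2"
    "\<And>Y i0 B. (\<And>i. i < i0 \<Longrightarrow> w i = 0) \<Longrightarrow> Y \<in> borel_measurable (F (grid j i0)) \<Longrightarrow>
       (\<And>\<omega>. \<omega> \<in> space M \<Longrightarrow> \<bar>Y \<omega>\<bar> \<le> B) \<Longrightarrow> (\<integral>\<omega>. Y \<omega> * grid_sum j p w I \<omega> \<partial>M) = 0"
proof -
  \<comment> \<open>The shift makes \<open>m \<ge> j\<close> and \<open>m \<ge> p\<close> hold along
    the whole sequence.\<close>
  define X where "X m = grid_sum j p w (approx (m + (j + p)))" for m
  have Xm: "X m \<in> borel_measurable M" for m
    unfolding X_def by (rule grid_sum_measurable[OF approx_continuous])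
  have Im: "grid_sum j p w I \<in> borel_measurable M"
    by (rule grid_sum_measurable[OF stochastic_integralD(5)[OF SI]])
  have conv: "converges_in_prob M X (grid_sum j p w I)"
    using approx_converges[of j p w] unfolding converges_in_prob_def X_def
    by (auto intro: LIMSEQ_ignore_initial_segment)
  note am = approx_moments[of j "_ + (j + p)" p w, folded X_def, simplified]
  note L2 = converges_in_prob_L2[OF Xm Im conv am(1) am(5) bd]
  note lims = L2_tendsto_moments[OF Xm Im am(1) bd L2(1)]
  have "(\<lambda>m. \<integral>\<omega>. 1 * X m \<omega> \<partial>M) \<longlonglongrightarrow> (\<integral>\<omega>. 1 * grid_sum j p w I \<omega> \<partial>M)"
    by (rule lims(1)[of _ 1]) auto
  then show "(\<integral>\<omega>. grid_sum j p w I \<omega> \<partial>M) = 0"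
    using am(2) by (simp add: LIMSEQ_const_iff)
  have lim2: "(\<lambda>m. quad j p w (m + (j + p))) \<longlonglongrightarrow> (\<integral>\<omega>. (grid_sum j p w I \<omega>)\<^sup>2 \<partial>M)"
    using lims(2)[of "\<lambda>_. 1" 1] unfolding am(3) by simp
  then show "quad j p w \<longlonglongrightarrow> (\<integral>\<omega>. (grid_sum j p w I \<omega>)\<^sup>2 \<partial>M)"
    by (rule LIMSEQ_offset)
  show "(\<integral>\<omega>. (grid_sum j p w I \<omega>)\<^sup>2 \<partial>M) \<le> weight_bound j p w"
    by (rule LIMSEQ_le_const2[OF lim2]) (use am(4) in auto)
  show "(\<integral>\<omega>. grid_sum j p w I \<omega> ^ 4 \<partial>M) \<le> 24 * (weight_bound j p w)\<^sup>2"
    using L2(2) by simp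
  show "(\<integral>\<omega>. Y \<omega> * grid_sum j p w I \<omega> \<partial>M) = 0"
    if "\<And>i. i < i0 \<Longrightarrow> w i = 0" and Y: "Y \<in> borel_measurable (F (grid j i0))"
      "\<And>\<omega>. \<omega> \<in> space M \<Longrightarrow> \<bar>Y \<omega>\<bar> \<le> B" for Y i0 B
  proof -
    have Ym: "Y \<in> borel_measurable M"
      using filtered_by_measurable[OF brownian_motionD(1)[OF bm] Y(1)] .
    have "(\<lambda>m. \<integral>\<omega>. Y \<omega> * X m \<omega> \<partial>M) \<longlonglongrightarrow> (\<integral>\<omega>. Y \<omega> * grid_sum j p w I \<omega> \<partial>M)"
      by (rule lims(1)[OF Ym]) (use Y in auto)
    moreover have "(\<integral>\<omega>. Y \<omega> * X m \<omega> \<partial>M) = 0" for m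
      unfolding X_def by (rule approx_orthogonal[OF _ _ that(1) Y]) auto
    ultimately show ?thesis by (simp add: LIMSEQ_const_iff)
  qed
qed

text \<open>For a deterministic integrand the sum is exactly Gaussian, with variance
  \<open>quad\<close>. This serves the limit process, whose integrals have no almost sure
  bound.\<close>

lemma char_approx:
  assumes m: "m \<ge> j" "m \<ge> p" and det: "\<And>t \<omega>. H t \<omega> = h t"
  shows "(CLINT \<omega>|M. iexp (grid_sum j p w (approx m) \<omega>)) = exp (- (quad j p w m / 2))"
proof -
  interpret B: brownian_sum M F V W "grid m" "integrand j m w" "\<lambda>l. K * norm (w (l div 2 ^ (m - j)))"
    by (rule brownian_sum_integrand)
  define b where "b l = adj (cut (h (grid m l))) (w (l div 2 ^ (m - j)))" for l
  have "(CLINT \<omega>|M. iexp (grid_sum j p w (approx m) \<omega>)) = (CLINT \<omega>|M. iexp (B.S (p * 2 ^ (m - j)) \<omega>))"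
    by (intro Bochner_Integration.integral_cong) (auto simp: grid_sum_approx[OF m] B.S_def)
  also have "\<dots> = exp (- ((\<Sum>l<p * 2 ^ (m - j). (grid m (Suc l) - grid m l) * (norm (b l))\<^sup>2) / 2))"
    by (rule B.char_S) (simp add: integrand_def b_def det)
  also have "(\<Sum>l<p * 2 ^ (m - j). (grid m (Suc l) - grid m l) * (norm (b l))\<^sup>2) = quad j p w m"
    unfolding quad_def grid_Suc_diff by (simp add: integrand_def det b_def prob_space)
  finally show ?thesis .
qed

end

section \<open>Riemann sums\<close>

text \<open>On each cell the error is at most the oscillation of \<open>f\<close> times the
  increment of \<open>G\<close>, because the derivative \<open>k\<close> of \<open>G\<close> is
  nonnegative. The Stieltjes weights and the evaluation at right end points are what summation by
  parts against an exponential produces; \<open>G = id\<close> gives ordinary Riemann sums.\<close>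

lemma riemann_stieltjes_bound:
  fixes f :: "real \<Rightarrow> 'e::banach" and G k :: "real \<Rightarrow> real"
  assumes t: "\<And>i. i < N \<Longrightarrow> t i \<le> t (Suc i)"
    and f: "continuous_on {t 0..t N} f" and k: "continuous_on {t 0..t N} k"
    and G: "\<And>s. s \<in> {t 0..t N} \<Longrightarrow> (G has_real_derivative k s) (at s within {t 0..t N})"
    and k0: "\<And>s. s \<in> {t 0..t N} \<Longrightarrow> k s \<ge> 0"
    and osc: "\<And>i s. i < N \<Longrightarrow> s \<in> {t i..t (Suc i)} \<Longrightarrow> norm (f (t (Suc i)) - f s) \<le> \<epsilon>"
  shows "norm ((\<Sum>i<N. (G (t (Suc i)) - G (t i)) *\<^sub>R f (t (Suc i))) - integral {t 0..t N} (\<lambda>s. k s *\<^sub>R f s))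
     \<le> \<epsilon> * (G (t N) - G (t 0))"
proof -
  have mono: "i \<le> j \<Longrightarrow> j \<le> N \<Longrightarrow> t i \<le> t j" for i j
  proof (induction j)
    case (Suc j)
    then show ?case using t[of j] by (cases "i = Suc j") auto
  qed simp
  have kf: "continuous_on {t 0..t N} (\<lambda>s. k s *\<^sub>R f s)"
    using f k by (intro continuous_intros)
  have "norm ((\<Sum>l<i. (G (t (Suc l)) - G (t l)) *\<^sub>R f (t (Suc l))) - integral {t 0..t i} (\<lambda>s. k s *\<^sub>R f s))
     \<le> \<epsilon> * (G (t i) - G (t 0))" if "i \<le> N" for i
    using that
  proof (induction i)
    case (Suc i)
    have ti: "t 0 \<le> t i" "t i \<le> t (Suc i)" "t (Suc i) \<le> t N"
      using Suc.prems mono[of 0 i] mono[of i "Suc i"] mono[of "Suc i" N] by auto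
    have sub: "{t i..t (Suc i)} \<subseteq> {t 0..t N}" "{t 0..t (Suc i)} \<subseteq> {t 0..t N}" using ti by auto
    have comb: "integral {t 0..t (Suc i)} (\<lambda>s. k s *\<^sub>R f s)
       = integral {t 0..t i} (\<lambda>s. k s *\<^sub>R f s) + integral {t i..t (Suc i)} (\<lambda>s. k s *\<^sub>R f s)"
      by (rule Henstock_Kurzweil_Integration.integral_combine[symmetric])
        (use ti integrable_continuous_real[OF continuous_on_subset[OF kf sub(2)]] in auto)
    have hi: "(k has_integral (G (t (Suc i)) - G (t i))) {t i..t (Suc i)}"
    proof (rule fundamental_theorem_of_calculus[OF ti(2)])
      fix s assume "s \<in> {t i..t (Suc i)}"
      then have "s \<in> {t 0..t N}" using sub(1) by blast
      from DERIV_subset[OF G[OF this] sub(1)]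
      show "(G has_vector_derivative k s) (at s within {t i..t (Suc i)})"
        by (simp add: has_real_derivative_iff_has_vector_derivative)
    qed
    have c1: "(\<lambda>s. k s *\<^sub>R f (t (Suc i))) integrable_on {t i..t (Suc i)}"
      and e1: "integral {t i..t (Suc i)} (\<lambda>s. k s *\<^sub>R f (t (Suc i))) = (G (t (Suc i)) - G (t i)) *\<^sub>R f (t (Suc i))"
      using has_integral_scaleR_left[OF hi, of "f (t (Suc i))"] by (auto simp: has_integral_iff)
    have c2: "(\<lambda>s. k s *\<^sub>R f s) integrable_on {t i..t (Suc i)}"
      by (rule integrable_continuous_real[OF continuous_on_subset[OF kf sub(1)]])
    have "norm (integral {t i..t (Suc i)} (\<lambda>s. k s *\<^sub>R f (t (Suc i)) - k s *\<^sub>R f s))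
       \<le> integral {t i..t (Suc i)} (\<lambda>s. \<epsilon> * k s)"
    proof (rule Henstock_Kurzweil_Integration.integral_norm_bound_integral)
      show "(\<lambda>s. k s *\<^sub>R f (t (Suc i)) - k s *\<^sub>R f s) integrable_on {t i..t (Suc i)}"
        by (rule Henstock_Kurzweil_Integration.integrable_diff[OF c1 c2])
      show "(\<lambda>s. \<epsilon> * k s) integrable_on {t i..t (Suc i)}"
        using has_integral_mult_right[OF hi, of \<epsilon>] by auto
      fix s assume s: "s \<in> {t i..t (Suc i)}"
      have "norm (k s *\<^sub>R f (t (Suc i)) - k s *\<^sub>R f s) = k s * norm (f (t (Suc i)) - f s)"
        using k0[of s] s sub by (simp add: scaleR_diff_right[symmetric] subset_iff)
      also have "\<dots> \<le> k s * \<epsilon>"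
        using osc[of i s] s Suc.prems k0[of s] sub by (intro mult_left_mono) auto
      finally show "norm (k s *\<^sub>R f (t (Suc i)) - k s *\<^sub>R f s) \<le> \<epsilon> * k s" by (simp add: mult.commute)
    qed
    also have "\<dots> = \<epsilon> * (G (t (Suc i)) - G (t i))"
      using has_integral_mult_right[OF hi, of \<epsilon>] by (simp add: has_integral_iff)
    finally have n: "norm ((G (t (Suc i)) - G (t i)) *\<^sub>R f (t (Suc i)) - integral {t i..t (Suc i)} (\<lambda>s. k s *\<^sub>R f s))
       \<le> \<epsilon> * (G (t (Suc i)) - G (t i))"
      by (simp add: Henstock_Kurzweil_Integration.integral_diff[OF c1 c2] e1)
    have "norm ((\<Sum>l<Suc i. (G (t (Suc l)) - G (t l)) *\<^sub>R f (t (Suc l))) - integral {t 0..t (Suc i)} (\<lambda>s. k s *\<^sub>R f s))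
       \<le> \<epsilon> * (G (t i) - G (t 0)) + \<epsilon> * (G (t (Suc i)) - G (t i))"
      unfolding comb using norm_triangle_le[OF add_mono[OF Suc.IH n]] Suc.prems
      by (simp add: algebra_simps)
    then show ?case by (simp add: algebra_simps)
  qed simp
  from this[of N] show ?thesis by simp
qed

lemma riemann_stieltjes_tendsto:
  fixes f :: "real \<Rightarrow> 'e::banach" and G k :: "real \<Rightarrow> real"
  assumes ab: "a \<le> b" and f: "continuous_on {a..b} f" and k: "continuous_on {a..b} k"
    and G: "\<And>s. s \<in> {a..b} \<Longrightarrow> (G has_real_derivative k s) (at s within {a..b})"
    and k0: "\<And>s. s \<in> {a..b} \<Longrightarrow> k s \<ge> 0"
    and t: "\<And>m. t m 0 = a" "\<And>m. t m (N m) = b" "\<And>m i. i < N m \<Longrightarrow> t m i \<le> t m (Suc i)"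
    and mesh: "\<And>m i. i < N m \<Longrightarrow> t m (Suc i) - t m i \<le> \<delta> m" and \<delta>: "\<delta> \<longlonglongrightarrow> 0"
  shows "(\<lambda>m. \<Sum>i<N m. (G (t m (Suc i)) - G (t m i)) *\<^sub>R f (t m (Suc i))) \<longlonglongrightarrow> integral {a..b} (\<lambda>s. k s *\<^sub>R f s)"
proof (rule LIMSEQ_I)
  fix r :: real assume r: "r > 0"
  define c where "c = \<bar>G b - G a\<bar> + 1"
  have c: "c > 0" by (simp add: c_def)
  define \<epsilon> where "\<epsilon> = r / (2 * c)"
  have \<epsilon>: "\<epsilon> > 0" using r c by (simp add: \<epsilon>_def)
  have "uniformly_continuous_on {a..b} f"
    by (rule compact_uniformly_continuous[OF f]) simp
  then obtain d where d: "d > 0" "\<And>s u. s \<in> {a..b} \<Longrightarrow> u \<in> {a..b} \<Longrightarrow> dist s u < d \<Longrightarrow> dist (f s) (f u) < \<epsilon>"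
    using \<epsilon> unfolding uniformly_continuous_on_def by metis
  have "\<forall>\<^sub>F m in sequentially. \<delta> m < d" using \<delta> d(1) by (rule order_tendstoD)
  then obtain m0 where m0: "\<And>m. m \<ge> m0 \<Longrightarrow> \<delta> m < d" by (auto simp: eventually_sequentially)
  have "norm ((\<Sum>i<N m. (G (t m (Suc i)) - G (t m i)) *\<^sub>R f (t m (Suc i))) - integral {a..b} (\<lambda>s. k s *\<^sub>R f s)) < r"
    if m: "m \<ge> m0" for m
  proof -
    have mono: "i \<le> j \<Longrightarrow> j \<le> N m \<Longrightarrow> t m i \<le> t m j" for i j
    proof (induction j)
      case (Suc j)
      then show ?case using t(3)[of j m] by (cases "i = Suc j") auto
    qed simp
    have osc: "norm (f (t m (Suc i)) - f s) \<le> \<epsilon>" if "i < N m" "s \<in> {t m i..t m (Suc i)}" for i s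
    proof -
      have "a \<le> t m i" "t m (Suc i) \<le> b"
        using mono[of 0 i] mono[of "Suc i" "N m"] that t(1,2) by auto
      moreover have "dist (t m (Suc i)) s < d"
        using mesh[OF that(1)] m0[OF m] that by (auto simp: dist_real_def)
      ultimately show ?thesis using d(2)[of "t m (Suc i)" s] that by (auto simp: dist_norm)
    qed
    have "norm ((\<Sum>i<N m. (G (t m (Suc i)) - G (t m i)) *\<^sub>R f (t m (Suc i))) - integral {a..b} (\<lambda>s. k s *\<^sub>R f s)) \<le> \<epsilon> * (G b - G a)"
      using riemann_stieltjes_bound[of "N m" "t m" f k G \<epsilon>] t f k G k0 osc by simp
    also have "\<dots> \<le> \<epsilon> * c" using \<epsilon> by (intro mult_left_mono) (auto simp: c_def)
    also have "\<dots> < r" using r c by (simp add: \<epsilon>_def)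
    finally show ?thesis .
  qed
  then show "\<exists>no. \<forall>m\<ge>no. norm ((\<Sum>i<N m. (G (t m (Suc i)) - G (t m i)) *\<^sub>R f (t m (Suc i))) - integral {a..b} (\<lambda>s. k s *\<^sub>R f s)) < r"
    by blast
qed

lemma riemann_tendsto:
  fixes f :: "real \<Rightarrow> 'e::banach"
  assumes ab: "a \<le> b" and f: "continuous_on {a..b} f"
  shows "(\<lambda>m. \<Sum>i<m. ((b - a) / real m) *\<^sub>R f (a + real (Suc i) * (b - a) / real m)) \<longlonglongrightarrow> integral {a..b} f"
proof -
  define t where "t m i = a + real i * (b - a) / real m" for m i
  have d: "t m (Suc i) - t m i = (b - a) / real m" for m i
    by (simp add: t_def diff_divide_distrib[symmetric] algebra_simps)
  \<comment> \<open>\<open>Suc m\<close> avoids the partition into 0 cells, whose last point is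
    \<open>a\<close> instead of \<open>b\<close>.\<close>
  have "(\<lambda>m. \<Sum>i<Suc m. (id (t (Suc m) (Suc i)) - id (t (Suc m) i)) *\<^sub>R f (t (Suc m) (Suc i)))
     \<longlonglongrightarrow> integral {a..b} (\<lambda>s. 1 *\<^sub>R f s)"
  proof (rule riemann_stieltjes_tendsto[OF ab f])
    show "(\<lambda>m. (b - a) / real (Suc m)) \<longlonglongrightarrow> 0"
      by (rule LIMSEQ_Suc) (rule lim_const_over_n)
    show "(id has_real_derivative 1) (at s within {a..b})" for s :: real
      unfolding id_def by (rule DERIV_ident)
    show "t (Suc m) i \<le> t (Suc m) (Suc i)" for m i
    proof -
      have "0 \<le> (b - a) / real (Suc m)" using ab by simp
      then show ?thesis using d[of "Suc m" i] by linarith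
    qed
    show "t (Suc m) (Suc i) - t (Suc m) i \<le> (b - a) / real (Suc m)" for m i using d by simp
    show "t (Suc m) (Suc m) = b" for m
    proof -
      have "real (Suc m) * (b - a) / real (Suc m) = b - a" by (rule nonzero_mult_div_cancel_left) simp
      then show ?thesis by (simp only: t_def)
    qed
  qed (auto simp: t_def)
  then have "(\<lambda>m. \<Sum>i<Suc m. (t (Suc m) (Suc i) - t (Suc m) i) *\<^sub>R f (t (Suc m) (Suc i))) \<longlonglongrightarrow> integral {a..b} f"
    by simp
  then have "(\<lambda>m. \<Sum>i<m. (t m (Suc i) - t m i) *\<^sub>R f (t m (Suc i))) \<longlonglongrightarrow> integral {a..b} f"
    by (rule LIMSEQ_imp_Suc)
  then show ?thesis unfolding d by (simp add: t_def)
qed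

lemma riemann_grid_tendsto:
  fixes f :: "real \<Rightarrow> 'e::banach" and G k :: "real \<Rightarrow> real"
  assumes ab: "a \<le> b" and f: "continuous_on {grid j a..grid j b} f" and k: "continuous_on {grid j a..grid j b} k"
    and G: "\<And>s. s \<in> {grid j a..grid j b} \<Longrightarrow> (G has_real_derivative k s) (at s within {grid j a..grid j b})"
    and k0: "\<And>s. s \<in> {grid j a..grid j b} \<Longrightarrow> k s \<ge> 0"
  shows "(\<lambda>m. \<Sum>l\<in>{a * 2 ^ m..<b * 2 ^ m}. (G (grid (j + m) (Suc l)) - G (grid (j + m) l)) *\<^sub>R f (grid (j + m) (Suc l)))
     \<longlonglongrightarrow> integral {grid j a..grid j b} (\<lambda>s. k s *\<^sub>R f s)"
proof -
  define t where "t m i = grid (j + m) (a * 2 ^ m + i)" for m i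
  define N where "N m = (b - a) * 2 ^ m" for m :: nat
  have r: "grid j x = grid (j + m) (x * 2 ^ m)" for x m
    using grid_refine[of j "j + m" x] by simp
  have "(\<lambda>m. \<Sum>i<N m. (G (t m (Suc i)) - G (t m i)) *\<^sub>R f (t m (Suc i))) \<longlonglongrightarrow> integral {grid j a..grid j b} (\<lambda>s. k s *\<^sub>R f s)"
  proof (rule riemann_stieltjes_tendsto[OF _ f k G k0])
    have "(\<lambda>m. (1/2) ^ j * (1/2::real) ^ m) \<longlonglongrightarrow> (1/2) ^ j * 0"
      by (intro tendsto_intros LIMSEQ_power_zero) simp
    then show "(\<lambda>m. (1/2::real) ^ (j + m)) \<longlonglongrightarrow> 0" by (simp add: power_add)
    show "t m (Suc i) - t m i \<le> (1/2) ^ (j + m)" for m i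
      using grid_Suc_diff[of "j + m" "a * 2 ^ m + i"] by (simp add: t_def power_divide)
    have "a * 2 ^ m + (b - a) * 2 ^ m = b * 2 ^ m" for m :: nat
      using ab by (simp add: add_mult_distrib[symmetric])
    then show "t m (N m) = grid j b" for m by (simp add: t_def N_def r[of b m])
    show "t m 0 = grid j a" for m by (simp add: t_def r[of a m])
  qed (use ab in \<open>auto simp: t_def\<close>)
  note lim = this
  have sh: "(\<Sum>i<N m. g (a * 2 ^ m + i)) = (\<Sum>l\<in>{a * 2 ^ m..<b * 2 ^ m}. g l)" for m and g :: "nat \<Rightarrow> 'e"
    using sum.shift_bounds_nat_ivl[of g 0 "a * 2 ^ m" "N m"] ab
    by (simp add: N_def add_mult_distrib[symmetric] atLeast0LessThan add.commute)
  have "(\<Sum>i<N m. (G (t m (Suc i)) - G (t m i)) *\<^sub>R f (t m (Suc i))) = (\<Sum>l\<in>{a * 2 ^ m..<b * 2 ^ m}.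
     (G (grid (j + m) (Suc l)) - G (grid (j + m) l)) *\<^sub>R f (grid (j + m) (Suc l)))" for m
    using sh[where m = m and g = "\<lambda>l. (G (grid (j + m) (Suc l)) - G (grid (j + m) l)) *\<^sub>R f (grid (j + m) (Suc l))"]
    by (simp add: t_def)
  then show ?thesis using lim by simp
qed

section \<open>Brownian motion on the sphere\<close>

lemma vector_matrix_mult_sigma01: "v v* sigma01 x = v - (x \<bullet> v) *\<^sub>R x"
proof (rule vec_eq_iff[THEN iffD2], rule allI)
  fix j
  have "(v v* sigma01 x) $ j = (\<Sum>i\<in>UNIV. (if i = j then v $ i else 0) - x $ j * (x $ i * v $ i))"
    unfolding vector_matrix_mult_def sigma01_def by (simp, intro sum.cong) (auto simp: algebra_simps)
  also have "\<dots> = v $ j - x $ j * (\<Sum>i\<in>UNIV. x $ i * v $ i)"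
    by (simp add: sum_subtractf sum_distrib_left)
  finally show "(v v* sigma01 x) $ j = (v - (x \<bullet> v) *\<^sub>R x) $ j"
    by (simp add: inner_vec_def mult.commute)
qed

text \<open>Pythagoras for the projection. Its expectation along the path is the variance rate of
  the noise in direction \<open>v\<close>.\<close>

lemma norm_vector_matrix_mult_sigma01:
  assumes "norm x = 1"
  shows "(norm (v v* sigma01 x))\<^sup>2 = (norm v)\<^sup>2 - (v \<bullet> x)\<^sup>2"
proof -
  have "x \<bullet> x = 1" using assms by (simp add: norm_eq_1)
  then show ?thesis
    unfolding vector_matrix_mult_sigma01 power2_norm_eq_inner
    by (simp add: inner_diff_left inner_diff_right inner_commute power2_eq_square algebra_simps)
qed

lemma bounded_bilinear_matrix_vector_mult:
  "bounded_bilinear ((*v) :: real^'n^'m \<Rightarrow> real^'n \<Rightarrow> real^'m)"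
  unfolding bilinear_conv_bounded_bilinear[symmetric] bilinear_def
  by (auto intro!: linearI simp: matrix_vector_mult_add_rdistrib matrix_vector_right_distrib
      matrix_vector_mult_scaleR scaleR_matrix_vector_assoc)

lemma borel_measurable_vector_matrix_mult:
  "(\<lambda>A :: real^'n^'m. v v* A) \<in> borel_measurable borel"
proof -
  have "continuous_on UNIV (\<lambda>A :: real^'n^'m. v v* A)"
    unfolding vector_matrix_mult_def
    by (intro continuous_on_vec_lambda continuous_intros)
  then show ?thesis by (rule borel_measurable_continuous_onI)
qed

lemma continuous_on_sigma01: "continuous_on S (sigma01 :: real^'n \<Rightarrow> real^'n^'n)"
  unfolding sigma01_def[abs_def]
  by (intro continuous_on_vec_lambda continuous_intros)

text \<open>The adjoint of a matrix is multiplication from the left, and the bound 1 holds because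
  \<open>sigma01\<close> of a unit vector is an orthogonal projection. These projections form a
  compact set, the image of the sphere.\<close>

lemma brownian_integral_sphere:
  fixes \<Theta>0 :: "real^'n"
  assumes "prob_space M" and s: "sphere_brownian_motion M F \<Theta>0 B I \<Theta>"
  shows "brownian_integral M F UNIV B (*v) (\<lambda>t \<omega>. sigma01 (\<Theta> t \<omega>)) I (\<lambda>A v. v v* A) (sigma01 ` sphere 0 1) 1"
proof -
  interpret prob_space M by fact
  show ?thesis
  proof (intro brownian_integral.intro[OF prob_space_axioms] brownian_integral_axioms.intro)
    show "brownian_motion M F UNIV B" "stochastic_integral M F (*v) (\<lambda>t \<omega>. sigma01 (\<Theta> t \<omega>)) B I"
      using s by (simp_all add: sphere_brownian_motion_def)
    show "compact (sigma01 ` sphere (0::real^'n) 1)"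
      by (intro compact_continuous_image continuous_on_sigma01) simp
    show "AE \<omega> in M. \<forall>t\<ge>0. sigma01 (\<Theta> t \<omega>) \<in> sigma01 ` sphere 0 1"
    proof -
      have "AE \<omega> in M. \<forall>t\<ge>0. \<Theta> t \<omega> \<in> sphere 0 1" using s by (simp add: sphere_brownian_motion_def)
      then show ?thesis by eventually_elim blast
    qed
    show "norm (v v* x) \<le> 1 * norm v" if x: "x \<in> sigma01 ` sphere (0::real^'n) 1" for x v
    proof -
      obtain y where "y \<in> sphere 0 1" and y1: "x = sigma01 y" using x by blast
      then have y: "x = sigma01 y" "norm y = 1" by simp_all
      have "(norm (v v* x))\<^sup>2 \<le> (norm v)\<^sup>2"
        unfolding y(1) norm_vector_matrix_mult_sigma01[OF y(2)] by simp
      then have "norm (v v* x) \<le> norm v" by (rule power2_le_imp_le) simp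
      then show ?thesis by simp
    qed
    show "v \<bullet> (A *v y) = (v v* A) \<bullet> y" for A :: "real^'n^'n" and v y by (simp add: dot_lmul_matrix)
    show "v v* (0 :: real^'n^'n) = 0" for v by (simp add: vector_matrix_mult_def vec_eq_iff)
    show "bounded_bilinear ((*v) :: real^'n^'n \<Rightarrow> real^'n \<Rightarrow> real^'n)"
      by (rule bounded_bilinear_matrix_vector_mult)
  qed (simp_all add: borel_measurable_vector_matrix_mult subspace_UNIV del: transpose_matrix_vector)
qed

text \<open>\<open>stochastic_integral\<close> does not prescribe the initial value; it is inherited
  from the elementary integrals, which vanish at time 0 and converge in probability there.\<close>

lemma (in brownian_integral) I_0: "AE \<omega> in M. I 0 \<omega> = 0"
proof -
  have z: "approx m 0 \<omega> = 0" for m \<omega>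
    unfolding approx_def using elementary_integral_grid[OF pr, of 0 "m * 2 ^ m" m] by simp
  have ucp: "ucp_tendsto M approx I"
    unfolding approx_def[abs_def]
    by (rule stochastic_integral_grid[OF prob_space_axioms SI, of "\<lambda>m i \<omega>. cut (H (grid m i) \<omega>)"])
      (use cut_H_measurable cut_bounded AE_cut in auto)
  have [measurable]: "I 0 \<in> borel_measurable M"
    using stochastic_integralD(5)[OF SI] by (simp add: continuous_process_def)
  have "AE \<omega> in M. b \<bullet> I 0 \<omega> = 0" for b
  proof -
    have "converges_in_prob M (\<lambda>m \<omega>. \<Sum>i\<in>{()}. b \<bullet> approx m 0 \<omega>) (\<lambda>\<omega>. \<Sum>i\<in>{()}. b \<bullet> I 0 \<omega>)"
      by (rule ucp_tendsto_weighted_sum[OF prob_space_axioms ucp approx_continuous stochastic_integralD(5)[OF SI]]) auto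
    then have "prob {\<omega> \<in> space M. \<epsilon> < \<bar>b \<bullet> I 0 \<omega>\<bar>} = 0" if "\<epsilon> > 0" for \<epsilon>
      using that by (simp add: converges_in_prob_def z LIMSEQ_const_iff)
    then have "AE \<omega> in M. \<not> 1 / real (Suc k) < \<bar>b \<bullet> I 0 \<omega>\<bar>" for k
      by (subst AE_iff_measurable[OF _ refl]) (auto simp: emeasure_eq_measure)
    then have "AE \<omega> in M. \<forall>k. \<not> 1 / real (Suc k) < \<bar>b \<bullet> I 0 \<omega>\<bar>"
      by (simp add: AE_all_countable)
    then show ?thesis
    proof eventually_elim
      case (elim \<omega>)
      show ?case
      proof (rule ccontr)
        assume "b \<bullet> I 0 \<omega> \<noteq> 0"
        then obtain k where "inverse (real (Suc k)) < \<bar>b \<bullet> I 0 \<omega>\<bar>" using reals_Archimedean[of "\<bar>b \<bullet> I 0 \<omega>\<bar>"] by auto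
        then show False using elim by (simp add: inverse_eq_divide)
      qed
    qed
  qed
  then have "AE \<omega> in M. \<forall>b\<in>Basis. b \<bullet> I 0 \<omega> = 0"
    by (intro AE_finite_allI) auto
  then show ?thesis
    by eventually_elim (simp add: euclidean_eq_iff[of "I 0 _"] inner_commute)
qed

text \<open>A mean inequality with weight \<open>sqrt h\<close>: it turns a second moment of order
  \<open>h\<close> into a first absolute moment of order \<open>sqrt h\<close>.\<close>

lemma abs_le_sqrt_bound:
  fixes x h :: real assumes "h > 0" shows "\<bar>x\<bar> \<le> sqrt h + x\<^sup>2 / sqrt h"
proof -
  define r where "r = sqrt h"
  have r: "r > 0" using assms by (simp add: r_def)
  have "0 \<le> (\<bar>x\<bar> - r / 2)\<^sup>2" by simp
  then have "\<bar>x\<bar> * r \<le> r * r / 4 + x\<^sup>2"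
    by (simp add: power2_eq_square algebra_simps abs_mult_self_eq)
  moreover have "r * r / 4 \<le> r * r" using r by simp
  ultimately have "\<bar>x\<bar> * r \<le> r * r + x\<^sup>2" by linarith
  then show ?thesis using r unfolding r_def[symmetric] by (simp add: field_simps power2_eq_square)
qed

lemma exp_minus_quadratic_bound:
  fixes x :: real assumes "x \<ge> 0" shows "\<bar>exp (- x) - 1 + x\<bar> \<le> x\<^sup>2"
proof -
  have 1: "1 - x \<le> exp (- x)" using exp_ge_add_one_self[of "- x"] by simp
  have "exp (- x) = 1 / exp x" by (simp add: exp_minus field_simps)
  also have "\<dots> \<le> 1 / (1 + x)" using assms exp_ge_add_one_self[of x] by (intro divide_left_mono) auto
  also have "\<dots> \<le> 1 - x + x\<^sup>2"
  proof -
    have "1 \<le> (1 - x + x\<^sup>2) * (1 + x)" using assms by (simp add: algebra_simps power2_eq_square)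
    then show ?thesis using assms by (simp add: pos_divide_le_eq)
  qed
  finally show ?thesis using 1 by simp
qed

lemma grid_sum_increment:
  assumes "a \<le> b"
  shows "grid_sum j b (\<lambda>i. if i < a then 0 else v) Z \<omega> = v \<bullet> (Z (grid j b) \<omega> - Z (grid j a) \<omega>)"
  using assms
proof (induction b)
  case (Suc b)
  show ?case
  proof (cases "a = Suc b")
    case True
    then show ?thesis by (simp add: grid_sum_def)
  next
    case False
    then show ?thesis using Suc by (simp add: grid_sum_def inner_diff_right)
  qed
qed (simp add: grid_sum_def)

lemma (in brownian_integral) weight_bound_increment:
  assumes "a \<le> b"
  shows "weight_bound j b (\<lambda>i. if i < a then 0 else v) = K\<^sup>2 * (norm v)\<^sup>2 * (grid j b - grid j a)"
proof -
  have "(\<Sum>i<b. (norm (if i < a then 0 else v))\<^sup>2) = (\<Sum>i\<in>{..<b}. if i \<in> {a..<b} then (norm v)\<^sup>2 else 0)"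
    by (intro sum.cong) auto
  also have "\<dots> = (\<Sum>i\<in>{..<b} \<inter> {a..<b}. (norm v)\<^sup>2)"
    by (rule sum.inter_restrict[symmetric]) simp
  also have "{..<b} \<inter> {a..<b} = {a..<b}" by auto
  finally show ?thesis
    using assms by (simp add: weight_bound_def grid_def diff_divide_distrib[symmetric] of_nat_diff)
qed

section \<open>Increments of the sphere process and of its noise\<close>

locale sphere_bm = prob_space M for M :: "'w measure" +
  fixes F :: "real \<Rightarrow> 'w measure" and \<Theta>0 :: "real^'n" and B I \<Theta> :: "real \<Rightarrow> 'w \<Rightarrow> real^'n"
  assumes sbm: "sphere_brownian_motion M F \<Theta>0 B I \<Theta>"
    and \<Theta>0: "norm \<Theta>0 = 1"
begin

sublocale BI: brownian_integral M F UNIV B "(*v)" "\<lambda>t \<omega>. sigma01 (\<Theta> t \<omega>)" I "\<lambda>A v. v v* A" "sigma01 ` sphere 0 1" 1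
  by (rule brownian_integral_sphere[OF prob_space_axioms sbm])

definition c :: real where "c = (real CARD('n) - 1) / 2"

lemma c_nonneg: "c \<ge> 0"
  unfolding c_def by (simp add: Suc_leI)

lemma \<Theta>_cont: "continuous_process M \<Theta>" and \<Theta>_adapted: "adapted F \<Theta>"
  using sbm by (simp_all add: sphere_brownian_motion_def)

lemma I_cont: "continuous_process M I"
  by (rule stochastic_integralD(5)[OF BI.SI])

lemma \<Theta>_meas [measurable]: "t \<ge> 0 \<Longrightarrow> \<Theta> t \<in> borel_measurable M"
  using \<Theta>_cont by (simp add: continuous_process_def)

lemma I_meas [measurable]: "t \<ge> 0 \<Longrightarrow> I t \<in> borel_measurable M"
  using I_cont by (simp add: continuous_process_def)

lemma \<Theta>_path: "\<omega> \<in> space M \<Longrightarrow> continuous_on {0..} (\<lambda>t. \<Theta> t \<omega>)"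
  using \<Theta>_cont by (simp add: continuous_process_def)

lemma AE_norm: "AE \<omega> in M. \<forall>t\<ge>0. norm (\<Theta> t \<omega>) = 1"
proof -
  have "AE \<omega> in M. \<forall>t\<ge>0. \<Theta> t \<omega> \<in> sphere 0 1" using sbm by (simp add: sphere_brownian_motion_def)
  then show ?thesis by eventually_elim simp
qed

lemma AE_sde: "AE \<omega> in M. \<forall>t\<ge>0. \<Theta> t \<omega> = \<Theta>0 + I t \<omega> - c *\<^sub>R integral {0..t} (\<lambda>s. \<Theta> s \<omega>)"
  using sbm by (simp add: sphere_brownian_motion_def c_def)

lemma AE_increment: "AE \<omega> in M. \<forall>s t. 0 \<le> s \<longrightarrow> s \<le> t \<longrightarrow>
   \<Theta> t \<omega> - \<Theta> s \<omega> = I t \<omega> - I s \<omega> - c *\<^sub>R integral {s..t} (\<lambda>r. \<Theta> r \<omega>) \<and>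
   norm (integral {s..t} (\<lambda>r. \<Theta> r \<omega>)) \<le> t - s"
  using AE_sde AE_norm AE_space
proof eventually_elim
  case (elim \<omega>)
  show ?case
  proof (intro allI impI conjI)
    fix s t :: real assume st: "0 \<le> s" "s \<le> t"
    have co: "continuous_on {0..t} (\<lambda>r. \<Theta> r \<omega>)" "continuous_on {s..t} (\<lambda>r. \<Theta> r \<omega>)"
      using \<Theta>_path[of \<omega>] elim st by (auto intro: continuous_on_subset)
    have e: "integral {0..s} (\<lambda>r. \<Theta> r \<omega>) + integral {s..t} (\<lambda>r. \<Theta> r \<omega>) = integral {0..t} (\<lambda>r. \<Theta> r \<omega>)"
      by (rule Henstock_Kurzweil_Integration.integral_combine) (use st integrable_continuous_real[OF co(1)] in auto)
    have "\<Theta> t \<omega> = \<Theta>0 + I t \<omega> - c *\<^sub>R integral {0..t} (\<lambda>s. \<Theta> s \<omega>)"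
      "\<Theta> s \<omega> = \<Theta>0 + I s \<omega> - c *\<^sub>R integral {0..s} (\<lambda>s. \<Theta> s \<omega>)" using elim st by auto
    then show "\<Theta> t \<omega> - \<Theta> s \<omega> = I t \<omega> - I s \<omega> - c *\<^sub>R integral {s..t} (\<lambda>r. \<Theta> r \<omega>)"
      unfolding e[symmetric] scaleR_add_right by simp
    have "norm (integral {s..t} (\<lambda>r. \<Theta> r \<omega>)) \<le> 1 * (t - s)"
      by (rule integral_bound[OF st(2) co(2)]) (use elim st in auto)
    then show "norm (integral {s..t} (\<lambda>r. \<Theta> r \<omega>)) \<le> t - s" by simp
  qed
qed

text \<open>The increment of \<open>I\<close> is that of \<open>\<Theta>\<close>, at most the
  diameter 2 of the sphere, plus the integrated drift. This is the source of the almost sure bound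
  required by \<open>grid_sum_moments\<close>.\<close>

lemma AE_I_increment: "AE \<omega> in M. \<forall>s t. 0 \<le> s \<longrightarrow> s \<le> t \<longrightarrow> norm (I t \<omega> - I s \<omega>) \<le> 2 + c * (t - s)"
  using AE_increment AE_norm
proof eventually_elim
  case (elim \<omega>)
  show ?case
  proof (intro allI impI)
    fix s t :: real assume st: "0 \<le> s" "s \<le> t"
    have "I t \<omega> - I s \<omega> = (\<Theta> t \<omega> - \<Theta> s \<omega>) + c *\<^sub>R integral {s..t} (\<lambda>r. \<Theta> r \<omega>)"
      using elim st by simp
    also have "norm \<dots> \<le> (norm (\<Theta> t \<omega>) + norm (\<Theta> s \<omega>)) + c * (t - s)"
      using elim st c_nonneg
      by (intro order_trans[OF norm_triangle_ineq] add_mono norm_triangle_ineq4) (auto intro: mult_left_mono)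
    finally show "norm (I t \<omega> - I s \<omega>) \<le> 2 + c * (t - s)" using elim st by simp
  qed
qed

lemma grid_sum_bounded: "\<exists>C. AE \<omega> in M. \<bar>grid_sum j p w I \<omega>\<bar> \<le> C"
proof
  show "AE \<omega> in M. \<bar>grid_sum j p w I \<omega>\<bar> \<le> (\<Sum>i<p. norm (w i) * (2 + c * (grid j (Suc i) - grid j i)))"
    using AE_I_increment
  proof eventually_elim
    case (elim \<omega>)
    show ?case unfolding grid_sum_def
      using elim less_imp_le[OF grid_less_Suc]
      by (intro order_trans[OF sum_abs] sum_mono order_trans[OF Cauchy_Schwarz_ineq2] mult_left_mono) auto
  qed
qed

text \<open>Instances of \<open>grid_sum_moments\<close> for a single increment. Orthogonality to
  \<open>u \<bullet> \<Theta> s\<close> is the martingale property that removes the first-order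
  noise term in \<open>msq_step\<close>.\<close>

lemma increment_moments:
  fixes j a b :: nat
  assumes ab: "a \<le> b"
  defines "s \<equiv> grid j a" and "t \<equiv> grid j b"
  shows "(\<integral>\<omega>. v \<bullet> (I t \<omega> - I s \<omega>) \<partial>M) = 0"
    "(\<integral>\<omega>. (v \<bullet> (I t \<omega> - I s \<omega>))\<^sup>2 \<partial>M) \<le> (norm v)\<^sup>2 * (t - s)"
    "(\<integral>\<omega>. (v \<bullet> (I t \<omega> - I s \<omega>))^4 \<partial>M) \<le> 24 * ((norm v)\<^sup>2 * (t - s))\<^sup>2"
    "(\<integral>\<omega>. (u \<bullet> \<Theta> s \<omega>) * (v \<bullet> (I t \<omega> - I s \<omega>)) \<partial>M) = 0"
    "BI.quad j b (\<lambda>i. if i < a then 0 else v) \<longlonglongrightarrow> (\<integral>\<omega>. (v \<bullet> (I t \<omega> - I s \<omega>))\<^sup>2 \<partial>M)"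
proof -
  let ?w = "\<lambda>i. if i < a then 0 else v"
  obtain C where C: "AE \<omega> in M. \<bar>grid_sum j b ?w I \<omega>\<bar> \<le> C" using grid_sum_bounded by blast
  note gm = BI.grid_sum_moments[OF C, unfolded BI.weight_bound_increment[OF ab] grid_sum_increment[OF ab], folded s_def t_def]
  show "(\<integral>\<omega>. v \<bullet> (I t \<omega> - I s \<omega>) \<partial>M) = 0" by (rule gm(1))
  show "(\<integral>\<omega>. (v \<bullet> (I t \<omega> - I s \<omega>))\<^sup>2 \<partial>M) \<le> (norm v)\<^sup>2 * (t - s)" using gm(3) by simp
  show "(\<integral>\<omega>. (v \<bullet> (I t \<omega> - I s \<omega>))^4 \<partial>M) \<le> 24 * ((norm v)\<^sup>2 * (t - s))\<^sup>2" using gm(4) by simp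
  show "BI.quad j b ?w \<longlonglongrightarrow> (\<integral>\<omega>. (v \<bullet> (I t \<omega> - I s \<omega>))\<^sup>2 \<partial>M)" by (rule gm(2))
  \<comment> \<open>Orthogonality is known for factors bounded at every point, whereas
    \<open>u \<bullet> \<Theta> s\<close> is bounded only almost surely; clipping at
    \<open>norm u\<close> changes it on a null set.\<close>
  define Y where "Y \<omega> = max (- norm u) (min (norm u) (u \<bullet> \<Theta> s \<omega>))" for \<omega>
  have "\<Theta> s \<in> borel_measurable (F s)" using \<Theta>_adapted by (simp add: adapted_def s_def)
  then have Ym: "Y \<in> borel_measurable (F s)" unfolding Y_def[abs_def] by measurable
  have "(\<integral>\<omega>. Y \<omega> * (v \<bullet> (I t \<omega> - I s \<omega>)) \<partial>M) = 0"
    by (rule gm(5)[of a Y "norm u"]) (use Ym in \<open>auto simp: s_def Y_def max_def min_def\<close>)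
  moreover have "(\<integral>\<omega>. Y \<omega> * (v \<bullet> (I t \<omega> - I s \<omega>)) \<partial>M) = (\<integral>\<omega>. (u \<bullet> \<Theta> s \<omega>) * (v \<bullet> (I t \<omega> - I s \<omega>)) \<partial>M)"
  proof (rule integral_cong_AE)
    show "AE \<omega> in M. Y \<omega> * (v \<bullet> (I t \<omega> - I s \<omega>)) = (u \<bullet> \<Theta> s \<omega>) * (v \<bullet> (I t \<omega> - I s \<omega>))"
      using AE_norm
    proof eventually_elim
      case (elim \<omega>)
      have "\<bar>u \<bullet> \<Theta> s \<omega>\<bar> \<le> norm u * norm (\<Theta> s \<omega>)" by (rule Cauchy_Schwarz_ineq2)
      then have "\<bar>u \<bullet> \<Theta> s \<omega>\<bar> \<le> norm u" using elim by (simp add: s_def)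
      then have "Y \<omega> = u \<bullet> \<Theta> s \<omega>" unfolding Y_def by linarith
      then show ?case by simp
    qed
    have [measurable]: "Y \<in> borel_measurable M"
      using filtered_by_measurable[OF brownian_motionD(1)[OF BI.bm] Ym] .
    show "(\<lambda>\<omega>. Y \<omega> * (v \<bullet> (I t \<omega> - I s \<omega>))) \<in> borel_measurable M"
      "(\<lambda>\<omega>. (u \<bullet> \<Theta> s \<omega>) * (v \<bullet> (I t \<omega> - I s \<omega>))) \<in> borel_measurable M"
      by (simp_all add: s_def t_def)
  qed
  ultimately show "(\<integral>\<omega>. (u \<bullet> \<Theta> s \<omega>) * (v \<bullet> (I t \<omega> - I s \<omega>)) \<partial>M) = 0" by simp
qed

definition msq :: "real^'n \<Rightarrow> real \<Rightarrow> real" where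
  "msq v t = (\<integral>\<omega>. (v \<bullet> \<Theta> t \<omega>)\<^sup>2 \<partial>M)"

lemma integrable_bound_AE:
  fixes f :: "'w \<Rightarrow> real"
  assumes "f \<in> borel_measurable M" "AE \<omega> in M. \<bar>f \<omega>\<bar> \<le> C"
  shows "integrable M f"
  using integrable_const_bound[of f C] assms by simp

lemma AE_inner_\<Theta>: "AE \<omega> in M. \<forall>t\<ge>0. \<bar>v \<bullet> \<Theta> t \<omega>\<bar> \<le> norm v"
  using AE_norm
proof eventually_elim
  case (elim \<omega>)
  show ?case
  proof (intro allI impI)
    fix t :: real assume "t \<ge> 0"
    then show "\<bar>v \<bullet> \<Theta> t \<omega>\<bar> \<le> norm v" using Cauchy_Schwarz_ineq2[of v "\<Theta> t \<omega>"] elim by simp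
  qed
qed

lemma integrable_msq: "t \<ge> 0 \<Longrightarrow> integrable M (\<lambda>\<omega>. (v \<bullet> \<Theta> t \<omega>)\<^sup>2)"
  by (rule integrable_bounded_powers[where C = "norm v"]) (use AE_inner_\<Theta>[of v] in \<open>auto elim: eventually_mono\<close>)

lemma quad_eq: "BI.quad j p w m = (\<Sum>l<p * 2 ^ (m - j). ((norm (w (l div 2 ^ (m - j))))\<^sup>2 - msq (w (l div 2 ^ (m - j))) (grid m l)) / 2 ^ m)"
  unfolding BI.quad_def
proof (intro sum.cong refl)
  fix l
  let ?v = "w (l div 2 ^ (m - j))"
  have "(\<integral>\<omega>. (norm (BI.integrand j m w l \<omega>))\<^sup>2 \<partial>M) = (\<integral>\<omega>. (norm ?v)\<^sup>2 - (?v \<bullet> \<Theta> (grid m l) \<omega>)\<^sup>2 \<partial>M)"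
  proof (rule integral_cong_AE)
    show "AE \<omega> in M. (norm (BI.integrand j m w l \<omega>))\<^sup>2 = (norm ?v)\<^sup>2 - (?v \<bullet> \<Theta> (grid m l) \<omega>)\<^sup>2"
      using AE_norm BI.AE_cut by eventually_elim (simp add: BI.integrand_def norm_vector_matrix_mult_sigma01)
    have [measurable]: "BI.integrand j m w l \<in> borel_measurable M"
      using filtered_by_measurable[OF brownian_motionD(1)[OF BI.bm] BI.integrand_measurable] .
    show "(\<lambda>\<omega>. (norm (BI.integrand j m w l \<omega>))\<^sup>2) \<in> borel_measurable M" by measurable
  qed simp
  also have "\<dots> = (norm ?v)\<^sup>2 - msq ?v (grid m l)"
    using integrable_msq[of "grid m l" ?v] by (simp add: msq_def prob_space)
  finally show "(\<integral>\<omega>. (norm (BI.integrand j m w l \<omega>))\<^sup>2 \<partial>M) / 2 ^ m = ((norm ?v)\<^sup>2 - msq ?v (grid m l)) / 2 ^ m" by simp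
qed

text \<open>One constant for the mean absolute increments of both \<open>I\<close> and
  \<open>\<Theta>\<close>. The latter, with its added drift, dictates the form.\<close>

definition L :: "real^'n \<Rightarrow> real" where
  "L v = 1 + 2 * (norm v)\<^sup>2 * (1 + c\<^sup>2)"

lemma L_nonneg: "L v \<ge> 0"
  unfolding L_def by (intro add_nonneg_nonneg mult_nonneg_nonneg) auto

lemma expectation_abs_increment_I:
  fixes j a b :: nat
  assumes ab: "a \<le> b"
  defines "s \<equiv> grid j a" and "t \<equiv> grid j b"
  assumes h: "t - s \<le> h" "0 < h"
  shows "integrable M (\<lambda>\<omega>. (v \<bullet> (I t \<omega> - I s \<omega>)) ^ k)"
    "(\<integral>\<omega>. \<bar>v \<bullet> (I t \<omega> - I s \<omega>)\<bar> \<partial>M) \<le> L v * sqrt h"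
proof -
  have st: "0 \<le> s" "s \<le> t" using ab by (simp_all add: s_def t_def)
  have [measurable]: "I t \<in> borel_measurable M" "I s \<in> borel_measurable M" using st by auto
  have bd: "AE \<omega> in M. \<bar>v \<bullet> (I t \<omega> - I s \<omega>)\<bar> \<le> norm v * (2 + c * (t - s))"
    using AE_I_increment
  proof eventually_elim
    case (elim \<omega>)
    then show ?case using st
      by (intro order_trans[OF Cauchy_Schwarz_ineq2] mult_left_mono) auto
  qed
  show i: "integrable M (\<lambda>\<omega>. (v \<bullet> (I t \<omega> - I s \<omega>)) ^ k)" for k
    by (rule integrable_bounded_powers[OF _ bd]) measurable
  have "(\<integral>\<omega>. \<bar>v \<bullet> (I t \<omega> - I s \<omega>)\<bar> \<partial>M) \<le> (\<integral>\<omega>. sqrt h + (v \<bullet> (I t \<omega> - I s \<omega>))\<^sup>2 / sqrt h \<partial>M)"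
    using i[of 1] i[of 2] h by (intro integral_mono abs_le_sqrt_bound) auto
  also have "\<dots> = sqrt h + (\<integral>\<omega>. (v \<bullet> (I t \<omega> - I s \<omega>))\<^sup>2 \<partial>M) / sqrt h"
    using i[of 2] by (simp add: prob_space)
  also have "\<dots> \<le> sqrt h + ((norm v)\<^sup>2 * h) / sqrt h"
  proof -
    have "(norm v)\<^sup>2 * (t - s) \<le> (norm v)\<^sup>2 * h" using h by (intro mult_left_mono) auto
    then have "(\<integral>\<omega>. (v \<bullet> (I t \<omega> - I s \<omega>))\<^sup>2 \<partial>M) \<le> (norm v)\<^sup>2 * h"
      using increment_moments(2)[OF ab, of v j] unfolding s_def t_def by linarith
    then show ?thesis using h by (intro add_left_mono divide_right_mono) auto
  qed
  also have "\<dots> = (1 + (norm v)\<^sup>2) * sqrt h"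
  proof -
    have "h / sqrt h = sqrt h" using h by (simp add: real_div_sqrt)
    then have "((norm v)\<^sup>2 * h) / sqrt h = (norm v)\<^sup>2 * sqrt h"
      by (metis times_divide_eq_right)
    then show ?thesis by (simp add: algebra_simps)
  qed
  also have "\<dots> \<le> L v * sqrt h"
  proof (rule mult_right_mono)
    have "(norm v)\<^sup>2 * 1 \<le> (norm v)\<^sup>2 * (2 * (1 + c\<^sup>2))" by (rule mult_left_mono) auto
    then show "1 + (norm v)\<^sup>2 \<le> L v" by (simp add: L_def algebra_simps)
  qed (use h in simp)
  finally show "(\<integral>\<omega>. \<bar>v \<bullet> (I t \<omega> - I s \<omega>)\<bar> \<partial>M) \<le> L v * sqrt h" .
qed

text \<open>The increment of \<open>\<Theta>\<close> is that of \<open>I\<close> minus a drift of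
  size at most \<open>c * h\<close>; for \<open>h \<le> 1\<close> the square of the drift is of
  order \<open>h\<close>, like the variance of the noise.\<close>

lemma expectation_abs_increment_\<Theta>:
  fixes j a b :: nat
  assumes ab: "a \<le> b"
  defines "s \<equiv> grid j a" and "t \<equiv> grid j b"
  assumes h: "t - s \<le> h" "0 < h" "h \<le> 1"
  shows "(\<integral>\<omega>. \<bar>v \<bullet> (\<Theta> t \<omega> - \<Theta> s \<omega>)\<bar> \<partial>M) \<le> L v * sqrt h"
proof -
  have st: "0 \<le> s" "s \<le> t" using ab by (simp_all add: s_def t_def)
  have [measurable]: "I t \<in> borel_measurable M" "I s \<in> borel_measurable M"
    "\<Theta> t \<in> borel_measurable M" "\<Theta> s \<in> borel_measurable M" using st by auto
  note iI = expectation_abs_increment_I(1)[OF ab h(1,2)[unfolded s_def t_def], folded s_def t_def]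
  have bd: "AE \<omega> in M. \<bar>v \<bullet> (\<Theta> t \<omega> - \<Theta> s \<omega>)\<bar> \<le> 2 * norm v"
    using AE_inner_\<Theta>[of v]
  proof eventually_elim
    case (elim \<omega>)
    then have "\<bar>v \<bullet> \<Theta> t \<omega>\<bar> \<le> norm v" "\<bar>v \<bullet> \<Theta> s \<omega>\<bar> \<le> norm v" using st by auto
    then show ?case by (simp add: inner_diff_right)
  qed
  have i: "integrable M (\<lambda>\<omega>. (v \<bullet> (\<Theta> t \<omega> - \<Theta> s \<omega>)) ^ k)" for k
    by (rule integrable_bounded_powers[OF _ bd]) measurable
  have "(\<integral>\<omega>. \<bar>v \<bullet> (\<Theta> t \<omega> - \<Theta> s \<omega>)\<bar> \<partial>M) \<le> (\<integral>\<omega>. sqrt h + (v \<bullet> (\<Theta> t \<omega> - \<Theta> s \<omega>))\<^sup>2 / sqrt h \<partial>M)"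
    using i[of 1] i[of 2] h by (intro integral_mono abs_le_sqrt_bound) auto
  also have "\<dots> = sqrt h + (\<integral>\<omega>. (v \<bullet> (\<Theta> t \<omega> - \<Theta> s \<omega>))\<^sup>2 \<partial>M) / sqrt h"
    using i[of 2] by (simp add: prob_space)
  also have "\<dots> \<le> sqrt h + (2 * (norm v)\<^sup>2 * (1 + c\<^sup>2) * h) / sqrt h"
  proof -
    have "(\<integral>\<omega>. (v \<bullet> (\<Theta> t \<omega> - \<Theta> s \<omega>))\<^sup>2 \<partial>M) \<le> (\<integral>\<omega>. 2 * (v \<bullet> (I t \<omega> - I s \<omega>))\<^sup>2 + 2 * (c * norm v * h)\<^sup>2 \<partial>M)"
    proof (rule integral_mono_AE)
      show "integrable M (\<lambda>\<omega>. (v \<bullet> (\<Theta> t \<omega> - \<Theta> s \<omega>))\<^sup>2)" by (rule i)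
      show "integrable M (\<lambda>\<omega>. 2 * (v \<bullet> (I t \<omega> - I s \<omega>))\<^sup>2 + 2 * (c * norm v * h)\<^sup>2)" using iI[of v 2] by simp
      show "AE \<omega> in M. (v \<bullet> (\<Theta> t \<omega> - \<Theta> s \<omega>))\<^sup>2 \<le> 2 * (v \<bullet> (I t \<omega> - I s \<omega>))\<^sup>2 + 2 * (c * norm v * h)\<^sup>2"
        using AE_increment
      proof eventually_elim
        case (elim \<omega>)
        define x where "x = v \<bullet> (I t \<omega> - I s \<omega>)"
        define y where "y = c * (v \<bullet> integral {s..t} (\<lambda>r. \<Theta> r \<omega>))"
        have e: "v \<bullet> (\<Theta> t \<omega> - \<Theta> s \<omega>) = x - y"
          using elim st by (simp add: x_def y_def inner_diff_right)
        have "\<bar>v \<bullet> integral {s..t} (\<lambda>r. \<Theta> r \<omega>)\<bar> \<le> norm v * h"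
          using elim st h(1) by (intro order_trans[OF Cauchy_Schwarz_ineq2] mult_left_mono) fastforce+
        then have "\<bar>y\<bar> \<le> c * norm v * h"
          using mult_left_mono[OF _ c_nonneg] c_nonneg by (fastforce simp: y_def abs_mult mult.assoc)
        then have y2: "y\<^sup>2 \<le> (c * norm v * h)\<^sup>2" using power_mono[of "\<bar>y\<bar>" "c * norm v * h" 2] by simp
        have "(x - y)\<^sup>2 \<le> 2 * x\<^sup>2 + 2 * y\<^sup>2" using zero_le_power2[of "x + y"]
          by (simp add: power2_eq_square algebra_simps)
        then show ?case using y2 unfolding e x_def[symmetric] by linarith
      qed
    qed
    also have "\<dots> = 2 * (\<integral>\<omega>. (v \<bullet> (I t \<omega> - I s \<omega>))\<^sup>2 \<partial>M) + 2 * (c * norm v * h)\<^sup>2"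
      using iI[of v 2] by (simp add: prob_space)
    also have "\<dots> \<le> 2 * ((norm v)\<^sup>2 * h) + 2 * (c\<^sup>2 * (norm v)\<^sup>2 * h)"
    proof -
      have "(norm v)\<^sup>2 * (t - s) \<le> (norm v)\<^sup>2 * h" using h by (intro mult_left_mono) auto
      then have 1: "(\<integral>\<omega>. (v \<bullet> (I t \<omega> - I s \<omega>))\<^sup>2 \<partial>M) \<le> (norm v)\<^sup>2 * h"
        using increment_moments(2)[OF ab, of v j] unfolding s_def t_def by linarith
      have "h\<^sup>2 \<le> h" using h by (simp add: power2_eq_square mult_left_le)
      then have "(c * norm v * h)\<^sup>2 \<le> c\<^sup>2 * (norm v)\<^sup>2 * h"
        by (simp add: power_mult_distrib mult_left_mono)
      then show ?thesis using 1 by linarith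
    qed
    also have "\<dots> = 2 * (norm v)\<^sup>2 * (1 + c\<^sup>2) * h" by (simp add: algebra_simps)
    finally show ?thesis using h by (intro add_left_mono divide_right_mono) auto
  qed
  also have "\<dots> = L v * sqrt h"
  proof -
    have "h / sqrt h = sqrt h" using h by (simp add: real_div_sqrt)
    then have "(2 * (norm v)\<^sup>2 * (1 + c\<^sup>2) * h) / sqrt h = 2 * (norm v)\<^sup>2 * (1 + c\<^sup>2) * sqrt h"
      by (metis times_divide_eq_right)
    then show ?thesis by (simp add: L_def algebra_simps)
  qed
  finally show ?thesis .
qed

text \<open>In the difference of squares one factor is bounded and the other is of order
  \<open>sqrt h\<close> in the mean.\<close>

lemma msq_increment:
  fixes j a b :: nat
  assumes ab: "a \<le> b"
  defines "s \<equiv> grid j a" and "t \<equiv> grid j b"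
  assumes h: "t - s \<le> h" "0 < h" "h \<le> 1"
  shows "\<bar>msq v t - msq v s\<bar> \<le> 2 * norm v * L v * sqrt h"
proof -
  have st: "0 \<le> s" "s \<le> t" using ab by (simp_all add: s_def t_def)
  have [measurable]: "\<Theta> t \<in> borel_measurable M" "\<Theta> s \<in> borel_measurable M" using st by auto
  have "\<bar>msq v t - msq v s\<bar> = \<bar>\<integral>\<omega>. (v \<bullet> \<Theta> t \<omega>)\<^sup>2 - (v \<bullet> \<Theta> s \<omega>)\<^sup>2 \<partial>M\<bar>"
    using integrable_msq st by (simp add: msq_def)
  also have "\<dots> \<le> (\<integral>\<omega>. \<bar>(v \<bullet> \<Theta> t \<omega>)\<^sup>2 - (v \<bullet> \<Theta> s \<omega>)\<^sup>2\<bar> \<partial>M)"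
    by (rule integral_abs_bound)
  also have "\<dots> \<le> (\<integral>\<omega>. 2 * norm v * \<bar>v \<bullet> (\<Theta> t \<omega> - \<Theta> s \<omega>)\<bar> \<partial>M)"
  proof (rule integral_mono_AE)
    show "integrable M (\<lambda>\<omega>. \<bar>(v \<bullet> \<Theta> t \<omega>)\<^sup>2 - (v \<bullet> \<Theta> s \<omega>)\<^sup>2\<bar>)"
      using integrable_msq st by simp
    have "integrable M (\<lambda>\<omega>. v \<bullet> (\<Theta> t \<omega> - \<Theta> s \<omega>))"
      by (rule integrable_bound_AE[where C = "2 * norm v"])
        (use AE_inner_\<Theta>[of v] st in \<open>auto simp: inner_diff_right elim!: eventually_mono
          intro: order_trans[OF abs_triangle_ineq4]\<close>, smt (verit))
    then show "integrable M (\<lambda>\<omega>. 2 * norm v * \<bar>v \<bullet> (\<Theta> t \<omega> - \<Theta> s \<omega>)\<bar>)" by simp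
    show "AE \<omega> in M. \<bar>(v \<bullet> \<Theta> t \<omega>)\<^sup>2 - (v \<bullet> \<Theta> s \<omega>)\<^sup>2\<bar> \<le> 2 * norm v * \<bar>v \<bullet> (\<Theta> t \<omega> - \<Theta> s \<omega>)\<bar>"
      using AE_inner_\<Theta>[of v]
    proof eventually_elim
      case (elim \<omega>)
      then have "\<bar>v \<bullet> \<Theta> t \<omega>\<bar> \<le> norm v" "\<bar>v \<bullet> \<Theta> s \<omega>\<bar> \<le> norm v" using st by auto
      then have "\<bar>v \<bullet> \<Theta> t \<omega> + v \<bullet> \<Theta> s \<omega>\<bar> \<le> 2 * norm v" by linarith
      then have "\<bar>v \<bullet> \<Theta> t \<omega> + v \<bullet> \<Theta> s \<omega>\<bar> * \<bar>v \<bullet> (\<Theta> t \<omega> - \<Theta> s \<omega>)\<bar> \<le> 2 * norm v * \<bar>v \<bullet> (\<Theta> t \<omega> - \<Theta> s \<omega>)\<bar>"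
        by (rule mult_right_mono) simp
      moreover have "(v \<bullet> \<Theta> t \<omega>)\<^sup>2 - (v \<bullet> \<Theta> s \<omega>)\<^sup>2 = (v \<bullet> \<Theta> t \<omega> + v \<bullet> \<Theta> s \<omega>) * (v \<bullet> (\<Theta> t \<omega> - \<Theta> s \<omega>))"
        by (simp add: inner_diff_right power2_eq_square algebra_simps)
      ultimately show ?case by (simp add: abs_mult)
    qed
  qed
  also have "\<dots> \<le> 2 * norm v * (L v * sqrt h)"
    using expectation_abs_increment_\<Theta>[OF ab h[unfolded s_def t_def], of v]
    unfolding s_def t_def by (simp add: mult_left_mono)
  finally show ?thesis by simp
qed

text \<open>\<open>quad\<close> sums the rate \<open>(norm v)^2 - msq v\<close>, which by
  \<open>msq_increment\<close> changes by \<open>O(sqrt h)\<close> over a cell of length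
  \<open>h\<close>. Freezing it at the left end costs \<open>O(h * sqrt h)\<close>, uniformly in the
  level \<open>m\<close>, hence also in the limit.\<close>

lemma variance_increment_cell:
  fixes j a :: nat
  assumes "h = 1 / 2 ^ j"
  defines "s \<equiv> grid j a" and "t \<equiv> grid j (Suc a)"
  shows "\<bar>(\<integral>\<omega>. (v \<bullet> (I t \<omega> - I s \<omega>))\<^sup>2 \<partial>M) - h * ((norm v)\<^sup>2 - msq v s)\<bar> \<le> 2 * norm v * L v * (h * sqrt h)"
proof -
  let ?w = "\<lambda>i. if i < a then 0 else v"
  have h: "0 < h" "h \<le> 1" using assms by auto
  have z: "msq 0 r = 0" for r by (simp add: msq_def)
  have "\<bar>BI.quad j (Suc a) ?w m - h * ((norm v)\<^sup>2 - msq v s)\<bar> \<le> 2 * norm v * L v * (h * sqrt h)" if m: "m \<ge> j" for m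
  proof -
    let ?k = "2 ^ (m - j) :: nat"
    have kk: "real ?k / 2 ^ m = h"
      using grid_refine[OF m, of 1] by (simp add: grid_def assms)
    have split: "{..<Suc a * ?k} = {..<a * ?k} \<union> {a * ?k..<Suc a * ?k}" by auto
    define g where "g l = ((norm (?w (l div ?k)))\<^sup>2 - msq (?w (l div ?k)) (grid m l)) / 2 ^ m" for l
    have "BI.quad j (Suc a) ?w m = sum g {..<Suc a * ?k}" unfolding quad_eq g_def by simp
    also have "\<dots> = sum g {..<a * ?k} + sum g {a * ?k..<Suc a * ?k}"
      unfolding split by (rule sum.union_disjoint) auto
    also have "sum g {..<a * ?k} = 0"
      by (rule sum.neutral) (auto simp: g_def less_mult_imp_div_less z)
    also have "sum g {a * ?k..<Suc a * ?k} = (\<Sum>l\<in>{a * ?k..<Suc a * ?k}. ((norm v)\<^sup>2 - msq v (grid m l)) / 2 ^ m)"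
    proof (rule sum.cong[OF refl])
      fix l assume "l \<in> {a * ?k..<Suc a * ?k}"
      then have "l div ?k = a" by (intro div_nat_eqI) (auto simp: algebra_simps)
      then show "g l = ((norm v)\<^sup>2 - msq v (grid m l)) / 2 ^ m" by (simp add: g_def)
    qed
    finally have q: "BI.quad j (Suc a) ?w m = (\<Sum>l\<in>{a * ?k..<Suc a * ?k}. ((norm v)\<^sup>2 - msq v (grid m l)) / 2 ^ m)" by simp
    have "h * ((norm v)\<^sup>2 - msq v s) = (\<Sum>l\<in>{a * ?k..<Suc a * ?k}. ((norm v)\<^sup>2 - msq v s) / 2 ^ m)"
      using kk by simp (metis mult.commute times_divide_eq_left)
    then have "\<bar>BI.quad j (Suc a) ?w m - h * ((norm v)\<^sup>2 - msq v s)\<bar>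
       = \<bar>\<Sum>l\<in>{a * ?k..<Suc a * ?k}. (msq v s - msq v (grid m l)) / 2 ^ m\<bar>"
      unfolding q by (simp only: sum_subtractf[symmetric]) (simp add: diff_divide_distrib)
    also have "\<dots> \<le> (\<Sum>l\<in>{a * ?k..<Suc a * ?k}. (2 * norm v * L v * sqrt h) / 2 ^ m)"
    proof (intro order_trans[OF sum_abs] sum_mono)
      fix l assume l: "l \<in> {a * ?k..<Suc a * ?k}"
      have s: "s = grid m (a * ?k)" and t: "grid j (Suc a) = grid m (Suc a * ?k)"
        unfolding s_def by (rule grid_refine[OF m])+
      have "grid m l \<le> grid m (Suc a * ?k)" using l by simp
      then have "grid m l - grid m (a * ?k) \<le> h"
        using grid_Suc_diff[of j a] unfolding t s[symmetric] s_def assms(1) by linarith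
      then have "\<bar>msq v (grid m l) - msq v s\<bar> \<le> 2 * norm v * L v * sqrt h"
        unfolding s using msq_increment[of "a * ?k" l m h v] l h by simp
      then show "\<bar>(msq v s - msq v (grid m l)) / 2 ^ m\<bar> \<le> 2 * norm v * L v * sqrt h / 2 ^ m"
        by (simp add: abs_divide divide_right_mono abs_minus_commute)
    qed
    also have "\<dots> = (2 * norm v * L v * sqrt h) * (real ?k / 2 ^ m)" by simp
    also have "\<dots> = 2 * norm v * L v * (h * sqrt h)" unfolding kk by simp
    finally show ?thesis .
  qed
  moreover have "BI.quad j (Suc a) ?w \<longlonglongrightarrow> (\<integral>\<omega>. (v \<bullet> (I t \<omega> - I s \<omega>))\<^sup>2 \<partial>M)"
    unfolding s_def t_def by (rule increment_moments(5)) simp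
  then have "(\<lambda>m. \<bar>BI.quad j (Suc a) ?w m - h * ((norm v)\<^sup>2 - msq v s)\<bar>)
     \<longlonglongrightarrow> \<bar>(\<integral>\<omega>. (v \<bullet> (I t \<omega> - I s \<omega>))\<^sup>2 \<partial>M) - h * ((norm v)\<^sup>2 - msq v s)\<bar>"
    by (intro tendsto_intros)
  ultimately show ?thesis by (intro LIMSEQ_le_const2) auto
qed

end

text \<open>The solution \<open>E\<close> of \<open>E' = |v|\<^sup>2 - n E\<close>, \<open>E(0) = (v \<bullet> \<Theta>0)\<^sup>2\<close>: by Ito's formula this is
  \<open>t \<mapsto> E (v \<bullet> \<Theta> t)\<^sup>2\<close>. Ito's formula is replaced below by a one-step estimate with error
  \<open>O(h powr (3/2))\<close> on the dyadic grid of mesh \<open>h\<close>, which sums up to \<open>O(sqrt h)\<close>.\<close>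

definition second_moment :: "real^'n \<Rightarrow> real^'n \<Rightarrow> real \<Rightarrow> real" where
  "second_moment \<Theta>0 v t = (norm v)\<^sup>2 / real CARD('n)
     + exp (- real CARD('n) * t) * ((v \<bullet> \<Theta>0)\<^sup>2 - (norm v)\<^sup>2 / real CARD('n))"

section \<open>The second moments of the position\<close>

context sphere_bm
begin

text \<open>By the equation the integrand is the absolute value of \<open>c\<close> times the time
  integral of \<open>v \<bullet> (\<Theta> r - \<Theta> s)\<close> over the cell. It is approximated
  by Riemann sums, whose terms have mean absolute values of order \<open>sqrt h\<close> times their
  weights, and dominated convergence carries the estimate over.\<close>

lemma msq_drift_step:
  fixes j a :: nat
  assumes h: "h = 1 / 2 ^ j"
  defines "s \<equiv> grid j a" and "t \<equiv> grid j (Suc a)"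
  shows "(\<integral>\<omega>. \<bar>v \<bullet> (I t \<omega> - I s \<omega>) - v \<bullet> (\<Theta> t \<omega> - \<Theta> s \<omega>) - c * h * (v \<bullet> \<Theta> s \<omega>)\<bar> \<partial>M) \<le> c * L v * (h * sqrt h)"
proof -
  have h01: "0 < h" "h \<le> 1" using h by auto
  have st: "0 \<le> s" "s \<le> t" "t - s = h" using grid_Suc_diff[of j a] by (simp_all add: s_def t_def h less_imp_le[OF grid_less_Suc])
  have [measurable]: "I t \<in> borel_measurable M" "I s \<in> borel_measurable M"
    "\<Theta> t \<in> borel_measurable M" "\<Theta> s \<in> borel_measurable M" using st by auto
  define y where "y \<omega> = v \<bullet> (I t \<omega> - I s \<omega>) - v \<bullet> (\<Theta> t \<omega> - \<Theta> s \<omega>)" for \<omega>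
  define A where "A m = {a * 2 ^ m..<Suc a * 2 ^ m}" for m :: nat
  define r where "r m \<omega> = (\<Sum>l\<in>A m. (c / 2 ^ (j + m)) * (v \<bullet> (\<Theta> (grid (j + m) (Suc l)) \<omega> - \<Theta> s \<omega>)))" for m \<omega>
  have card: "real (card (A m)) / 2 ^ (j + m) = h" for m
    by (simp add: A_def h power_add)
  have sumc: "(\<Sum>l\<in>A m. (c / 2 ^ (j + m)) * z) = c * h * z" for m z
    using card[of m] by (simp add: field_simps)
  have bound: "\<bar>r m \<omega>\<bar> \<le> c * h * (2 * norm v)" if "\<forall>t\<ge>0. \<bar>v \<bullet> \<Theta> t \<omega>\<bar> \<le> norm v" for m \<omega>
  proof -
    have "\<bar>r m \<omega>\<bar> \<le> (\<Sum>l\<in>A m. (c / 2 ^ (j + m)) * (2 * norm v))"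
      unfolding r_def
    proof (intro order_trans[OF sum_abs] sum_mono)
      fix l
      have "\<bar>v \<bullet> \<Theta> (grid (j + m) (Suc l)) \<omega>\<bar> \<le> norm v" "\<bar>v \<bullet> \<Theta> s \<omega>\<bar> \<le> norm v"
        using that st by auto
      then have "\<bar>v \<bullet> (\<Theta> (grid (j + m) (Suc l)) \<omega> - \<Theta> s \<omega>)\<bar> \<le> 2 * norm v" by (simp add: inner_diff_right)
      then show "\<bar>(c / 2 ^ (j + m)) * (v \<bullet> (\<Theta> (grid (j + m) (Suc l)) \<omega> - \<Theta> s \<omega>))\<bar> \<le> (c / 2 ^ (j + m)) * (2 * norm v)"
        using c_nonneg by (simp add: abs_mult mult_left_mono divide_right_mono)
    qed
    then show ?thesis unfolding sumc .
  qed
  have lim: "AE \<omega> in M. (\<lambda>m. r m \<omega>) \<longlonglongrightarrow> y \<omega> - c * h * (v \<bullet> \<Theta> s \<omega>)"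
    using AE_increment AE_space
  proof eventually_elim
    case (elim \<omega>)
    have co: "continuous_on {s..t} (\<lambda>r. \<Theta> r \<omega>)"
      using \<Theta>_path[of \<omega>] elim st by (auto intro: continuous_on_subset)
    have "(\<lambda>m. \<Sum>l\<in>A m. (id (grid (j + m) (Suc l)) - id (grid (j + m) l)) *\<^sub>R \<Theta> (grid (j + m) (Suc l)) \<omega>)
      \<longlonglongrightarrow> integral {s..t} (\<lambda>s. 1 *\<^sub>R \<Theta> s \<omega>)"
      unfolding A_def s_def t_def
      by (rule riemann_grid_tendsto) (use co in \<open>auto simp: s_def t_def id_def\<close>)
    then have "(\<lambda>m. \<Sum>l\<in>A m. (1 / 2 ^ (j + m)) *\<^sub>R \<Theta> (grid (j + m) (Suc l)) \<omega>) \<longlonglongrightarrow> integral {s..t} (\<lambda>s. \<Theta> s \<omega>)"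
      by (simp add: grid_Suc_diff)
    then have "(\<lambda>m. c * (v \<bullet> (\<Sum>l\<in>A m. (1 / 2 ^ (j + m)) *\<^sub>R \<Theta> (grid (j + m) (Suc l)) \<omega>)) - c * h * (v \<bullet> \<Theta> s \<omega>))
      \<longlonglongrightarrow> c * (v \<bullet> integral {s..t} (\<lambda>s. \<Theta> s \<omega>)) - c * h * (v \<bullet> \<Theta> s \<omega>)"
      by (intro tendsto_intros)
    moreover have "c * (v \<bullet> (\<Sum>l\<in>A m. (1 / 2 ^ (j + m)) *\<^sub>R \<Theta> (grid (j + m) (Suc l)) \<omega>)) - c * h * (v \<bullet> \<Theta> s \<omega>) = r m \<omega>" for m
      unfolding r_def inner_diff_right right_diff_distrib sum_subtractf sumc
      by (simp add: inner_sum_right sum_distrib_left)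
    moreover have "y \<omega> = c * (v \<bullet> integral {s..t} (\<lambda>s. \<Theta> s \<omega>))"
      using elim st by (simp add: y_def inner_diff_right)
    ultimately show ?case by simp
  qed
  have rm: "r m \<in> borel_measurable M" for m
    unfolding r_def[abs_def] by measurable
  have ym: "y \<in> borel_measurable M" unfolding y_def[abs_def] by measurable
  have "(\<lambda>m. \<integral>\<omega>. \<bar>r m \<omega>\<bar> \<partial>M) \<longlonglongrightarrow> (\<integral>\<omega>. \<bar>y \<omega> - c * h * (v \<bullet> \<Theta> s \<omega>)\<bar> \<partial>M)"
  proof (rule integral_dominated_convergence[where w = "\<lambda>_. c * h * (2 * norm v)"])
    show "AE \<omega> in M. (\<lambda>m. \<bar>r m \<omega>\<bar>) \<longlonglongrightarrow> \<bar>y \<omega> - c * h * (v \<bullet> \<Theta> s \<omega>)\<bar>"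
      using lim by eventually_elim (rule tendsto_rabs)
    show "AE \<omega> in M. norm \<bar>r m \<omega>\<bar> \<le> c * h * (2 * norm v)" for m
      using AE_inner_\<Theta>[of v] by eventually_elim (use bound in simp)
  qed (use rm ym in auto)
  moreover have "(\<integral>\<omega>. \<bar>r m \<omega>\<bar> \<partial>M) \<le> c * L v * (h * sqrt h)" for m
  proof -
    have i: "integrable M (\<lambda>\<omega>. \<bar>v \<bullet> (\<Theta> (grid (j + m) (Suc l)) \<omega> - \<Theta> s \<omega>)\<bar>)" for l
    proof (rule integrable_bound_AE)
      show "AE \<omega> in M. \<bar>\<bar>v \<bullet> (\<Theta> (grid (j + m) (Suc l)) \<omega> - \<Theta> s \<omega>)\<bar>\<bar> \<le> 2 * norm v"
        using AE_inner_\<Theta>[of v]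
      proof eventually_elim
        case (elim \<omega>)
        have "\<bar>v \<bullet> \<Theta> (grid (j + m) (Suc l)) \<omega>\<bar> \<le> norm v" "\<bar>v \<bullet> \<Theta> s \<omega>\<bar> \<le> norm v"
          using elim st by auto
        then show ?case by (simp add: inner_diff_right)
      qed
    qed simp
    have ir: "integrable M (r m)"
      by (rule integrable_bound_AE[OF rm, of _ "c * h * (2 * norm v)"])
        (use AE_inner_\<Theta>[of v] bound in \<open>auto elim: eventually_mono\<close>)
    have "(\<integral>\<omega>. \<bar>r m \<omega>\<bar> \<partial>M) \<le> (\<integral>\<omega>. (\<Sum>l\<in>A m. (c / 2 ^ (j + m)) * \<bar>v \<bullet> (\<Theta> (grid (j + m) (Suc l)) \<omega> - \<Theta> s \<omega>)\<bar>) \<partial>M)"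
    proof (rule integral_mono)
      show "integrable M (\<lambda>\<omega>. \<bar>r m \<omega>\<bar>)" using ir by simp
      show "integrable M (\<lambda>\<omega>. \<Sum>l\<in>A m. (c / 2 ^ (j + m)) * \<bar>v \<bullet> (\<Theta> (grid (j + m) (Suc l)) \<omega> - \<Theta> s \<omega>)\<bar>)"
        using i by (intro Bochner_Integration.integrable_sum integrable_mult_right) auto
      show "\<bar>r m \<omega>\<bar> \<le> (\<Sum>l\<in>A m. (c / 2 ^ (j + m)) * \<bar>v \<bullet> (\<Theta> (grid (j + m) (Suc l)) \<omega> - \<Theta> s \<omega>)\<bar>)" for \<omega>
        unfolding r_def using c_nonneg by (intro order_trans[OF sum_abs] sum_mono) (simp add: abs_mult)
    qed
    also have "\<dots> = (\<Sum>l\<in>A m. (c / 2 ^ (j + m)) * (\<integral>\<omega>. \<bar>v \<bullet> (\<Theta> (grid (j + m) (Suc l)) \<omega> - \<Theta> s \<omega>)\<bar> \<partial>M))"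
      using i by (subst Bochner_Integration.integral_sum) auto
    also have "\<dots> \<le> (\<Sum>l\<in>A m. (c / 2 ^ (j + m)) * (L v * sqrt h))"
    proof (intro sum_mono mult_left_mono)
      fix l assume l: "l \<in> A m"
      have s: "s = grid (j + m) (a * 2 ^ m)" and t: "t = grid (j + m) (Suc a * 2 ^ m)"
        using grid_refine[of j "j + m"] by (simp_all add: s_def t_def)
      have "grid (j + m) (Suc l) \<le> t" unfolding t grid_le_iff using l by (simp add: A_def Suc_le_eq)
      then have "grid (j + m) (Suc l) - grid (j + m) (a * 2 ^ m) \<le> h" using st s by linarith
      then show "(\<integral>\<omega>. \<bar>v \<bullet> (\<Theta> (grid (j + m) (Suc l)) \<omega> - \<Theta> s \<omega>)\<bar> \<partial>M) \<le> L v * sqrt h"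
        unfolding s using expectation_abs_increment_\<Theta>[of "a * 2 ^ m" "Suc l" "j + m" h v] l h01
        by (simp add: A_def)
    qed (use c_nonneg in simp)
    also have "\<dots> = c * L v * (h * sqrt h)" unfolding sumc by simp
    finally show ?thesis .
  qed
  ultimately show ?thesis
    unfolding y_def by (intro LIMSEQ_le_const2) auto
qed

text \<open>The four errors \<open>b1\<close> to \<open>b4\<close> of \<open>msq_step\<close>, with
  \<open>b2\<close> and \<open>b4\<close>, which come from mixed terms, doubled.\<close>

definition drift_const :: "real^'n \<Rightarrow> real" where
  "drift_const v = 2 * norm v * L v + 2 * (c * norm v * L v) + (c * norm v)\<^sup>2 + 2 * (norm v * (c * L v))"

text \<open>A discrete Ito formula: in the square of \<open>\<theta> + x - y\<close> the mean of
  \<open>\<theta> * x\<close> vanishes, \<open>x^2\<close> contributes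
  \<open>h * ((norm v)^2 - msq v s)\<close>, and \<open>- 2 * \<theta> * y\<close> contributes
  \<open>- 2 * c * h * msq v s\<close>. The total coefficient of \<open>msq\<close> is
  \<open>1 + 2 * c\<close>, the dimension; everything else is of order
  \<open>h * sqrt h\<close>.\<close>

lemma msq_step:
  fixes j a :: nat
  assumes h: "h = 1 / 2 ^ j"
  defines "s \<equiv> grid j a" and "t \<equiv> grid j (Suc a)"
  shows "\<bar>msq v t - msq v s - h * ((norm v)\<^sup>2 - real CARD('n) * msq v s)\<bar> \<le> drift_const v * (h * sqrt h)"
proof -
  have h01: "0 < h" "h \<le> 1" using h by auto
  have st: "0 \<le> s" "s \<le> t" "0 \<le> t" "t - s = h" using grid_Suc_diff[of j a] by (simp_all add: s_def t_def h less_imp_le[OF grid_less_Suc])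
  have [measurable]: "I t \<in> borel_measurable M" "I s \<in> borel_measurable M"
    "\<Theta> t \<in> borel_measurable M" "\<Theta> s \<in> borel_measurable M" using st by auto
  \<comment> \<open>\<open>x\<close> is the noise, \<open>y\<close> the integrated drift,
    \<open>\<theta>\<close> the initial value, and \<open>g\<close> the error of freezing the drift
    at time \<open>s\<close>.\<close>
  define x where "x \<omega> = v \<bullet> (I t \<omega> - I s \<omega>)" for \<omega>
  define y where "y \<omega> = x \<omega> - v \<bullet> (\<Theta> t \<omega> - \<Theta> s \<omega>)" for \<omega>
  define \<theta> where "\<theta> \<omega> = v \<bullet> \<Theta> s \<omega>" for \<omega>
  define g where "g \<omega> = y \<omega> - c * h * \<theta> \<omega>" for \<omega>
  have [measurable]: "x \<in> borel_measurable M" "\<theta> \<in> borel_measurable M"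
    unfolding x_def[abs_def] \<theta>_def[abs_def] by measurable
  have ym[measurable]: "y \<in> borel_measurable M" unfolding y_def[abs_def] by measurable
  have gm[measurable]: "g \<in> borel_measurable M" unfolding g_def[abs_def] by measurable
  have \<theta>b: "AE \<omega> in M. \<bar>\<theta> \<omega>\<bar> \<le> norm v"
    using AE_inner_\<Theta>[of v] by eventually_elim (use st in \<open>auto simp: \<theta>_def\<close>)
  have yb: "AE \<omega> in M. \<bar>y \<omega>\<bar> \<le> c * norm v * h"
    using AE_increment
  proof eventually_elim
    case (elim \<omega>)
    have e: "y \<omega> = c * (v \<bullet> integral {s..t} (\<lambda>r. \<Theta> r \<omega>))"
      using elim st by (simp add: x_def y_def inner_diff_right)
    have "norm (integral {s..t} (\<lambda>r. \<Theta> r \<omega>)) \<le> h" using elim st by auto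
    then have "\<bar>v \<bullet> integral {s..t} (\<lambda>r. \<Theta> r \<omega>)\<bar> \<le> norm v * h"
      by (intro order_trans[OF Cauchy_Schwarz_ineq2] mult_left_mono) auto
    from mult_left_mono[OF this c_nonneg] show ?case
      using c_nonneg by (simp add: e abs_mult mult.assoc)
  qed
  have xb: "AE \<omega> in M. \<bar>x \<omega>\<bar> \<le> 2 * norm v + c * norm v * h"
    using yb AE_inner_\<Theta>[of v]
  proof eventually_elim
    case (elim \<omega>)
    have "\<bar>v \<bullet> \<Theta> t \<omega>\<bar> \<le> norm v" "\<bar>v \<bullet> \<Theta> s \<omega>\<bar> \<le> norm v" using elim st by auto
    moreover have "x \<omega> = y \<omega> + (v \<bullet> \<Theta> t \<omega> - v \<bullet> \<Theta> s \<omega>)" by (simp add: y_def inner_diff_right)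
    ultimately show ?case using elim(1) by linarith
  qed
  have gb: "AE \<omega> in M. \<bar>g \<omega>\<bar> \<le> 2 * (c * norm v * h)"
    using yb \<theta>b
  proof eventually_elim
    case (elim \<omega>)
    have "\<bar>c * h * \<theta> \<omega>\<bar> \<le> c * h * norm v" using elim c_nonneg h01 by (simp add: abs_mult mult_left_mono)
    then show ?case using elim(1) unfolding g_def by (simp add: mult.commute mult.left_commute)
  qed
  have prod: "integrable M (\<lambda>\<omega>. f \<omega> * f' \<omega>)" if "AE \<omega> in M. \<bar>f \<omega>\<bar> \<le> C" "AE \<omega> in M. \<bar>f' \<omega>\<bar> \<le> C'"
    "f \<in> borel_measurable M" "f' \<in> borel_measurable M" for f f' :: "'w \<Rightarrow> real" and C C'
  proof (rule integrable_bound_AE[of _ "C * C'"])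
    show "AE \<omega> in M. \<bar>f \<omega> * f' \<omega>\<bar> \<le> C * C'"
      using that(1,2) by eventually_elim (auto simp: abs_mult intro: mult_mono)
  qed (use that in simp)
  have i: "integrable M (\<lambda>\<omega>. (x \<omega>)\<^sup>2)" "integrable M (\<lambda>\<omega>. x \<omega> * y \<omega>)" "integrable M (\<lambda>\<omega>. (y \<omega>)\<^sup>2)"
    "integrable M (\<lambda>\<omega>. \<theta> \<omega> * x \<omega>)" "integrable M (\<lambda>\<omega>. \<theta> \<omega> * g \<omega>)" "integrable M (\<lambda>\<omega>. (\<theta> \<omega>)\<^sup>2)"
    unfolding power2_eq_square
    by (rule prod[OF xb xb] prod[OF xb yb] prod[OF yb yb] prod[OF \<theta>b xb] prod[OF \<theta>b gb] prod[OF \<theta>b \<theta>b]; simp)+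
  have ix: "integrable M x" "integrable M y" "integrable M g"
    by (rule integrable_bound_AE[OF _ xb] integrable_bound_AE[OF _ yb] integrable_bound_AE[OF _ gb]; simp)+
  have "(\<integral>\<omega>. (v \<bullet> \<Theta> t \<omega>)\<^sup>2 - (v \<bullet> \<Theta> s \<omega>)\<^sup>2 \<partial>M) =
     (\<integral>\<omega>. (x \<omega>)\<^sup>2 - 2 * (x \<omega> * y \<omega>) + (y \<omega>)\<^sup>2 + 2 * (\<theta> \<omega> * x \<omega>) - 2 * (\<theta> \<omega> * g \<omega>) - 2 * c * h * (\<theta> \<omega>)\<^sup>2 \<partial>M)"
  proof (rule Bochner_Integration.integral_cong[OF refl])
    fix \<omega>
    have e: "v \<bullet> \<Theta> t \<omega> = \<theta> \<omega> + x \<omega> - y \<omega>" by (simp add: y_def \<theta>_def inner_diff_right)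
    show "(v \<bullet> \<Theta> t \<omega>)\<^sup>2 - (v \<bullet> \<Theta> s \<omega>)\<^sup>2 = (x \<omega>)\<^sup>2 - 2 * (x \<omega> * y \<omega>) + (y \<omega>)\<^sup>2 + 2 * (\<theta> \<omega> * x \<omega>) - 2 * (\<theta> \<omega> * g \<omega>) - 2 * c * h * (\<theta> \<omega>)\<^sup>2"
      unfolding e \<theta>_def[symmetric] g_def by (simp add: power2_eq_square algebra_simps)
  qed
  also have "\<dots> = (\<integral>\<omega>. (x \<omega>)\<^sup>2 \<partial>M) - 2 * (\<integral>\<omega>. x \<omega> * y \<omega> \<partial>M) + (\<integral>\<omega>. (y \<omega>)\<^sup>2 \<partial>M) + 2 * (\<integral>\<omega>. \<theta> \<omega> * x \<omega> \<partial>M)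
     - 2 * (\<integral>\<omega>. \<theta> \<omega> * g \<omega> \<partial>M) - 2 * c * h * (\<integral>\<omega>. (\<theta> \<omega>)\<^sup>2 \<partial>M)"
    using i by simp
  also have "(\<integral>\<omega>. \<theta> \<omega> * x \<omega> \<partial>M) = 0"
    unfolding \<theta>_def x_def s_def t_def by (rule increment_moments(4)) simp
  also have "(\<integral>\<omega>. (\<theta> \<omega>)\<^sup>2 \<partial>M) = msq v s" by (simp add: msq_def \<theta>_def)
  also have "(\<integral>\<omega>. (v \<bullet> \<Theta> t \<omega>)\<^sup>2 - (v \<bullet> \<Theta> s \<omega>)\<^sup>2 \<partial>M) = msq v t - msq v s"
    using integrable_msq st by (simp add: msq_def)
  finally have eq: "msq v t - msq v s = (\<integral>\<omega>. (x \<omega>)\<^sup>2 \<partial>M) - 2 * (\<integral>\<omega>. x \<omega> * y \<omega> \<partial>M) + (\<integral>\<omega>. (y \<omega>)\<^sup>2 \<partial>M)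
     - 2 * (\<integral>\<omega>. \<theta> \<omega> * g \<omega> \<partial>M) - 2 * c * h * msq v s" by simp
  have n: "real CARD('n) = 1 + 2 * c" unfolding c_def by (simp add: field_simps)
  have eq': "msq v t - msq v s - h * ((norm v)\<^sup>2 - real CARD('n) * msq v s) =
     ((\<integral>\<omega>. (x \<omega>)\<^sup>2 \<partial>M) - h * ((norm v)\<^sup>2 - msq v s)) - 2 * (\<integral>\<omega>. x \<omega> * y \<omega> \<partial>M) + (\<integral>\<omega>. (y \<omega>)\<^sup>2 \<partial>M)
     - 2 * (\<integral>\<omega>. \<theta> \<omega> * g \<omega> \<partial>M)"
    unfolding eq n by (simp add: algebra_simps)
  have b1: "\<bar>(\<integral>\<omega>. (x \<omega>)\<^sup>2 \<partial>M) - h * ((norm v)\<^sup>2 - msq v s)\<bar> \<le> 2 * norm v * L v * (h * sqrt h)"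
    unfolding x_def s_def t_def by (rule variance_increment_cell[OF h])
  have ptb: "\<bar>\<integral>\<omega>. f \<omega> * f' \<omega> \<partial>M\<bar> \<le> C * (\<integral>\<omega>. \<bar>f \<omega>\<bar> \<partial>M)"
    if "integrable M (\<lambda>\<omega>. f \<omega> * f' \<omega>)" "integrable M f" "AE \<omega> in M. \<bar>f' \<omega>\<bar> \<le> C" for f f' :: "'w \<Rightarrow> real" and C
  proof -
    have "\<bar>\<integral>\<omega>. f \<omega> * f' \<omega> \<partial>M\<bar> \<le> (\<integral>\<omega>. \<bar>f \<omega> * f' \<omega>\<bar> \<partial>M)" by (rule integral_abs_bound)
    also have "\<dots> \<le> (\<integral>\<omega>. C * \<bar>f \<omega>\<bar> \<partial>M)"
    proof (rule integral_mono_AE)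
      show "AE \<omega> in M. \<bar>f \<omega> * f' \<omega>\<bar> \<le> C * \<bar>f \<omega>\<bar>"
        using that(3) by eventually_elim (simp add: abs_mult mult.commute mult_right_mono)
    qed (use that in auto)
    finally show ?thesis by simp
  qed
  have ex: "(\<integral>\<omega>. \<bar>x \<omega>\<bar> \<partial>M) \<le> L v * sqrt h"
    unfolding x_def s_def t_def
    by (rule expectation_abs_increment_I(2)) (use st h01 in \<open>auto simp: s_def t_def\<close>)
  have b2: "\<bar>\<integral>\<omega>. x \<omega> * y \<omega> \<partial>M\<bar> \<le> c * norm v * L v * (h * sqrt h)"
  proof -
    have "\<bar>\<integral>\<omega>. x \<omega> * y \<omega> \<partial>M\<bar> \<le> c * norm v * h * (\<integral>\<omega>. \<bar>x \<omega>\<bar> \<partial>M)"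
      by (rule ptb[OF i(2) ix(1) yb])
    also have "\<dots> \<le> c * norm v * h * (L v * sqrt h)"
      using ex c_nonneg h01 by (intro mult_left_mono) auto
    finally show ?thesis by (simp add: mult_ac)
  qed
  have b3: "\<bar>\<integral>\<omega>. (y \<omega>)\<^sup>2 \<partial>M\<bar> \<le> (c * norm v)\<^sup>2 * (h * sqrt h)"
  proof -
    have "\<bar>\<integral>\<omega>. y \<omega> * y \<omega> \<partial>M\<bar> \<le> c * norm v * h * (\<integral>\<omega>. \<bar>y \<omega>\<bar> \<partial>M)"
      by (rule ptb[OF i(3)[unfolded power2_eq_square] ix(2) yb])
    also have "\<dots> \<le> c * norm v * h * (c * norm v * h)"
    proof (rule mult_left_mono)
      have "(\<integral>\<omega>. \<bar>y \<omega>\<bar> \<partial>M) \<le> (\<integral>\<omega>. c * norm v * h \<partial>M)"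
        by (rule integral_mono_AE) (use ix yb in auto)
      then show "(\<integral>\<omega>. \<bar>y \<omega>\<bar> \<partial>M) \<le> c * norm v * h" by (simp add: prob_space)
    qed (use c_nonneg h01 in auto)
    finally have "\<bar>\<integral>\<omega>. (y \<omega>)\<^sup>2 \<partial>M\<bar> \<le> (c * norm v)\<^sup>2 * (h * h)"
      by (simp add: power2_eq_square mult_ac)
    also have "\<dots> \<le> (c * norm v)\<^sup>2 * (h * sqrt h)"
    proof (intro mult_left_mono)
      show "h \<le> sqrt h" using h01 by (simp add: real_le_rsqrt power2_eq_square mult_left_le)
    qed (use h01 in auto)
    finally show ?thesis .
  qed
  have eg: "(\<integral>\<omega>. \<bar>g \<omega>\<bar> \<partial>M) \<le> c * L v * (h * sqrt h)"
    unfolding g_def y_def x_def \<theta>_def s_def t_def by (rule msq_drift_step[OF h])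
  have b4: "\<bar>\<integral>\<omega>. \<theta> \<omega> * g \<omega> \<partial>M\<bar> \<le> norm v * (c * L v) * (h * sqrt h)"
  proof -
    have "\<bar>\<integral>\<omega>. g \<omega> * \<theta> \<omega> \<partial>M\<bar> \<le> norm v * (\<integral>\<omega>. \<bar>g \<omega>\<bar> \<partial>M)"
      by (rule ptb[OF _ ix(3) \<theta>b]) (use i(5) in \<open>simp add: mult.commute\<close>)
    also have "\<dots> \<le> norm v * (c * L v * (h * sqrt h))" using eg by (intro mult_left_mono) auto
    finally show ?thesis by (simp add: mult_ac)
  qed
  show ?thesis
    unfolding eq' drift_const_def using b1 b2 b3 b4 by (simp only: distrib_right)
qed

text \<open>By Taylor the exact solution obeys the same recursion with an error of order
  \<open>h^2\<close>, weakened to \<open>h * sqrt h\<close> to match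
  \<open>msq_step\<close>.\<close>

lemma second_moment_step:
  assumes "t \<ge> 0" "h \<ge> 0" "h \<le> 1"
  shows "\<bar>second_moment \<Theta>0 v (t + h) - second_moment \<Theta>0 v t - h * ((norm v)\<^sup>2 - real CARD('n) * second_moment \<Theta>0 v t)\<bar>
    \<le> \<bar>(v \<bullet> \<Theta>0)\<^sup>2 - (norm v)\<^sup>2 / real CARD('n)\<bar> * (real CARD('n))\<^sup>2 * (h * sqrt h)"
proof -
  define n where "n = real CARD('n)"
  have n: "n > 0" by (simp add: n_def)
  define A where "A = (v \<bullet> \<Theta>0)\<^sup>2 - (norm v)\<^sup>2 / n"
  have "second_moment \<Theta>0 v (t + h) - second_moment \<Theta>0 v t - h * ((norm v)\<^sup>2 - n * second_moment \<Theta>0 v t)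
     = A * exp (- n * t) * (exp (- (n * h)) - 1 + n * h)"
    unfolding second_moment_def n_def[symmetric] A_def[symmetric]
    using n by (simp add: field_simps exp_add[symmetric])
  also have "\<bar>\<dots>\<bar> \<le> \<bar>A\<bar> * 1 * (n * h)\<^sup>2"
    unfolding abs_mult
    by (intro mult_mono exp_minus_quadratic_bound) (use n assms in auto)
  also have "\<dots> \<le> \<bar>A\<bar> * n\<^sup>2 * (h * sqrt h)"
  proof -
    have "h \<le> sqrt h" using assms by (simp add: real_le_rsqrt power2_eq_square mult_left_le)
    then have "h * h \<le> h * sqrt h" using assms by (intro mult_left_mono) auto
    then have "\<bar>A\<bar> * n\<^sup>2 * (h * h) \<le> \<bar>A\<bar> * n\<^sup>2 * (h * sqrt h)"
      by (rule mult_left_mono) simp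
    then show ?thesis
      by (simp add: power2_eq_square mult_ac)
  qed
  finally show ?thesis unfolding n_def A_def .
qed

lemma \<Theta>_0: "AE \<omega> in M. \<Theta> 0 \<omega> = \<Theta>0"
  using AE_sde BI.I_0 by eventually_elim (auto dest: spec[of _ 0])

lemma msq_0: "msq v 0 = second_moment \<Theta>0 v 0"
proof -
  have "msq v 0 = (\<integral>\<omega>. (v \<bullet> \<Theta>0)\<^sup>2 \<partial>M)"
    unfolding msq_def by (rule integral_cong_AE) (use \<Theta>_0 in \<open>auto elim: eventually_mono\<close>)
  then show ?thesis by (simp add: second_moment_def prob_space)
qed

text \<open>Both sides satisfy the same linear recursion up to \<open>O(h * sqrt h)\<close> and
  start from the same value. The time being fixed, it can be reached on ever finer grids, and the
  accumulated error \<open>O(sqrt h)\<close> tends to 0.\<close>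

lemma msq_eq: "msq v (grid j a) = second_moment \<Theta>0 v (grid j a)"
proof -
  define n where "n = real CARD('n)"
  have n: "n > 0" by (simp add: n_def)
  define C where "C = drift_const v + \<bar>(v \<bullet> \<Theta>0)\<^sup>2 - (norm v)\<^sup>2 / real CARD('n)\<bar> * (real CARD('n))\<^sup>2"
  define D where "D t = msq v t - second_moment \<Theta>0 v t" for t
  \<comment> \<open>\<open>n * h \<le> 1\<close> puts the factor \<open>1 - n * h\<close> between 0
    and 1, so that the one-step errors merely add up.\<close>
  have step: "\<bar>D (grid J i)\<bar> \<le> real i * (C * (1 / 2 ^ J * sqrt (1 / 2 ^ J)))" if J: "n \<le> 2 ^ J" for J i
  proof (induction i)
    case 0
    show ?case by (simp add: D_def msq_0)
  next
    case (Suc i)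
    define h where "h = 1 / (2::real) ^ J"
    have h: "0 \<le> h" "h \<le> 1" "n * h \<le> 1" using J by (auto simp: h_def)
    have g: "grid J (Suc i) = grid J i + h" using grid_Suc_diff[of J i] by (simp add: h_def)
    define e1 where "e1 = msq v (grid J (Suc i)) - msq v (grid J i) - h * ((norm v)\<^sup>2 - n * msq v (grid J i))"
    define e2 where "e2 = second_moment \<Theta>0 v (grid J i + h) - second_moment \<Theta>0 v (grid J i) - h * ((norm v)\<^sup>2 - n * second_moment \<Theta>0 v (grid J i))"
    have "\<bar>e1\<bar> \<le> drift_const v * (h * sqrt h)"
      unfolding e1_def n_def by (rule msq_step) (simp add: h_def)
    moreover have "\<bar>e2\<bar> \<le> \<bar>(v \<bullet> \<Theta>0)\<^sup>2 - (norm v)\<^sup>2 / real CARD('n)\<bar> * (real CARD('n))\<^sup>2 * (h * sqrt h)"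
      unfolding e2_def n_def by (rule second_moment_step) (use h in auto)
    ultimately have e: "\<bar>e1\<bar> + \<bar>e2\<bar> \<le> C * (h * sqrt h)" by (simp add: C_def distrib_right)
    have "D (grid J (Suc i)) = (1 - n * h) * D (grid J i) + e1 - e2"
      unfolding D_def e1_def e2_def g by (simp add: algebra_simps)
    then have "\<bar>D (grid J (Suc i))\<bar> \<le> \<bar>1 - n * h\<bar> * \<bar>D (grid J i)\<bar> + C * (h * sqrt h)"
      using e abs_mult[of "1 - n * h" "D (grid J i)"] by linarith
    also have "\<bar>1 - n * h\<bar> * \<bar>D (grid J i)\<bar> \<le> 1 * \<bar>D (grid J i)\<bar>"
      using h n by (intro mult_right_mono) (auto simp: abs_le_iff)
    finally show ?case using Suc by (simp add: h_def algebra_simps add_divide_distrib)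
  qed
  obtain k0 :: nat where k0: "n \<le> 2 ^ k0" using real_arch_pow[of 2 n] by (auto intro: less_imp_le)
  have bound: "\<bar>D (grid j a)\<bar> \<le> grid j a * C * sqrt ((1/2) ^ k)" if k: "k \<ge> k0" for k
  proof -
    have "(2::real) ^ k0 \<le> 2 ^ (j + k)" using k by (intro power_increasing) auto
    then have "n \<le> 2 ^ (j + k)" using k0 by linarith
    from step[OF this, of "a * 2 ^ k"]
    have "\<bar>D (grid j a)\<bar> \<le> real (a * 2 ^ k) * (C * (1 / 2 ^ (j + k) * sqrt (1 / 2 ^ (j + k))))"
      using grid_refine[of j "j + k" a] by simp
    also have "\<dots> = grid j a * C * sqrt (1 / 2 ^ (j + k))"
      by (simp add: grid_def power_add field_simps)
    also have "\<dots> \<le> grid j a * C * sqrt ((1/2) ^ k)"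
    proof (intro mult_left_mono)
      have "(1::real) * 2 ^ k \<le> 2 ^ j * 2 ^ k" by (rule mult_right_mono) auto
      then have "1 / (2::real) ^ (j + k) \<le> 1 / 2 ^ k"
        by (intro divide_left_mono) (auto simp: power_add)
      then show "sqrt (1 / 2 ^ (j + k)) \<le> sqrt ((1/2::real) ^ k)" by (simp add: power_divide)
      show "0 \<le> grid j a * C"
        using c_nonneg L_nonneg by (simp add: C_def drift_const_def)
    qed
    finally show ?thesis .
  qed
  have "(\<lambda>k. grid j a * C * sqrt ((1/2) ^ k)) \<longlonglongrightarrow> grid j a * C * sqrt 0"
    by (intro tendsto_intros LIMSEQ_power_zero) simp
  then have "\<bar>D (grid j a)\<bar> \<le> grid j a * C * sqrt 0"
    by (rule LIMSEQ_le_const) (use bound in blast)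
  then show ?thesis by (simp add: D_def)
qed

end

section \<open>The space of paths\<close>

lemma space_path_borel: "space path_borel = path_space"
  unfolding path_borel_def by (rule space_measure_of) (auto simp: openin_path_topology)

lemma open_sets_path_borel: "openin path_topology U \<Longrightarrow> U \<in> sets path_borel"
  unfolding path_borel_def by (subst sets_measure_of) (auto simp: openin_path_topology)

lemma continuous_map_measurable_path_borel:
  assumes "continuous_map path_topology euclideanreal \<phi>"
  shows "\<phi> \<in> borel_measurable path_borel"
proof (rule borel_measurableI)
  fix S :: "real set" assume "open S"
  then have "openin path_topology {f \<in> topspace path_topology. \<phi> f \<in> S}"
    using assms by (simp add: continuous_map)
  then show "\<phi> -` S \<inter> space path_borel \<in> sets path_borel"
    by (intro open_sets_path_borel) (simp add: topspace_path_topology space_path_borel vimage_def Int_def conj_commute)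
qed

lemma eval_measurable:
  assumes "t \<ge> 0"
  shows "(\<lambda>f :: real \<Rightarrow> 'e::metric_space. f t) \<in> borel_measurable path_borel"
proof (rule borel_measurableI)
  fix S :: "'e set" assume S: "open S"
  have "openin path_topology {f \<in> path_space. f t \<in> S}"
    unfolding openin_path_topology
  proof (intro conjI ballI)
    fix f assume f: "f \<in> {f \<in> path_space. f t \<in> S}"
    then obtain e where e: "e > 0" "\<And>y. dist y (f t) < e \<Longrightarrow> y \<in> S" using S by (auto simp: open_dist)
    show "\<exists>T\<ge>0. \<exists>\<epsilon>>0. \<forall>g\<in>path_space. (\<forall>t\<in>{0..T}. dist (g t) (f t) < \<epsilon>) \<longrightarrow> g \<in> {f \<in> path_space. f t \<in> S}"
      using e assms by (intro exI[of _ t] conjI exI[of _ e]) auto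
  qed auto
  moreover have "(\<lambda>f :: real \<Rightarrow> 'e. f t) -` S \<inter> space path_borel = {f \<in> path_space. f t \<in> S}"
    by (auto simp: space_path_borel)
  ultimately show "(\<lambda>f :: real \<Rightarrow> 'e. f t) -` S \<inter> space path_borel \<in> sets path_borel"
    using open_sets_path_borel by simp
qed

text \<open>A sum of tent functions at the grid points: linear interpolation up to
  \<open>grid m p\<close>, then a descent to 0 within one cell. As a finite sum with fixed
  coefficient functions it is visibly continuous in \<open>t\<close> and measurable in the
  values.\<close>

definition interp :: "nat \<Rightarrow> nat \<Rightarrow> (nat \<Rightarrow> 'e::real_normed_vector) \<Rightarrow> real \<Rightarrow> 'e" where
  "interp m p a t = (\<Sum>i\<le>p. max 0 (1 - \<bar>2 ^ m * t - real i\<bar>) *\<^sub>R a i)"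

lemma continuous_on_interp: "continuous_on S (interp m p a)"
  unfolding interp_def[abs_def] by (intro continuous_intros)

lemma interp_cell:
  assumes i: "i < p" and t: "grid m i \<le> t" "t \<le> grid m (Suc i)"
  obtains \<theta> where "0 \<le> \<theta>" "\<theta> \<le> 1" "interp m p a t = (1 - \<theta>) *\<^sub>R a i + \<theta> *\<^sub>R a (Suc i)"
proof
  define \<theta> where "\<theta> = 2 ^ m * t - real i"
  have x: "real i \<le> 2 ^ m * t" "2 ^ m * t \<le> real i + 1"
    using t by (simp_all add: grid_def field_simps)
  then show "0 \<le> \<theta>" "\<theta> \<le> 1" by (simp_all add: \<theta>_def)
  have z: "max 0 (1 - \<bar>2 ^ m * t - real l\<bar>) = 0" if "l \<noteq> i" "l \<noteq> Suc i" for l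
  proof -
    have "l < i \<or> Suc i < l" using that by auto
    then have "real l + 1 \<le> real i \<or> real i + 2 \<le> real l" by auto
    then show ?thesis using x by auto
  qed
  have "interp m p a t = (\<Sum>l\<in>{i, Suc i}. max 0 (1 - \<bar>2 ^ m * t - real l\<bar>) *\<^sub>R a l)"
    unfolding interp_def by (rule sum.mono_neutral_right) (use i z in auto)
  also have "\<dots> = max 0 (1 - \<bar>2 ^ m * t - real i\<bar>) *\<^sub>R a i + max 0 (1 - \<bar>2 ^ m * t - real (Suc i)\<bar>) *\<^sub>R a (Suc i)"
    by simp
  also have "max 0 (1 - \<bar>2 ^ m * t - real i\<bar>) = 1 - \<theta>" using x by (auto simp: \<theta>_def)
  also have "max 0 (1 - \<bar>2 ^ m * t - real (Suc i)\<bar>) = \<theta>" using x by (auto simp: \<theta>_def)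
  finally show "interp m p a t = (1 - \<theta>) *\<^sub>R a i + \<theta> *\<^sub>R a (Suc i)" .
qed

lemma interp_close:
  assumes i: "i < p" and t: "grid m i \<le> t" "t \<le> grid m (Suc i)"
    and a: "norm (a i - z) \<le> \<delta>" "norm (a (Suc i) - z) \<le> \<delta>"
  shows "norm (interp m p a t - z) \<le> \<delta>"
proof -
  obtain \<theta> where \<theta>: "0 \<le> \<theta>" "\<theta> \<le> 1" "interp m p a t = (1 - \<theta>) *\<^sub>R a i + \<theta> *\<^sub>R a (Suc i)"
    using interp_cell[OF i t] by blast
  have "interp m p a t - z = (1 - \<theta>) *\<^sub>R (a i - z) + \<theta> *\<^sub>R (a (Suc i) - z)"
    unfolding \<theta>(3) by (simp add: algebra_simps)
  also have "norm \<dots> \<le> (1 - \<theta>) * \<delta> + \<theta> * \<delta>"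
    using \<theta> a by (intro order_trans[OF norm_triangle_ineq] add_mono) (auto intro: mult_left_mono)
  finally show ?thesis by (simp add: algebra_simps)
qed

lemma grid_cell_closed:
  assumes "0 \<le> t" "t \<le> grid m p" "0 < p"
  obtains i where "i < p" "grid m i \<le> t" "t \<le> grid m (Suc i)"
proof (cases "t = 0")
  case True
  then show ?thesis using that[of 0] assms(3) by simp
next
  case False
  then obtain i where i: "grid m i < t" "t \<le> grid m (Suc i)" using grid_cell[of t m] assms by auto
  then have "grid m i < grid m p" using assms by linarith
  then show ?thesis using that[of i] i by simp
qed

section \<open>Trajectories as random elements of the path space\<close>

lemma trajectory_in_path_space:
  assumes "continuous_process M X" "\<omega> \<in> space M"
  shows "trajectory X \<omega> \<in> path_space"
proof -
  have "continuous_on {0..} (trajectory X \<omega>)"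
    using assms by (subst continuous_on_cong[of _ _ _ "\<lambda>t. X t \<omega>"]) (auto simp: trajectory_def continuous_process_def)
  then show ?thesis by (simp add: path_space_def trajectory_def)
qed

text \<open>\<open>path_borel\<close> is generated by the open sets, not by evaluations, and the
  link is separability: every open set is a countable union of closed tubes around interpolations
  with values in a countable dense set, and whether a continuous path stays in a tube is decided at
  countably many times.\<close>

lemma trajectory_measurable:
  fixes X :: "real \<Rightarrow> 'w \<Rightarrow> 'e::euclidean_space"
  assumes X: "continuous_process M X"
  shows "trajectory X \<in> measurable M path_borel"
  unfolding path_borel_def
proof (rule measurable_measure_of)
  show "{U. openin path_topology U} \<subseteq> Pow path_space" by (auto simp: openin_path_topology)
  show "trajectory X \<in> space M \<rightarrow> path_space" using trajectory_in_path_space[OF X] by blast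
  fix U :: "(real \<Rightarrow> 'e) set" assume "U \<in> {U. openin path_topology U}"
  then have U: "openin path_topology U" by simp
  obtain D :: "'e set" where D: "countable D" "\<And>S. open S \<Longrightarrow> S \<noteq> {} \<Longrightarrow> \<exists>d\<in>D. d \<in> S"
    using countable_dense_exists by blast
  define h where "h m q = interp m (length q - 1) (\<lambda>i. q ! i)" for m :: nat and q :: "'e list"
  \<comment> \<open>The weak inequality makes the complement of a tube an event of
    \<open>measurable_exceeds\<close>.\<close>
  define P where "P = (\<lambda>(T::nat, k::nat, m, q). {g \<in> path_space. \<forall>t\<in>{0..real T}. norm (g t - h m q t) \<le> 1 / real (Suc k)})"
  define Q where "Q = {x \<in> UNIV \<times> UNIV \<times> UNIV \<times> lists D. P x \<subseteq> U}"
  have cQ: "countable Q" unfolding Q_def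
    by (rule countable_Collect) (use D(1) countable_lists in auto)
  have UQ: "U = (\<Union>x\<in>Q. P x)"
  proof (intro equalityI subsetI)
    fix f assume f: "f \<in> U"
    then have fp: "f \<in> path_space" using U by (auto simp: openin_path_topology)
    obtain T0 \<epsilon> where T0: "T0 \<ge> 0" "\<epsilon> > 0" "\<And>g. g \<in> path_space \<Longrightarrow> (\<forall>t\<in>{0..T0}. dist (g t) (f t) < \<epsilon>) \<Longrightarrow> g \<in> U"
      using U f unfolding openin_path_topology by metis
    obtain T :: nat where T: "T0 \<le> real T" "T > 0" using real_arch_simple[of "max T0 1"] by fastforce
    obtain k where k: "inverse (real (Suc k)) < \<epsilon> / 2" using reals_Archimedean[of "\<epsilon> / 2"] T0 by auto
    define \<delta> where "\<delta> = 1 / real (Suc k)"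
    \<comment> \<open>\<open>f\<close> and any other path of the tube are each within
      \<open>\<delta>\<close> of the interpolation, hence less than \<open>\<epsilon>\<close>
      apart.\<close>
    have \<delta>: "\<delta> > 0" "2 * \<delta> < \<epsilon>" using k by (simp_all add: \<delta>_def inverse_eq_divide field_simps)
    have "uniformly_continuous_on {0..real T} f"
      by (rule compact_uniformly_continuous)
        (use fp continuous_on_subset[of "{0..}" f "{0..real T}"] in \<open>auto simp: path_space_def\<close>)
    then obtain d where d: "d > 0" "\<And>s t. s \<in> {0..real T} \<Longrightarrow> t \<in> {0..real T} \<Longrightarrow> dist s t < d \<Longrightarrow> dist (f s) (f t) < \<delta> / 2"
      using \<delta> unfolding uniformly_continuous_on_def by (metis half_gt_zero)
    obtain m where m: "(1/2::real) ^ m < d" using real_arch_pow_inv[of d "1/2"] d(1) by auto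
    define p where "p = T * 2 ^ m"
    have gp: "grid m p = real T" by (simp add: grid_def p_def)
    have p0: "p > 0" using T by (simp add: p_def)
    have "\<exists>q. \<forall>i. q i \<in> D \<and> dist (q i) (f (grid m i)) < \<delta> / 2"
    proof -
      have "\<exists>y\<in>D. y \<in> ball (f (grid m i)) (\<delta> / 2)" for i
        by (rule D(2)) (use \<delta> in auto)
      then have "\<forall>i. \<exists>y. y \<in> D \<and> dist y (f (grid m i)) < \<delta> / 2" by (auto simp: dist_commute)
      then show ?thesis by (rule choice)
    qed
    then obtain q where q: "\<And>i. q i \<in> D" "\<And>i. dist (q i) (f (grid m i)) < \<delta> / 2" by blast
    define qs where "qs = map q [0..<Suc p]"
    have heq: "h m qs = interp m p q"
      unfolding h_def interp_def[abs_def] by (intro ext sum.cong) (auto simp: qs_def simp del: upt_Suc)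
    have close: "norm (f t - h m qs t) \<le> \<delta>" if t: "t \<in> {0..real T}" for t
    proof -
      obtain i where i: "i < p" "grid m i \<le> t" "t \<le> grid m (Suc i)"
        using grid_cell_closed[of t m p] t gp p0 by auto
      have le: "grid m (Suc i) \<le> real T" using i(1) by (subst gp[symmetric]) (simp add: Suc_le_eq)
      have n: "norm (q l - f t) \<le> \<delta>" if l: "l = i \<or> l = Suc i" for l
      proof -
        have "dist (grid m l) t < d" using i l grid_Suc_diff[of m i] m
          by (auto simp: dist_real_def power_divide)
        moreover have "grid m l \<in> {0..real T}" using l le i t by auto
        ultimately have "dist (f (grid m l)) (f t) < \<delta> / 2" using d(2) t by blast
        then have "dist (q l) (f t) < \<delta>" using dist_triangle_half_r q(2)
          by (metis dist_commute dist_triangle_half_l)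
        then show ?thesis by (simp add: dist_norm)
      qed
      have "norm (interp m p q t - f t) \<le> \<delta>"
        by (rule interp_close[OF i]) (use n in auto)
      then show ?thesis by (simp add: heq norm_minus_commute)
    qed
    have "P (T, k, m, qs) \<subseteq> U"
    proof
      fix g assume "g \<in> P (T, k, m, qs)"
      then have g: "g \<in> path_space" "\<And>t. t \<in> {0..real T} \<Longrightarrow> norm (g t - h m qs t) \<le> \<delta>"
        by (auto simp: P_def \<delta>_def)
      show "g \<in> U"
      proof (rule T0(3)[OF g(1)], rule ballI)
        fix t assume "t \<in> {0..T0}"
        then have t: "t \<in> {0..real T}" using T by auto
        have "norm (g t - f t) \<le> norm (g t - h m qs t) + norm (f t - h m qs t)"
          using norm_triangle_ineq4[of "g t - h m qs t" "f t - h m qs t"] by simp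
        then show "dist (g t) (f t) < \<epsilon>" using g(2)[OF t] close[OF t] \<delta> by (simp add: dist_norm)
      qed
    qed
    moreover have "f \<in> P (T, k, m, qs)" using fp close by (auto simp: P_def \<delta>_def)
    moreover have "qs \<in> lists D" using q(1) by (auto simp: qs_def)
    ultimately show "f \<in> (\<Union>x\<in>Q. P x)" unfolding Q_def by blast
  qed (auto simp: Q_def)
  have "trajectory X -` P x \<inter> space M \<in> sets M" for x
  proof -
    obtain T k m q where x: "x = (T, k, m, q)" by (cases x) auto
    have cp: "continuous_process M (\<lambda>t \<omega>. X t \<omega> - h m q t)"
      using X continuous_on_interp by (auto simp: continuous_process_def h_def intro!: continuous_on_diff borel_measurable_diff)
    have "trajectory X -` P x \<inter> space M = space M - {\<omega> \<in> space M. \<exists>t\<in>{0..real T}. norm (X t \<omega> - h m q t) > 1 / real (Suc k)}"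
      using trajectory_in_path_space[OF X] by (auto simp: x P_def trajectory_def not_less)
    then show ?thesis using measurable_exceeds[OF cp, of "{0..real T}"] by auto
  qed
  then have "(\<Union>x\<in>Q. trajectory X -` P x \<inter> space M) \<in> sets M"
    using cQ by (intro sets.countable_UN') auto
  moreover have "trajectory X -` U \<inter> space M = (\<Union>x\<in>Q. trajectory X -` P x \<inter> space M)"
    unfolding UQ by auto
  ultimately show "trajectory X -` U \<inter> space M \<in> sets M" by simp
qed

text \<open>This metric induces \<open>path_topology\<close>: the factor \<open>1 / (1 + t)\<close> discounts late times.\<close>

definition path_dist :: "(real \<Rightarrow> 'e::metric_space) \<Rightarrow> (real \<Rightarrow> 'e) \<Rightarrow> real" where
  "path_dist f g = (SUP t\<in>{0..}. min (dist (f t) (g t)) (1 / (1 + t)))"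

lemma path_dist_bdd: "bdd_above ((\<lambda>t. min (dist (f t) (g t)) (1 / (1 + t))) ` {0..})"
proof (rule bdd_aboveI2)
  fix t :: real assume "t \<in> {0..}"
  then have "1 / (1 + t) \<le> 1" by (simp add: divide_le_eq)
  then show "min (dist (f t) (g t)) (1 / (1 + t)) \<le> 1" by linarith
qed

lemma path_dist_upper: "t \<ge> 0 \<Longrightarrow> min (dist (f t) (g t)) (1 / (1 + t)) \<le> path_dist f g"
  unfolding path_dist_def by (rule cSUP_upper[OF _ path_dist_bdd]) simp

lemma path_dist_least: "(\<And>t. t \<ge> 0 \<Longrightarrow> min (dist (f t) (g t)) (1 / (1 + t)) \<le> c) \<Longrightarrow> path_dist f g \<le> c"
  unfolding path_dist_def by (rule cSUP_least) auto

lemma path_dist_nonneg: "path_dist f g \<ge> 0"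
proof -
  have "0 \<le> min (dist (f 0) (g 0)) (1 / (1 + 0))" by simp
  also have "\<dots> \<le> path_dist f g" by (rule path_dist_upper) simp
  finally show ?thesis .
qed

lemma path_dist_self: "path_dist f f = 0"
  by (rule antisym[OF path_dist_least path_dist_nonneg]) simp

lemma path_dist_commute: "path_dist f g = path_dist g f"
  unfolding path_dist_def by (simp add: dist_commute)

lemma path_dist_triangle: "path_dist f h \<le> path_dist f g + path_dist g h"
proof (rule path_dist_least)
  fix t :: real assume t: "t \<ge> 0"
  have "min (dist (f t) (h t)) (1 / (1 + t)) \<le> min (dist (f t) (g t)) (1 / (1 + t)) + min (dist (g t) (h t)) (1 / (1 + t))"
  proof -
    have "0 \<le> 1 / (1 + t)" using t by simp
    then show ?thesis
      using dist_triangle[of "f t" "h t" "g t"] zero_le_dist[of "f t" "g t"] zero_le_dist[of "g t" "h t"]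
      unfolding min_def by (smt (verit))
  qed
  then show "min (dist (f t) (h t)) (1 / (1 + t)) \<le> path_dist f g + path_dist g h"
    using path_dist_upper[OF t, of f g] path_dist_upper[OF t, of g h] by linarith
qed

lemma path_dist_le:
  assumes "T \<ge> 0" "\<And>t. t \<in> {0..T} \<Longrightarrow> dist (f t) (g t) \<le> \<delta>"
  shows "path_dist f g \<le> max \<delta> (1 / (1 + T))"
proof (rule path_dist_least)
  fix t :: real assume t: "t \<ge> 0"
  show "min (dist (f t) (g t)) (1 / (1 + t)) \<le> max \<delta> (1 / (1 + T))"
  proof (cases "t \<le> T")
    case True
    then show ?thesis using assms(2)[of t] t by auto
  next
    case False
    then have "1 / (1 + t) \<le> 1 / (1 + T)" using assms(1) by (intro divide_left_mono) auto
    then show ?thesis by linarith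
  qed
qed

text \<open>Below the cap \<open>1 / (1 + T)\<close> the minimum at a time up to \<open>T\<close> is
  the distance itself.\<close>

lemma dist_le_path_dist:
  assumes "path_dist f g < 1 / (1 + T)" "t \<in> {0..T}"
  shows "dist (f t) (g t) \<le> path_dist f g"
proof -
  have "1 / (1 + T) \<le> 1 / (1 + t)" using assms(2) by (intro divide_left_mono) auto
  then show ?thesis using path_dist_upper[of t f g] assms by auto
qed

section \<open>Continuous and Lipschitz functionals of paths\<close>

definition path_lipschitz :: "real \<Rightarrow> ((real \<Rightarrow> 'e::metric_space) \<Rightarrow> real) \<Rightarrow> bool" where
  "path_lipschitz \<Lambda> \<psi> \<longleftrightarrow> \<Lambda> \<ge> 0 \<and> (\<forall>f\<in>path_space. \<forall>g\<in>path_space. \<bar>\<psi> f - \<psi> g\<bar> \<le> \<Lambda> * path_dist f g)"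

lemma path_continuousI:
  assumes "\<And>f e. f \<in> path_space \<Longrightarrow> e > 0 \<Longrightarrow> \<exists>d>0. \<forall>g\<in>path_space. path_dist g f < d \<longrightarrow> \<bar>\<psi> g - \<psi> f\<bar> < e"
  shows "continuous_map path_topology euclideanreal \<psi>"
  unfolding continuous_map topspace_path_topology
proof (intro conjI allI impI)
  fix S :: "real set" assume "openin euclideanreal S"
  then have S: "open S" by simp
  show "openin path_topology {f \<in> path_space. \<psi> f \<in> S}"
    unfolding openin_path_topology
  proof (intro conjI ballI)
    fix f assume f: "f \<in> {f \<in> path_space. \<psi> f \<in> S}"
    then obtain e where e: "e > 0" "\<And>y. \<bar>y - \<psi> f\<bar> < e \<Longrightarrow> y \<in> S" using S by (auto simp: open_dist dist_real_def)
    obtain d where d: "d > 0" "\<And>g. g \<in> path_space \<Longrightarrow> path_dist g f < d \<Longrightarrow> \<bar>\<psi> g - \<psi> f\<bar> < e"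
      using assms[of f e] f e(1) by auto
    \<comment> \<open>\<open>1 / (1 + T) = d / (d + 2) < d\<close>: times after \<open>T\<close>
      cannot raise \<open>path_dist\<close> to \<open>d\<close>.\<close>
    define T where "T = 2 / d"
    have T: "T \<ge> 0" "1 / (1 + T) < d" using d(1) by (auto simp: T_def field_simps add_pos_pos)
    have "\<forall>g\<in>path_space. (\<forall>t\<in>{0..T}. dist (g t) (f t) < d / 2) \<longrightarrow> g \<in> {f \<in> path_space. \<psi> f \<in> S}"
    proof (intro ballI impI)
      fix g assume g: "g \<in> path_space" "\<forall>t\<in>{0..T}. dist (g t) (f t) < d / 2"
      have "path_dist g f \<le> max (d / 2) (1 / (1 + T))" by (rule path_dist_le[OF T(1)]) (use g in \<open>auto intro: less_imp_le\<close>)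
      also have "\<dots> < d" using T d(1) by simp
      finally show "g \<in> {f \<in> path_space. \<psi> f \<in> S}" using d(2) e(2) g by blast
    qed
    then show "\<exists>T\<ge>0. \<exists>\<epsilon>>0. \<forall>g\<in>path_space. (\<forall>t\<in>{0..T}. dist (g t) (f t) < \<epsilon>) \<longrightarrow> g \<in> {f \<in> path_space. \<psi> f \<in> S}"
      using T(1) d(1) by (meson half_gt_zero)
  qed auto
qed auto

lemma path_continuousD:
  assumes "continuous_map path_topology euclideanreal \<psi>" "f \<in> path_space" "e > 0"
  shows "\<exists>d>0. \<forall>g\<in>path_space. path_dist g f < d \<longrightarrow> \<bar>\<psi> g - \<psi> f\<bar> < e"
proof -
  define U where "U = {g \<in> path_space. \<psi> g \<in> ball (\<psi> f) e}"
  have "openin path_topology U"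
    using assms(1) unfolding continuous_map topspace_path_topology U_def by auto
  moreover have "f \<in> U" using assms by (simp add: U_def)
  ultimately have "\<exists>T\<ge>0. \<exists>d>0. \<forall>g\<in>path_space. (\<forall>t\<in>{0..T}. dist (g t) (f t) < d) \<longrightarrow> g \<in> U"
    unfolding openin_path_topology by blast
  then obtain T d where T: "T \<ge> 0" "d > 0"
    "\<And>g. g \<in> path_space \<Longrightarrow> (\<forall>t\<in>{0..T}. dist (g t) (f t) < d) \<Longrightarrow> g \<in> U" by blast
  have "\<bar>\<psi> g - \<psi> f\<bar> < e" if g: "g \<in> path_space" "path_dist g f < min d (1 / (1 + T))" for g
  proof -
    have "dist (g t) (f t) < d" if "t \<in> {0..T}" for t
      using dist_le_path_dist[of g f T t] g that by auto
    then have "g \<in> U" using T(3)[OF g(1)] by blast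
    then show ?thesis by (auto simp: U_def dist_real_def)
  qed
  moreover have "min d (1 / (1 + T)) > 0" using T by simp
  ultimately show ?thesis by blast
qed

lemma path_lipschitz_continuous:
  assumes "path_lipschitz \<Lambda> \<psi>"
  shows "continuous_map path_topology euclideanreal \<psi>"
proof (rule path_continuousI)
  fix f :: "real \<Rightarrow> 'a" and e :: real assume f: "f \<in> path_space" "e > 0"
  have L: "\<Lambda> \<ge> 0" using assms by (simp add: path_lipschitz_def)
  have "\<bar>\<psi> g - \<psi> f\<bar> < e" if g: "g \<in> path_space" "path_dist g f < e / (\<Lambda> + 1)" for g
  proof -
    have "\<bar>\<psi> g - \<psi> f\<bar> \<le> \<Lambda> * path_dist g f" using assms f g by (simp add: path_lipschitz_def)
    also have "\<dots> \<le> (\<Lambda> + 1) * path_dist g f" by (intro mult_right_mono path_dist_nonneg) simp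
    also have "\<dots> < e" using g(2) L by (simp add: field_simps)
    finally show ?thesis .
  qed
  moreover have "e / (\<Lambda> + 1) > 0" using f L by (simp add: add_nonneg_pos)
  ultimately show "\<exists>d>0. \<forall>g\<in>path_space. path_dist g f < d \<longrightarrow> \<bar>\<psi> g - \<psi> f\<bar> < e" by blast
qed

text \<open>Inf-convolution: these Lipschitz functions increase to \<open>\<phi>\<close> as \<open>j\<close> grows, so that testing convergence
  in law on bounded Lipschitz functions gives the lower bounds for \<open>\<phi>\<close> and \<open>- \<phi>\<close>.\<close>

definition lipschitz_regularization :: "((real \<Rightarrow> 'e::metric_space) \<Rightarrow> real) \<Rightarrow> nat \<Rightarrow> (real \<Rightarrow> 'e) \<Rightarrow> real" where
  "lipschitz_regularization \<phi> j f = (INF g\<in>path_space. \<phi> g + real j * path_dist f g)"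

context
  fixes \<phi> :: "(real \<Rightarrow> 'e::metric_space) \<Rightarrow> real" and C :: real
  assumes C: "\<And>f. f \<in> path_space \<Longrightarrow> \<bar>\<phi> f\<bar> \<le> C"
begin

lemma regularization_bdd: "bdd_below ((\<lambda>g. \<phi> g + real j * path_dist f g) ` path_space)"
proof (rule bdd_belowI2)
  fix g :: "real \<Rightarrow> 'e" assume "g \<in> path_space"
  then show "- C \<le> \<phi> g + real j * path_dist f g"
    using C[of g] path_dist_nonneg[of f g] by (simp add: abs_le_iff add_increasing2)
qed

lemma regularization_lower: "g \<in> path_space \<Longrightarrow> lipschitz_regularization \<phi> j f \<le> \<phi> g + real j * path_dist f g"
  unfolding lipschitz_regularization_def by (rule cINF_lower[OF regularization_bdd])

lemma regularization_greatest:
  assumes "f \<in> path_space" "\<And>g. g \<in> path_space \<Longrightarrow> c \<le> \<phi> g + real j * path_dist f g"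
  shows "c \<le> lipschitz_regularization \<phi> j f"
  unfolding lipschitz_regularization_def using assms by (intro cINF_greatest) auto

lemma regularization_le: "f \<in> path_space \<Longrightarrow> lipschitz_regularization \<phi> j f \<le> \<phi> f"
  using regularization_lower[of f j f] by (simp add: path_dist_self)

lemma regularization_bound: "f \<in> path_space \<Longrightarrow> \<bar>lipschitz_regularization \<phi> j f\<bar> \<le> C"
proof -
  assume f: "f \<in> path_space"
  have "- C \<le> lipschitz_regularization \<phi> j f"
  proof (rule regularization_greatest[OF f])
    fix g :: "real \<Rightarrow> 'e" assume "g \<in> path_space"
    then show "- C \<le> \<phi> g + real j * path_dist f g"
      using C[of g] path_dist_nonneg[of f g] by (simp add: abs_le_iff add_increasing2)
  qed
  then show ?thesis using regularization_le[OF f, of j] C[OF f] by auto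
qed

lemma regularization_lipschitz: "path_lipschitz (real j) (lipschitz_regularization \<phi> j)"
proof -
  have "lipschitz_regularization \<phi> j f - real j * path_dist f f' \<le> lipschitz_regularization \<phi> j f'"
    if f: "f \<in> path_space" "f' \<in> path_space" for f f'
  proof (rule regularization_greatest[OF f(2)])
    fix g :: "real \<Rightarrow> 'e" assume g: "g \<in> path_space"
    have "real j * path_dist f g \<le> real j * (path_dist f f' + path_dist f' g)"
      by (intro mult_left_mono path_dist_triangle) simp
    then show "lipschitz_regularization \<phi> j f - real j * path_dist f f' \<le> \<phi> g + real j * path_dist f' g"
      using regularization_lower[OF g, of j f] by (simp add: algebra_simps)
  qed
  then have "\<bar>lipschitz_regularization \<phi> j f - lipschitz_regularization \<phi> j f'\<bar> \<le> real j * path_dist f f'"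
    if f: "f \<in> path_space" "f' \<in> path_space" for f f'
    using f by (simp add: abs_le_iff) (smt (verit) path_dist_commute)
  then show ?thesis by (simp add: path_lipschitz_def)
qed

lemma regularization_tendsto:
  assumes cont: "continuous_map path_topology euclideanreal \<phi>" and f: "f \<in> path_space"
  shows "(\<lambda>j. lipschitz_regularization \<phi> j f) \<longlonglongrightarrow> \<phi> f"
proof (rule LIMSEQ_I)
  fix e :: real assume e: "e > 0"
  obtain d where d: "d > 0" "\<And>g. g \<in> path_space \<Longrightarrow> path_dist g f < d \<Longrightarrow> \<bar>\<phi> g - \<phi> f\<bar> < e / 2"
    using path_continuousD[OF cont f, of "e / 2"] e by auto
  \<comment> \<open>Beyond distance \<open>d\<close> the penalty is at least \<open>2 * C\<close>,
    which no oscillation of \<open>\<phi>\<close> can offset; nearer paths are handled by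
    continuity.\<close>
  obtain j0 :: nat where j0: "2 * C / d \<le> real j0" using real_arch_simple by blast
  have "norm (lipschitz_regularization \<phi> j f - \<phi> f) < e" if j: "j \<ge> j0" for j
  proof -
    have "\<phi> f - e / 2 \<le> lipschitz_regularization \<phi> j f"
    proof (rule regularization_greatest[OF f])
      fix g :: "real \<Rightarrow> 'e" assume g: "g \<in> path_space"
      show "\<phi> f - e / 2 \<le> \<phi> g + real j * path_dist f g"
      proof (cases "path_dist g f < d")
        case True
        then show ?thesis using d(2)[OF g True] path_dist_nonneg[of f g]
          by (smt (verit) mult_nonneg_nonneg of_nat_0_le_iff)
      next
        case False
        have "2 * C \<le> real j0 * d" using j0 d(1) by (simp add: field_simps)
        also have "\<dots> \<le> real j * path_dist f g"
          using False j d(1) path_dist_commute[of f g] by (intro mult_mono) auto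
        finally show ?thesis using C[OF f] C[OF g] e by (simp add: abs_le_iff)
      qed
    qed
    then show ?thesis using regularization_le[OF f, of j] e by auto
  qed
  then show "\<exists>no. \<forall>j\<ge>no. norm (lipschitz_regularization \<phi> j f - \<phi> f) < e" by blast
qed

end

text \<open>\<open>\<phi>\<close> dominates its regularizations under every \<open>\<mu> K\<close>,
  while their expectations have to approach that of \<open>\<phi>\<close> under the single law
  \<open>\<nu>\<close> only. This gives an estimate from one side, with one regularization serving
  all \<open>K\<close>.\<close>

lemma continuous_from_lipschitz_below:
  fixes \<mu> :: "nat \<Rightarrow> (real \<Rightarrow> 'e::metric_space) measure"
  assumes \<mu>: "\<And>K. prob_space (\<mu> K)" "\<And>K. sets (\<mu> K) = sets path_borel"
    and \<nu>: "prob_space \<nu>" "sets \<nu> = sets path_borel"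
    and lip: "\<forall>\<psi> \<Lambda> C. path_lipschitz \<Lambda> \<psi> \<longrightarrow> (\<forall>f\<in>path_space. \<bar>\<psi> f\<bar> \<le> C) \<longrightarrow>
       (\<lambda>K. \<integral>f. \<psi> f \<partial>\<mu> K) \<longlonglongrightarrow> (\<integral>f. \<psi> f \<partial>\<nu>)"
    and cont: "continuous_map path_topology euclideanreal \<phi>" and C: "\<And>f. f \<in> path_space \<Longrightarrow> \<bar>\<phi> f\<bar> \<le> C"
    and e: "e > 0"
  shows "\<forall>\<^sub>F K in sequentially. (\<integral>f. \<phi> f \<partial>\<nu>) - e < (\<integral>f. \<phi> f \<partial>\<mu> K)"
proof -
  let ?r = "lipschitz_regularization \<phi>"
  have sp: "space (\<mu> K) = path_space" "space \<nu> = path_space" for K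
    using sets_eq_imp_space_eq[OF \<mu>(2)] sets_eq_imp_space_eq[OF \<nu>(2)] by (simp_all add: space_path_borel)
  have pm: "\<phi> \<in> borel_measurable path_borel" by (rule continuous_map_measurable_path_borel[OF cont])
  have rm: "?r j \<in> borel_measurable path_borel" for j
    by (intro continuous_map_measurable_path_borel path_lipschitz_continuous[OF regularization_lipschitz[of \<phi> C, OF C]])
  have int: "integrable \<kappa> \<psi>" if "prob_space \<kappa>" "sets \<kappa> = sets path_borel" "\<psi> \<in> borel_measurable path_borel"
    "\<And>f. f \<in> path_space \<Longrightarrow> \<bar>\<psi> f\<bar> \<le> C" for \<kappa> and \<psi> :: "(real \<Rightarrow> 'e) \<Rightarrow> real"
  proof -
    interpret prob_space \<kappa> by fact
    have "space \<kappa> = path_space" using sets_eq_imp_space_eq[OF that(2)] by (simp add: space_path_borel)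
    then show ?thesis
      using that by (intro integrable_const_bound[of _ C] AE_I2) (auto simp: measurable_cong_sets[OF that(2) refl])
  qed
  have "(\<lambda>j. \<integral>f. ?r j f \<partial>\<nu>) \<longlonglongrightarrow> (\<integral>f. \<phi> f \<partial>\<nu>)"
  proof (rule integral_dominated_convergence[where w = "\<lambda>_. C"])
    interpret prob_space \<nu> by fact
    show "integrable \<nu> (\<lambda>_. C)" by simp
    show "\<phi> \<in> borel_measurable \<nu>" "?r j \<in> borel_measurable \<nu>" for j
      using pm rm by (simp_all add: measurable_cong_sets[OF \<nu>(2) refl])
    show "AE f in \<nu>. (\<lambda>j. ?r j f) \<longlonglongrightarrow> \<phi> f"
      by (rule AE_I2) (use regularization_tendsto[of \<phi> C, OF C cont] sp in auto)
    show "AE f in \<nu>. norm (?r j f) \<le> C" for j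
      by (rule AE_I2) (use regularization_bound[of \<phi> C, OF C] sp in auto)
  qed
  then have "\<forall>\<^sub>F j in sequentially. (\<integral>f. \<phi> f \<partial>\<nu>) - e / 2 < (\<integral>f. ?r j f \<partial>\<nu>)"
    using e by (intro order_tendstoD(1)) auto
  then obtain j where j: "(\<integral>f. \<phi> f \<partial>\<nu>) - e / 2 < (\<integral>f. ?r j f \<partial>\<nu>)"
    by (auto simp: eventually_sequentially)
  have "(\<lambda>K. \<integral>f. ?r j f \<partial>\<mu> K) \<longlonglongrightarrow> (\<integral>f. ?r j f \<partial>\<nu>)"
  proof (rule lip[rule_format])
    show "path_lipschitz (real j) (?r j)" by (rule regularization_lipschitz[of \<phi> C, OF C])
    show "\<bar>?r j f\<bar> \<le> C" if "f \<in> path_space" for f by (rule regularization_bound[of \<phi> C, OF C that])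
  qed
  then have "\<forall>\<^sub>F K in sequentially. (\<integral>f. ?r j f \<partial>\<nu>) - e / 2 < (\<integral>f. ?r j f \<partial>\<mu> K)"
    using e by (intro order_tendstoD(1)) auto
  then show ?thesis
  proof eventually_elim
    case (elim K)
    have "(\<integral>f. ?r j f \<partial>\<mu> K) \<le> (\<integral>f. \<phi> f \<partial>\<mu> K)"
      by (rule integral_mono[OF int int])
        (use \<mu> rm pm C regularization_bound[of \<phi> C, OF C] regularization_le[of \<phi> C, OF C] sp in auto)
    then show ?case using elim j by linarith
  qed
qed

lemma tendsto_of_lipschitz:
  fixes \<mu> :: "nat \<Rightarrow> (real \<Rightarrow> 'e::metric_space) measure"
  assumes \<mu>: "\<And>K. prob_space (\<mu> K)" "\<And>K. sets (\<mu> K) = sets path_borel"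
    and \<nu>: "prob_space \<nu>" "sets \<nu> = sets path_borel"
    and lip: "\<forall>\<psi> \<Lambda> C. path_lipschitz \<Lambda> \<psi> \<longrightarrow> (\<forall>f\<in>path_space. \<bar>\<psi> f\<bar> \<le> C) \<longrightarrow>
       (\<lambda>K. \<integral>f. \<psi> f \<partial>\<mu> K) \<longlonglongrightarrow> (\<integral>f. \<psi> f \<partial>\<nu>)"
    and cont: "continuous_map path_topology euclideanreal \<phi>" and C: "\<And>f. f \<in> path_space \<Longrightarrow> \<bar>\<phi> f\<bar> \<le> C"
  shows "(\<lambda>K. \<integral>f. \<phi> f \<partial>\<mu> K) \<longlonglongrightarrow> (\<integral>f. \<phi> f \<partial>\<nu>)"
proof (rule order_tendstoI)
  fix a assume "a < (\<integral>f. \<phi> f \<partial>\<nu>)"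
  then show "\<forall>\<^sub>F K in sequentially. a < (\<integral>f. \<phi> f \<partial>\<mu> K)"
    using continuous_from_lipschitz_below[OF \<mu> \<nu> lip cont C, where e = "(\<integral>f. \<phi> f \<partial>\<nu>) - a"] by simp
next
  fix a assume a: "(\<integral>f. \<phi> f \<partial>\<nu>) < a"
  have cont': "continuous_map path_topology euclideanreal (\<lambda>f. - \<phi> f)"
    using cont by (rule continuous_map_minus)
  have "\<forall>\<^sub>F K in sequentially. (\<integral>f. - \<phi> f \<partial>\<nu>) - (a - (\<integral>f. \<phi> f \<partial>\<nu>)) < (\<integral>f. - \<phi> f \<partial>\<mu> K)"
    by (rule continuous_from_lipschitz_below[OF \<mu> \<nu> lip cont', of C]) (use C a in auto)
  then show "\<forall>\<^sub>F K in sequentially. (\<integral>f. \<phi> f \<partial>\<mu> K) < a"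
    by eventually_elim simp
qed

section \<open>Multivariate Levy continuity theorem\<close>

text \<open>The triangle wave \<open>2 R / pi * arcsin (sin (pi / (2 R) * x))\<close> is the identity on \<open>[-R, R]\<close> and is bounded
  by \<open>R\<close>. A continuous function of triangle waves is a continuous function of sines, which range over a
  compact cube, so Stone-Weierstrass approximates it by trigonometric polynomials uniformly on the whole space.\<close>

inductive trig_poly :: "'i set \<Rightarrow> (('i \<Rightarrow> real) \<Rightarrow> complex) \<Rightarrow> bool" for F where
  trig_poly_exp: "trig_poly F (\<lambda>x. z * iexp (\<Sum>i\<in>F. u i * x i))"
| trig_poly_add: "trig_poly F f \<Longrightarrow> trig_poly F g \<Longrightarrow> trig_poly F (\<lambda>x. f x + g x)"

lemma trig_poly_const: "trig_poly F (\<lambda>_. z)"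
  using trig_poly_exp[of F z "\<lambda>_. 0"] by simp

lemma trig_poly_mult:
  assumes "trig_poly F f" "trig_poly F g"
  shows "trig_poly F (\<lambda>x. f x * g x)"
  using assms(1)
proof induction
  case (trig_poly_exp z u)
  show ?case using assms(2)
  proof induction
    case (trig_poly_exp z' u')
    have "(\<lambda>x. z * iexp (\<Sum>i\<in>F. u i * x i) * (z' * iexp (\<Sum>i\<in>F. u' i * x i))) =
       (\<lambda>x. (z * z') * iexp (\<Sum>i\<in>F. (u i + u' i) * x i))"
      by (simp add: fun_eq_iff distrib_right sum.distrib exp_add distrib_left)
    then show ?case using trig_poly.trig_poly_exp[of F "z * z'" "\<lambda>i. u i + u' i"] by simp
  next
    case (trig_poly_add f g)
    then show ?case using trig_poly.trig_poly_add by (fastforce simp: distrib_left)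
  qed
next
  case (trig_poly_add f g')
  then show ?case using trig_poly.trig_poly_add by (fastforce simp: distrib_right)
qed

lemma trig_poly_sin:
  assumes "finite F" "i \<in> F"
  shows "trig_poly F (\<lambda>x. of_real (sin (\<kappa> * x i)))"
proof -
  have s: "(\<Sum>l\<in>F. (if l = i then r else 0) * x l) = r * x i" for r :: real and x
    using assms by (simp add: if_distrib[of "\<lambda>z. z * _"] cong: if_cong)
  have "trig_poly F (\<lambda>x. (1 / (2 * \<i>)) * iexp (\<kappa> * x i) + (- 1 / (2 * \<i>)) * iexp (- \<kappa> * x i))"
    using trig_poly_add[OF trig_poly_exp[of F "1 / (2 * \<i>)" "\<lambda>l. if l = i then \<kappa> else 0"]
        trig_poly_exp[of F "- 1 / (2 * \<i>)" "\<lambda>l. if l = i then - \<kappa> else 0"]]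
    unfolding s .
  moreover have "(1 / (2 * \<i>)) * iexp (\<kappa> * x i) + (- 1 / (2 * \<i>)) * iexp (- \<kappa> * x i) = of_real (sin (\<kappa> * x i))" for x
    unfolding sin_of_real[symmetric] sin_exp_eq by (simp add: field_simps)
  ultimately show ?thesis by simp
qed

lemma trig_poly_expectation:
  assumes "trig_poly F f" and M: "prob_space M" and N: "prob_space N"
    and X: "\<And>K i. i \<in> F \<Longrightarrow> X K i \<in> borel_measurable M"
    and Y: "\<And>i. i \<in> F \<Longrightarrow> Y i \<in> borel_measurable N"
    and conv: "\<And>u. (\<lambda>K. (CLINT \<omega>|M. iexp (\<Sum>i\<in>F. u i * X K i \<omega>))) \<longlonglongrightarrow> (CLINT \<omega>|N. iexp (\<Sum>i\<in>F. u i * Y i \<omega>))"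
  shows "(\<forall>K. complex_integrable M (\<lambda>\<omega>. f (\<lambda>i. X K i \<omega>))) \<and> complex_integrable N (\<lambda>\<omega>. f (\<lambda>i. Y i \<omega>)) \<and>
     (\<lambda>K. (CLINT \<omega>|M. f (\<lambda>i. X K i \<omega>))) \<longlonglongrightarrow> (CLINT \<omega>|N. f (\<lambda>i. Y i \<omega>))"
  using assms(1)
proof induction
  case (trig_poly_exp z u)
  interpret M: prob_space M by fact
  interpret N: prob_space N by fact
  have "complex_integrable M (\<lambda>\<omega>. iexp (\<Sum>i\<in>F. u i * X K i \<omega>))" for K
    using X by (intro M.integrable_const_bound[where B = 1]) auto
  moreover have "complex_integrable N (\<lambda>\<omega>. iexp (\<Sum>i\<in>F. u i * Y i \<omega>))"
    using Y by (intro N.integrable_const_bound[where B = 1]) auto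
  ultimately show ?case
    using tendsto_mult_left[OF conv[of u], of z] by auto
next
  case (trig_poly_add f g)
  then show ?case by (auto intro!: tendsto_add)
qed

lemma trig_poly_approximation:
  fixes g :: "('i::countable \<Rightarrow> real) \<Rightarrow> real"
  assumes F: "finite F" and g: "continuous_on UNIV g" and R: "R > 0" and e: "e > 0"
  obtains p where "trig_poly F (\<lambda>x. of_real (p x))"
    "\<And>x. \<bar>g (\<lambda>i. if i \<in> F then 2 * R / pi * arcsin (sin (pi / (2 * R) * x i)) else 0) - p x\<bar> < e"
proof -
  \<comment> \<open>Coordinates outside \<open>F\<close> are pinned to 0, so that \<open>S\<close>
    is a compact subset of the full function space and its points are separated by the coordinates
    in \<open>F\<close>.\<close>
  define S where "S = (\<Pi>\<^sub>E i\<in>(UNIV :: 'i set). if i \<in> F then {-1..1::real} else {0})"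
  define G where "G y = g (\<lambda>i. if i \<in> F then 2 * R / pi * arcsin (y i) else 0)" for y
  define sn where "sn x = (\<lambda>i. if i \<in> F then sin (pi / (2 * R) * x i) else 0)" for x :: "'i \<Rightarrow> real"
  define Rg where "Rg = {p. continuous_on S p \<and> trig_poly F (\<lambda>x. of_real (p (sn x)))}"
  have S: "y \<in> S \<longleftrightarrow> (\<forall>i. if i \<in> F then y i \<in> {-1..1} else y i = 0)" for y
    unfolding S_def by (auto simp: PiE_UNIV_domain Pi_iff split: if_splits)
  interpret function_ring_on Rg S
  proof
    have "compactin (product_topology (\<lambda>_. euclidean) UNIV) S"
      unfolding S_def compactin_PiE by auto
    then show "compact S" by (simp add: euclidean_product_topology)
    fix f g assume f: "f \<in> Rg" and g: "g \<in> Rg"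
    show "continuous_on S f" using f by (simp add: Rg_def)
    show "(\<lambda>x. f x + g x) \<in> Rg" "(\<lambda>x. f x * g x) \<in> Rg"
      using f g by (auto simp: Rg_def intro!: continuous_intros trig_poly_add trig_poly_mult)
  next
    show "(\<lambda>_. z) \<in> Rg" for z by (auto simp: Rg_def intro: trig_poly_const)
  next
    fix x y assume xy: "x \<in> S" "y \<in> S" "x \<noteq> y"
    then obtain i where i: "x i \<noteq> y i" by blast
    then have iF: "i \<in> F" using xy S by (metis)
    have "(\<lambda>x. x i) \<in> Rg"
      using trig_poly_sin[OF F iF, of "pi / (2 * R)"] iF
      by (auto simp: Rg_def sn_def intro: continuous_on_product_coordinates continuous_on_subset)
    then show "\<exists>f\<in>Rg. f x \<noteq> f y" using i by (intro bexI[of _ "\<lambda>x. x i"]) auto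
  qed
  have "continuous_on S G"
  proof -
    have "continuous_on S (\<lambda>y i. if i \<in> F then 2 * R / pi * arcsin (y i) else 0)"
    proof (rule continuous_on_coordinatewise_then_product)
      fix i
      show "continuous_on S (\<lambda>y. if i \<in> F then 2 * R / pi * arcsin (y i) else 0)"
      proof (cases "i \<in> F")
        case True
        have "continuous_on S (\<lambda>y. y i)"
          by (rule continuous_on_subset[OF continuous_on_product_coordinates]) simp
        then have "continuous_on S (\<lambda>y. arcsin (y i))"
        proof (rule continuous_on_arcsin, intro ballI)
          fix y assume "y \<in> S"
          then show "- 1 \<le> y i \<and> y i \<le> 1" using S[of y] True by (metis atLeastAtMost_iff)
        qed
        from continuous_on_mult_left[OF this, of "2 * R / pi"] show ?thesis using True by simp
      qed simp
    qed
    then show ?thesis unfolding G_def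
      by (rule continuous_on_compose2[OF g]) simp
  qed
  then obtain q where q: "q \<in> Rg" "\<And>y. y \<in> S \<Longrightarrow> \<bar>G y - q y\<bar> < e"
    using Stone_Weierstrass_basic[OF _ e] by blast
  show ?thesis
  proof (rule that[of "\<lambda>x. q (sn x)"])
    show "trig_poly F (\<lambda>x. of_real (q (sn x)))" using q by (simp add: Rg_def)
    fix x
    have "sn x \<in> S" unfolding S by (simp add: sn_def)
    from q(2)[OF this] have "\<bar>G (sn x) - q (sn x)\<bar> < e" .
    moreover have "G (sn x) = g (\<lambda>i. if i \<in> F then 2 * R / pi * arcsin (sin (pi / (2 * R) * x i)) else 0)"
      unfolding G_def sn_def by (rule arg_cong[of _ _ g]) auto
    ultimately show "\<bar>g (\<lambda>i. if i \<in> F then 2 * R / pi * arcsin (sin (pi / (2 * R) * x i)) else 0) - q (sn x)\<bar> < e"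
      by simp
  qed
qed

text \<open>Where all coordinates are at most \<open>R\<close> in absolute value, folding by
  triangle waves changes nothing, and tightness makes the complement small uniformly in
  \<open>K\<close>. The folded function is uniformly close to a trigonometric polynomial, whose
  expectations converge by \<open>conv\<close>. For the single law of \<open>Y\<close> dominated
  convergence takes the place of tightness.\<close>

lemma levy_multivariate:
  fixes g :: "('i::countable \<Rightarrow> real) \<Rightarrow> real" and X :: "nat \<Rightarrow> 'i \<Rightarrow> 'w \<Rightarrow> real" and Y :: "'i \<Rightarrow> 'v \<Rightarrow> real"
  assumes M: "prob_space M" and N: "prob_space N" and F: "finite F"
    and X: "\<And>K i. i \<in> F \<Longrightarrow> X K i \<in> borel_measurable M"
    and Y: "\<And>i. i \<in> F \<Longrightarrow> Y i \<in> borel_measurable N"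
    and conv: "\<And>u. (\<lambda>K. (CLINT \<omega>|M. iexp (\<Sum>i\<in>F. u i * X K i \<omega>))) \<longlonglongrightarrow> (CLINT \<omega>|N. iexp (\<Sum>i\<in>F. u i * Y i \<omega>))"
    and tight: "\<And>\<delta>. \<delta> > 0 \<Longrightarrow> \<exists>R0. \<forall>R\<ge>R0. \<forall>K. measure M {\<omega> \<in> space M. \<exists>i\<in>F. R < \<bar>X K i \<omega>\<bar>} \<le> \<delta>"
    and g: "continuous_on UNIV g" and C: "\<And>x. \<bar>g x\<bar> \<le> C"
  shows "(\<lambda>K. \<integral>\<omega>. g (\<lambda>i. if i \<in> F then X K i \<omega> else 0) \<partial>M) \<longlonglongrightarrow> (\<integral>\<omega>. g (\<lambda>i. if i \<in> F then Y i \<omega> else 0) \<partial>N)"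
proof (rule LIMSEQ_I)
  fix r :: real assume r: "r > 0"
  interpret M: prob_space M by fact
  interpret N: prob_space N by fact
  define fold where "fold R x = (\<lambda>i. if i \<in> F then 2 * R / pi * arcsin (sin (pi / (2 * R) * x i)) else 0)" for R and x :: "'i \<Rightarrow> real"
  define cut where "cut x = (\<lambda>i. if i \<in> F then x i else 0)" for x :: "'i \<Rightarrow> real"
  have fold_id: "fold R x = cut x" if R: "R > 0" "\<And>i. i \<in> F \<Longrightarrow> \<bar>x i\<bar> \<le> R" for R x
  proof -
    have "2 * R / pi * arcsin (sin (pi / (2 * R) * x i)) = x i" if "i \<in> F" for i
    proof -
      have "\<bar>pi / (2 * R) * x i\<bar> \<le> pi / 2"
      proof -
        have "\<bar>pi / (2 * R) * x i\<bar> = pi / (2 * R) * \<bar>x i\<bar>" using R by (simp add: abs_mult)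
        also have "\<dots> \<le> pi / (2 * R) * R" using R that by (intro mult_left_mono) auto
        finally show ?thesis using R by simp
      qed
      then have "arcsin (sin (pi / (2 * R) * x i)) = pi / (2 * R) * x i" by (intro arcsin_sin) linarith+
      then show ?thesis using R by simp
    qed
    then show ?thesis by (auto simp: fold_def cut_def)
  qed
  have gm: "g \<in> borel_measurable borel" using g by (rule borel_measurable_continuous_onI)
  have m1: "(\<lambda>\<omega>. g (cut (\<lambda>i. Z i \<omega>))) \<in> borel_measurable P"
    and m2: "(\<lambda>\<omega>. g (fold R (\<lambda>i. Z i \<omega>))) \<in> borel_measurable P"
    if Z: "\<And>i. i \<in> F \<Longrightarrow> Z i \<in> borel_measurable P" for Z P R
  proof -
    have "(\<lambda>\<omega>. cut (\<lambda>i. Z i \<omega>)) \<in> borel_measurable P"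
    proof (rule measurable_coordinatewise_then_product)
      show "(\<lambda>\<omega>. cut (\<lambda>i. Z i \<omega>) i) \<in> borel_measurable P" for i
        using Z by (cases "i \<in> F") (auto simp: cut_def)
    qed
    then show "(\<lambda>\<omega>. g (cut (\<lambda>i. Z i \<omega>))) \<in> borel_measurable P" by (rule measurable_compose[OF _ gm])
    have "(\<lambda>x. arcsin (sin (pi / (2 * R) * x))) \<in> borel_measurable (borel :: real measure)"
      by (intro borel_measurable_continuous_onI continuous_on_arcsin continuous_intros) auto
    note as = measurable_compose[OF Z this]
    have "(\<lambda>\<omega>. fold R (\<lambda>i. Z i \<omega>)) \<in> borel_measurable P"
    proof (rule measurable_coordinatewise_then_product)
      show "(\<lambda>\<omega>. fold R (\<lambda>i. Z i \<omega>) i) \<in> borel_measurable P" for i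
        using as by (cases "i \<in> F") (auto simp: fold_def)
    qed
    then show "(\<lambda>\<omega>. g (fold R (\<lambda>i. Z i \<omega>))) \<in> borel_measurable P" by (rule measurable_compose[OF _ gm])
  qed
  have "C \<ge> 0" using C[of "\<lambda>_. 0"] by linarith
  \<comment> \<open>Budget: less than \<open>r / 4\<close> for unfolding under \<open>M\<close>, and
    at most \<open>r / 8\<close> each for unfolding under \<open>N\<close>, for the two polynomial
    approximations and for the convergence of the polynomial. The \<open>+ 1\<close> covers
    \<open>C = 0\<close>.\<close>
  define \<delta> where "\<delta> = r / (8 * (C + 1))"
  have \<delta>: "\<delta> > 0" "2 * C * \<delta> < r / 4" using r \<open>C \<ge> 0\<close> by (auto simp: \<delta>_def field_simps)
  obtain R0 where R0: "\<And>R K. R \<ge> R0 \<Longrightarrow> measure M {\<omega> \<in> space M. \<exists>i\<in>F. R < \<bar>X K i \<omega>\<bar>} \<le> \<delta>"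
    using tight[OF \<delta>(1)] by blast
  have "(\<lambda>k. \<integral>\<omega>. g (fold (real k) (\<lambda>i. Y i \<omega>)) \<partial>N) \<longlonglongrightarrow> (\<integral>\<omega>. g (cut (\<lambda>i. Y i \<omega>)) \<partial>N)"
  proof (rule integral_dominated_convergence[where w = "\<lambda>_. C"])
    show "AE \<omega> in N. (\<lambda>k. g (fold (real k) (\<lambda>i. Y i \<omega>))) \<longlonglongrightarrow> g (cut (\<lambda>i. Y i \<omega>))"
    proof (rule AE_I2, rule tendsto_eventually)
      fix \<omega>
      have "\<forall>\<^sub>F k in sequentially. \<forall>i\<in>F. \<bar>Y i \<omega>\<bar> \<le> real k"
        using F filterlim_real_sequentially by (intro eventually_ball_finite) (auto simp: filterlim_at_top)
      then show "\<forall>\<^sub>F k in sequentially. g (fold (real k) (\<lambda>i. Y i \<omega>)) = g (cut (\<lambda>i. Y i \<omega>))"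
        using eventually_gt_at_top[of 0] by eventually_elim (use fold_id in auto)
    qed
  qed (use C m1[OF Y] m2[OF Y] in auto)
  then have "\<forall>\<^sub>F k in sequentially. \<bar>(\<integral>\<omega>. g (fold (real k) (\<lambda>i. Y i \<omega>)) \<partial>N) - (\<integral>\<omega>. g (cut (\<lambda>i. Y i \<omega>)) \<partial>N)\<bar> < r / 8"
    using r tendstoD[of _ _ _ "r / 8"] by (fastforce simp: dist_real_def)
  moreover have "\<forall>\<^sub>F k in sequentially. R0 \<le> real k"
    using filterlim_real_sequentially by (auto simp: filterlim_at_top)
  ultimately have "\<forall>\<^sub>F k in sequentially. \<bar>(\<integral>\<omega>. g (fold (real k) (\<lambda>i. Y i \<omega>)) \<partial>N) - (\<integral>\<omega>. g (cut (\<lambda>i. Y i \<omega>)) \<partial>N)\<bar> < r / 8 \<and> R0 \<le> real k \<and> 0 < k"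
    using eventually_gt_at_top[of "0::nat"] by eventually_elim auto
  then obtain k where k: "\<bar>(\<integral>\<omega>. g (fold (real k) (\<lambda>i. Y i \<omega>)) \<partial>N) - (\<integral>\<omega>. g (cut (\<lambda>i. Y i \<omega>)) \<partial>N)\<bar> < r / 8"
    "R0 \<le> real k" "0 < k" by (auto simp: eventually_sequentially)
  define R where "R = real k"
  have R: "R > 0" "R \<ge> R0" using k by (auto simp: R_def)
  obtain p where p: "trig_poly F (\<lambda>x. of_real (p x))" "\<And>x. \<bar>g (fold R x) - p x\<bar> < r / 8"
    using trig_poly_approximation[OF F g R(1), of "r / 8"] r unfolding fold_def by auto
  from trig_poly_expectation[OF p(1) M N X Y conv]
  have pi: "\<And>K. integrable M (\<lambda>\<omega>. p (\<lambda>i. X K i \<omega>))" "integrable N (\<lambda>\<omega>. p (\<lambda>i. Y i \<omega>))"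
    and "(\<lambda>K. complex_of_real (\<integral>\<omega>. p (\<lambda>i. X K i \<omega>) \<partial>M)) \<longlonglongrightarrow> complex_of_real (\<integral>\<omega>. p (\<lambda>i. Y i \<omega>) \<partial>N)"
    by (auto simp: complex_of_real_integrable_eq)
  then have "(\<lambda>K. \<integral>\<omega>. p (\<lambda>i. X K i \<omega>) \<partial>M) \<longlonglongrightarrow> (\<integral>\<omega>. p (\<lambda>i. Y i \<omega>) \<partial>N)"
    by (simp add: tendsto_of_real_iff)
  then have "\<forall>\<^sub>F K in sequentially. \<bar>(\<integral>\<omega>. p (\<lambda>i. X K i \<omega>) \<partial>M) - (\<integral>\<omega>. p (\<lambda>i. Y i \<omega>) \<partial>N)\<bar> < r / 8"
    using r tendstoD[of _ _ _ "r / 8"] by (fastforce simp: dist_real_def)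
  then obtain K0 where K0: "\<And>K. K \<ge> K0 \<Longrightarrow> \<bar>(\<integral>\<omega>. p (\<lambda>i. X K i \<omega>) \<partial>M) - (\<integral>\<omega>. p (\<lambda>i. Y i \<omega>) \<partial>N)\<bar> < r / 8"
    by (auto simp: eventually_sequentially)
  have pg: "\<bar>(\<integral>\<omega>. g (fold R (\<lambda>i. Z i \<omega>)) \<partial>P) - (\<integral>\<omega>. p (\<lambda>i. Z i \<omega>) \<partial>P)\<bar> \<le> r / 8"
    if P: "prob_space P" and Z: "\<And>i. i \<in> F \<Longrightarrow> Z i \<in> borel_measurable P"
      and pZ: "integrable P (\<lambda>\<omega>. p (\<lambda>i. Z i \<omega>))" for P Z
  proof -
    interpret P: prob_space P by fact
    have i: "integrable P (\<lambda>\<omega>. g (fold R (\<lambda>i. Z i \<omega>)))"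
      by (rule P.integrable_const_bound[of _ C]) (use C m2[OF Z] in auto)
    have "\<bar>(\<integral>\<omega>. g (fold R (\<lambda>i. Z i \<omega>)) - p (\<lambda>i. Z i \<omega>) \<partial>P)\<bar> \<le> (\<integral>\<omega>. \<bar>g (fold R (\<lambda>i. Z i \<omega>)) - p (\<lambda>i. Z i \<omega>)\<bar> \<partial>P)"
      by (rule integral_abs_bound)
    also have "\<dots> \<le> (\<integral>\<omega>. r / 8 \<partial>P)"
      using i pZ p(2) by (intro integral_mono) (auto intro: less_imp_le)
    finally show ?thesis using i pZ by (simp add: P.prob_space)
  qed
  have "norm ((\<integral>\<omega>. g (cut (\<lambda>i. X K i \<omega>)) \<partial>M) - (\<integral>\<omega>. g (cut (\<lambda>i. Y i \<omega>)) \<partial>N)) < r" if K: "K \<ge> K0" for K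
  proof -
    define B where "B = {\<omega> \<in> space M. \<exists>i\<in>F. R < \<bar>X K i \<omega>\<bar>}"
    have [measurable]: "B \<in> sets M" unfolding B_def
    proof -
      have "{\<omega> \<in> space M. \<exists>i\<in>F. R < \<bar>X K i \<omega>\<bar>} = (\<Union>i\<in>F. {\<omega> \<in> space M. R < \<bar>X K i \<omega>\<bar>})" by auto
      moreover have "{\<omega> \<in> space M. R < \<bar>X K i \<omega>\<bar>} \<in> sets M" if "i \<in> F" for i
        using X[OF that] by measurable
      ultimately show "{\<omega> \<in> space M. \<exists>i\<in>F. R < \<bar>X K i \<omega>\<bar>} \<in> sets M" using F by auto
    qed
    have iB: "integrable M (indicator B :: _ \<Rightarrow> real)"
      by (rule integrable_real_indicator) (simp_all add: less_top[symmetric])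
    have i: "integrable M (\<lambda>\<omega>. g (cut (\<lambda>i. X K i \<omega>)))" "integrable M (\<lambda>\<omega>. g (fold R (\<lambda>i. X K i \<omega>)))"
      by (rule M.integrable_const_bound[of _ C]; use C m1[OF X] m2[OF X] in auto)+
    have "\<bar>(\<integral>\<omega>. g (cut (\<lambda>i. X K i \<omega>)) \<partial>M) - (\<integral>\<omega>. g (fold R (\<lambda>i. X K i \<omega>)) \<partial>M)\<bar>
       = \<bar>\<integral>\<omega>. g (cut (\<lambda>i. X K i \<omega>)) - g (fold R (\<lambda>i. X K i \<omega>)) \<partial>M\<bar>" using i by simp
    also have "\<dots> \<le> (\<integral>\<omega>. \<bar>g (cut (\<lambda>i. X K i \<omega>)) - g (fold R (\<lambda>i. X K i \<omega>))\<bar> \<partial>M)"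
      by (rule integral_abs_bound)
    also have "\<dots> \<le> (\<integral>\<omega>. 2 * C * indicator B \<omega> \<partial>M)"
    proof (rule integral_mono)
      fix \<omega> assume w: "\<omega> \<in> space M"
      show "\<bar>g (cut (\<lambda>i. X K i \<omega>)) - g (fold R (\<lambda>i. X K i \<omega>))\<bar> \<le> 2 * C * indicator B \<omega>"
      proof (cases "\<omega> \<in> B")
        case True
        then show ?thesis using C[of "cut (\<lambda>i. X K i \<omega>)"] C[of "fold R (\<lambda>i. X K i \<omega>)"] by simp
      next
        case False
        then have "fold R (\<lambda>i. X K i \<omega>) = cut (\<lambda>i. X K i \<omega>)"
          using w R by (intro fold_id) (auto simp: B_def not_less)
        then show ?thesis using False by simp
      qed
    qed (use i iB in auto)
    also have "\<dots> = 2 * C * measure M B" by simp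
    also have "\<dots> \<le> 2 * C * \<delta>" using R0[OF R(2), of K] \<open>C \<ge> 0\<close> by (intro mult_left_mono) (auto simp: B_def)
    also have "\<dots> < r / 4" by (rule \<delta>(2))
    finally have a1: "\<bar>(\<integral>\<omega>. g (cut (\<lambda>i. X K i \<omega>)) \<partial>M) - (\<integral>\<omega>. g (fold R (\<lambda>i. X K i \<omega>)) \<partial>M)\<bar> < r / 4" .
    have a2: "\<bar>(\<integral>\<omega>. g (fold R (\<lambda>i. X K i \<omega>)) \<partial>M) - (\<integral>\<omega>. p (\<lambda>i. X K i \<omega>) \<partial>M)\<bar> \<le> r / 8"
      by (rule pg[OF M X pi(1)])
    have a3: "\<bar>(\<integral>\<omega>. g (fold R (\<lambda>i. Y i \<omega>)) \<partial>N) - (\<integral>\<omega>. p (\<lambda>i. Y i \<omega>) \<partial>N)\<bar> \<le> r / 8"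
      by (rule pg[OF N Y pi(2)])
    show ?thesis
      using a1 a2 a3 K0[OF K] k(1) r unfolding R_def[symmetric] real_norm_def by linarith
  qed
  then show "\<exists>no. \<forall>K\<ge>no. norm ((\<integral>\<omega>. g (\<lambda>i. if i \<in> F then X K i \<omega> else 0) \<partial>M) - (\<integral>\<omega>. g (\<lambda>i. if i \<in> F then Y i \<omega> else 0) \<partial>N)) < r"
    unfolding cut_def by blast
qed

section \<open>Convergence in law from increments\<close>

text \<open>The interpolation follows the path up to time \<open>m\<close>; what happens later is
  discounted by \<open>path_dist\<close>.\<close>

definition grid_path :: "nat \<Rightarrow> (real \<Rightarrow> 'w \<Rightarrow> 'e::real_normed_vector) \<Rightarrow> 'w \<Rightarrow> real \<Rightarrow> 'e" where
  "grid_path m Z \<omega> = restrict (interp m (m * 2 ^ m) (\<lambda>i. Z (grid m i) \<omega>)) {0..}"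

lemma restrict_interp_path_space: "restrict (interp m p a) {0..} \<in> path_space"
proof -
  have "continuous_on {0..} (restrict (interp m p a) {0..})"
    by (subst continuous_on_cong[of _ _ _ "interp m p a"]) (auto intro: continuous_on_interp)
  then show ?thesis by (simp add: path_space_def)
qed

lemma path_dist_grid_path:
  assumes T: "T \<ge> 0" "real m \<ge> T + 1"
    and le: "\<And>t i. t \<in> {0..T} \<Longrightarrow> grid m i \<le> t \<Longrightarrow> t \<le> grid m (Suc i) \<Longrightarrow>
       norm (Z (grid m i) \<omega> - Z t \<omega>) \<le> \<delta> \<and> norm (Z (grid m (Suc i)) \<omega> - Z t \<omega>) \<le> \<delta>"
  shows "path_dist (trajectory Z \<omega>) (grid_path m Z \<omega>) \<le> max \<delta> (1 / (1 + T))"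
proof (rule path_dist_le[OF T(1)])
  fix t assume t: "t \<in> {0..T}"
  have gm: "grid m (m * 2 ^ m) = real m" by (simp add: grid_def)
  have "m > 0" using T by (cases m) auto
  then obtain i where i: "i < m * 2 ^ m" "grid m i \<le> t" "t \<le> grid m (Suc i)"
    using grid_cell_closed[of t m "m * 2 ^ m"] t T gm by auto
  have "norm (interp m (m * 2 ^ m) (\<lambda>i. Z (grid m i) \<omega>) t - Z t \<omega>) \<le> \<delta>"
    by (rule interp_close[OF i]) (use le[OF t i(2,3)] in auto)
  then show "dist (trajectory Z \<omega> t) (grid_path m Z \<omega> t) \<le> \<delta>"
    using t by (simp add: trajectory_def grid_path_def dist_norm norm_minus_commute)
qed

lemma path_dist_grid_path_tendsto:
  assumes Z: "continuous_on {0..} (\<lambda>t. Z t \<omega>)"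
  shows "(\<lambda>m. path_dist (trajectory Z \<omega>) (grid_path m Z \<omega>)) \<longlonglongrightarrow> 0"
proof (rule LIMSEQ_I)
  fix e :: real assume e: "e > 0"
  define T where "T = 2 / e"
  have T: "T \<ge> 0" "1 / (1 + T) < e" using e by (auto simp: T_def field_simps add_pos_pos)
  \<comment> \<open>The right end of the cell of a time \<open>t \<le> T\<close> may lie beyond
    \<open>T\<close>, but not beyond \<open>T + 1\<close>.\<close>
  have "uniformly_continuous_on {0..T + 1} (\<lambda>t. Z t \<omega>)"
    by (rule compact_uniformly_continuous) (use continuous_on_subset[OF Z] in auto)
  then obtain d where d: "d > 0" "\<And>s t. s \<in> {0..T+1} \<Longrightarrow> t \<in> {0..T+1} \<Longrightarrow> dist s t < d \<Longrightarrow> dist (Z s \<omega>) (Z t \<omega>) < e / 2"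
    using e unfolding uniformly_continuous_on_def by (metis half_gt_zero)
  obtain m1 where m1: "(1/2::real) ^ m1 < d" using real_arch_pow_inv[of d "1/2"] d(1) by auto
  obtain m2 :: nat where m2: "T + 1 \<le> real m2" using real_arch_simple by blast
  have "norm (path_dist (trajectory Z \<omega>) (grid_path m Z \<omega>) - 0) < e" if m: "m \<ge> max m1 m2" for m
  proof -
    have "(1/2::real) ^ m \<le> (1/2) ^ m1" using m by (intro power_decreasing) auto
    then have md: "(1/2::real) ^ m < d" using m1 by linarith
    have m1': "(1/2::real) ^ m \<le> 1" by (simp add: power_le_one)
    have "path_dist (trajectory Z \<omega>) (grid_path m Z \<omega>) \<le> max (e / 2) (1 / (1 + T))"
    proof (rule path_dist_grid_path[OF T(1)])
      show "T + 1 \<le> real m" using m m2 by linarith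
      fix t i assume t: "t \<in> {0..T}" and i: "grid m i \<le> t" "t \<le> grid m (Suc i)"
      have t0: "0 \<le> t" "t \<le> T" using t by auto
      have s: "grid m (Suc i) = grid m i + (1/2) ^ m" using grid_Suc_diff[of m i] by (simp add: power_divide)
      have "dist (Z (grid m i) \<omega>) (Z t \<omega>) < e / 2"
      proof (rule d(2))
        show "grid m i \<in> {0..T + 1}" "t \<in> {0..T + 1}" using t0 i(1) by simp_all
        show "dist (grid m i) t < d" unfolding dist_real_def using i s md by linarith
      qed
      moreover have "dist (Z (grid m (Suc i)) \<omega>) (Z t \<omega>) < e / 2"
      proof (rule d(2))
        have "grid m (Suc i) \<le> T + 1" using t0 i(1) s m1' by linarith
        then show "grid m (Suc i) \<in> {0..T + 1}" "t \<in> {0..T + 1}" using t0 by simp_all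
        show "dist (grid m (Suc i)) t < d" unfolding dist_real_def using i s md by linarith
      qed
      ultimately show "norm (Z (grid m i) \<omega> - Z t \<omega>) \<le> e / 2 \<and> norm (Z (grid m (Suc i)) \<omega> - Z t \<omega>) \<le> e / 2"
        by (simp add: dist_norm)
    qed
    also have "\<dots> < e" using T e by simp
    finally show ?thesis using path_dist_nonneg[of "trajectory Z \<omega>" "grid_path m Z \<omega>"] by simp
  qed
  then show "\<exists>no. \<forall>m\<ge>no. norm (path_dist (trajectory Z \<omega>) (grid_path m Z \<omega>) - 0) < e" by blast
qed

lemma dyadic_floor_tendsto:
  assumes "t \<ge> 0"
  shows "(\<lambda>m. grid m (nat \<lfloor>t * 2 ^ m\<rfloor>)) \<longlonglongrightarrow> t"
proof -
  have "\<bar>grid m (nat \<lfloor>t * 2 ^ m\<rfloor>) - t\<bar> \<le> (1/2) ^ m" for m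
  proof -
    have "real (nat \<lfloor>t * 2 ^ m\<rfloor>) \<le> t * 2 ^ m" "t * 2 ^ m < real (nat \<lfloor>t * 2 ^ m\<rfloor>) + 1"
      using assms by (auto simp: of_nat_nat)
    then have "real (nat \<lfloor>t * 2 ^ m\<rfloor>) / 2 ^ m \<le> t" "t < (real (nat \<lfloor>t * 2 ^ m\<rfloor>) + 1) / 2 ^ m"
      by (simp_all add: pos_divide_le_eq pos_less_divide_eq)
    moreover have "(real (nat \<lfloor>t * 2 ^ m\<rfloor>) + 1) / 2 ^ m = grid m (nat \<lfloor>t * 2 ^ m\<rfloor>) + (1/2) ^ m"
      by (simp add: grid_def add_divide_distrib power_divide)
    ultimately show ?thesis by (simp add: grid_def abs_le_iff)
  qed
  then have "\<forall>\<^sub>F m in sequentially. norm (grid m (nat \<lfloor>t * 2 ^ m\<rfloor>) - t) \<le> (1/2) ^ m"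
    unfolding real_norm_def by (intro always_eventually allI)
  moreover have "(\<lambda>m. (1/2::real) ^ m) \<longlonglongrightarrow> 0" by (rule LIMSEQ_power_zero) simp
  ultimately have "(\<lambda>m. grid m (nat \<lfloor>t * 2 ^ m\<rfloor>) - t) \<longlonglongrightarrow> 0"
    by (rule Lim_null_comparison)
  then show ?thesis by (rule LIM_zero_cancel)
qed

text \<open>Chaining along the dyadic floors of \<open>t\<close>; the ratio \<open>9/10\<close> is chosen because
  \<open>(9/10)^4 > 1/2\<close>, which makes the sum of the bad events converge under a fourth moment bound.\<close>

lemma dyadic_chaining:
  fixes f :: "real \<Rightarrow> 'e::real_normed_vector"
  assumes f: "continuous_on {0..} f" and t: "t \<in> {0..real T}"
    and inc: "\<And>j i. j \<ge> m \<Longrightarrow> i < (T + 1) * 2 ^ j \<Longrightarrow> norm (f (grid j (Suc i)) - f (grid j i)) \<le> (9/10) ^ j"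
    and i: "grid m i \<le> t" "t \<le> grid m (Suc i)"
  shows "norm (f (grid m i) - f t) \<le> 10 * (9/10) ^ m \<and> norm (f (grid m (Suc i)) - f t) \<le> 10 * (9/10) ^ m"
proof -
  define r :: real where "r = 9/10"
  have r: "0 < r" "r < 1" by (simp_all add: r_def)
  define a where "a j = nat \<lfloor>t * 2 ^ j\<rfloor>" for j
  have a: "real (a j) \<le> t * 2 ^ j" "t * 2 ^ j < real (a j) + 1" for j
    using t by (auto simp: a_def of_nat_nat)
  have aT: "a j < (T + 1) * 2 ^ j" "a j \<le> T * 2 ^ j" for j
  proof -
    have "t * 2 ^ j \<le> real T * 2 ^ j" using t by (intro mult_right_mono) auto
    then have "real (a j) \<le> real T * 2 ^ j" using a(1)[of j] by linarith
    then have "real (a j) \<le> real (T * 2 ^ j)" by simp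
    then show "a j \<le> T * 2 ^ j" unfolding of_nat_le_iff .
    then show "a j < (T + 1) * 2 ^ j" by (simp add: le_less_trans[of _ "T * 2 ^ j"])
  qed
  have step: "norm (f (grid (Suc j) (a (Suc j))) - f (grid j (a j))) \<le> r ^ Suc j" if j: "j \<ge> m" for j
  proof -
    \<comment> \<open>The dyadic floor of level \<open>Suc j\<close> equals that of level
      \<open>j\<close> or lies one fine cell to its right, so each link of the chain is at most one
      increment.\<close>
    have "2 * real (a j) < real (a (Suc j)) + 1" "real (a (Suc j)) < 2 * real (a j) + 2"
      using a[of j] a[of "Suc j"] by auto
    then have "a (Suc j) = 2 * a j \<or> a (Suc j) = Suc (2 * a j)" by linarith
    moreover have g: "grid j (a j) = grid (Suc j) (2 * a j)" by (simp add: grid_def)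
    moreover have "2 * a j < (T + 1) * 2 ^ Suc j" using aT(1)[of j] by simp
    ultimately show ?thesis
      using inc[of "Suc j" "2 * a j"] j r unfolding r_def[symmetric] by auto
  qed
  have tele: "norm (f (grid (m + k) (a (m + k))) - f (grid m (a m))) \<le> (r ^ Suc m) * (\<Sum>l<k. r ^ l)" for k
  proof (induction k)
    case (Suc k)
    have "norm (f (grid (m + Suc k) (a (m + Suc k))) - f (grid m (a m)))
      \<le> norm (f (grid (Suc (m + k)) (a (Suc (m + k)))) - f (grid (m + k) (a (m + k))))
        + norm (f (grid (m + k) (a (m + k))) - f (grid m (a m)))"
      using norm_triangle_ineq[of "f (grid (Suc (m + k)) (a (Suc (m + k)))) - f (grid (m + k) (a (m + k)))"
          "f (grid (m + k) (a (m + k))) - f (grid m (a m))"] by simp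
    also have "\<dots> \<le> r ^ Suc (m + k) + (r ^ Suc m) * (\<Sum>l<k. r ^ l)"
      by (intro add_mono step Suc.IH) simp
    finally show ?case by (simp add: power_add algebra_simps)
  qed simp
  have geo: "(\<Sum>l<k. r ^ l) \<le> 10" for k
  proof -
    have "(\<Sum>l<k. r ^ l) = (1 - r ^ k) / (1 - r)" using r by (simp add: sum_gp_strict)
    also have "\<dots> \<le> 1 / (1 - r)" using r by (intro divide_right_mono) auto
    finally show ?thesis by (simp add: r_def)
  qed
  have lim: "(\<lambda>k. f (grid (m + k) (a (m + k)))) \<longlonglongrightarrow> f t"
  proof (rule continuous_on_tendsto_compose[OF f])
    show "(\<lambda>k. grid (m + k) (a (m + k))) \<longlonglongrightarrow> t"
      using LIMSEQ_ignore_initial_segment[OF dyadic_floor_tendsto, of t m] t by (simp add: a_def add.commute)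
  qed (use t in auto)
  \<comment> \<open>The tail of the chain costs \<open>10 * r ^ Suc m = 9 * r ^ m\<close>; one more
    increment of level \<open>m\<close>, for the other end of the cell, makes the total
    \<open>10 * r ^ m\<close>.\<close>
  have near: "norm (f t - f (grid m (a m))) \<le> 9 * r ^ m"
  proof (rule LIMSEQ_le_const2)
    show "(\<lambda>k. norm (f (grid (m + k) (a (m + k))) - f (grid m (a m)))) \<longlonglongrightarrow> norm (f t - f (grid m (a m)))"
      by (intro tendsto_intros lim)
    have "norm (f (grid (m + k) (a (m + k))) - f (grid m (a m))) \<le> 9 * r ^ m" for k
    proof -
      have "(r ^ Suc m) * (\<Sum>l<k. r ^ l) \<le> (r ^ Suc m) * 10"
        using geo r by (intro mult_left_mono) auto
      also have "\<dots> = 9 * r ^ m" by (simp add: r_def)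
      finally show ?thesis using tele[of k] by linarith
    qed
    then show "\<exists>N. \<forall>k\<ge>N. norm (f (grid (m + k) (a (m + k))) - f (grid m (a m))) \<le> 9 * r ^ m" by blast
  qed
  have next_le: "norm (f (grid m (Suc l)) - f (grid m l)) \<le> r ^ m" if "l < (T + 1) * 2 ^ m" for l
    using inc[of m l] that by (simp add: r_def)
  have rm: "0 \<le> r ^ m" using r by simp
  have "real i \<le> t * 2 ^ m" "t * 2 ^ m \<le> real i + 1" using i by (simp_all add: grid_def field_simps)
  \<comment> \<open>\<open>t\<close> may be the right end of the given cell, and then its floor is
    \<open>Suc i\<close>.\<close>
  then have "i = a m \<or> Suc i = a m" using a[of m] by linarith
  then have "norm (f (grid m i) - f t) \<le> 10 * r ^ m \<and> norm (f (grid m (Suc i)) - f t) \<le> 10 * r ^ m"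
  proof
    assume e: "i = a m"
    have "norm (f (grid m (Suc i)) - f t) \<le> norm (f (grid m (Suc i)) - f (grid m i)) + norm (f t - f (grid m i))"
      using norm_triangle_ineq4[of "f (grid m (Suc i)) - f (grid m i)" "f t - f (grid m i)"] by simp
    moreover have "norm (f (grid m (Suc i)) - f (grid m i)) \<le> r ^ m" using next_le[of i] aT(1)[of m] e by simp
    moreover have "norm (f (grid m i) - f t) = norm (f t - f (grid m i))" by (rule norm_minus_commute)
    ultimately show ?thesis using near rm unfolding e[symmetric] by linarith
  next
    assume e: "Suc i = a m"
    have "norm (f (grid m i) - f t) \<le> norm (f (grid m (Suc i)) - f (grid m i)) + norm (f t - f (grid m (Suc i)))"
      using norm_triangle_ineq[of "f (grid m (Suc i)) - f (grid m i)" "f t - f (grid m (Suc i))"] by (simp add: norm_minus_commute)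
    moreover have "norm (f (grid m (Suc i)) - f (grid m i)) \<le> r ^ m" using next_le[of i] aT(1)[of m] e by simp
    moreover have "norm (f (grid m (Suc i)) - f t) = norm (f t - f (grid m (Suc i)))" by (rule norm_minus_commute)
    ultimately show ?thesis using near rm unfolding e[symmetric] by linarith
  qed
  then show ?thesis by (simp add: r_def)
qed

section \<open>Tightness from fourth moments\<close>

lemma markov_fourth:
  assumes "prob_space M" and X: "X \<in> borel_measurable M" "integrable M (\<lambda>\<omega>. X \<omega> ^ 4)" and a: "a > 0"
  shows "measure M {\<omega> \<in> space M. a < \<bar>X \<omega>\<bar>} \<le> (\<integral>\<omega>. X \<omega> ^ 4 \<partial>M) / a ^ 4"
proof -
  interpret prob_space M by fact
  have "measure M {\<omega> \<in> space M. a < \<bar>X \<omega>\<bar>} \<le> measure M {\<omega> \<in> space M. a ^ 4 \<le> X \<omega> ^ 4}"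
  proof (rule finite_measure_mono)
    show "{\<omega> \<in> space M. a < \<bar>X \<omega>\<bar>} \<subseteq> {\<omega> \<in> space M. a ^ 4 \<le> X \<omega> ^ 4}"
    proof clarify
      fix \<omega> assume "a < \<bar>X \<omega>\<bar>"
      then have "a ^ 4 \<le> \<bar>X \<omega>\<bar> ^ 4" using a by (intro power_mono) auto
      then show "a ^ 4 \<le> X \<omega> ^ 4" by simp
    qed
    show "{\<omega> \<in> space M. a ^ 4 \<le> X \<omega> ^ 4} \<in> sets M" using X(1) by measurable
  qed
  also have "\<dots> \<le> (\<integral>\<omega>. X \<omega> ^ 4 \<partial>M) / a ^ 4"
    using a by (intro integral_Markov_inequality_measure[OF X(2), of "space M"]) auto
  finally show ?thesis .
qed

text \<open>Markov's inequality for fourth powers and a union bound over the cells.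
  \<open>n ^ 5\<close> collects one \<open>n\<close> from the union over coordinates and
  \<open>n ^ 4\<close> from asking some coordinate to exceed the \<open>n\<close>-th part of the
  threshold; 5 is the geometric sum \<open>1 / (1 - 4/5)\<close> over the levels.\<close>

lemma measure_bad_increments:
  fixes Z :: "real \<Rightarrow> 'w \<Rightarrow> 'e::euclidean_space" and T m :: nat
  assumes "prob_space M" and Z: "continuous_process M Z" and D: "D \<ge> 0"
    and i4: "\<And>b j i. b \<in> Basis \<Longrightarrow> integrable M (\<lambda>\<omega>. (b \<bullet> (Z (grid j (Suc i)) \<omega> - Z (grid j i) \<omega>)) ^ 4)"
    and E4: "\<And>b j i. b \<in> Basis \<Longrightarrow> (\<integral>\<omega>. (b \<bullet> (Z (grid j (Suc i)) \<omega> - Z (grid j i) \<omega>)) ^ 4 \<partial>M) \<le> D * (1 / 2 ^ j)\<^sup>2"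
  defines "n \<equiv> real DIM('e)"
  defines "B \<equiv> \<lambda>m. {\<omega> \<in> space M. \<exists>j\<ge>m. \<exists>i<(T + 1) * 2 ^ j. (9/10) ^ j < norm (Z (grid j (Suc i)) \<omega> - Z (grid j i) \<omega>)}"
  shows "B m \<in> sets M" "measure M (B m) \<le> (real T + 1) * n ^ 5 * D * 5 * (4/5) ^ m"
proof -
  interpret prob_space M by fact
  have n: "n > 0" by (simp add: n_def)
  define A where "A j i = {\<omega> \<in> space M. (9/10) ^ j < norm (Z (grid j (Suc i)) \<omega> - Z (grid j i) \<omega>)}" for j i
  have [measurable]: "Z (grid j i) \<in> borel_measurable M" for j i
    using Z by (simp add: continuous_process_def)
  have Am: "A j i \<in> sets M" for j i unfolding A_def by measurable
  \<comment> \<open>An increment of level \<open>j\<close> is bad with probability of order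
    \<open>((1/4) / (9/10)^4) ^ j\<close>, whose base is below \<open>2/5\<close>; the
    \<open>2 ^ j\<close> cells per unit of time raise the base to \<open>4/5\<close>.\<close>
  define \<rho> where "\<rho> = (4/5 :: real)"
  have PA: "measure M (A j i) \<le> n ^ 5 * D * (\<rho> / 2) ^ j" for j i
  proof -
    define C where "C b = {\<omega> \<in> space M. (9/10) ^ j / n < \<bar>b \<bullet> (Z (grid j (Suc i)) \<omega> - Z (grid j i) \<omega>)\<bar>}" for b
    have Cm: "C b \<in> sets M" for b unfolding C_def by measurable
    have "A j i \<subseteq> (\<Union>b\<in>Basis. C b)"
    proof (rule subsetI, rule ccontr)
      fix \<omega> assume w: "\<omega> \<in> A j i" "\<omega> \<notin> (\<Union>b\<in>Basis. C b)"
      define z where "z = Z (grid j (Suc i)) \<omega> - Z (grid j i) \<omega>"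
      have "\<bar>z \<bullet> b\<bar> \<le> (9/10) ^ j / n" if "b \<in> Basis" for b
        using w that by (auto simp: A_def C_def z_def not_less inner_commute)
      then have "(\<Sum>b\<in>Basis. \<bar>z \<bullet> b\<bar>) \<le> (\<Sum>b\<in>(Basis::'e set). (9/10) ^ j / n)" by (rule sum_mono)
      then have "norm z \<le> (9/10) ^ j" using norm_le_l1[of z] n by (simp add: n_def)
      then show False using w(1) by (simp add: A_def z_def)
    qed
    then have "measure M (A j i) \<le> measure M (\<Union>b\<in>Basis. C b)"
      using Cm by (intro finite_measure_mono) auto
    also have "\<dots> \<le> (\<Sum>b\<in>Basis. measure M (C b))"
      using Cm by (intro measure_UNION_le) auto
    also have "\<dots> \<le> (\<Sum>b\<in>(Basis::'e set). D * (1 / 2 ^ j)\<^sup>2 / ((9/10) ^ j / n) ^ 4)"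
    proof (rule sum_mono)
      fix b :: 'e assume b: "b \<in> Basis"
      have "measure M (C b) \<le> (\<integral>\<omega>. (b \<bullet> (Z (grid j (Suc i)) \<omega> - Z (grid j i) \<omega>)) ^ 4 \<partial>M) / ((9/10) ^ j / n) ^ 4"
        unfolding C_def by (rule markov_fourth[OF prob_space_axioms _ i4[OF b]]) (use n in auto)
      also have "\<dots> \<le> D * (1 / 2 ^ j)\<^sup>2 / ((9/10) ^ j / n) ^ 4"
        by (intro divide_right_mono E4[OF b]) simp
      finally show "measure M (C b) \<le> D * (1 / 2 ^ j)\<^sup>2 / ((9/10) ^ j / n) ^ 4" .
    qed
    also have "\<dots> = n ^ 5 * D * ((1/4) / (9/10) ^ 4) ^ j"
      using n by (simp add: n_def[symmetric] power_divide power_mult[symmetric] power_mult_distrib[symmetric]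
          power2_eq_square field_simps eval_nat_numeral mult.commute[of j])
    also have "\<dots> \<le> n ^ 5 * D * (\<rho> / 2) ^ j"
      using n D by (intro mult_left_mono power_mono) (auto simp: \<rho>_def eval_nat_numeral)
    finally show ?thesis .
  qed
  define U where "U j = (\<Union>i<(T + 1) * 2 ^ j. A j i)" for j
  have Um: "U j \<in> sets M" for j unfolding U_def using Am by auto
  have PU: "measure M (U j) \<le> (real T + 1) * n ^ 5 * D * \<rho> ^ j" for j
  proof -
    have "measure M (U j) \<le> (\<Sum>i<(T + 1) * 2 ^ j. measure M (A j i))"
      unfolding U_def using Am by (intro measure_UNION_le) auto
    also have "\<dots> \<le> (\<Sum>i<(T + 1) * 2 ^ j. n ^ 5 * D * (\<rho> / 2) ^ j)" by (intro sum_mono PA)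
    also have "\<dots> = (real T + 1) * n ^ 5 * D * \<rho> ^ j" by (simp add: power_divide field_simps)
    finally show ?thesis .
  qed
  have BU: "B m = (\<Union>k. U (m + k))"
  proof -
    have "\<exists>k. j = m + k" if "j \<ge> m" for j using that by (metis le_iff_add)
    then show ?thesis by (fastforce simp: B_def U_def A_def)
  qed
  show "B m \<in> sets M" unfolding BU using Um by auto
  have s: "(\<lambda>k. (real T + 1) * n ^ 5 * D * \<rho> ^ m * \<rho> ^ k) sums ((real T + 1) * n ^ 5 * D * \<rho> ^ m * (1 / (1 - \<rho>)))"
    by (intro sums_mult geometric_sums) (simp add: \<rho>_def)
  have le: "measure M (U (m + k)) \<le> (real T + 1) * n ^ 5 * D * \<rho> ^ m * \<rho> ^ k" for k
    using PU[of "m + k"] by (simp add: power_add mult.assoc)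
  have su: "summable (\<lambda>k. measure M (U (m + k)))"
    by (rule summable_comparison_test'[OF sums_summable[OF s]]) (use le in auto)
  have "measure M (B m) \<le> (\<Sum>k. measure M (U (m + k)))"
    unfolding BU by (rule finite_measure_subadditive_countably) (use Um su in auto)
  also have "\<dots> \<le> (real T + 1) * n ^ 5 * D * \<rho> ^ m * (1 / (1 - \<rho>))"
    using suminf_le[OF le su sums_summable[OF s]] sums_unique[OF s] by simp
  finally show "measure M (B m) \<le> (real T + 1) * n ^ 5 * D * 5 * (4/5) ^ m"
    by (simp add: \<rho>_def mult_ac)
qed

text \<open>Increments, not values, are the arguments, because it is their characteristic functions
  that are computed; scalar coordinates fit \<open>levy_multivariate\<close>. Paths built in this
  way start at 0.\<close>

definition path_of_increments :: "nat \<Rightarrow> (nat \<times> 'n::finite \<Rightarrow> real) \<Rightarrow> real \<Rightarrow> real^'n" where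
  "path_of_increments m x = restrict (interp m (m * 2 ^ m) (\<lambda>i. \<Sum>l<i. (\<chi> b. x (l, b)))) {0..}"

lemma path_dist_path_of_increments:
  "path_dist (path_of_increments m x) (path_of_increments m y)
     \<le> (\<Sum>i\<le>m * 2 ^ m. norm ((\<Sum>l<i. (\<chi> b. x (l, b))) - (\<Sum>l<i. (\<chi> b. y (l, b))) :: real^'n::finite))"
proof (rule path_dist_least)
  fix t :: real assume t: "t \<ge> 0"
  let ?a = "\<lambda>i. \<Sum>l<i. (\<chi> b. x (l, b)) :: real^'n" and ?a' = "\<lambda>i. \<Sum>l<i. (\<chi> b. y (l, b)) :: real^'n"
  let ?c = "\<lambda>i. max 0 (1 - \<bar>2 ^ m * t - real i\<bar>)"
  have "dist (path_of_increments m x t) (path_of_increments m y t) = norm (\<Sum>i\<le>m * 2 ^ m. ?c i *\<^sub>R (?a i - ?a' i))"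
    using t by (simp add: path_of_increments_def interp_def dist_norm scaleR_diff_right sum_subtractf)
  also have "\<dots> \<le> (\<Sum>i\<le>m * 2 ^ m. norm (?a i - ?a' i))"
    by (intro order_trans[OF norm_sum] sum_mono) (auto intro: mult_left_le_one_le)
  finally show "min (dist (path_of_increments m x t) (path_of_increments m y t)) (1 / (1 + t))
     \<le> (\<Sum>i\<le>m * 2 ^ m. norm (?a i - ?a' i))" by linarith
qed

lemma continuous_on_lipschitz_path_of_increments:
  fixes \<psi> :: "(real \<Rightarrow> real^'n) \<Rightarrow> real"
  assumes \<psi>: "path_lipschitz \<Lambda> \<psi>"
  shows "continuous_on UNIV (\<lambda>x. \<psi> (path_of_increments m x))"
  unfolding continuous_on_eq_continuous_at[OF open_UNIV]
proof
  fix y :: "nat \<times> 'n \<Rightarrow> real"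
  let ?a = "\<lambda>i x. \<Sum>l<i. (\<chi> b. x (l, b)) :: real^'n"
  have co: "continuous_on UNIV (\<lambda>x. ?a i x)" for i
    by (intro continuous_intros continuous_on_vec_lambda continuous_on_product_coordinates)
  have "continuous_on UNIV (\<lambda>x. \<Lambda> * (\<Sum>i\<le>m * 2 ^ m. norm (?a i x - ?a i y)))"
    by (intro continuous_on_mult_left continuous_on_sum continuous_on_norm continuous_on_diff co continuous_on_const)
  then have "isCont (\<lambda>x. \<Lambda> * (\<Sum>i\<le>m * 2 ^ m. norm (?a i x - ?a i y))) y"
    by (simp add: continuous_on_eq_continuous_at)
  then have lim: "((\<lambda>x. \<Lambda> * (\<Sum>i\<le>m * 2 ^ m. norm (?a i x - ?a i y))) \<longlongrightarrow> 0) (at y)"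
    by (simp add: isCont_def)
  have bd: "\<bar>\<psi> (path_of_increments m x) - \<psi> (path_of_increments m y)\<bar> \<le> \<Lambda> * (\<Sum>i\<le>m * 2 ^ m. norm (?a i x - ?a i y))" for x
  proof -
    have "\<bar>\<psi> (path_of_increments m x) - \<psi> (path_of_increments m y)\<bar> \<le> \<Lambda> * path_dist (path_of_increments m x) (path_of_increments m y)"
      using \<psi> restrict_interp_path_space unfolding path_lipschitz_def path_of_increments_def by blast
    also have "\<dots> \<le> \<Lambda> * (\<Sum>i\<le>m * 2 ^ m. norm (?a i x - ?a i y))"
      using \<psi> by (intro mult_left_mono path_dist_path_of_increments) (simp add: path_lipschitz_def)
    finally show ?thesis .
  qed
  have "((\<lambda>x. \<psi> (path_of_increments m x) - \<psi> (path_of_increments m y)) \<longlongrightarrow> 0) (at y)"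
    by (rule Lim_null_comparison[OF _ lim]) (use bd in simp)
  then show "isCont (\<lambda>x. \<psi> (path_of_increments m x)) y"
    unfolding isCont_def by (rule LIM_zero_cancel)
qed

lemma grid_path_of_increments:
  assumes "Z 0 \<omega> = 0"
  shows "grid_path m Z \<omega> = path_of_increments m (\<lambda>i. if i \<in> {..<m * 2 ^ m} \<times> UNIV
     then (Z (grid m (Suc (fst i))) \<omega> - Z (grid m (fst i)) \<omega>) $ snd i else 0)"
proof -
  have tele: "Z (grid m i) \<omega> = (\<Sum>l<i. Z (grid m (Suc l)) \<omega> - Z (grid m l) \<omega>)" for i
    using sum_lessThan_telescope[of "\<lambda>l. Z (grid m l) \<omega>" i] assms by simp
  show ?thesis
    unfolding grid_path_def path_of_increments_def interp_def[abs_def]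
  proof (rule arg_cong[of _ _ "\<lambda>f. restrict f {0..}"], rule ext, rule sum.cong[OF refl])
    fix t i assume "i \<in> {..m * 2 ^ m}"
    then have "(\<Sum>l<i. \<chi> b. if (l, b) \<in> {..<m * 2 ^ m} \<times> UNIV
        then (Z (grid m (Suc (fst (l, b)))) \<omega> - Z (grid m (fst (l, b))) \<omega>) $ snd (l, b) else 0)
       = (\<Sum>l<i. Z (grid m (Suc l)) \<omega> - Z (grid m l) \<omega>)"
      by (intro sum.cong) (auto simp: vec_eq_iff)
    then show "max 0 (1 - \<bar>2 ^ m * t - real i\<bar>) *\<^sub>R Z (grid m i) \<omega> = max 0 (1 - \<bar>2 ^ m * t - real i\<bar>) *\<^sub>R
       (\<Sum>l<i. \<chi> b. if (l, b) \<in> {..<m * 2 ^ m} \<times> UNIV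
        then (Z (grid m (Suc (fst (l, b)))) \<omega> - Z (grid m (fst (l, b))) \<omega>) $ snd (l, b) else 0)"
      by (simp only: tele[of i])
  qed
qed

section \<open>Convergence of discretized paths and the discretization error\<close>

definition inc_coord :: "nat \<Rightarrow> (real \<Rightarrow> 'w \<Rightarrow> real^'n) \<Rightarrow> nat \<times> 'n \<Rightarrow> 'w \<Rightarrow> real" where
  "inc_coord m Z i \<omega> = axis (snd i) 1 \<bullet> (Z (grid m (Suc (fst i))) \<omega> - Z (grid m (fst i)) \<omega>)"

lemma inc_coord_measurable:
  assumes "continuous_process M Z"
  shows "inc_coord m Z i \<in> borel_measurable M"
proof -
  have [measurable]: "Z (grid m l) \<in> borel_measurable M" for l
    using assms by (simp add: continuous_process_def)
  show ?thesis unfolding inc_coord_def[abs_def] by measurable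
qed

lemma sum_inc_coord:
  "(\<Sum>i\<in>{..<p} \<times> UNIV. u i * inc_coord m Z i \<omega>) = grid_sum m p (\<lambda>l. \<chi> b. u (l, b)) Z \<omega>"
proof -
  have "(\<Sum>i\<in>{..<p} \<times> UNIV. u i * inc_coord m Z i \<omega>) = (\<Sum>l<p. \<Sum>b\<in>UNIV. u (l, b) * inc_coord m Z (l, b) \<omega>)"
    by (simp add: sum.cartesian_product')
  then show ?thesis
    by (simp add: grid_sum_def inc_coord_def inner_vec_def[of "vec_lambda _"] inner_axis')
qed

lemma grid_path_inc_coord:
  fixes Z :: "real \<Rightarrow> 'w \<Rightarrow> real^'n"
  assumes "Z 0 \<omega> = 0"
  shows "grid_path m Z \<omega> = path_of_increments m (\<lambda>i. if i \<in> {..<m * 2 ^ m} \<times> UNIV then inc_coord m Z i \<omega> else 0)"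
  unfolding grid_path_of_increments[of Z, OF assms] inc_coord_def
  by (intro arg_cong[of _ _ "path_of_increments m"] ext) (auto simp: inner_axis')

lemma grid_path_measurable:
  fixes Z :: "real \<Rightarrow> 'w \<Rightarrow> real^'n"
  assumes Z: "continuous_process M Z"
  shows "grid_path m Z \<in> measurable M path_borel"
proof -
  have [measurable]: "Z (grid m l) \<in> borel_measurable M" for l
    using Z by (simp add: continuous_process_def)
  have "continuous_process M (\<lambda>t \<omega>. interp m (m * 2 ^ m) (\<lambda>i. Z (grid m i) \<omega>) t)"
    unfolding continuous_process_def
  proof (intro conjI allI impI ballI continuous_on_interp)
    show "(\<lambda>\<omega>. interp m (m * 2 ^ m) (\<lambda>i. Z (grid m i) \<omega>) t) \<in> borel_measurable M" for t
      unfolding interp_def by measurable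
  qed
  from trajectory_measurable[OF this] show ?thesis
    by (simp add: grid_path_def[abs_def] trajectory_def[abs_def] restrict_def)
qed

text \<open>At a fixed level the path is a continuous function of finitely many increments, so
  \<open>levy_multivariate\<close> applies; its tightness condition follows from the fourth moments
  by \<open>markov_fourth\<close>.\<close>

lemma grid_path_expectation_tendsto:
  fixes X :: "nat \<Rightarrow> real \<Rightarrow> 'w \<Rightarrow> real^'n" and Y :: "real \<Rightarrow> 'v \<Rightarrow> real^'n"
  assumes M: "prob_space M" and N: "prob_space N"
    and X: "\<And>K. continuous_process M (X K)" and Y: "continuous_process N Y"
    and X0: "\<And>K. AE \<omega> in M. X K 0 \<omega> = 0" and Y0: "AE \<omega> in N. Y 0 \<omega> = 0"
    and conv: "\<And>p w. (\<lambda>K. (CLINT \<omega>|M. iexp (grid_sum m p w (X K) \<omega>))) \<longlonglongrightarrow> (CLINT \<omega>|N. iexp (grid_sum m p w Y \<omega>))"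
    and D: "D \<ge> 0"
    and i4: "\<And>K b i. b \<in> Basis \<Longrightarrow> integrable M (\<lambda>\<omega>. (b \<bullet> (X K (grid m (Suc i)) \<omega> - X K (grid m i) \<omega>)) ^ 4)"
    and E4: "\<And>K b i. b \<in> Basis \<Longrightarrow> (\<integral>\<omega>. (b \<bullet> (X K (grid m (Suc i)) \<omega> - X K (grid m i) \<omega>)) ^ 4 \<partial>M) \<le> D"
    and \<psi>: "path_lipschitz \<Lambda> \<psi>" and C: "\<And>f. f \<in> path_space \<Longrightarrow> \<bar>\<psi> f\<bar> \<le> C"
  shows "(\<lambda>K. \<integral>\<omega>. \<psi> (grid_path m (X K) \<omega>) \<partial>M) \<longlonglongrightarrow> (\<integral>\<omega>. \<psi> (grid_path m Y \<omega>) \<partial>N)"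
proof -
  interpret M: prob_space M by fact
  define F where "F = {..<m * 2 ^ m} \<times> (UNIV :: 'n set)"
  have F: "finite F" by (simp add: F_def)
  define g where "g x = \<psi> (path_of_increments m x)" for x :: "nat \<times> 'n \<Rightarrow> real"
  have gc: "continuous_on UNIV g"
    unfolding g_def[abs_def] by (rule continuous_on_lipschitz_path_of_increments[OF \<psi>])
  have gC: "\<bar>g x\<bar> \<le> C" for x
    unfolding g_def path_of_increments_def by (intro C restrict_interp_path_space)
  have \<psi>m: "\<psi> \<in> borel_measurable path_borel"
    by (rule continuous_map_measurable_path_borel[OF path_lipschitz_continuous[OF \<psi>]])
  have cutm: "(\<lambda>\<omega>. g (\<lambda>i. if i \<in> F then inc_coord m Z i \<omega> else 0)) \<in> borel_measurable P"
    if "continuous_process P Z" for P and Z :: "real \<Rightarrow> 'z \<Rightarrow> real^'n"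
  proof -
    have "(\<lambda>\<omega> i. if i \<in> F then inc_coord m Z i \<omega> else 0) \<in> borel_measurable P"
    proof (rule measurable_coordinatewise_then_product)
      show "(\<lambda>\<omega>. if i \<in> F then inc_coord m Z i \<omega> else 0) \<in> borel_measurable P" for i
        using inc_coord_measurable[OF that] by (cases "i \<in> F") auto
    qed
    then show ?thesis by (rule measurable_compose[OF _ borel_measurable_continuous_onI[OF gc]])
  qed
  have eX: "(\<integral>\<omega>. \<psi> (grid_path m (X K) \<omega>) \<partial>M) = (\<integral>\<omega>. g (\<lambda>i. if i \<in> F then inc_coord m (X K) i \<omega> else 0) \<partial>M)" for K
  proof (rule integral_cong_AE)
    show "AE \<omega> in M. \<psi> (grid_path m (X K) \<omega>) = g (\<lambda>i. if i \<in> F then inc_coord m (X K) i \<omega> else 0)"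
      using X0[of K] by eventually_elim (simp add: g_def grid_path_inc_coord F_def)
  qed (use cutm[OF X] measurable_compose[OF grid_path_measurable[OF X] \<psi>m] in auto)
  have eY: "(\<integral>\<omega>. \<psi> (grid_path m Y \<omega>) \<partial>N) = (\<integral>\<omega>. g (\<lambda>i. if i \<in> F then inc_coord m Y i \<omega> else 0) \<partial>N)"
  proof (rule integral_cong_AE)
    show "AE \<omega> in N. \<psi> (grid_path m Y \<omega>) = g (\<lambda>i. if i \<in> F then inc_coord m Y i \<omega> else 0)"
      using Y0 by eventually_elim (simp add: g_def grid_path_inc_coord F_def)
  qed (use cutm[OF Y] measurable_compose[OF grid_path_measurable[OF Y] \<psi>m] in auto)
  show ?thesis
    unfolding eX eY
  proof (rule levy_multivariate[OF M N F _ _ _ _ gc gC])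
    show "(\<lambda>K. (CLINT \<omega>|M. iexp (\<Sum>i\<in>F. u i * inc_coord m (X K) i \<omega>))) \<longlonglongrightarrow> (CLINT \<omega>|N. iexp (\<Sum>i\<in>F. u i * inc_coord m Y i \<omega>))" for u
      unfolding F_def sum_inc_coord by (rule conv)
    fix \<delta> :: real assume \<delta>: "\<delta> > 0"
    \<comment> \<open>\<open>R \<ge> 1\<close> allows \<open>D / R ^ 4\<close> to be replaced by
      \<open>D / R\<close>.\<close>
    define R0 where "R0 = max 1 (real (card F) * D / \<delta>)"
    have "measure M {\<omega> \<in> space M. \<exists>i\<in>F. R < \<bar>inc_coord m (X K) i \<omega>\<bar>} \<le> \<delta>" if R: "R \<ge> R0" for R K
    proof -
      have R1: "R \<ge> 1" "real (card F) * D \<le> R * \<delta>" using R \<delta> by (auto simp: R0_def pos_divide_le_eq)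
      define A where "A i = {\<omega> \<in> space M. R < \<bar>inc_coord m (X K) i \<omega>\<bar>}" for i
      have [measurable]: "inc_coord m (X K) i \<in> borel_measurable M" for i by (rule inc_coord_measurable[OF X])
      have Am: "A i \<in> sets M" for i unfolding A_def by measurable
      have "measure M {\<omega> \<in> space M. \<exists>i\<in>F. R < \<bar>inc_coord m (X K) i \<omega>\<bar>} = measure M (\<Union>i\<in>F. A i)"
        by (rule arg_cong[of _ _ "measure M"]) (auto simp: A_def)
      also have "\<dots> \<le> (\<Sum>i\<in>F. measure M (A i))" using Am F by (intro measure_UNION_le) auto
      also have "\<dots> \<le> (\<Sum>i\<in>F. D / R)"
      proof (rule sum_mono)
        fix i :: "nat \<times> 'n"
        have b: "axis (snd i) 1 \<in> (Basis :: (real^'n) set)" by (simp add: axis_in_Basis_iff)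
        have "measure M (A i) \<le> (\<integral>\<omega>. inc_coord m (X K) i \<omega> ^ 4 \<partial>M) / R ^ 4"
          unfolding A_def
        proof (rule markov_fourth[OF M inc_coord_measurable[OF X]])
          show "integrable M (\<lambda>\<omega>. inc_coord m (X K) i \<omega> ^ 4)"
            unfolding inc_coord_def by (rule i4[OF b])
        qed (use R1 in simp)
        also have "\<dots> \<le> D / R ^ 4" unfolding inc_coord_def by (intro divide_right_mono E4[OF b]) simp
        also have "\<dots> \<le> D / R"
          using R1 D self_le_power[of R 4] by (intro divide_left_mono) auto
        finally show "measure M (A i) \<le> D / R" .
      qed
      also have "\<dots> = real (card F) * D / R" by simp
      also have "\<dots> \<le> \<delta>" using R1 by (simp add: pos_divide_le_eq mult.commute)
      finally show ?thesis .
    qed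
    then show "\<exists>R0. \<forall>R\<ge>R0. \<forall>K. measure M {\<omega> \<in> space M. \<exists>i\<in>F. R < \<bar>inc_coord m (X K) i \<omega>\<bar>} \<le> \<delta>" by blast
  qed (use inc_coord_measurable[OF X] inc_coord_measurable[OF Y] in auto)
qed

text \<open>Off the bad event \<open>dyadic_chaining\<close> keeps the path within
  \<open>10 * (9/10) ^ m\<close> of its interpolation up to time \<open>T\<close>; on it the
  difference of the two values of \<open>\<psi>\<close> is at most \<open>2 * C\<close>. The bound
  involves the process only through \<open>D\<close>, so it is uniform along a sequence.\<close>

lemma grid_path_expectation_error:
  fixes Z :: "real \<Rightarrow> 'w \<Rightarrow> real^'n"
  assumes M: "prob_space M" and Z: "continuous_process M Z" and D: "D \<ge> 0"
    and i4: "\<And>b j i. b \<in> Basis \<Longrightarrow> integrable M (\<lambda>\<omega>. (b \<bullet> (Z (grid j (Suc i)) \<omega> - Z (grid j i) \<omega>)) ^ 4)"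
    and E4: "\<And>b j i. b \<in> Basis \<Longrightarrow> (\<integral>\<omega>. (b \<bullet> (Z (grid j (Suc i)) \<omega> - Z (grid j i) \<omega>)) ^ 4 \<partial>M) \<le> D * (1 / 2 ^ j)\<^sup>2"
    and \<psi>: "path_lipschitz \<Lambda> \<psi>" and C: "\<And>f. f \<in> path_space \<Longrightarrow> \<bar>\<psi> f\<bar> \<le> C"
    and m: "m \<ge> T + 1"
  shows "\<bar>(\<integral>\<omega>. \<psi> (trajectory Z \<omega>) \<partial>M) - (\<integral>\<omega>. \<psi> (grid_path m Z \<omega>) \<partial>M)\<bar> \<le>
    \<Lambda> * (10 * (9/10) ^ m + 1 / (1 + real T)) + 2 * C * ((real T + 1) * real CARD('n) ^ 5 * D * 5 * (4/5) ^ m)"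
proof -
  interpret M: prob_space M by fact
  have \<Lambda>: "\<Lambda> \<ge> 0" using \<psi> by (simp add: path_lipschitz_def)
  have C0: "C \<ge> 0" using C[OF restrict_interp_path_space, of 0 0 "\<lambda>_. 0"] by linarith
  have \<psi>m: "\<psi> \<in> borel_measurable path_borel"
    by (rule continuous_map_measurable_path_borel[OF path_lipschitz_continuous[OF \<psi>]])
  define B where "B = {\<omega> \<in> space M. \<exists>j\<ge>m. \<exists>i<(T + 1) * 2 ^ j. (9/10) ^ j < norm (Z (grid j (Suc i)) \<omega> - Z (grid j i) \<omega>)}"
  note bad = measure_bad_increments[OF M Z D i4 E4, where T = T and m = m, folded B_def]
  have iB: "integrable M (indicator B :: _ \<Rightarrow> real)"
    by (rule integrable_real_indicator) (simp_all add: bad(1) less_top[symmetric])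
  have gp: "grid_path m Z \<omega> \<in> path_space" for \<omega> unfolding grid_path_def by (rule restrict_interp_path_space)
  have i: "integrable M (\<lambda>\<omega>. \<psi> (trajectory Z \<omega>))" "integrable M (\<lambda>\<omega>. \<psi> (grid_path m Z \<omega>))"
    using measurable_compose[OF trajectory_measurable[OF Z] \<psi>m] measurable_compose[OF grid_path_measurable[OF Z] \<psi>m]
      C trajectory_in_path_space[OF Z] gp
    by (auto intro!: M.integrable_const_bound[of _ C] AE_I2)
  define \<epsilon> where "\<epsilon> = \<Lambda> * (10 * (9/10) ^ m + 1 / (1 + real T))"
  have \<epsilon>: "\<epsilon> \<ge> 0" unfolding \<epsilon>_def using \<Lambda> by (intro mult_nonneg_nonneg add_nonneg_nonneg) auto
  have "\<bar>(\<integral>\<omega>. \<psi> (trajectory Z \<omega>) \<partial>M) - (\<integral>\<omega>. \<psi> (grid_path m Z \<omega>) \<partial>M)\<bar> =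
     \<bar>\<integral>\<omega>. \<psi> (trajectory Z \<omega>) - \<psi> (grid_path m Z \<omega>) \<partial>M\<bar>" using i by simp
  also have "\<dots> \<le> (\<integral>\<omega>. \<bar>\<psi> (trajectory Z \<omega>) - \<psi> (grid_path m Z \<omega>)\<bar> \<partial>M)" by (rule integral_abs_bound)
  also have "\<dots> \<le> (\<integral>\<omega>. \<epsilon> + 2 * C * indicator B \<omega> \<partial>M)"
  proof (rule integral_mono)
    fix \<omega> assume w: "\<omega> \<in> space M"
    have tp: "trajectory Z \<omega> \<in> path_space" by (rule trajectory_in_path_space[OF Z w])
    show "\<bar>\<psi> (trajectory Z \<omega>) - \<psi> (grid_path m Z \<omega>)\<bar> \<le> \<epsilon> + 2 * C * indicator B \<omega>"
    proof (cases "\<omega> \<in> B")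
      case True
      then show ?thesis using C[OF tp] C[OF gp, of \<omega>] \<epsilon> by simp
    next
      case False
      have co: "continuous_on {0..} (\<lambda>t. Z t \<omega>)" using Z w by (simp add: continuous_process_def)
      have "path_dist (trajectory Z \<omega>) (grid_path m Z \<omega>) \<le> max (10 * (9/10) ^ m) (1 / (1 + real T))"
      proof (rule path_dist_grid_path)
        show "real m \<ge> real T + 1" using m by linarith
        fix t i assume t: "t \<in> {0..real T}" "grid m i \<le> t" "t \<le> grid m (Suc i)"
        show "norm (Z (grid m i) \<omega> - Z t \<omega>) \<le> 10 * (9/10) ^ m \<and> norm (Z (grid m (Suc i)) \<omega> - Z t \<omega>) \<le> 10 * (9/10) ^ m"
        proof (rule dyadic_chaining[OF co t(1) _ t(2,3)])
          fix j l assume "m \<le> j" "l < (T + 1) * 2 ^ j"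
          then have "\<not> (9/10) ^ j < norm (Z (grid j (Suc l)) \<omega> - Z (grid j l) \<omega>)"
            using False w unfolding B_def by blast
          then show "norm (Z (grid j (Suc l)) \<omega> - Z (grid j l) \<omega>) \<le> (9/10) ^ j" by simp
        qed
      qed simp
      also have "\<dots> \<le> 10 * (9/10) ^ m + 1 / (1 + real T)" by simp
      finally have "\<Lambda> * path_dist (trajectory Z \<omega>) (grid_path m Z \<omega>) \<le> \<epsilon>"
        unfolding \<epsilon>_def using \<Lambda> by (rule mult_left_mono)
      moreover have "\<bar>\<psi> (trajectory Z \<omega>) - \<psi> (grid_path m Z \<omega>)\<bar> \<le> \<Lambda> * path_dist (trajectory Z \<omega>) (grid_path m Z \<omega>)"
        using \<psi> tp gp by (simp add: path_lipschitz_def)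
      ultimately show ?thesis using False by simp
    qed
  qed (use i iB in auto)
  also have "\<dots> = \<epsilon> + 2 * C * measure M B" using iB bad(1) by (simp add: M.prob_space)
  also have "\<dots> \<le> \<epsilon> + 2 * C * ((real T + 1) * real CARD('n) ^ 5 * D * 5 * (4/5) ^ m)"
    using bad(2) C0 by (intro add_left_mono mult_left_mono) auto
  finally show ?thesis unfolding \<epsilon>_def .
qed

text \<open>For the sequence the fourth moments make the discretization error uniform in
  \<open>K\<close>. The limit is a single process with continuous paths, whose interpolations
  converge pathwise, so dominated convergence suffices there; this is why the moment conditions
  concern \<open>X\<close> alone.\<close>

lemma converges_in_law_criterion:
  fixes X :: "nat \<Rightarrow> real \<Rightarrow> 'w \<Rightarrow> real^'n" and Y :: "real \<Rightarrow> 'v \<Rightarrow> real^'n"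
  assumes M: "prob_space M" and N: "prob_space N"
    and X: "\<And>K. continuous_process M (X K)" and Y: "continuous_process N Y"
    and X0: "\<And>K. AE \<omega> in M. X K 0 \<omega> = 0" and Y0: "AE \<omega> in N. Y 0 \<omega> = 0"
    and conv: "\<And>j p w. (\<lambda>K. (CLINT \<omega>|M. iexp (grid_sum j p w (X K) \<omega>))) \<longlonglongrightarrow> (CLINT \<omega>|N. iexp (grid_sum j p w Y \<omega>))"
    and D: "D \<ge> 0"
    and i4: "\<And>K b j i. b \<in> Basis \<Longrightarrow> integrable M (\<lambda>\<omega>. (b \<bullet> (X K (grid j (Suc i)) \<omega> - X K (grid j i) \<omega>)) ^ 4)"
    and E4: "\<And>K b j i. b \<in> Basis \<Longrightarrow> (\<integral>\<omega>. (b \<bullet> (X K (grid j (Suc i)) \<omega> - X K (grid j i) \<omega>)) ^ 4 \<partial>M) \<le> D * (1 / 2 ^ j)\<^sup>2"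
  shows "converges_in_law M X N Y"
proof -
  interpret M: prob_space M by fact
  interpret N: prob_space N by fact
  have Xm: "trajectory (X K) \<in> measurable M path_borel" for K by (rule trajectory_measurable[OF X])
  have Ym: "trajectory Y \<in> measurable N path_borel" by (rule trajectory_measurable[OF Y])
  have lip: "(\<lambda>K. \<integral>f. \<psi> f \<partial>law M (X K)) \<longlonglongrightarrow> (\<integral>f. \<psi> f \<partial>law N Y)"
    if \<psi>: "path_lipschitz \<Lambda> \<psi>" and C: "\<forall>f\<in>path_space. \<bar>\<psi> f\<bar> \<le> C" for \<psi> \<Lambda> C
  proof -
    have \<psi>m: "\<psi> \<in> borel_measurable path_borel"
      by (rule continuous_map_measurable_path_borel[OF path_lipschitz_continuous[OF \<psi>]])
    have \<Lambda>: "\<Lambda> \<ge> 0" using \<psi> by (simp add: path_lipschitz_def)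
    have C': "\<And>f. f \<in> path_space \<Longrightarrow> \<bar>\<psi> f\<bar> \<le> C" using C by blast
    have gp: "grid_path m Z \<omega> \<in> path_space" for m and Z :: "real \<Rightarrow> 'v \<Rightarrow> real^'n" and \<omega>
      unfolding grid_path_def by (rule restrict_interp_path_space)
    have lawX: "(\<integral>f. \<psi> f \<partial>law M (X K)) = (\<integral>\<omega>. \<psi> (trajectory (X K) \<omega>) \<partial>M)" for K
      unfolding law_def by (rule integral_distr[OF Xm \<psi>m])
    have lawY: "(\<integral>f. \<psi> f \<partial>law N Y) = (\<integral>\<omega>. \<psi> (trajectory Y \<omega>) \<partial>N)"
      unfolding law_def by (rule integral_distr[OF Ym \<psi>m])
    have limY: "(\<lambda>m. \<integral>\<omega>. \<psi> (grid_path m Y \<omega>) \<partial>N) \<longlonglongrightarrow> (\<integral>\<omega>. \<psi> (trajectory Y \<omega>) \<partial>N)"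
    proof (rule integral_dominated_convergence[where w = "\<lambda>_. C"])
      show "AE \<omega> in N. (\<lambda>m. \<psi> (grid_path m Y \<omega>)) \<longlonglongrightarrow> \<psi> (trajectory Y \<omega>)"
      proof (rule AE_I2)
        fix \<omega> assume w: "\<omega> \<in> space N"
        have "(\<lambda>m. \<Lambda> * path_dist (trajectory Y \<omega>) (grid_path m Y \<omega>)) \<longlonglongrightarrow> \<Lambda> * 0"
          using Y w by (intro tendsto_intros path_dist_grid_path_tendsto) (simp add: continuous_process_def)
        then have l0: "(\<lambda>m. \<Lambda> * path_dist (trajectory Y \<omega>) (grid_path m Y \<omega>)) \<longlonglongrightarrow> 0" by simp
        have "norm (\<psi> (grid_path m Y \<omega>) - \<psi> (trajectory Y \<omega>)) \<le> \<Lambda> * path_dist (trajectory Y \<omega>) (grid_path m Y \<omega>)" for m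
          using \<psi> gp trajectory_in_path_space[OF Y w] unfolding path_lipschitz_def
          by (simp add: path_dist_commute[of "trajectory Y \<omega>"])
        then have "(\<lambda>m. \<psi> (grid_path m Y \<omega>) - \<psi> (trajectory Y \<omega>)) \<longlonglongrightarrow> 0"
          by (rule Lim_null_comparison[OF always_eventually[OF allI] l0])
        then show "(\<lambda>m. \<psi> (grid_path m Y \<omega>)) \<longlonglongrightarrow> \<psi> (trajectory Y \<omega>)" by (rule LIM_zero_cancel)
      qed
    qed (use C' gp measurable_compose[OF grid_path_measurable[OF Y] \<psi>m] measurable_compose[OF Ym \<psi>m] in auto)
    show ?thesis
      unfolding lawX lawY
    proof (rule LIMSEQ_I)
      fix r :: real assume r: "r > 0"
      \<comment> \<open>The order of choice matters: \<open>T\<close> for the late times, then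
        \<open>m\<close>, since \<open>Q\<close> grows with \<open>T\<close>, and \<open>K\<close>
        last.\<close>
      obtain T :: nat where T: "4 * \<Lambda> / r < real T" using reals_Archimedean2 by blast
      then have T: "\<Lambda> * (1 / (1 + real T)) < r / 4" using r by (simp add: field_simps)
      define Q where "Q = (real T + 1) * real CARD('n) ^ 5 * D * 5"
      have "(\<lambda>m. \<Lambda> * (10 * (9/10) ^ m) + 2 * C * (Q * (4/5) ^ m)) \<longlonglongrightarrow> \<Lambda> * (10 * 0) + 2 * C * (Q * 0)"
        by (intro tendsto_intros LIMSEQ_power_zero) auto
      then have "\<forall>\<^sub>F m in sequentially. \<Lambda> * (10 * (9/10) ^ m) + 2 * C * (Q * (4/5) ^ m) < r / 4"
        by (rule order_tendstoD) (use r in simp)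
      moreover have "\<forall>\<^sub>F m in sequentially. dist (\<integral>\<omega>. \<psi> (grid_path m Y \<omega>) \<partial>N) (\<integral>\<omega>. \<psi> (trajectory Y \<omega>) \<partial>N) < r / 4"
        by (rule tendstoD[OF limY]) (use r in simp)
      ultimately have "\<forall>\<^sub>F m in sequentially. \<Lambda> * (10 * (9/10) ^ m) + 2 * C * (Q * (4/5) ^ m) < r / 4 \<and>
         dist (\<integral>\<omega>. \<psi> (grid_path m Y \<omega>) \<partial>N) (\<integral>\<omega>. \<psi> (trajectory Y \<omega>) \<partial>N) < r / 4 \<and> T + 1 \<le> m"
        using eventually_ge_at_top[of "T + 1"] by eventually_elim auto
      then obtain m where m: "\<Lambda> * (10 * (9/10) ^ m) + 2 * C * (Q * (4/5) ^ m) < r / 4"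
        "dist (\<integral>\<omega>. \<psi> (grid_path m Y \<omega>) \<partial>N) (\<integral>\<omega>. \<psi> (trajectory Y \<omega>) \<partial>N) < r / 4" "m \<ge> T + 1"
        by (auto simp: eventually_sequentially)
      have E4': "(\<integral>\<omega>. (b \<bullet> (X K (grid m (Suc i)) \<omega> - X K (grid m i) \<omega>)) ^ 4 \<partial>M) \<le> D" if "b \<in> Basis" for K b i
      proof -
        have "D * (1 / 2 ^ m)\<^sup>2 \<le> D * 1" using D by (intro mult_left_mono) (auto simp: power_le_one)
        then show ?thesis using E4[OF that, of K m i] by linarith
      qed
      have "(\<lambda>K. \<integral>\<omega>. \<psi> (grid_path m (X K) \<omega>) \<partial>M) \<longlonglongrightarrow> (\<integral>\<omega>. \<psi> (grid_path m Y \<omega>) \<partial>N)"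
        by (rule grid_path_expectation_tendsto[OF M N X Y X0 Y0 conv D i4 E4' \<psi> C'])
      then have "\<forall>\<^sub>F K in sequentially. dist (\<integral>\<omega>. \<psi> (grid_path m (X K) \<omega>) \<partial>M) (\<integral>\<omega>. \<psi> (grid_path m Y \<omega>) \<partial>N) < r / 4"
        by (rule tendstoD) (use r in simp)
      then obtain K0 where K0: "\<And>K. K \<ge> K0 \<Longrightarrow> dist (\<integral>\<omega>. \<psi> (grid_path m (X K) \<omega>) \<partial>M) (\<integral>\<omega>. \<psi> (grid_path m Y \<omega>) \<partial>N) < r / 4"
        by (auto simp: eventually_sequentially)
      have "norm ((\<integral>\<omega>. \<psi> (trajectory (X K) \<omega>) \<partial>M) - (\<integral>\<omega>. \<psi> (trajectory Y \<omega>) \<partial>N)) < r" if K: "K \<ge> K0" for K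
      proof -
        have "\<bar>(\<integral>\<omega>. \<psi> (trajectory (X K) \<omega>) \<partial>M) - (\<integral>\<omega>. \<psi> (grid_path m (X K) \<omega>) \<partial>M)\<bar>
          \<le> \<Lambda> * (10 * (9/10) ^ m + 1 / (1 + real T)) + 2 * C * (Q * (4/5) ^ m)"
          unfolding Q_def by (rule grid_path_expectation_error[OF M X D i4 E4 \<psi> C' m(3)])
        then show ?thesis using m(1,2) K0[OF K] T unfolding dist_real_def real_norm_def distrib_left by linarith
      qed
      then show "\<exists>no. \<forall>K\<ge>no. norm ((\<integral>\<omega>. \<psi> (trajectory (X K) \<omega>) \<partial>M) - (\<integral>\<omega>. \<psi> (trajectory Y \<omega>) \<partial>N)) < r" by blast
    qed
  qed
  show ?thesis
    unfolding converges_in_law_def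
  proof (intro conjI allI impI Xm Ym)
    fix \<phi> :: "(real \<Rightarrow> real^'n) \<Rightarrow> real"
    assume c: "continuous_map path_topology euclideanreal \<phi>" and "\<exists>C. \<forall>f\<in>path_space. \<bar>\<phi> f\<bar> \<le> C"
    then obtain C where C: "\<And>f. f \<in> path_space \<Longrightarrow> \<bar>\<phi> f\<bar> \<le> C" by blast
    show "(\<lambda>K. \<integral>f. \<phi> f \<partial>law M (X K)) \<longlonglongrightarrow> (\<integral>f. \<phi> f \<partial>law N Y)"
    proof (rule tendsto_of_lipschitz[OF _ _ _ _ _ c C])
      show "prob_space (law M (X K))" for K unfolding law_def by (rule M.prob_space_distr[OF Xm])
      show "prob_space (law N Y)" unfolding law_def by (rule N.prob_space_distr[OF Ym])
    qed (use lip in \<open>auto simp: law_def\<close>)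
  qed
qed

section \<open>The limit process\<close>

lemma (in prob_space) converges_in_prob_add:
  assumes [measurable]: "\<And>m. X m \<in> borel_measurable M" "X' \<in> borel_measurable M"
    "\<And>m. Y m \<in> borel_measurable M" "Y' \<in> borel_measurable M"
    and X: "converges_in_prob M X X'" and Y: "converges_in_prob M Y Y'"
  shows "converges_in_prob M (\<lambda>m \<omega>. X m \<omega> + Y m \<omega>) (\<lambda>\<omega>. X' \<omega> + Y' \<omega>)"
  unfolding converges_in_prob_def
proof (intro allI impI)
  fix \<epsilon> :: real assume \<epsilon>: "\<epsilon> > 0"
  define A where "A m = {\<omega> \<in> space M. \<epsilon> / 2 < \<bar>X m \<omega> - X' \<omega>\<bar>}" for m
  define B where "B m = {\<omega> \<in> space M. \<epsilon> / 2 < \<bar>Y m \<omega> - Y' \<omega>\<bar>}" for m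
  have [measurable]: "A m \<in> sets M" "B m \<in> sets M" for m unfolding A_def B_def by measurable
  have e2: "\<epsilon> / 2 > 0" using \<epsilon> by simp
  have lim: "(\<lambda>m. prob (A m) + prob (B m)) \<longlonglongrightarrow> 0 + 0"
    using X[unfolded converges_in_prob_def, rule_format, OF e2] Y[unfolded converges_in_prob_def, rule_format, OF e2]
    unfolding A_def B_def by (rule tendsto_add)
  have le: "prob {\<omega> \<in> space M. \<epsilon> < \<bar>X m \<omega> + Y m \<omega> - (X' \<omega> + Y' \<omega>)\<bar>} \<le> prob (A m) + prob (B m)" for m
  proof -
    have "{\<omega> \<in> space M. \<epsilon> < \<bar>X m \<omega> + Y m \<omega> - (X' \<omega> + Y' \<omega>)\<bar>} \<subseteq> A m \<union> B m"
    proof (rule subsetI, rule ccontr)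
      fix \<omega> assume w: "\<omega> \<in> {\<omega> \<in> space M. \<epsilon> < \<bar>X m \<omega> + Y m \<omega> - (X' \<omega> + Y' \<omega>)\<bar>}" "\<omega> \<notin> A m \<union> B m"
      then have "\<bar>X m \<omega> - X' \<omega>\<bar> \<le> \<epsilon> / 2" "\<bar>Y m \<omega> - Y' \<omega>\<bar> \<le> \<epsilon> / 2" "\<epsilon> < \<bar>X m \<omega> + Y m \<omega> - (X' \<omega> + Y' \<omega>)\<bar>"
        by (auto simp: A_def B_def not_less)
      then show False by linarith
    qed
    then have "prob {\<omega> \<in> space M. \<epsilon> < \<bar>X m \<omega> + Y m \<omega> - (X' \<omega> + Y' \<omega>)\<bar>} \<le> prob (A m \<union> B m)"
      by (intro finite_measure_mono) auto
    also have "\<dots> \<le> prob (A m) + prob (B m)" by (rule measure_Un_le) auto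
    finally show ?thesis .
  qed
  show "(\<lambda>m. prob {\<omega> \<in> space M. \<epsilon> < \<bar>X m \<omega> + Y m \<omega> - (X' \<omega> + Y' \<omega>)\<bar>}) \<longlonglongrightarrow> 0"
    by (rule tendsto_sandwich[OF _ _ tendsto_const lim[simplified]]) (use le in auto)
qed

lemma eval_trajectory_measurable:
  fixes X :: "real \<Rightarrow> 'w \<Rightarrow> 'e::metric_space"
  assumes "t \<ge> 0" "\<And>\<omega>. \<omega> \<in> S \<Longrightarrow> trajectory X \<omega> \<in> path_space"
  shows "X t \<in> borel_measurable (vimage_algebra S (trajectory X) path_borel)"
proof -
  have "trajectory X \<in> measurable (vimage_algebra S (trajectory X) path_borel) path_borel"
    by (rule measurable_vimage_algebra1) (use assms(2) in \<open>auto simp: space_path_borel\<close>)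
  from measurable_compose[OF this eval_measurable[OF assms(1)]] show ?thesis
    using assms(1) by (simp add: trajectory_def)
qed

text \<open>Riemann sums of the variance rate \<open>|w|\<^sup>2 - E (w \<bullet> \<Theta>)\<^sup>2\<close> of \<open>w \<bullet> I\<close>.\<close>

definition variance_sum :: "real^'n \<Rightarrow> nat \<Rightarrow> nat \<Rightarrow> (nat \<Rightarrow> real^'n) \<Rightarrow> nat \<Rightarrow> real" where
  "variance_sum \<Theta>0 j p w m = (\<Sum>l<p * 2 ^ (m - j). ((norm (w (l div 2 ^ (m - j))))\<^sup>2
     - second_moment \<Theta>0 (w (l div 2 ^ (m - j))) (grid m l)) / 2 ^ m)"

lemma (in sphere_bm) quad_eq_variance_sum: "BI.quad j p w m = variance_sum \<Theta>0 j p w m"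
  unfolding quad_eq variance_sum_def msq_eq ..

locale limit_process = prob_space N for N :: "'v measure" +
  fixes G :: "real \<Rightarrow> 'v measure" and \<Theta>0 :: "real^'n"
    and \<beta> J :: "real \<Rightarrow> 'v \<Rightarrow> real" and B' L Minf :: "real \<Rightarrow> 'v \<Rightarrow> real^'n"
  assumes dim: "CARD('n) \<ge> 2"
    and \<Theta>0: "norm \<Theta>0 = 1"
    and beta: "brownian_motion N G UNIV \<beta>"
    and B': "brownian_motion N G {x. \<Theta>0 \<bullet> x = 0} B'"
    and indep_beta_B': "indep_set
                  (sets (vimage_algebra (space N) (trajectory \<beta>) path_borel))
                  (sets (vimage_algebra (space N) (trajectory B') path_borel))"
    and J: "stochastic_integral N G (*\<^sub>R) (\<lambda>s _. sqrt (1 - exp (- real CARD('n) * s))) \<beta> J"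
    and L: "stochastic_integral N G (*\<^sub>R)
              (\<lambda>s _. sqrt (1 + exp (- real CARD('n) * s) / (real CARD('n) - 1))) B' L"
    and Minf: "\<And>t \<omega>. Minf t \<omega> = sqrt (1 - 1 / real CARD('n)) *\<^sub>R (J t \<omega> *\<^sub>R \<Theta>0 + L t \<omega>)"
begin

definition n :: real where "n = real CARD('n)"

lemma n: "n \<ge> 2" using dim by (simp add: n_def)

text \<open>The orthogonal projection onto the hyperplane of \<open>B'\<close>. On that hyperplane
  \<open>w\<close> and \<open>P w\<close> have the same scalar products, which yields the adjoint
  required by \<open>brownian_integral\<close>.\<close>

definition P :: "real^'n \<Rightarrow> real^'n" where "P w = w - (\<Theta>0 \<bullet> w) *\<^sub>R \<Theta>0"

lemma \<Theta>0_inner: "\<Theta>0 \<bullet> \<Theta>0 = 1" using \<Theta>0 by (simp add: norm_eq_1)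

lemma P_in: "\<Theta>0 \<bullet> P w = 0" by (simp add: P_def inner_diff_right \<Theta>0_inner)

lemma norm_P: "(norm (P w))\<^sup>2 = (norm w)\<^sup>2 - (w \<bullet> \<Theta>0)\<^sup>2"
  unfolding P_def power2_norm_eq_inner
  by (simp add: inner_diff_left inner_diff_right \<Theta>0_inner inner_commute power2_eq_square algebra_simps)

definition h1 :: "real \<Rightarrow> real" where "h1 s = sqrt (1 - exp (- n * s))"
definition h2 :: "real \<Rightarrow> real" where "h2 s = sqrt (1 + exp (- n * s) / (n - 1))"

lemma h1: "s \<ge> 0 \<Longrightarrow> h1 s \<in> {0..1}" "s \<ge> 0 \<Longrightarrow> (h1 s)\<^sup>2 = 1 - exp (- n * s)"
  using n by (auto simp: h1_def)

lemma h2: "s \<ge> 0 \<Longrightarrow> h2 s \<in> {0..2}" "s \<ge> 0 \<Longrightarrow> (h2 s)\<^sup>2 = 1 + exp (- n * s) / (n - 1)"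
proof -
  assume s: "s \<ge> 0"
  have e1: "exp (- n * s) \<le> 1" using s n by simp
  define e where "e = exp (- n * s)"
  have "e \<le> 1" using e1 unfolding e_def .
  moreover have "0 < n - 1" "1 \<le> n - 1" using n by simp_all
  ultimately have "e / (n - 1) \<le> 1" by (simp add: pos_divide_le_eq)
  then have "exp (- n * s) / (n - 1) \<le> 1" unfolding e_def .
  moreover have "0 \<le> exp (- n * s) / (n - 1)" using n by simp
  \<comment> \<open>The fraction is at most 1 because \<open>n \<ge> 2\<close>, so \<open>h2\<close>
    is at most \<open>sqrt 2\<close>, rounded up to 2.\<close>
  ultimately have b: "0 \<le> 1 + exp (- n * s) / (n - 1)" "1 + exp (- n * s) / (n - 1) \<le> 2\<^sup>2" by auto
  then show "(h2 s)\<^sup>2 = 1 + exp (- n * s) / (n - 1)" by (simp add: h2_def)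
  show "h2 s \<in> {0..2}" using b real_le_lsqrt[of 2 "1 + exp (- n * s) / (n - 1)"] by (simp add: h2_def)
qed

sublocale BJ: brownian_integral N G UNIV \<beta> "(*\<^sub>R)" "\<lambda>s _. h1 s" J "(*)" "{0..1}" 1
proof (intro brownian_integral.intro[OF prob_space_axioms] brownian_integral_axioms.intro)
  show "stochastic_integral N G (*\<^sub>R) (\<lambda>s _. h1 s) \<beta> J" using J by (simp add: h1_def n_def)
  show "bounded_bilinear ((*\<^sub>R) :: real \<Rightarrow> real \<Rightarrow> real)" by (rule bounded_bilinear_scaleR)
  show "norm (x * v) \<le> 1 * norm v" if "x \<in> {0..1}" for x v :: real
    using that mult_right_mono[of "\<bar>x\<bar>" 1 "\<bar>v\<bar>"] by (simp add: abs_mult)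
  show "AE \<omega> in N. \<forall>t\<ge>0. h1 t \<in> {0..1}" using h1(1) by auto
qed (use beta in \<open>auto simp: subspace_UNIV\<close>)

sublocale BL: brownian_integral N G "{x. \<Theta>0 \<bullet> x = 0}" B' "(*\<^sub>R)" "\<lambda>s _. h2 s" L "\<lambda>x v. x *\<^sub>R P v" "{0..2}" 2
proof (intro brownian_integral.intro[OF prob_space_axioms] brownian_integral_axioms.intro)
  show "stochastic_integral N G (*\<^sub>R) (\<lambda>s _. h2 s) B' L" using L by (simp add: h2_def n_def)
  show "bounded_bilinear ((*\<^sub>R) :: real \<Rightarrow> real^'n \<Rightarrow> real^'n)" by (rule bounded_bilinear_scaleR)
  show "norm (x *\<^sub>R P v) \<le> 2 * norm v" if "x \<in> {0..2}" for x v
  proof -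
    have "(norm (P v))\<^sup>2 \<le> (norm v)\<^sup>2" unfolding norm_P by simp
    then have "norm (P v) \<le> norm v" by (rule power2_le_imp_le) simp
    then show ?thesis using that by (simp add: mult_mono)
  qed
  show "AE \<omega> in N. \<forall>t\<ge>0. h2 t \<in> {0..2}" using h2(1) by auto
  show "subspace {x. \<Theta>0 \<bullet> x = 0}" by (auto simp: subspace_def inner_add_right)
  show "v \<bullet> x *\<^sub>R y = x *\<^sub>R P v \<bullet> y" if "y \<in> {x. \<Theta>0 \<bullet> x = 0}" for x v y
    using that by (simp add: P_def inner_diff_left)
  show "x *\<^sub>R P v \<in> {x. \<Theta>0 \<bullet> x = 0}" for x v by (simp add: P_in)
qed (use B' in auto)

lemma Minf_continuous: "continuous_process N Minf"
proof -
  have "continuous_process N J" "continuous_process N L"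
    using stochastic_integralD(5)[OF BJ.SI] stochastic_integralD(5)[OF BL.SI] .
  then show ?thesis
    unfolding continuous_process_def Minf[abs_def]
    by (auto intro!: continuous_intros borel_measurable_scaleR borel_measurable_add borel_measurable_const)
qed

lemma Minf_0: "AE \<omega> in N. Minf 0 \<omega> = 0"
  using BJ.I_0 BL.I_0 by eventually_elim (simp add: Minf)

definition \<kappa> :: real where "\<kappa> = sqrt (1 - 1 / n)"

lemma grid_sum_Minf: "grid_sum j p w Minf \<omega> = grid_sum j p (\<lambda>i. \<kappa> * (w i \<bullet> \<Theta>0)) J \<omega> + grid_sum j p (\<lambda>i. \<kappa> *\<^sub>R w i) L \<omega>"
  unfolding grid_sum_def Minf sum.distrib[symmetric] \<kappa>_def n_def
  by (intro sum.cong refl) (simp add: inner_diff_right inner_add_right algebra_simps)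

text \<open>The component along \<open>\<Theta>0\<close> and the orthogonal one contribute the two
  variance rates of \<open>Minf\<close>, which add up to \<open>(norm w)^2 - second_moment\<close>.
  The identity holds term by term at every level, since all three sums live on the same
  grid.\<close>

lemma quad_sum:
  "BJ.quad j p (\<lambda>i. \<kappa> * (w i \<bullet> \<Theta>0)) m + BL.quad j p (\<lambda>i. \<kappa> *\<^sub>R w i) m = variance_sum \<Theta>0 j p w m"
  unfolding BJ.quad_def BL.quad_def variance_sum_def sum.distrib[symmetric]
proof (intro sum.cong refl)
  fix l
  let ?v = "w (l div 2 ^ (m - j))" and ?s = "grid m l"
  define q where "q = (?v \<bullet> \<Theta>0)\<^sup>2"
  define a where "a = (norm ?v)\<^sup>2"
  define e where "e = exp (- n * ?s)"
  have k2: "\<kappa>\<^sup>2 = 1 - 1 / n" using n by (simp add: \<kappa>_def)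
  have s: "?s \<ge> 0" by simp
  have cJ: "BJ.cut (h1 ?s) = h1 ?s" using h1(1)[OF s] by (simp add: BJ.cut_def)
  have cL: "BL.cut (h2 ?s) = h2 ?s" using h2(1)[OF s] by (simp add: BL.cut_def)
  have 1: "(\<integral>\<omega>. (norm (BJ.integrand j m (\<lambda>i. \<kappa> * (w i \<bullet> \<Theta>0)) l \<omega>))\<^sup>2 \<partial>N) = (1 - e) * ((1 - 1 / n) * q)"
    by (simp add: BJ.integrand_def cJ prob_space power_mult_distrib h1(2)[OF s] k2 e_def q_def)
  have Pk: "P (\<kappa> *\<^sub>R x) = \<kappa> *\<^sub>R P x" for x by (simp add: P_def algebra_simps)
  have 2: "(\<integral>\<omega>. (norm (BL.integrand j m (\<lambda>i. \<kappa> *\<^sub>R w i) l \<omega>))\<^sup>2 \<partial>N) = (1 + e / (n - 1)) * ((1 - 1 / n) * (a - q))"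
    by (simp add: BL.integrand_def cL prob_space power_mult_distrib h2(2)[OF s] k2 e_def q_def a_def Pk norm_P)
  have "second_moment \<Theta>0 ?v ?s = a / n + e * (q - a / n)"
    by (simp add: second_moment_def a_def q_def e_def n_def)
  moreover have "(1 - e) * ((1 - 1 / n) * q) + (1 + e / (n - 1)) * ((1 - 1 / n) * (a - q)) = a - (a / n + e * (q - a / n))"
    using n by (simp add: field_simps)
  ultimately show "(\<integral>\<omega>. (norm (BJ.integrand j m (\<lambda>i. \<kappa> * (w i \<bullet> \<Theta>0)) l \<omega>))\<^sup>2 \<partial>N) / 2 ^ m
     + (\<integral>\<omega>. (norm (BL.integrand j m (\<lambda>i. \<kappa> *\<^sub>R w i) l \<omega>))\<^sup>2 \<partial>N) / 2 ^ m
     = ((norm ?v)\<^sup>2 - second_moment \<Theta>0 ?v ?s) / 2 ^ m"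
    unfolding 1 2 a_def[symmetric] by (simp add: add_divide_distrib[symmetric])
qed

text \<open>The independence of \<open>\<beta>\<close> and \<open>B'\<close> is used on the
  elementary integrals, which are explicit functions of the two paths and so inherit it; there the
  characteristic function factors. The sum of the two approximations then converges in probability
  to the weighted increments of \<open>Minf\<close>.\<close>

lemma char_Minf:
  "(\<lambda>m. complex_of_real (exp (- (variance_sum \<Theta>0 j p w m / 2)))) \<longlonglongrightarrow> (CLINT \<omega>|N. iexp (grid_sum j p w Minf \<omega>))"
proof -
  let ?w1 = "\<lambda>i. \<kappa> * (w i \<bullet> \<Theta>0)" and ?w2 = "\<lambda>i. \<kappa> *\<^sub>R w i"
  have [measurable]: "grid_sum j p ?w1 (BJ.approx m) \<in> borel_measurable N" "grid_sum j p ?w1 J \<in> borel_measurable N"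
    "grid_sum j p ?w2 (BL.approx m) \<in> borel_measurable N" "grid_sum j p ?w2 L \<in> borel_measurable N" for m
    by (intro grid_sum_measurable BJ.approx_continuous BL.approx_continuous
        stochastic_integralD(5)[OF BJ.SI] stochastic_integralD(5)[OF BL.SI])+
  have "(\<lambda>m. (CLINT \<omega>|N. iexp (grid_sum j p ?w1 (BJ.approx m) \<omega> + grid_sum j p ?w2 (BL.approx m) \<omega>)))
    \<longlonglongrightarrow> (CLINT \<omega>|N. iexp (grid_sum j p ?w1 J \<omega> + grid_sum j p ?w2 L \<omega>))"
    by (intro converges_in_prob_char converges_in_prob_add BJ.approx_converges BL.approx_converges) measurable
  then have lim: "(\<lambda>m. (CLINT \<omega>|N. iexp (grid_sum j p ?w1 (BJ.approx m) \<omega> + grid_sum j p ?w2 (BL.approx m) \<omega>)))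
    \<longlonglongrightarrow> (CLINT \<omega>|N. iexp (grid_sum j p w Minf \<omega>))" by (simp only: grid_sum_Minf)
  have ev: "(CLINT \<omega>|N. iexp (grid_sum j p ?w1 (BJ.approx m) \<omega> + grid_sum j p ?w2 (BL.approx m) \<omega>))
     = complex_of_real (exp (- (variance_sum \<Theta>0 j p w m / 2)))" if m: "m \<ge> j" "m \<ge> p" for m
  proof -
    let ?A = "vimage_algebra (space N) (trajectory \<beta>) path_borel"
    let ?B = "vimage_algebra (space N) (trajectory B') path_borel"
    have [measurable]: "\<beta> (grid m l) \<in> borel_measurable ?A" "B' (grid m l) \<in> borel_measurable ?B" for l
      using trajectory_in_path_space[OF brownian_motionD(3)[OF beta]] trajectory_in_path_space[OF brownian_motionD(3)[OF B']]
      by (auto intro!: eval_trajectory_measurable)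
    have "(\<lambda>\<omega>. grid_sum j p ?w1 (BJ.approx m) \<omega>) \<in> borel_measurable ?A"
    proof (subst measurable_cong)
      show "grid_sum j p ?w1 (BJ.approx m) \<omega> = (\<Sum>l<p * 2 ^ (m - j). (BJ.cut (h1 (grid m l)) * ?w1 (l div 2 ^ (m - j))) \<bullet> (\<beta> (grid m (Suc l)) \<omega> - \<beta> (grid m l) \<omega>))"
        if "\<omega> \<in> space ?A" for \<omega>
        using that by (subst BJ.grid_sum_approx[OF m]) (simp_all add: BJ.integrand_def)
      show "(\<lambda>\<omega>. \<Sum>l<p * 2 ^ (m - j). (BJ.cut (h1 (grid m l)) * ?w1 (l div 2 ^ (m - j))) \<bullet> (\<beta> (grid m (Suc l)) \<omega> - \<beta> (grid m l) \<omega>)) \<in> borel_measurable ?A"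
        by measurable
    qed
    then have mA: "(\<lambda>\<omega>. iexp (grid_sum j p ?w1 (BJ.approx m) \<omega>)) \<in> borel_measurable ?A" by measurable
    have "(\<lambda>\<omega>. grid_sum j p ?w2 (BL.approx m) \<omega>) \<in> borel_measurable ?B"
    proof (subst measurable_cong)
      show "grid_sum j p ?w2 (BL.approx m) \<omega> = (\<Sum>l<p * 2 ^ (m - j). (BL.cut (h2 (grid m l)) *\<^sub>R P (?w2 (l div 2 ^ (m - j)))) \<bullet> (B' (grid m (Suc l)) \<omega> - B' (grid m l) \<omega>))"
        if "\<omega> \<in> space ?B" for \<omega>
        using that by (subst BL.grid_sum_approx[OF m]) (simp_all add: BL.integrand_def)
      show "(\<lambda>\<omega>. \<Sum>l<p * 2 ^ (m - j). (BL.cut (h2 (grid m l)) *\<^sub>R P (?w2 (l div 2 ^ (m - j)))) \<bullet> (B' (grid m (Suc l)) \<omega> - B' (grid m l) \<omega>)) \<in> borel_measurable ?B"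
        by measurable
    qed
    then have mB: "(\<lambda>\<omega>. iexp (grid_sum j p ?w2 (BL.approx m) \<omega>)) \<in> borel_measurable ?B" by measurable
    have iv: "indep_var borel (\<lambda>\<omega>. iexp (grid_sum j p ?w1 (BJ.approx m) \<omega>)) borel (\<lambda>\<omega>. iexp (grid_sum j p ?w2 (BL.approx m) \<omega>))"
      by (rule indep_var_of_indep_set[OF indep_beta_B' _ _ mA mB]) auto
    have i: "complex_integrable N (\<lambda>\<omega>. iexp (grid_sum j p ?w1 (BJ.approx m) \<omega>))"
      "complex_integrable N (\<lambda>\<omega>. iexp (grid_sum j p ?w2 (BL.approx m) \<omega>))"
      by (auto intro!: integrable_const_bound[where B = 1])
    have "(CLINT \<omega>|N. iexp (grid_sum j p ?w1 (BJ.approx m) \<omega> + grid_sum j p ?w2 (BL.approx m) \<omega>))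
      = (CLINT \<omega>|N. iexp (grid_sum j p ?w1 (BJ.approx m) \<omega>) * iexp (grid_sum j p ?w2 (BL.approx m) \<omega>))"
      by (simp add: distrib_left exp_add)
    also have "\<dots> = (CLINT \<omega>|N. iexp (grid_sum j p ?w1 (BJ.approx m) \<omega>)) * (CLINT \<omega>|N. iexp (grid_sum j p ?w2 (BL.approx m) \<omega>))"
      by (rule indep_var_lebesgue_integral[OF iv i])
    also have "\<dots> = complex_of_real (exp (- (BJ.quad j p ?w1 m / 2)) * exp (- (BL.quad j p ?w2 m / 2)))"
      unfolding BJ.char_approx[OF m refl] BL.char_approx[OF m refl] by simp
    also have "exp (- (BJ.quad j p ?w1 m / 2)) * exp (- (BL.quad j p ?w2 m / 2)) = exp (- (variance_sum \<Theta>0 j p w m / 2))"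
      unfolding quad_sum[symmetric] exp_add[symmetric] by (simp add: add_divide_distrib)
    finally show ?thesis .
  qed
  show ?thesis
  proof (rule Lim_transform_eventually[OF lim])
    show "\<forall>\<^sub>F m in sequentially. (CLINT \<omega>|N. iexp (grid_sum j p ?w1 (BJ.approx m) \<omega> + grid_sum j p ?w2 (BL.approx m) \<omega>))
     = complex_of_real (exp (- (variance_sum \<Theta>0 j p w m / 2)))"
      using eventually_ge_at_top[of j] eventually_ge_at_top[of p] by eventually_elim (rule ev)
  qed
qed

lemma char_Minf_limit:
  assumes "variance_sum \<Theta>0 j p w \<longlonglongrightarrow> v"
  shows "(CLINT \<omega>|N. iexp (grid_sum j p w Minf \<omega>)) = complex_of_real (exp (- (v / 2)))"
proof (rule LIMSEQ_unique[OF char_Minf])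
  show "(\<lambda>m. complex_of_real (exp (- (variance_sum \<Theta>0 j p w m / 2)))) \<longlonglongrightarrow> complex_of_real (exp (- (v / 2)))"
    by (intro tendsto_of_real tendsto_exp tendsto_minus tendsto_divide assms tendsto_const) simp
qed

end

section \<open>The central limit theorem for the martingales\<close>

text \<open>The copies are numbered from 1, the summands in the central limit theorem from
  0.\<close>

lemma (in prob_space) indep_vars_Suc:
  assumes "indep_vars N X {1..}"
  shows "indep_vars (\<lambda>i. N (Suc i)) (\<lambda>i. X (Suc i)) UNIV"
proof -
  define E where "E i = {X i -` A \<inter> space M |A. A \<in> sets (N i)}" for i
  have I: "\<And>i. i \<in> {1..} \<Longrightarrow> random_variable (N i) (X i)" "indep_sets E {1..}"
    using assms unfolding indep_vars_def2 E_def[abs_def] by blast+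
  have "indep_sets (\<lambda>i. E (Suc i)) UNIV"
  proof (rule indep_setsI)
    show "E (Suc i) \<subseteq> events" for i using I(2) by (simp add: indep_sets_def)
    fix A J assume J: "J \<noteq> {}" "finite J" and A: "\<forall>j\<in>J. A j \<in> E (Suc j)"
    have "prob (\<Inter>j\<in>Suc ` J. A (j - 1)) = (\<Prod>j\<in>Suc ` J. prob (A (j - 1)))"
      by (rule indep_setsD[OF I(2)]) (use J A in auto)
    then show "prob (\<Inter>j\<in>J. A j) = (\<Prod>j\<in>J. prob (A j))"
      by (simp add: prod.reindex)
  qed
  then show ?thesis using I(1) by (simp add: indep_vars_def2 E_def)
qed

text \<open>In the expansion of the fourth power all terms with an isolated factor have mean 0. The
  diagonal contributes at most \<open>24 * K * h^2\<close> and the pairs at most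
  \<open>3 * K^2 * h^2\<close>, together at most \<open>27 * K^2 * h^2\<close>.\<close>

lemma (in prob_space) fourth_moment_indep_sum:
  fixes y :: "nat \<Rightarrow> 'a \<Rightarrow> real"
  assumes ind: "indep_vars (\<lambda>_. borel) y {1..}" and bd: "\<And>k. k \<ge> 1 \<Longrightarrow> AE \<omega> in M. \<bar>y k \<omega>\<bar> \<le> C"
    and E1: "\<And>k. k \<ge> 1 \<Longrightarrow> (\<integral>\<omega>. y k \<omega> \<partial>M) = 0"
    and E2: "\<And>k. k \<ge> 1 \<Longrightarrow> (\<integral>\<omega>. (y k \<omega>)\<^sup>2 \<partial>M) \<le> h"
    and E4: "\<And>k. k \<ge> 1 \<Longrightarrow> (\<integral>\<omega>. y k \<omega> ^ 4 \<partial>M) \<le> 24 * h\<^sup>2" and h: "h \<ge> 0"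
  shows "integrable M (\<lambda>\<omega>. (\<Sum>k=1..K. y k \<omega>) ^ q)"
    "(\<integral>\<omega>. (\<Sum>k=1..K. y k \<omega>) ^ 4 \<partial>M) \<le> 27 * (real K)\<^sup>2 * h\<^sup>2"
proof -
  have ym: "y k \<in> borel_measurable M" if "k \<ge> 1" for k
    using ind that by (auto simp: indep_vars_def2)
  define S where "S K \<omega> = (\<Sum>k=1..K. y k \<omega>)" for K \<omega>
  have Sm: "S K \<in> borel_measurable M" for K unfolding S_def[abs_def] using ym by auto
  have Sb: "AE \<omega> in M. \<bar>S K \<omega>\<bar> \<le> real K * C" for K
  proof -
    have "AE \<omega> in M. \<forall>k\<in>{1..K}. \<bar>y k \<omega>\<bar> \<le> C" using bd by (intro AE_finite_allI) auto
    then show ?thesis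
    proof eventually_elim
      case (elim \<omega>)
      have "\<bar>S K \<omega>\<bar> \<le> (\<Sum>k=1..K. C)" unfolding S_def using elim by (intro order_trans[OF sum_abs] sum_mono) auto
      then show ?case by simp
    qed
  qed
  have iS: "integrable M (\<lambda>\<omega>. S K \<omega> ^ q)" for K q by (rule integrable_bounded_powers[OF Sm Sb])
  have iy: "integrable M (\<lambda>\<omega>. y (Suc K) \<omega> ^ q)" for K q by (rule integrable_bounded_powers[OF ym bd]) auto
  have prod: "integrable M (\<lambda>\<omega>. y (Suc K) \<omega> ^ a * S K \<omega> ^ b)"
    "(\<integral>\<omega>. y (Suc K) \<omega> ^ a * S K \<omega> ^ b \<partial>M) = (\<integral>\<omega>. y (Suc K) \<omega> ^ a \<partial>M) * (\<integral>\<omega>. S K \<omega> ^ b \<partial>M)" for K a b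
  proof -
    have "indep_var borel (y (Suc K)) borel (S K)"
      unfolding S_def[abs_def]
      by (rule indep_vars_sum) (auto intro: indep_vars_subset[OF ind])
    from indep_var_compose[OF this, of "\<lambda>x. x ^ a" borel "\<lambda>x. x ^ b" borel]
    have iv: "indep_var borel (\<lambda>\<omega>. y (Suc K) \<omega> ^ a) borel (\<lambda>\<omega>. S K \<omega> ^ b)" by (simp add: o_def)
    show "integrable M (\<lambda>\<omega>. y (Suc K) \<omega> ^ a * S K \<omega> ^ b)" by (rule indep_var_integrable[OF iv iy iS])
    show "(\<integral>\<omega>. y (Suc K) \<omega> ^ a * S K \<omega> ^ b \<partial>M) = (\<integral>\<omega>. y (Suc K) \<omega> ^ a \<partial>M) * (\<integral>\<omega>. S K \<omega> ^ b \<partial>M)"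
      by (rule indep_var_lebesgue_integral[OF iv iy iS])
  qed
  have SS: "S (Suc K) \<omega> = y (Suc K) \<omega> + S K \<omega>" for K \<omega> by (simp add: S_def)
  have S1: "(\<integral>\<omega>. S K \<omega> \<partial>M) = 0" for K
  proof (induction K)
    case (Suc K)
    show ?case unfolding SS using iS[of K 1] iy[of K 1] E1[of "Suc K"] Suc by simp
  qed (simp add: S_def)
  have S2: "(\<integral>\<omega>. (S K \<omega>)\<^sup>2 \<partial>M) \<le> real K * h" for K
  proof (induction K)
    case (Suc K)
    have "(S (Suc K) \<omega>)\<^sup>2 = (S K \<omega>)\<^sup>2 + 2 * (y (Suc K) \<omega> ^ 1 * S K \<omega> ^ 1) + (y (Suc K) \<omega>)\<^sup>2" for \<omega>
      by (simp add: SS power2_eq_square algebra_simps)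
    then have "(\<integral>\<omega>. (S (Suc K) \<omega>)\<^sup>2 \<partial>M) = (\<integral>\<omega>. (S K \<omega>)\<^sup>2 \<partial>M) + (\<integral>\<omega>. (y (Suc K) \<omega>)\<^sup>2 \<partial>M)"
      using iS[of K 2] iy[of K 2] prod[of K 1 1] E1[of "Suc K"] by simp
    then show ?case using Suc E2[of "Suc K"] by (simp add: algebra_simps)
  qed (simp add: S_def)
  have "(\<integral>\<omega>. S K \<omega> ^ 4 \<partial>M) \<le> 27 * (real K)\<^sup>2 * h\<^sup>2" for K
  proof (induction K)
    case (Suc K)
    have e: "S (Suc K) \<omega> ^ 4 = S K \<omega> ^ 4 + 4 * (y (Suc K) \<omega> ^ 1 * S K \<omega> ^ 3) + 6 * (y (Suc K) \<omega> ^ 2 * S K \<omega> ^ 2)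
       + 4 * (y (Suc K) \<omega> ^ 3 * S K \<omega> ^ 1) + y (Suc K) \<omega> ^ 4" for \<omega>
      by (simp add: SS power4_eq_xxxx power3_eq_cube power2_eq_square algebra_simps)
    have "(\<integral>\<omega>. S (Suc K) \<omega> ^ 4 \<partial>M) = (\<integral>\<omega>. S K \<omega> ^ 4 \<partial>M) + 6 * ((\<integral>\<omega>. (y (Suc K) \<omega>)\<^sup>2 \<partial>M) * (\<integral>\<omega>. (S K \<omega>)\<^sup>2 \<partial>M)) + (\<integral>\<omega>. y (Suc K) \<omega> ^ 4 \<partial>M)"
      unfolding e using iS[of K 4] iy[of K 4] prod[of K 1 3] prod[of K 2 2] prod[of K 3 1] E1[of "Suc K"] S1[of K] by simp
    also have "\<dots> \<le> 27 * (real K)\<^sup>2 * h\<^sup>2 + 6 * (h * (real K * h)) + 24 * h\<^sup>2"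
      using Suc E2[of "Suc K"] S2[of K] E4[of "Suc K"] h
      by (intro add_mono mult_left_mono mult_mono) auto
    also have "\<dots> \<le> 27 * (real (Suc K))\<^sup>2 * h\<^sup>2"
    proof -
      have "27 * (real (Suc K))\<^sup>2 * h\<^sup>2 = 27 * (real K)\<^sup>2 * h\<^sup>2 + 54 * (real K * h\<^sup>2) + 27 * h\<^sup>2"
        by (simp add: power2_eq_square algebra_simps)
      moreover have "h * (real K * h) = real K * h\<^sup>2" by (simp add: power2_eq_square)
      moreover have "0 \<le> real K * h\<^sup>2" "0 \<le> h\<^sup>2" by simp_all
      ultimately show ?thesis by linarith
    qed
    finally show ?case .
  qed (simp add: S_def)
  then show "(\<integral>\<omega>. (\<Sum>k=1..K. y k \<omega>) ^ 4 \<partial>M) \<le> 27 * (real K)\<^sup>2 * h\<^sup>2" by (simp add: S_def)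
  show "integrable M (\<lambda>\<omega>. (\<Sum>k=1..K. y k \<omega>) ^ q)" using iS by (simp add: S_def)
qed

text \<open>The central limit theorem asks for positive variance, so the degenerate case, where all
  summands vanish almost surely, is separate. Evaluating the characteristic function at
  \<open>\<sigma>\<close> undoes the normalization by \<open>\<sigma>\<close>.\<close>

lemma (in prob_space) clt_char:
  fixes x :: "nat \<Rightarrow> 'a \<Rightarrow> real"
  assumes ind: "indep_vars (\<lambda>_. borel) x {1..}"
    and E1: "\<And>k. k \<ge> 1 \<Longrightarrow> (\<integral>\<omega>. x k \<omega> \<partial>M) = 0"
    and i2: "\<And>k. k \<ge> 1 \<Longrightarrow> integrable M (\<lambda>\<omega>. (x k \<omega>)\<^sup>2)"
    and E2: "\<And>k. k \<ge> 1 \<Longrightarrow> (\<integral>\<omega>. (x k \<omega>)\<^sup>2 \<partial>M) = v"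
    and id: "\<And>k. k \<ge> 1 \<Longrightarrow> distr M borel (x k) = distr M borel (x 1)"
  shows "(\<lambda>K. (CLINT \<omega>|M. iexp ((\<Sum>k=1..K. x k \<omega>) / sqrt (real K)))) \<longlonglongrightarrow> complex_of_real (exp (- (v / 2)))"
proof -
  have xm[measurable]: "x k \<in> borel_measurable M" if "k \<ge> 1" for k
    using ind that by (auto simp: indep_vars_def2)
  have v0: "v \<ge> 0" using E2[of 1] by (metis Bochner_Integration.integral_nonneg order_refl zero_le_power2)
  have sh: "(\<Sum>i<K. x (Suc i) \<omega>) = (\<Sum>k=1..K. x k \<omega>)" for K \<omega>
    by (rule sum.reindex_bij_witness[of _ "\<lambda>k. k - 1" Suc]) auto
  show ?thesis
  proof (cases "v = 0")
    case True
    have "AE \<omega> in M. x k \<omega> = 0" if "k \<ge> 1" for k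
    proof -
      have "AE \<omega> in M. (x k \<omega>)\<^sup>2 = 0"
        using integral_nonneg_eq_0_iff_AE[OF i2[OF that]] E2[OF that] True by simp
      then show ?thesis by simp
    qed
    note x0 = this
    have "(CLINT \<omega>|M. iexp ((\<Sum>k=1..K. x k \<omega>) / sqrt (real K))) = (CLINT \<omega>|M. 1)" for K
    proof (rule integral_cong_AE)
      have "AE \<omega> in M. \<forall>k\<in>{1..K}. x k \<omega> = 0" using x0 by (intro AE_finite_allI) auto
      then show "AE \<omega> in M. iexp ((\<Sum>k=1..K. x k \<omega>) / sqrt (real K)) = 1"
      proof eventually_elim
        case (elim \<omega>)
        have "(\<Sum>k=1..K. x k \<omega>) = 0" using elim by (intro sum.neutral)
        then show ?case by simp
      qed
    qed auto
    then show ?thesis using True by (simp add: prob_space)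
  next
    case False
    define \<sigma> where "\<sigma> = sqrt v"
    have \<sigma>: "\<sigma> > 0" "\<sigma>\<^sup>2 = v" using v0 False by (auto simp: \<sigma>_def)
    have w: "weak_conv_m (\<lambda>K. distr M borel (\<lambda>\<omega>. (\<Sum>i<K. x (Suc i) \<omega>) / sqrt (real K * \<sigma>\<^sup>2))) std_normal_distribution"
    proof (rule central_limit_theorem_zero_mean[OF indep_vars_Suc[OF ind] _ \<sigma>(1)])
      show "distr M borel (x (Suc k)) = distr M borel (x 1)" for k by (rule id) simp
      show "variance (x (Suc k)) = \<sigma>\<^sup>2" for k using E1[of "Suc k"] E2[of "Suc k"] \<sigma> by simp
    qed (use E1 i2 in auto)
    have "(\<lambda>K. char (distr M borel (\<lambda>\<omega>. (\<Sum>i<K. x (Suc i) \<omega>) / sqrt (real K * \<sigma>\<^sup>2))) \<sigma>) \<longlonglongrightarrow> char std_normal_distribution \<sigma>"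
      by (rule levy_continuity1[OF _ real_dist_normal_dist w]) (intro real_distribution_distr, measurable)
    moreover have "char (distr M borel (\<lambda>\<omega>. (\<Sum>i<K. x (Suc i) \<omega>) / sqrt (real K * \<sigma>\<^sup>2))) \<sigma> = (CLINT \<omega>|M. iexp ((\<Sum>k=1..K. x k \<omega>) / sqrt (real K)))" for K
    proof -
      have "\<sigma> * (z / sqrt (real K * \<sigma>\<^sup>2)) = z / sqrt (real K)" for z
        using \<sigma>(1) by (simp add: real_sqrt_mult)
      then show ?thesis unfolding char_def sh[symmetric]
        by (subst integral_distr) (simp_all add: of_real_mult[symmetric] del: of_real_mult of_real_divide)
    qed
    moreover have "char std_normal_distribution \<sigma> = complex_of_real (exp (- (v / 2)))"
      by (simp add: char_std_normal_distribution \<sigma>)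
    ultimately show ?thesis by simp
  qed
qed

text \<open>Evaluations are measurable, and the integral of a continuous function is the limit of
  its Riemann sums.\<close>

lemma measurable_integral_path:
  fixes g :: "'e::metric_space \<Rightarrow> 'f::euclidean_space"
  assumes g: "continuous_on UNIV g" and t: "t \<ge> 0"
  shows "(\<lambda>f. integral {0..t} (\<lambda>s. g (f s))) \<in> borel_measurable path_borel"
proof (rule borel_measurable_LIMSEQ_metric)
  fix f :: "real \<Rightarrow> 'e" assume "f \<in> space path_borel"
  then have "continuous_on {0..t} f"
    by (auto simp: space_path_borel path_space_def intro: continuous_on_subset)
  then have "continuous_on {0..t} (\<lambda>s. g (f s))"
    by (rule continuous_on_compose2[OF g]) simp
  from riemann_tendsto[OF t this]
  show "(\<lambda>m. \<Sum>i<m. ((t - 0) / real m) *\<^sub>R g (f (0 + real (Suc i) * (t - 0) / real m))) \<longlonglongrightarrow> integral {0..t} (\<lambda>s. g (f s))" .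
next
  have gm: "g \<in> borel_measurable borel" by (rule borel_measurable_continuous_onI[OF g])
  show "(\<lambda>f. \<Sum>i<m. ((t - 0) / real m) *\<^sub>R g (f (0 + real (Suc i) * (t - 0) / real m))) \<in> borel_measurable path_borel" for m
  proof (intro borel_measurable_sum borel_measurable_scaleR borel_measurable_const)
    fix i
    have "0 \<le> 0 + real (Suc i) * (t - 0) / real m" using t by simp
    from measurable_compose[OF eval_measurable[OF this] gm]
    show "(\<lambda>f. g (f (0 + real (Suc i) * (t - 0) / real m))) \<in> borel_measurable path_borel" .
  qed
qed

section \<open>The independent copies and their normalized sum\<close>

locale iid_spheres = prob_space M for M :: "'w measure" +
  fixes F :: "nat \<Rightarrow> real \<Rightarrow> 'w measure" and \<Theta>0 :: "real^'n" and \<Theta> B I :: "nat \<Rightarrow> real \<Rightarrow> 'w \<Rightarrow> real^'n"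
  assumes start: "norm \<Theta>0 = 1"
    and sphere_bm: "\<And>k. k \<ge> 1 \<Longrightarrow> sphere_brownian_motion M (F k) \<Theta>0 (B k) (I k) (\<Theta> k)"
    and indep: "indep_vars (\<lambda>_. path_borel) (\<lambda>k. trajectory (\<lambda>t \<omega>. (\<Theta> k t \<omega>, B k t \<omega>))) {1..}"
    and ident: "\<And>k. k \<ge> 1 \<Longrightarrow>
                  law M (\<lambda>t \<omega>. (\<Theta> k t \<omega>, B k t \<omega>)) = law M (\<lambda>t \<omega>. (\<Theta> 1 t \<omega>, B 1 t \<omega>))"
begin

lemma sphere: "k \<ge> 1 \<Longrightarrow> sphere_bm M (F k) \<Theta>0 (B k) (I k) (\<Theta> k)"
  using sphere_bm start by (intro sphere_bm.intro sphere_bm_axioms.intro prob_space_axioms) auto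

definition drift :: real where "drift = (real CARD('n) - 1) / 2"

text \<open>The stochastic integral \<open>I k\<close> as a functional of the path of \<open>(\<Theta> k, B k)\<close>, whose law and independence are
  given, read off from the equation.\<close>

definition noise :: "real \<Rightarrow> (real \<Rightarrow> (real^'n) \<times> (real^'n)) \<Rightarrow> real^'n" where
  "noise t f = fst (f t) - \<Theta>0 + drift *\<^sub>R integral {0..t} (\<lambda>s. fst (f s))"

definition traj :: "nat \<Rightarrow> 'w \<Rightarrow> real \<Rightarrow> (real^'n) \<times> (real^'n)" where
  "traj k = trajectory (\<lambda>t \<omega>. (\<Theta> k t \<omega>, B k t \<omega>))"

lemma noise_measurable: "t \<ge> 0 \<Longrightarrow> noise t \<in> borel_measurable path_borel"
proof -
  assume t: "t \<ge> 0"
  have fm: "(fst :: (real^'n) \<times> (real^'n) \<Rightarrow> _) \<in> borel_measurable borel"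
    by (intro borel_measurable_continuous_onI continuous_intros)
  have "(\<lambda>f :: real \<Rightarrow> (real^'n) \<times> (real^'n). fst (f t)) \<in> borel_measurable path_borel"
    by (rule measurable_compose[OF eval_measurable[OF t] fm])
  moreover have "(\<lambda>f :: real \<Rightarrow> (real^'n) \<times> (real^'n). integral {0..t} (\<lambda>s. fst (f s))) \<in> borel_measurable path_borel"
    by (rule measurable_integral_path[OF _ t]) (intro continuous_intros)
  ultimately show "noise t \<in> borel_measurable path_borel"
    unfolding noise_def[abs_def] by simp
qed

lemma AE_noise:
  assumes "k \<ge> 1"
  shows "AE \<omega> in M. \<forall>t\<ge>0. I k t \<omega> = noise t (traj k \<omega>)"
proof -
  have "AE \<omega> in M. \<forall>t\<ge>0. \<Theta> k t \<omega> = \<Theta>0 + I k t \<omega> - drift *\<^sub>R integral {0..t} (\<lambda>s. \<Theta> k s \<omega>)"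
    using sphere_bm[OF assms] by (simp add: sphere_brownian_motion_def drift_def)
  then show ?thesis
  proof eventually_elim
    case (elim \<omega>)
    show ?case
    proof (intro allI impI)
      fix t :: real assume t: "t \<ge> 0"
      have "integral {0..t} (\<lambda>s. fst (traj k \<omega> s)) = integral {0..t} (\<lambda>s. \<Theta> k s \<omega>)"
        by (rule Henstock_Kurzweil_Integration.integral_cong) (simp add: traj_def trajectory_def)
      moreover have "fst (traj k \<omega> t) = \<Theta> k t \<omega>" using t by (simp add: traj_def trajectory_def)
      moreover have "\<Theta> k t \<omega> = \<Theta>0 + I k t \<omega> - drift *\<^sub>R integral {0..t} (\<lambda>s. \<Theta> k s \<omega>)" using elim t by blast
      ultimately show "I k t \<omega> = noise t (traj k \<omega>)" by (simp add: noise_def)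
    qed
  qed
qed

text \<open>Agrees almost surely with the weighted increments of \<open>I k\<close>; being one fixed
  measurable functional of the \<open>k\<close>-th path, it inherits independence and equality of
  laws.\<close>

definition gs :: "nat \<Rightarrow> nat \<Rightarrow> (nat \<Rightarrow> real^'n) \<Rightarrow> nat \<Rightarrow> 'w \<Rightarrow> real" where
  "gs j p w k \<omega> = grid_sum j p w noise (traj k \<omega>)"

lemma grid_noise_measurable: "grid_sum j p w noise \<in> borel_measurable path_borel"
proof -
  have [measurable]: "noise (grid j i) \<in> borel_measurable path_borel" for i by (rule noise_measurable) simp
  show ?thesis unfolding grid_sum_def[abs_def] by measurable
qed

lemma traj_measurable: "k \<ge> 1 \<Longrightarrow> traj k \<in> measurable M path_borel"
  using indep by (auto simp: indep_vars_def2 traj_def)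

lemma gs_measurable: "k \<ge> 1 \<Longrightarrow> gs j p w k \<in> borel_measurable M"
  unfolding gs_def[abs_def] by (rule measurable_compose[OF traj_measurable grid_noise_measurable])

lemma AE_gs: "k \<ge> 1 \<Longrightarrow> AE \<omega> in M. grid_sum j p w (I k) \<omega> = gs j p w k \<omega>"
  using AE_noise[of k] by (auto elim!: eventually_mono simp: gs_def grid_sum_def)

lemma indep_gs: "indep_vars (\<lambda>_. borel) (gs j p w) {1..}"
  unfolding gs_def[abs_def] traj_def
  by (rule indep_vars_compose2[OF indep]) (rule grid_noise_measurable)

lemma ident_gs:
  assumes "k \<ge> 1"
  shows "distr M borel (gs j p w k) = distr M borel (gs j p w 1)"
proof -
  have "distr M borel (gs j p w k) = distr (law M (\<lambda>t \<omega>. (\<Theta> k t \<omega>, B k t \<omega>))) borel (grid_sum j p w noise)" if "k \<ge> 1" for k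
    unfolding law_def gs_def[abs_def] traj_def[symmetric]
    by (subst distr_distr[OF grid_noise_measurable traj_measurable[OF that]]) (simp add: o_def)
  then show ?thesis using ident[OF assms] assms by simp
qed

lemma I_measurable: "k \<ge> 1 \<Longrightarrow> grid_sum j p w (I k) \<in> borel_measurable M"
  by (intro grid_sum_measurable sphere_bm.I_cont[OF sphere])

text \<open>The bound depends only on the weights, the grid and the dimension, hence is common to
  all copies.\<close>

lemma gs_bounded: "\<exists>C. \<forall>k\<ge>1. AE \<omega> in M. \<bar>gs j p w k \<omega>\<bar> \<le> C"
proof -
  have "AE \<omega> in M. \<bar>gs j p w k \<omega>\<bar> \<le> (\<Sum>i<p. norm (w i) * (2 + sphere_bm.c TYPE('n) * (grid j (Suc i) - grid j i)))" if k: "k \<ge> 1" for k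
    using sphere_bm.AE_I_increment[OF sphere[OF k]] AE_gs[OF k, of j p w]
  proof eventually_elim
    case (elim \<omega>)
    show ?case unfolding elim(2)[symmetric] grid_sum_def
      using elim(1) less_imp_le[OF grid_less_Suc]
      by (intro order_trans[OF sum_abs] sum_mono order_trans[OF Cauchy_Schwarz_ineq2] mult_left_mono) auto
  qed
  then show ?thesis by blast
qed

lemma gs_moments:
  assumes k: "k \<ge> 1"
  shows "(\<integral>\<omega>. gs j p w k \<omega> \<partial>M) = 0" "variance_sum \<Theta>0 j p w \<longlonglongrightarrow> (\<integral>\<omega>. (gs j p w k \<omega>)\<^sup>2 \<partial>M)"
    "integrable M (\<lambda>\<omega>. gs j p w k \<omega> ^ q)"
proof -
  interpret S: sphere_bm M "F k" \<Theta>0 "B k" "I k" "\<Theta> k" by (rule sphere[OF k])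
  obtain C where C: "AE \<omega> in M. \<bar>grid_sum j p w (I k) \<omega>\<bar> \<le> C" using S.grid_sum_bounded by blast
  have E: "(\<integral>\<omega>. f (gs j p w k \<omega>) \<partial>M) = (\<integral>\<omega>. f (grid_sum j p w (I k) \<omega>) \<partial>M)" if "f \<in> borel_measurable borel" for f :: "real \<Rightarrow> real"
    by (rule integral_cong_AE) (use AE_gs[OF k, of j p w] measurable_compose[OF gs_measurable[OF k] that]
        measurable_compose[OF I_measurable[OF k] that] in \<open>auto elim!: eventually_mono\<close>)
  show "(\<integral>\<omega>. gs j p w k \<omega> \<partial>M) = 0" using E[of "\<lambda>x. x"] S.BI.grid_sum_moments(1)[OF C] by simp
  show "variance_sum \<Theta>0 j p w \<longlonglongrightarrow> (\<integral>\<omega>. (gs j p w k \<omega>)\<^sup>2 \<partial>M)"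
    using E[of "\<lambda>x. x\<^sup>2"] S.BI.grid_sum_moments(2)[OF C] unfolding S.quad_eq_variance_sum[abs_def] by simp
  obtain C' where "AE \<omega> in M. \<bar>gs j p w k \<omega>\<bar> \<le> C'" using gs_bounded k by blast
  then show "integrable M (\<lambda>\<omega>. gs j p w k \<omega> ^ q)" by (rule integrable_bounded_powers[OF gs_measurable[OF k]])
qed

definition MK :: "nat \<Rightarrow> real \<Rightarrow> 'w \<Rightarrow> real^'n" where
  "MK K t \<omega> = (1 / sqrt (real K)) *\<^sub>R (\<Sum>k=1..K. I k t \<omega>)"

lemma MK_continuous: "continuous_process M (MK K)"
proof -
  have I: "(\<forall>t\<ge>0. I k t \<in> borel_measurable M) \<and> (\<forall>\<omega>\<in>space M. continuous_on {0..} (\<lambda>t. I k t \<omega>))"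
    if "k \<in> {1..K}" for k
    using sphere_bm.I_cont[OF sphere[of k]] that by (simp add: continuous_process_def)
  show ?thesis
    unfolding continuous_process_def MK_def[abs_def]
    using I by (auto intro!: continuous_on_scaleR continuous_on_sum continuous_on_const borel_measurable_scaleR
        borel_measurable_sum borel_measurable_const)
qed

lemma MK_0: "AE \<omega> in M. MK K 0 \<omega> = 0"
proof -
  have "AE \<omega> in M. I k 0 \<omega> = 0" if "k \<ge> 1" for k
  proof -
    interpret S: sphere_bm M "F k" \<Theta>0 "B k" "I k" "\<Theta> k" by (rule sphere[OF that])
    show ?thesis by (rule S.BI.I_0)
  qed
  then have "AE \<omega> in M. \<forall>k\<in>{1..K}. I k 0 \<omega> = 0" by (intro AE_finite_allI) auto
  then show ?thesis by eventually_elim (simp add: MK_def)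
qed

lemma AE_MK: "AE \<omega> in M. grid_sum j p w (MK K) \<omega> = (\<Sum>k=1..K. gs j p w k \<omega>) / sqrt (real K)"
proof -
  have e: "grid_sum j p w (MK K) \<omega> = (\<Sum>k=1..K. grid_sum j p w (I k) \<omega>) / sqrt (real K)" for \<omega>
  proof -
    have "grid_sum j p w (MK K) \<omega> = (\<Sum>i<p. \<Sum>k=1..K. (1 / sqrt (real K)) * (w i \<bullet> (I k (grid j (Suc i)) \<omega> - I k (grid j i) \<omega>)))"
      unfolding grid_sum_def MK_def
      by (intro sum.cong refl) (simp add: scaleR_diff_right[symmetric] sum_subtractf[symmetric] inner_sum_right sum_distrib_left
          sum_divide_distrib del: sum_subtractf scaleR_diff_right)
    also have "\<dots> = (\<Sum>k=1..K. \<Sum>i<p. (1 / sqrt (real K)) * (w i \<bullet> (I k (grid j (Suc i)) \<omega> - I k (grid j i) \<omega>)))"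
      by (rule sum.swap)
    finally show ?thesis by (simp add: grid_sum_def sum_divide_distrib)
  qed
  have "AE \<omega> in M. \<forall>k\<in>{1..K}. grid_sum j p w (I k) \<omega> = gs j p w k \<omega>"
    using AE_gs by (intro AE_finite_allI) auto
  then show ?thesis by eventually_elim (simp add: e)
qed

lemma char_MK:
  assumes "variance_sum \<Theta>0 j p w \<longlonglongrightarrow> v"
  shows "(\<lambda>K. (CLINT \<omega>|M. iexp (grid_sum j p w (MK K) \<omega>))) \<longlonglongrightarrow> complex_of_real (exp (- (v / 2)))"
proof -
  \<comment> \<open>Each second moment is the limit of the same sequence
    \<open>variance_sum\<close>.\<close>
  have v: "(\<integral>\<omega>. (gs j p w k \<omega>)\<^sup>2 \<partial>M) = v" if "k \<ge> 1" for k
    using LIMSEQ_unique[OF gs_moments(2)[OF that] assms] .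
  have m[measurable]: "gs j p w k \<in> borel_measurable M" if "k \<ge> 1" for k by (rule gs_measurable[OF that])
  have [measurable]: "grid_sum j p w (MK K) \<in> borel_measurable M" for K by (rule grid_sum_measurable[OF MK_continuous])
  have e: "(CLINT \<omega>|M. iexp (grid_sum j p w (MK K) \<omega>)) = (CLINT \<omega>|M. iexp ((\<Sum>k=1..K. gs j p w k \<omega>) / sqrt (real K)))" for K
    by (rule integral_cong_AE) (use AE_MK[of j p w K] in \<open>auto elim!: eventually_mono\<close>)
  show ?thesis
    unfolding e by (rule clt_char[OF indep_gs _ _ v ident_gs]) (use gs_moments in auto)
qed

lemma MK_fourth_moment:
  assumes b: "b \<in> Basis"
  shows "integrable M (\<lambda>\<omega>. (b \<bullet> (MK K (grid j (Suc i)) \<omega> - MK K (grid j i) \<omega>)) ^ 4)"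
    "(\<integral>\<omega>. (b \<bullet> (MK K (grid j (Suc i)) \<omega> - MK K (grid j i) \<omega>)) ^ 4 \<partial>M) \<le> 27 * (1 / 2 ^ j)\<^sup>2"
proof -
  let ?w = "\<lambda>l. if l < i then 0 else b"
  define h where "h = 1 / (2::real) ^ j"
  have h: "h \<ge> 0" by (simp add: h_def)
  have gi: "grid_sum j (Suc i) ?w Z \<omega> = b \<bullet> (Z (grid j (Suc i)) \<omega> - Z (grid j i) \<omega>)" for Z :: "real \<Rightarrow> 'w \<Rightarrow> real^'n" and \<omega>
    by (rule grid_sum_increment) simp
  have m[measurable]: "gs j (Suc i) ?w k \<in> borel_measurable M" if "k \<ge> 1" for k by (rule gs_measurable[OF that])
  obtain C where C: "\<And>k. k \<ge> 1 \<Longrightarrow> AE \<omega> in M. \<bar>gs j (Suc i) ?w k \<omega>\<bar> \<le> C" using gs_bounded by blast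
  have E: "(\<integral>\<omega>. (gs j (Suc i) ?w k \<omega>)\<^sup>2 \<partial>M) \<le> h" "(\<integral>\<omega>. gs j (Suc i) ?w k \<omega> ^ 4 \<partial>M) \<le> 24 * h\<^sup>2" if k: "k \<ge> 1" for k
  proof -
    interpret S: sphere_bm M "F k" \<Theta>0 "B k" "I k" "\<Theta> k" by (rule sphere[OF k])
    have [measurable]: "grid_sum j (Suc i) ?w (I k) \<in> borel_measurable M" by (rule I_measurable[OF k])
    have e: "(\<integral>\<omega>. gs j (Suc i) ?w k \<omega> ^ q \<partial>M) = (\<integral>\<omega>. grid_sum j (Suc i) ?w (I k) \<omega> ^ q \<partial>M)" for q
      by (rule integral_cong_AE) (use AE_gs[OF k, of j "Suc i" ?w] m[OF k] in \<open>auto elim!: eventually_mono\<close>)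
    have n: "(norm b)\<^sup>2 = 1" using b by simp
    show "(\<integral>\<omega>. (gs j (Suc i) ?w k \<omega>)\<^sup>2 \<partial>M) \<le> h" "(\<integral>\<omega>. gs j (Suc i) ?w k \<omega> ^ 4 \<partial>M) \<le> 24 * h\<^sup>2"
      unfolding e gi using S.increment_moments(2)[of i "Suc i" b j] S.increment_moments(3)[of i "Suc i" b j]
      by (simp_all add: n grid_Suc_diff h_def)
  qed
  note fm = fourth_moment_indep_sum[OF indep_gs C gs_moments(1) E h]
  have [measurable]: "grid_sum j (Suc i) ?w (MK K) \<in> borel_measurable M" for K by (rule grid_sum_measurable[OF MK_continuous])
  have ae: "AE \<omega> in M. ((\<Sum>k=1..K. gs j (Suc i) ?w k \<omega>) / sqrt (real K)) ^ 4 = (b \<bullet> (MK K (grid j (Suc i)) \<omega> - MK K (grid j i) \<omega>)) ^ 4"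
    using AE_MK[of j "Suc i" ?w K] unfolding gi by eventually_elim simp
  have i: "integrable M (\<lambda>\<omega>. ((\<Sum>k=1..K. gs j (Suc i) ?w k \<omega>) / sqrt (real K)) ^ 4)"
    unfolding power_divide using fm(1)[of K 4] by (simp only: integrable_divide)
  have mm: "(\<lambda>\<omega>. (b \<bullet> (MK K (grid j (Suc i)) \<omega> - MK K (grid j i) \<omega>)) ^ 4) \<in> borel_measurable M"
    using grid_sum_measurable[OF MK_continuous[of K], of j "Suc i" ?w] unfolding gi[abs_def] by simp
  show "integrable M (\<lambda>\<omega>. (b \<bullet> (MK K (grid j (Suc i)) \<omega> - MK K (grid j i) \<omega>)) ^ 4)"
    by (rule integrable_cong_AE_imp[OF i mm]) (use ae in \<open>auto elim: eventually_mono\<close>)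
  have "(\<integral>\<omega>. (b \<bullet> (MK K (grid j (Suc i)) \<omega> - MK K (grid j i) \<omega>)) ^ 4 \<partial>M)
     = (\<integral>\<omega>. ((\<Sum>k=1..K. gs j (Suc i) ?w k \<omega>) / sqrt (real K)) ^ 4 \<partial>M)"
    by (rule integral_cong_AE[OF mm borel_measurable_integrable[OF i]]) (use ae in \<open>auto elim: eventually_mono\<close>)
  also have "\<dots> = (\<integral>\<omega>. (\<Sum>k=1..K. gs j (Suc i) ?w k \<omega>) ^ 4 \<partial>M) / (real K)\<^sup>2"
  proof -
    have "sqrt (real K) ^ 4 = (real K)\<^sup>2"
      using power_mult[of "sqrt (real K)" 2 2] by simp
    then show ?thesis by (simp add: power_divide)
  qed
  also have "\<dots> \<le> (27 * (real K)\<^sup>2 * h\<^sup>2) / (real K)\<^sup>2"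
    by (intro divide_right_mono fm(2)) auto
  \<comment> \<open>For \<open>K = 0\<close> the quotient is 0 by the convention for division by
    zero.\<close>
  also have "\<dots> \<le> 27 * h\<^sup>2" by (cases "K = 0") auto
  finally show "(\<integral>\<omega>. (b \<bullet> (MK K (grid j (Suc i)) \<omega> - MK K (grid j i) \<omega>)) ^ 4 \<partial>M) \<le> 27 * (1 / 2 ^ j)\<^sup>2"
    by (simp add: h_def)
qed

end

lemma martingale_convergence:
  assumes "iid_spheres M F \<Theta>0 \<Theta> B I" and "limit_process N G \<Theta>0 \<beta> J B' L Minf"
  shows "converges_in_law M (\<lambda>K t \<omega>. (1 / sqrt (real K)) *\<^sub>R (\<Sum>k=1..K. I k t \<omega>)) N Minf"
proof -
  interpret A: iid_spheres M F \<Theta>0 \<Theta> B I by fact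
  interpret C: limit_process N G \<Theta>0 \<beta> J B' L Minf by fact
  have "converges_in_law M A.MK N Minf"
  proof (rule converges_in_law_criterion[OF A.prob_space_axioms C.prob_space_axioms A.MK_continuous
        C.Minf_continuous A.MK_0 C.Minf_0 _ _ A.MK_fourth_moment])
    fix j p and w :: "nat \<Rightarrow> real^'b"
    \<comment> \<open>The limit variance is never evaluated: it is named as the second moment of the
      first copy, and both characteristic functions are expressed through it.\<close>
    have v: "variance_sum \<Theta>0 j p w \<longlonglongrightarrow> (\<integral>\<omega>. (A.gs j p w 1 \<omega>)\<^sup>2 \<partial>M)" by (rule A.gs_moments(2)) simp
    show "(\<lambda>K. (CLINT \<omega>|M. iexp (grid_sum j p w (A.MK K) \<omega>))) \<longlonglongrightarrow> (CLINT \<omega>|N. iexp (grid_sum j p w Minf \<omega>))"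
      unfolding C.char_Minf_limit[OF v] by (rule A.char_MK[OF v])
  qed simp
  then show ?thesis by (simp add: A.MK_def[abs_def])
qed

section \<open>The linear equation driven by a path\<close>

lemma continuous_on_eq_of_dyadic:
  fixes f g :: "real \<Rightarrow> 'e::t2_space"
  assumes f: "continuous_on {0..} f" and g: "continuous_on {0..} g"
    and eq: "\<And>j b. f (grid j b) = g (grid j b)" and t: "t \<ge> 0"
  shows "f t = g t"
proof -
  have "(\<lambda>m. f (grid m (nat \<lfloor>t * 2 ^ m\<rfloor>))) \<longlonglongrightarrow> f t"
    by (rule continuous_on_tendsto_compose[OF f dyadic_floor_tendsto[OF t]]) (use t in auto)
  moreover have "(\<lambda>m. f (grid m (nat \<lfloor>t * 2 ^ m\<rfloor>))) \<longlonglongrightarrow> g t"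
    unfolding eq by (rule continuous_on_tendsto_compose[OF g dyadic_floor_tendsto[OF t]]) (use t in auto)
  ultimately show ?thesis by (rule LIMSEQ_unique)
qed

lemma integral_has_vector_derivative_nonneg:
  fixes g :: "real \<Rightarrow> 'e::banach"
  assumes "continuous_on {0..} g" "0 \<le> s" "s \<le> T"
  shows "((\<lambda>u. integral {0..u} g) has_vector_derivative g s) (at s within {0..T})"
  by (rule integral_has_vector_derivative) (use assms in \<open>auto intro: continuous_on_subset\<close>)

lemma continuous_on_integral_nonneg:
  fixes g :: "real \<Rightarrow> 'e::banach"
  assumes "continuous_on {0..} g"
  shows "continuous_on {0..} (\<lambda>u. integral {0..u} g)"
  unfolding continuous_on_eq_continuous_within
proof
  fix t :: real assume t: "t \<in> {0..}"
  have "continuous (at t within {0..t + 1}) (\<lambda>u. integral {0..u} g)"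
    using integral_has_vector_derivative_nonneg[OF assms, of t "t + 1"] t
    by (auto intro: has_vector_derivative_continuous)
  moreover have "at t within {0..t + 1} = at t within {0..}"
    by (rule at_within_nhd[of _ "{..<t + 1}"]) (use t in auto)
  ultimately show "continuous (at t within {0..}) (\<lambda>u. integral {0..u} g)" by simp
qed

text \<open>The solution \<open>Y\<close> of \<open>Y = f - c \<integral> Y\<close>.\<close>

definition relax :: "real \<Rightarrow> (real \<Rightarrow> 'e::banach) \<Rightarrow> real \<Rightarrow> 'e" where
  "relax c f t = f t - (c * exp (- (c * t))) *\<^sub>R integral {0..t} (\<lambda>s. exp (c * s) *\<^sub>R f s)"

text \<open>Integrating factor: with \<open>U\<close> the integral of \<open>\<theta>\<close>, the
  derivative of \<open>exp (c * s) *\<^sub>R U s\<close> is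
  \<open>exp (c * s) *\<^sub>R x s\<close>. Only \<open>U\<close> is differentiated;
  \<open>x\<close>, later the path of a martingale, is in general not differentiable.\<close>

lemma relax_solution:
  fixes \<theta> x :: "real \<Rightarrow> 'e::banach"
  assumes \<theta>: "continuous_on {0..} \<theta>" and eq: "\<And>t. t \<ge> 0 \<Longrightarrow> \<theta> t = x t - c *\<^sub>R integral {0..t} \<theta>"
    and t: "t \<ge> 0"
  shows "\<theta> t = relax c x t"
proof -
  define U where "U = (\<lambda>t. integral {0..t} \<theta>)"
  have "((\<lambda>s. exp (c * s) *\<^sub>R x s) has_integral (exp (c * t) *\<^sub>R U t - exp (c * 0) *\<^sub>R U 0)) {0..t}"
  proof (rule fundamental_theorem_of_calculus[OF t])
    fix s assume s: "s \<in> {0..t}"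
    have "(U has_vector_derivative \<theta> s) (at s within {0..t})"
      unfolding U_def using integral_has_vector_derivative_nonneg[OF \<theta>] s by auto
    moreover have "((\<lambda>s. exp (c * s)) has_real_derivative c * exp (c * s)) (at s within {0..t})"
      by (auto intro!: derivative_eq_intros)
    ultimately have "((\<lambda>s. exp (c * s) *\<^sub>R U s) has_vector_derivative exp (c * s) *\<^sub>R \<theta> s + (c * exp (c * s)) *\<^sub>R U s) (at s within {0..t})"
      by (intro has_vector_derivative_scaleR)
    moreover have "exp (c * s) *\<^sub>R \<theta> s + (c * exp (c * s)) *\<^sub>R U s = exp (c * s) *\<^sub>R x s"
      using eq[of s] s by (simp add: U_def scaleR_diff_right mult.commute)
    ultimately show "((\<lambda>s. exp (c * s) *\<^sub>R U s) has_vector_derivative exp (c * s) *\<^sub>R x s) (at s within {0..t})" by simp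
  qed
  then have "integral {0..t} (\<lambda>s. exp (c * s) *\<^sub>R x s) = exp (c * t) *\<^sub>R U t"
    by (simp add: has_integral_iff U_def)
  moreover have "c * exp (- (c * t)) * exp (c * t) = c" by (simp add: exp_minus)
  ultimately show ?thesis using eq[OF t] by (simp add: relax_def U_def)
qed

lemma relax_restrict: "t \<ge> 0 \<Longrightarrow> relax c (restrict f {0..}) t = relax c f t"
proof -
  assume t: "t \<ge> 0"
  have "integral {0..t} (\<lambda>s. exp (c * s) *\<^sub>R restrict f {0..} s) = integral {0..t} (\<lambda>s. exp (c * s) *\<^sub>R f s)"
    by (rule Henstock_Kurzweil_Integration.integral_cong) simp
  then show ?thesis using t by (simp add: relax_def)
qed

lemma continuous_on_relax:
  assumes "continuous_on {0..} f"
  shows "continuous_on {0..} (relax c f)"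
  unfolding relax_def[abs_def]
  by (intro continuous_intros assms continuous_on_integral_nonneg)

text \<open>For \<open>s \<le> t\<close> the weight \<open>c * exp (- (c * t)) * exp (c * s)\<close>
  is at most \<open>c\<close>, so the integral contributes at most
  \<open>c * T * \<eta>\<close>.\<close>

lemma relax_dist:
  fixes f g :: "real \<Rightarrow> 'e::banach"
  assumes f: "continuous_on {0..} f" and g: "continuous_on {0..} g" and c: "c \<ge> 0"
    and le: "\<And>s. s \<in> {0..T} \<Longrightarrow> norm (f s - g s) \<le> \<eta>" and t: "t \<in> {0..T}"
  shows "norm (relax c f t - relax c g t) \<le> (1 + c * T) * \<eta>"
proof -
  have \<eta>: "\<eta> \<ge> 0" using le[OF t] norm_ge_zero[of "f t - g t"] by linarith
  have i: "(\<lambda>s. exp (c * s) *\<^sub>R f s) integrable_on {0..t}" "(\<lambda>s. exp (c * s) *\<^sub>R g s) integrable_on {0..t}"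
    using f g by (auto intro!: integrable_continuous_real continuous_intros intro: continuous_on_subset)
  define D where "D = integral {0..t} (\<lambda>s. exp (c * s) *\<^sub>R f s - exp (c * s) *\<^sub>R g s)"
  have "norm D \<le> (exp (c * t) * \<eta>) * (t - 0)"
    unfolding D_def
  proof (rule integral_bound)
    show "continuous_on {0..t} (\<lambda>s. exp (c * s) *\<^sub>R f s - exp (c * s) *\<^sub>R g s)"
      using f g by (intro continuous_intros) (auto intro: continuous_on_subset)
    fix s assume s: "s \<in> {0..t}"
    have "norm (exp (c * s) *\<^sub>R f s - exp (c * s) *\<^sub>R g s) = exp (c * s) * norm (f s - g s)"
      by (simp add: scaleR_diff_right[symmetric])
    also have "\<dots> \<le> exp (c * t) * \<eta>"
      using le[of s] s t c by (intro mult_mono) (auto intro: mult_left_mono)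
    finally show "norm (exp (c * s) *\<^sub>R f s - exp (c * s) *\<^sub>R g s) \<le> exp (c * t) * \<eta>" .
  qed (use t in simp)
  then have "c * exp (- (c * t)) * norm D \<le> c * exp (- (c * t)) * ((exp (c * t) * \<eta>) * (t - 0))"
    using c by (intro mult_left_mono) auto
  also have "\<dots> = c * \<eta> * t" by (simp add: exp_minus)
  also have "\<dots> \<le> c * \<eta> * T" using c \<eta> t by (intro mult_left_mono) auto
  finally have D: "c * exp (- (c * t)) * norm D \<le> c * \<eta> * T" .
  have "relax c f t - relax c g t = (f t - g t) - (c * exp (- (c * t))) *\<^sub>R D"
    unfolding D_def Henstock_Kurzweil_Integration.integral_diff[OF i] by (simp add: relax_def scaleR_diff_right)
  also have "norm \<dots> \<le> norm (f t - g t) + c * exp (- (c * t)) * norm D"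
    using c by (intro order_trans[OF norm_triangle_ineq4]) simp
  also have "\<dots> \<le> \<eta> + c * \<eta> * T" using le[OF t] D by (intro add_mono)
  finally show ?thesis by (simp add: algebra_simps)
qed

lemma relax_path_space:
  fixes f :: "real \<Rightarrow> 'e::banach"
  assumes "f \<in> path_space"
  shows "restrict (relax c f) {0..} \<in> path_space"
proof -
  have "continuous_on {0..} (relax c f)" using assms by (intro continuous_on_relax) (simp add: path_space_def)
  then have "continuous_on {0..} (restrict (relax c f) {0..})"
    by (subst continuous_on_cong[of _ _ _ "relax c f"]) auto
  then show ?thesis by (simp add: path_space_def)
qed

text \<open>Up to time \<open>T\<close> the solution depends only on the driving path up to
  \<open>T\<close>, and by \<open>relax_dist\<close> it does so continuously; hence locally uniform
  convergence is preserved.\<close>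

lemma continuous_map_relax:
  fixes \<phi> :: "(real \<Rightarrow> 'e::banach) \<Rightarrow> real"
  assumes \<phi>: "continuous_map path_topology euclideanreal \<phi>" and c: "c \<ge> 0"
  shows "continuous_map path_topology euclideanreal (\<lambda>f. \<phi> (restrict (relax c f) {0..}))"
proof (rule path_continuousI)
  fix f :: "real \<Rightarrow> 'e" and e :: real assume f: "f \<in> path_space" and e: "e > 0"
  obtain d where d: "d > 0" "\<And>g. g \<in> path_space \<Longrightarrow> path_dist g (restrict (relax c f) {0..}) < d \<Longrightarrow>
      \<bar>\<phi> g - \<phi> (restrict (relax c f) {0..})\<bar> < e"
    using path_continuousD[OF \<phi> relax_path_space[OF f] e] by blast
  define T where "T = 2 / d"
  have T: "T \<ge> 0" "1 / (1 + T) < d" using d(1) by (auto simp: T_def field_simps add_pos_pos)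
  have cT: "1 + c * T > 0" using c T by (simp add: add_pos_nonneg)
  define q where "q = 1 + c * T"
  define \<eta> where "\<eta> = d / (2 * q)"
  have "\<eta> > 0" "q * \<eta> = d / 2" using d(1) cT by (auto simp: \<eta>_def q_def[symmetric])
  then have \<eta>: "\<eta> > 0" "(1 + c * T) * \<eta> = d / 2" by (simp_all add: q_def)
  have "\<bar>\<phi> (restrict (relax c g) {0..}) - \<phi> (restrict (relax c f) {0..})\<bar> < e"
    if g: "g \<in> path_space" "path_dist g f < min \<eta> (1 / (1 + T))" for g
  proof (rule d(2)[OF relax_path_space[OF g(1)]])
    have "path_dist (restrict (relax c g) {0..}) (restrict (relax c f) {0..}) \<le> max (d / 2) (1 / (1 + T))"
    proof (rule path_dist_le[OF T(1)])
      fix t assume t: "t \<in> {0..T}"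
      have "norm (relax c g t - relax c f t) \<le> (1 + c * T) * \<eta>"
      proof (rule relax_dist[OF _ _ c _ t])
        show "continuous_on {0..} g" "continuous_on {0..} f" using f g by (auto simp: path_space_def)
        fix s assume "s \<in> {0..T}"
        then show "norm (g s - f s) \<le> \<eta>" using dist_le_path_dist[of g f T s] g(2) by (auto simp: dist_norm)
      qed
      then show "dist (restrict (relax c g) {0..} t) (restrict (relax c f) {0..} t) \<le> d / 2"
        using t \<eta>(2) by (simp add: dist_norm)
    qed
    also have "\<dots> < d" using T d(1) by simp
    finally show "path_dist (restrict (relax c g) {0..}) (restrict (relax c f) {0..}) < d" .
  qed
  moreover have "min \<eta> (1 / (1 + T)) > 0" using \<eta> T by simp
  ultimately show "\<exists>d>0. \<forall>g\<in>path_space. path_dist g f < d \<longrightarrow>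
     \<bar>\<phi> (restrict (relax c g) {0..}) - \<phi> (restrict (relax c f) {0..})\<bar> < e" by blast
qed

section \<open>Expectations of paths and of their integrals\<close>

lemma (in prob_space) continuous_on_expectation:
  fixes X :: "real \<Rightarrow> 'a \<Rightarrow> 'e::euclidean_space"
  assumes X: "continuous_process M X" and bd: "\<And>t. t \<ge> 0 \<Longrightarrow> AE \<omega> in M. \<forall>s\<in>{0..t}. norm (X s \<omega>) \<le> C t"
  shows "continuous_on {0..t} (\<lambda>s. \<integral>\<omega>. X s \<omega> \<partial>M)"
  unfolding continuous_on_sequentially
proof (intro ballI allI impI, elim conjE)
  fix u and s assume u: "\<forall>n. u n \<in> {0..t}" and us: "u \<longlonglongrightarrow> s" and s: "s \<in> {0..t}"
  then have t: "t \<ge> 0" by simp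
  have "(\<lambda>n. \<integral>\<omega>. X (u n) \<omega> \<partial>M) \<longlonglongrightarrow> (\<integral>\<omega>. X s \<omega> \<partial>M)"
  proof (rule integral_dominated_convergence[where w = "\<lambda>_. C t"])
    show "AE \<omega> in M. (\<lambda>n. X (u n) \<omega>) \<longlonglongrightarrow> X s \<omega>"
    proof (rule AE_I2)
      fix \<omega> assume "\<omega> \<in> space M"
      then have "continuous_on {0..} (\<lambda>t. X t \<omega>)" using X by (simp add: continuous_process_def)
      then show "(\<lambda>n. X (u n) \<omega>) \<longlonglongrightarrow> X s \<omega>"
        by (rule continuous_on_tendsto_compose[OF _ us]) (use u s in auto)
    qed
    show "AE \<omega> in M. norm (X (u n) \<omega>) \<le> C t" for n
      using bd[OF t] by eventually_elim (use u in auto)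
  qed (use X u s in \<open>auto simp: continuous_process_def\<close>)
  then show "((\<lambda>s. \<integral>\<omega>. X s \<omega> \<partial>M) \<circ> u) \<longlonglongrightarrow> (\<integral>\<omega>. X s \<omega> \<partial>M)" by (simp add: o_def)
qed

text \<open>Fubini through Riemann sums: expectation commutes with the finite sums, and both sides
  are limits of the result, one by dominated convergence, the other by continuity of the expectation
  in time.\<close>

lemma (in prob_space) expectation_integral:
  fixes X :: "real \<Rightarrow> 'a \<Rightarrow> 'e::euclidean_space"
  assumes X: "continuous_process M X" and bd: "\<And>t. t \<ge> 0 \<Longrightarrow> AE \<omega> in M. \<forall>s\<in>{0..t}. norm (X s \<omega>) \<le> C t"
    and t: "t \<ge> 0"
  shows "(\<lambda>\<omega>. integral {0..t} (\<lambda>s. X s \<omega>)) \<in> borel_measurable M"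
    "integrable M (\<lambda>\<omega>. integral {0..t} (\<lambda>s. X s \<omega>))"
    "(\<integral>\<omega>. integral {0..t} (\<lambda>s. X s \<omega>) \<partial>M) = integral {0..t} (\<lambda>s. \<integral>\<omega>. X s \<omega> \<partial>M)"
proof -
  define r where "r m \<omega> = (\<Sum>i<m. ((t - 0) / real m) *\<^sub>R X (0 + real (Suc i) * (t - 0) / real m) \<omega>)" for m \<omega>
  have pt: "0 + real (Suc i) * (t - 0) / real m \<in> {0..t}" if "i < m" for i m
  proof -
    have "real (Suc i) / real m \<le> 1" using that by simp
    from mult_right_mono[OF this t] show ?thesis using t by simp
  qed
  have Xm: "X s \<in> borel_measurable M" if "s \<ge> 0" for s using X that by (simp add: continuous_process_def)
  have iX: "integrable M (X s)" if "s \<in> {0..t}" for s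
    by (rule integrable_const_bound[of _ "C t"]) (use bd[OF t] Xm that in \<open>auto elim!: eventually_mono\<close>)
  have rm: "r m \<in> borel_measurable M" for m
    unfolding r_def[abs_def]
  proof (intro borel_measurable_sum borel_measurable_scaleR borel_measurable_const)
    fix i show "X (0 + real (Suc i) * (t - 0) / real m) \<in> borel_measurable M" by (rule Xm) (use t in simp)
  qed
  have lim: "(\<lambda>m. r m \<omega>) \<longlonglongrightarrow> integral {0..t} (\<lambda>s. X s \<omega>)" if "\<omega> \<in> space M" for \<omega>
    unfolding r_def
    by (rule riemann_tendsto[OF t]) (use X that in \<open>auto simp: continuous_process_def intro: continuous_on_subset\<close>)
  show m: "(\<lambda>\<omega>. integral {0..t} (\<lambda>s. X s \<omega>)) \<in> borel_measurable M"
    by (rule borel_measurable_LIMSEQ_metric[OF rm lim])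
  have rb: "AE \<omega> in M. norm (r m \<omega>) \<le> t * \<bar>C t\<bar>" for m
    using bd[OF t]
  proof eventually_elim
    case (elim \<omega>)
    have "norm (r m \<omega>) \<le> (\<Sum>i<m. (t / real m) * \<bar>C t\<bar>)"
      unfolding r_def
    proof (intro order_trans[OF norm_sum] sum_mono)
      fix i assume "i \<in> {..<m}"
      then have "norm (X (0 + real (Suc i) * (t - 0) / real m) \<omega>) \<le> \<bar>C t\<bar>" using elim pt[of i m] by fastforce
      then show "norm (((t - 0) / real m) *\<^sub>R X (0 + real (Suc i) * (t - 0) / real m) \<omega>) \<le> (t / real m) * \<bar>C t\<bar>"
        using t by (simp add: mult_left_mono divide_right_mono)
    qed
    also have "\<dots> \<le> t * \<bar>C t\<bar>" using t by (cases "m = 0") auto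
    finally show ?case .
  qed
  have lr: "(\<lambda>m. \<integral>\<omega>. r m \<omega> \<partial>M) \<longlonglongrightarrow> (\<integral>\<omega>. integral {0..t} (\<lambda>s. X s \<omega>) \<partial>M)"
    and "integrable M (\<lambda>\<omega>. integral {0..t} (\<lambda>s. X s \<omega>))"
    by (rule integral_dominated_convergence[where w = "\<lambda>_. t * \<bar>C t\<bar>"] integrable_dominated_convergence[where w = "\<lambda>_. t * \<bar>C t\<bar>" and s = r];
        use rm m rb lim in auto)+
  then show "integrable M (\<lambda>\<omega>. integral {0..t} (\<lambda>s. X s \<omega>))" by simp
  have "(\<integral>\<omega>. r m \<omega> \<partial>M) = (\<Sum>i<m. ((t - 0) / real m) *\<^sub>R (\<integral>\<omega>. X (0 + real (Suc i) * (t - 0) / real m) \<omega> \<partial>M))" for m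
    unfolding r_def
  proof (subst Bochner_Integration.integral_sum)
    fix i assume "i \<in> {..<m}"
    then show "integrable M (\<lambda>\<omega>. ((t - 0) / real m) *\<^sub>R X (0 + real (Suc i) * (t - 0) / real m) \<omega>)"
      using iX[OF pt] by auto
  qed simp
  moreover have "(\<lambda>m. \<Sum>i<m. ((t - 0) / real m) *\<^sub>R (\<integral>\<omega>. X (0 + real (Suc i) * (t - 0) / real m) \<omega> \<partial>M))
     \<longlonglongrightarrow> integral {0..t} (\<lambda>s. \<integral>\<omega>. X s \<omega> \<partial>M)"
    by (rule riemann_tendsto[OF t continuous_on_expectation[OF X bd]])
  ultimately have "(\<lambda>m. \<integral>\<omega>. r m \<omega> \<partial>M) \<longlonglongrightarrow> integral {0..t} (\<lambda>s. \<integral>\<omega>. X s \<omega> \<partial>M)" by simp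
  then show "(\<integral>\<omega>. integral {0..t} (\<lambda>s. X s \<omega>) \<partial>M) = integral {0..t} (\<lambda>s. \<integral>\<omega>. X s \<omega> \<partial>M)"
    by (rule LIMSEQ_unique[OF lr])
qed

context sphere_bm
begin

text \<open>The mean vanishes at dyadic times by \<open>increment_moments\<close>, and it is
  continuous in time by dominated convergence.\<close>

lemma expectation_I:
  assumes t: "t \<ge> 0"
  shows "integrable M (I t)" "(\<integral>\<omega>. I t \<omega> \<partial>M) = 0"
proof -
  have bd: "AE \<omega> in M. \<forall>s\<in>{0..t}. norm (I s \<omega>) \<le> 2 + c * t" for t
    using AE_I_increment BI.I_0
  proof eventually_elim
    case (elim \<omega>)
    show ?case
    proof
      fix s assume s: "s \<in> {0..t}"
      then have "norm (I s \<omega> - I 0 \<omega>) \<le> 2 + c * (s - 0)" using elim by auto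
      also have "\<dots> \<le> 2 + c * t" using c_nonneg s by (simp add: mult_left_mono)
      finally show "norm (I s \<omega>) \<le> 2 + c * t" using elim by simp
    qed
  qed
  have i: "integrable M (I s)" if "s \<ge> 0" for s
    by (rule integrable_const_bound[of _ "2 + c * s"]) (use bd[of s] that in \<open>auto elim!: eventually_mono\<close>)
  show "integrable M (I t)" by (rule i[OF t])
  have dy: "(\<integral>\<omega>. I (grid j b) \<omega> \<partial>M) = 0" for j b
  proof (rule vector_eq_ldot[THEN iffD1], rule allI)
    fix v :: "real^'n"
    have "v \<bullet> (\<integral>\<omega>. I (grid j b) \<omega> \<partial>M) = (\<integral>\<omega>. v \<bullet> I (grid j b) \<omega> \<partial>M)"
      using i[of "grid j b"] by simp
    also have "\<dots> = (\<integral>\<omega>. v \<bullet> (I (grid j b) \<omega> - I (grid j 0) \<omega>) \<partial>M)"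
      by (rule integral_cong_AE) (use BI.I_0 in \<open>auto elim!: eventually_mono\<close>)
    also have "\<dots> = 0" by (rule increment_moments(1)) simp
    finally show "v \<bullet> (\<integral>\<omega>. I (grid j b) \<omega> \<partial>M) = v \<bullet> 0" by simp
  qed
  have co: "continuous_on {0..t + 1} (\<lambda>s. \<integral>\<omega>. I s \<omega> \<partial>M)"
    by (rule continuous_on_expectation[OF I_cont bd])
  have g: "(\<lambda>m. grid m (nat \<lfloor>t * 2 ^ m\<rfloor>)) \<longlonglongrightarrow> t" by (rule dyadic_floor_tendsto[OF t])
  have "(\<lambda>m. \<integral>\<omega>. I (grid m (nat \<lfloor>t * 2 ^ m\<rfloor>)) \<omega> \<partial>M) \<longlonglongrightarrow> (\<integral>\<omega>. I t \<omega> \<partial>M)"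
  proof (rule continuous_on_tendsto_compose[OF co g])
    show "t \<in> {0..t + 1}" using t by simp
    have "\<forall>\<^sub>F m in sequentially. grid m (nat \<lfloor>t * 2 ^ m\<rfloor>) < t + 1" using g by (rule order_tendstoD) simp
    then show "\<forall>\<^sub>F m in sequentially. grid m (nat \<lfloor>t * 2 ^ m\<rfloor>) \<in> {0..t + 1}" by eventually_elim simp
  qed
  then show "(\<integral>\<omega>. I t \<omega> \<partial>M) = 0" by (simp add: dy LIMSEQ_const_iff)
qed

lemma \<Theta>_bound: "AE \<omega> in M. \<forall>s\<in>{0..t}. norm (\<Theta> s \<omega>) \<le> 1"
  using AE_norm by eventually_elim auto

lemma continuous_on_expectation_\<Theta>: "continuous_on {0..} (\<lambda>s. \<integral>\<omega>. \<Theta> s \<omega> \<partial>M)"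
  unfolding continuous_on_eq_continuous_within
proof
  fix t :: real assume t: "t \<in> {0..}"
  have "continuous_on {0..t + 1} (\<lambda>s. \<integral>\<omega>. \<Theta> s \<omega> \<partial>M)"
    by (rule continuous_on_expectation[OF \<Theta>_cont \<Theta>_bound])
  then have "continuous (at t within {0..t + 1}) (\<lambda>s. \<integral>\<omega>. \<Theta> s \<omega> \<partial>M)"
    using t by (simp add: continuous_on_eq_continuous_within)
  moreover have "at t within {0..t + 1} = at t within {0..}"
    by (rule at_within_nhd[of _ "{..<t + 1}"]) (use t in auto)
  ultimately show "continuous (at t within {0..}) (\<lambda>s. \<integral>\<omega>. \<Theta> s \<omega> \<partial>M)" by simp
qed

lemma expectation_\<Theta>:
  assumes t: "t \<ge> 0"
  shows "(\<integral>\<omega>. \<Theta> t \<omega> \<partial>M) = relax c (\<lambda>_. \<Theta>0) t"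
proof (rule relax_solution[OF continuous_on_expectation_\<Theta> _ t])
  fix t :: real assume t: "t \<ge> 0"
  note ei = expectation_integral[OF \<Theta>_cont \<Theta>_bound t]
  have "(\<integral>\<omega>. \<Theta> t \<omega> \<partial>M) = (\<integral>\<omega>. \<Theta>0 + I t \<omega> - c *\<^sub>R integral {0..t} (\<lambda>s. \<Theta> s \<omega>) \<partial>M)"
    by (rule integral_cong_AE) (use AE_sde ei(1) t in \<open>auto elim!: eventually_mono\<close>)
  also have "\<dots> = \<Theta>0 - c *\<^sub>R integral {0..t} (\<lambda>s. \<integral>\<omega>. \<Theta> s \<omega> \<partial>M)"
    using ei(2,3) expectation_I[OF t] by (simp add: prob_space)
  finally show "(\<integral>\<omega>. \<Theta> t \<omega> \<partial>M) = \<Theta>0 - c *\<^sub>R integral {0..t} (\<lambda>s. \<integral>\<omega>. \<Theta> s \<omega> \<partial>M)" .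
qed

text \<open>\<open>relax\<close> is linear: \<open>\<Theta>\<close> is the solution driven by
  \<open>\<Theta>0 + I\<close>, and its expectation is the one driven by the constant
  \<open>\<Theta>0\<close>.\<close>

lemma AE_centred: "AE \<omega> in M. \<forall>t\<ge>0. \<Theta> t \<omega> - (\<integral>\<omega>'. \<Theta> t \<omega>' \<partial>M) = relax c (\<lambda>t. I t \<omega>) t"
  using AE_sde AE_space
proof eventually_elim
  case (elim \<omega>)
  show ?case
  proof (intro allI impI)
    fix t :: real assume t: "t \<ge> 0"
    have Ic: "continuous_on {0..t} (\<lambda>t. I t \<omega>)"
      using I_cont elim by (auto simp: continuous_process_def intro: continuous_on_subset)
    have "\<Theta> t \<omega> = relax c (\<lambda>t. \<Theta>0 + I t \<omega>) t"
      by (rule relax_solution[OF \<Theta>_path _ t]) (use elim in auto)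
    also have "\<dots> = relax c (\<lambda>_. \<Theta>0) t + relax c (\<lambda>t. I t \<omega>) t"
    proof -
      have "integral {0..t} (\<lambda>s. exp (c * s) *\<^sub>R (\<Theta>0 + I s \<omega>)) =
         integral {0..t} (\<lambda>s. exp (c * s) *\<^sub>R \<Theta>0) + integral {0..t} (\<lambda>s. exp (c * s) *\<^sub>R I s \<omega>)"
        unfolding scaleR_add_right
        by (rule Henstock_Kurzweil_Integration.integral_add)
          (auto intro!: integrable_continuous_real continuous_intros Ic)
      then show ?thesis by (simp add: relax_def scaleR_add_right)
    qed
    finally show "\<Theta> t \<omega> - (\<integral>\<omega>'. \<Theta> t \<omega>' \<partial>M) = relax c (\<lambda>t. I t \<omega>) t"
      unfolding expectation_\<Theta>[OF t] by simp
  qed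
qed

end

section \<open>Exponential integrals against continuous processes\<close>

lemma (in prob_space) converges_in_prob_AE_unique:
  assumes [measurable]: "\<And>m. X m \<in> borel_measurable M" "Y \<in> borel_measurable M" "Z \<in> borel_measurable M"
    and conv: "converges_in_prob M X Y" and lim: "AE \<omega> in M. (\<lambda>m. X m \<omega>) \<longlonglongrightarrow> Z \<omega>"
  shows "AE \<omega> in M. Y \<omega> = Z \<omega>"
proof -
  have p0: "prob {\<omega> \<in> space M. \<epsilon> < \<bar>Y \<omega> - Z \<omega>\<bar>} = 0" if \<epsilon>: "\<epsilon> > 0" for \<epsilon>
  proof -
    define A where "A m = {\<omega> \<in> space M. \<epsilon> / 2 < \<bar>X m \<omega> - Y \<omega>\<bar>}" for m
    define B where "B m = {\<omega> \<in> space M. \<epsilon> / 2 < \<bar>X m \<omega> - Z \<omega>\<bar>}" for m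
    have [measurable]: "A m \<in> sets M" "B m \<in> sets M" for m unfolding A_def B_def by measurable
    have e2: "\<epsilon> / 2 > 0" using \<epsilon> by simp
    have lA: "(\<lambda>m. prob (A m)) \<longlonglongrightarrow> 0"
      using conv[unfolded converges_in_prob_def, rule_format, OF e2] unfolding A_def .
    have "(\<lambda>m. \<integral>\<omega>. indicator (B m) \<omega> \<partial>M) \<longlonglongrightarrow> (\<integral>\<omega>. 0 \<partial>M :: real)"
    proof (rule integral_dominated_convergence[where w = "\<lambda>_. 1"])
      show "AE \<omega> in M. (\<lambda>m. indicator (B m) \<omega> :: real) \<longlonglongrightarrow> 0"
        using lim
      proof eventually_elim
        case (elim \<omega>)
        have "\<forall>\<^sub>F m in sequentially. dist (X m \<omega>) (Z \<omega>) < \<epsilon> / 2" using elim e2 by (rule tendstoD)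
        then have "\<forall>\<^sub>F m in sequentially. indicator (B m) \<omega> = (0::real)"
          by eventually_elim (simp add: B_def dist_real_def)
        then show ?case by (rule tendsto_eventually)
      qed
    qed (auto simp: indicator_def)
    then have lB: "(\<lambda>m. prob (B m)) \<longlonglongrightarrow> 0" by simp
    have "prob {\<omega> \<in> space M. \<epsilon> < \<bar>Y \<omega> - Z \<omega>\<bar>} \<le> prob (A m) + prob (B m)" for m
    proof -
      have "{\<omega> \<in> space M. \<epsilon> < \<bar>Y \<omega> - Z \<omega>\<bar>} \<subseteq> A m \<union> B m"
      proof (rule subsetI, rule ccontr)
        fix \<omega> assume "\<omega> \<in> {\<omega> \<in> space M. \<epsilon> < \<bar>Y \<omega> - Z \<omega>\<bar>}" "\<omega> \<notin> A m \<union> B m"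
        then have "\<bar>X m \<omega> - Y \<omega>\<bar> \<le> \<epsilon> / 2" "\<bar>X m \<omega> - Z \<omega>\<bar> \<le> \<epsilon> / 2" "\<epsilon> < \<bar>Y \<omega> - Z \<omega>\<bar>"
          by (auto simp: A_def B_def not_less)
        then show False by linarith
      qed
      then have "prob {\<omega> \<in> space M. \<epsilon> < \<bar>Y \<omega> - Z \<omega>\<bar>} \<le> prob (A m \<union> B m)"
        by (intro finite_measure_mono) auto
      also have "\<dots> \<le> prob (A m) + prob (B m)" by (rule measure_Un_le) auto
      finally show ?thesis .
    qed
    then have "prob {\<omega> \<in> space M. \<epsilon> < \<bar>Y \<omega> - Z \<omega>\<bar>} \<le> 0 + 0"
      by (intro LIMSEQ_le_const[OF tendsto_add[OF lA lB]]) auto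
    then show ?thesis by (simp add: measure_le_0_iff)
  qed
  have "AE \<omega> in M. \<not> 1 / real (Suc k) < \<bar>Y \<omega> - Z \<omega>\<bar>" for k
    by (subst AE_iff_measurable[OF _ refl]) (use p0[of "1 / real (Suc k)"] in \<open>auto simp: emeasure_eq_measure\<close>)
  then have "AE \<omega> in M. \<forall>k. \<not> 1 / real (Suc k) < \<bar>Y \<omega> - Z \<omega>\<bar>"
    by (simp add: AE_all_countable)
  then show ?thesis
  proof eventually_elim
    case (elim \<omega>)
    show ?case
    proof (rule ccontr)
      assume "Y \<omega> \<noteq> Z \<omega>"
      then obtain k where "inverse (real (Suc k)) < \<bar>Y \<omega> - Z \<omega>\<bar>" using reals_Archimedean[of "\<bar>Y \<omega> - Z \<omega>\<bar>"] by auto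
      then show False using elim by (simp add: inverse_eq_divide)
    qed
  qed
qed

lemma relax_scaleR_sum:
  fixes f :: "'k \<Rightarrow> real \<Rightarrow> 'e::banach"
  assumes "finite A" "\<And>k. k \<in> A \<Longrightarrow> continuous_on {0..} (f k)"
  shows "relax c (\<lambda>t. a *\<^sub>R (\<Sum>k\<in>A. f k t)) t = a *\<^sub>R (\<Sum>k\<in>A. relax c (f k) t)"
proof -
  have i: "(\<lambda>s. exp (c * s) *\<^sub>R f k s) integrable_on {0..t}" if "k \<in> A" for k
    using assms(2)[OF that] by (auto intro!: integrable_continuous_real continuous_intros intro: continuous_on_subset)
  have "integral {0..t} (\<lambda>s. exp (c * s) *\<^sub>R (a *\<^sub>R (\<Sum>k\<in>A. f k s))) = integral {0..t} (\<lambda>s. a *\<^sub>R (\<Sum>k\<in>A. exp (c * s) *\<^sub>R f k s))"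
    by (simp add: scaleR_sum_right mult.commute)
  also have "\<dots> = a *\<^sub>R (\<Sum>k\<in>A. integral {0..t} (\<lambda>s. exp (c * s) *\<^sub>R f k s))"
    by (simp add: Henstock_Kurzweil_Integration.integral_sum[OF assms(1) i])
  finally show ?thesis
    by (simp add: relax_def sum_subtractf scaleR_diff_right scaleR_sum_right mult_ac)
qed

lemma abel_summation:
  fixes x :: "nat \<Rightarrow> 'e::real_vector" and a :: "nat \<Rightarrow> real"
  shows "(\<Sum>i<q. a i *\<^sub>R (x (Suc i) - x i)) = a q *\<^sub>R x q - a 0 *\<^sub>R x 0 - (\<Sum>i<q. (a (Suc i) - a i) *\<^sub>R x (Suc i))"
  by (induction q) (simp_all add: algebra_simps)

text \<open>The integrand is deterministic and smooth, so after summation by parts the elementary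
  integrals converge along every path, whatever the law of \<open>X\<close>. Their limit is
  identified with \<open>Q\<close> at dyadic times first, almost surely, and then at all times by
  continuity.\<close>

lemma (in prob_space) stochastic_integral_exp:
  fixes X Q :: "real \<Rightarrow> 'a \<Rightarrow> 'e::euclidean_space"
  assumes SI: "stochastic_integral M F (*\<^sub>R) (\<lambda>s _. exp (c * s)) X Q" and X0: "AE \<omega> in M. X 0 \<omega> = 0" and c: "c \<ge> 0"
  shows "AE \<omega> in M. \<forall>t\<ge>0. exp (- (c * t)) *\<^sub>R Q t \<omega> = relax c (\<lambda>t. X t \<omega>) t"
proof -
  have X: "continuous_process M X" and Q: "continuous_process M Q"
    using stochastic_integralD(4,5)[OF SI] by auto
  define \<xi> where "\<xi> m i = (\<lambda>_ :: 'a. exp (c * grid m i))" for m i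
  define A where "A m = elementary_integral (*\<^sub>R) (m * 2 ^ m) (grid m) (\<xi> m) X" for m
  \<comment> \<open>The outcome of integrating \<open>exp (c * s)\<close> against \<open>dX\<close>
    by parts.\<close>
  define R where "R t \<omega> = exp (c * t) *\<^sub>R X t \<omega> - X 0 \<omega> - integral {0..t} (\<lambda>s. (c * exp (c * s)) *\<^sub>R X s \<omega>)" for t \<omega>
  have ucp: "ucp_tendsto M A Q"
    unfolding A_def[abs_def]
    by (rule stochastic_integral_grid[OF prob_space_axioms SI]) (auto simp: \<xi>_def)
  have Ac: "continuous_process M (A m)" for m
    unfolding A_def by (rule continuous_process_elementary_integral[OF bounded_bilinear_scaleR X]) (simp add: \<xi>_def)
  have path: "continuous_on {0..} (\<lambda>t. X t \<omega>)" if "\<omega> \<in> space M" for \<omega>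
    using X that by (simp add: continuous_process_def)
  have lim: "(\<lambda>m. A m (grid j b) \<omega>) \<longlonglongrightarrow> R (grid j b) \<omega>" if w: "\<omega> \<in> space M" for j b \<omega>
  proof -
    define G where "G s = exp (c * s)" for s
    have "(\<lambda>m. \<Sum>l\<in>{0 * 2 ^ m..<b * 2 ^ m}. (G (grid (j + m) (Suc l)) - G (grid (j + m) l)) *\<^sub>R X (grid (j + m) (Suc l)) \<omega>)
      \<longlonglongrightarrow> integral {grid j 0..grid j b} (\<lambda>s. (c * exp (c * s)) *\<^sub>R X s \<omega>)"
    proof (rule riemann_grid_tendsto)
      show "continuous_on {grid j 0..grid j b} (\<lambda>s. X s \<omega>)"
        by (rule continuous_on_subset[OF path[OF w]]) auto
      show "(G has_real_derivative c * exp (c * s)) (at s within {grid j 0..grid j b})" for s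
        unfolding G_def[abs_def] by (auto intro!: derivative_eq_intros)
    qed (use c in \<open>auto intro!: continuous_intros\<close>)
    then have l: "(\<lambda>m. exp (c * grid j b) *\<^sub>R X (grid j b) \<omega> - X 0 \<omega> - (\<Sum>l<b * 2 ^ m. (G (grid (j + m) (Suc l)) - G (grid (j + m) l)) *\<^sub>R X (grid (j + m) (Suc l)) \<omega>))
      \<longlonglongrightarrow> R (grid j b) \<omega>"
      unfolding R_def by (intro tendsto_diff tendsto_const) (simp add: atLeast0LessThan)
    \<comment> \<open>For \<open>m \<ge> b\<close> the cells of level \<open>m + j\<close> reach as
      far as \<open>grid j b\<close>.\<close>
    have ev: "A (m + j) (grid j b) \<omega> = exp (c * grid j b) *\<^sub>R X (grid j b) \<omega> - X 0 \<omega> - (\<Sum>l<b * 2 ^ m. (G (grid (j + m) (Suc l)) - G (grid (j + m) l)) *\<^sub>R X (grid (j + m) (Suc l)) \<omega>)"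
      if m: "m \<ge> b" for m
    proof -
      have g: "grid j b = grid (m + j) (b * 2 ^ m)" using grid_refine[of j "m + j" b] by simp
      have "(2::nat) ^ m \<le> 2 ^ (m + j)" by (rule power_increasing) auto
      then have le: "b * 2 ^ m \<le> (m + j) * 2 ^ (m + j)" using m by (intro mult_le_mono) auto
      have "A (m + j) (grid j b) \<omega> = (\<Sum>i<b * 2 ^ m. G (grid (m + j) i) *\<^sub>R (X (grid (m + j) (Suc i)) \<omega> - X (grid (m + j) i) \<omega>))"
        unfolding A_def g by (subst elementary_integral_grid[OF bounded_bilinear_scaleR le]) (simp add: \<xi>_def G_def)
      also have "\<dots> = G (grid j b) *\<^sub>R X (grid j b) \<omega> - G (grid (m + j) 0) *\<^sub>R X (grid (m + j) 0) \<omega>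
         - (\<Sum>i<b * 2 ^ m. (G (grid (m + j) (Suc i)) - G (grid (m + j) i)) *\<^sub>R X (grid (m + j) (Suc i)) \<omega>)"
        unfolding g by (rule abel_summation)
      finally show ?thesis by (simp add: G_def add.commute)
    qed
    have "(\<lambda>m. A (m + j) (grid j b) \<omega>) \<longlonglongrightarrow> R (grid j b) \<omega>"
      by (rule Lim_transform_eventually[OF l eventually_sequentiallyI[of b]]) (rule ev[symmetric])
    then show ?thesis by (rule LIMSEQ_offset)
  qed
  have eq: "AE \<omega> in M. v \<bullet> Q (grid j b) \<omega> = v \<bullet> R (grid j b) \<omega>" for v j b
  proof (rule converges_in_prob_AE_unique)
    have Am: "A m (grid j b) \<in> borel_measurable M" for m using Ac by (simp add: continuous_process_def)
    then show "(\<lambda>\<omega>. v \<bullet> A m (grid j b) \<omega>) \<in> borel_measurable M" for m by measurable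
    have "Q (grid j b) \<in> borel_measurable M" using Q by (simp add: continuous_process_def)
    then show "(\<lambda>\<omega>. v \<bullet> Q (grid j b) \<omega>) \<in> borel_measurable M" by measurable
    have "R (grid j b) \<in> borel_measurable M" by (rule borel_measurable_LIMSEQ_metric[OF Am lim])
    then show "(\<lambda>\<omega>. v \<bullet> R (grid j b) \<omega>) \<in> borel_measurable M" by measurable
    have "converges_in_prob M (\<lambda>m \<omega>. \<Sum>i\<in>{()}. v \<bullet> A m (grid j b) \<omega>) (\<lambda>\<omega>. \<Sum>i\<in>{()}. v \<bullet> Q (grid j b) \<omega>)"
      by (rule ucp_tendsto_weighted_sum[OF prob_space_axioms ucp Ac Q]) auto
    then show "converges_in_prob M (\<lambda>m \<omega>. v \<bullet> A m (grid j b) \<omega>) (\<lambda>\<omega>. v \<bullet> Q (grid j b) \<omega>)" by simp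
    show "AE \<omega> in M. (\<lambda>m. v \<bullet> A m (grid j b) \<omega>) \<longlonglongrightarrow> v \<bullet> R (grid j b) \<omega>"
      by (rule AE_I2) (intro tendsto_inner tendsto_const lim)
  qed
  have "AE \<omega> in M. \<forall>v\<in>Basis. v \<bullet> Q (grid j b) \<omega> = v \<bullet> R (grid j b) \<omega>" for j b
    using eq by (intro AE_finite_allI) auto
  then have "AE \<omega> in M. \<forall>j b. \<forall>v\<in>Basis. v \<bullet> Q (grid j b) \<omega> = v \<bullet> R (grid j b) \<omega>"
    by (intro AE_all_countable[THEN iffD2] allI)
  then show ?thesis
    using X0 AE_space
  proof eventually_elim
    case (elim \<omega>)
    have d: "Q (grid j b) \<omega> = R (grid j b) \<omega>" for j b
      by (rule euclidean_eqI) (use elim(1) in \<open>simp add: inner_commute\<close>)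
    have Rc: "continuous_on {0..} (\<lambda>t. R t \<omega>)"
      unfolding R_def by (intro continuous_intros continuous_on_integral_nonneg path elim(3))
    have Qc: "continuous_on {0..} (\<lambda>t. Q t \<omega>)" using Q elim by (simp add: continuous_process_def)
    show ?case
    proof (intro allI impI)
      fix t :: real assume t: "t \<ge> 0"
      have "Q t \<omega> = R t \<omega>" by (rule continuous_on_eq_of_dyadic[OF Qc Rc d t])
      also have "\<dots> = exp (c * t) *\<^sub>R X t \<omega> - c *\<^sub>R integral {0..t} (\<lambda>s. exp (c * s) *\<^sub>R X s \<omega>)"
        using elim(2) by (simp add: R_def flip: scaleR_scaleR)
      finally have "exp (- (c * t)) *\<^sub>R Q t \<omega> = (exp (- (c * t)) * exp (c * t)) *\<^sub>R X t \<omega>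
         - (c * exp (- (c * t))) *\<^sub>R integral {0..t} (\<lambda>s. exp (c * s) *\<^sub>R X s \<omega>)"
        by (simp add: scaleR_diff_right mult.commute)
      then show "exp (- (c * t)) *\<^sub>R Q t \<omega> = relax c (\<lambda>t. X t \<omega>) t"
        by (simp add: relax_def exp_add[symmetric])
    qed
  qed
qed

text \<open>Continuous mapping: a test function \<open>\<phi>\<close> for \<open>Z\<close> is
  composed with \<open>relax\<close> to a test function for \<open>X\<close>. The relation between
  the processes holds almost surely, which is enough because only expectations are compared.\<close>

lemma converges_in_law_relax:
  fixes X Z :: "nat \<Rightarrow> real \<Rightarrow> 'w \<Rightarrow> 'e::euclidean_space" and Y W :: "real \<Rightarrow> 'v \<Rightarrow> 'e"
  assumes law: "converges_in_law M X N Y" and c: "c \<ge> 0"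
    and Z: "\<And>K. continuous_process M (Z K)" and W: "continuous_process N W"
    and ZX: "\<And>K. AE \<omega> in M. \<forall>t\<ge>0. Z K t \<omega> = relax c (\<lambda>t. X K t \<omega>) t"
    and WY: "AE \<omega> in N. \<forall>t\<ge>0. W t \<omega> = relax c (\<lambda>t. Y t \<omega>) t"
  shows "converges_in_law M Z N W"
  unfolding converges_in_law_def
proof (intro conjI allI impI trajectory_measurable Z W)
  fix \<phi> :: "(real \<Rightarrow> 'e) \<Rightarrow> real"
  assume \<phi>: "continuous_map path_topology euclideanreal \<phi>" and "\<exists>C. \<forall>f\<in>path_space. \<bar>\<phi> f\<bar> \<le> C"
  then obtain C where C: "\<And>f. f \<in> path_space \<Longrightarrow> \<bar>\<phi> f\<bar> \<le> C" by blast
  let ?\<psi> = "\<lambda>f. \<phi> (restrict (relax c f) {0..})"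
  have \<psi>: "continuous_map path_topology euclideanreal ?\<psi>" by (rule continuous_map_relax[OF \<phi> c])
  have \<psi>C: "\<exists>C. \<forall>f\<in>path_space. \<bar>?\<psi> f\<bar> \<le> C" using C[OF relax_path_space] by blast
  have m: "\<phi> \<in> borel_measurable path_borel" "?\<psi> \<in> borel_measurable path_borel"
    using \<phi> \<psi> by (auto intro: continuous_map_measurable_path_borel)
  have key: "(\<integral>f. \<phi> f \<partial>law P U) = (\<integral>f. ?\<psi> f \<partial>law P S)"
    if U: "trajectory U \<in> measurable P path_borel" and S: "trajectory S \<in> measurable P path_borel"
      and US: "AE \<omega> in P. \<forall>t\<ge>0. U t \<omega> = relax c (\<lambda>t. S t \<omega>) t" for P and U S :: "real \<Rightarrow> 'z \<Rightarrow> 'e"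
  proof -
    have "(\<integral>f. \<phi> f \<partial>law P U) = (\<integral>\<omega>. \<phi> (trajectory U \<omega>) \<partial>P)" unfolding law_def by (rule integral_distr[OF U m(1)])
    also have "\<dots> = (\<integral>\<omega>. ?\<psi> (trajectory S \<omega>) \<partial>P)"
    proof (rule integral_cong_AE)
      show "AE \<omega> in P. \<phi> (trajectory U \<omega>) = ?\<psi> (trajectory S \<omega>)"
        using US
      proof eventually_elim
        case (elim \<omega>)
        have "trajectory U \<omega> = restrict (relax c (trajectory S \<omega>)) {0..}"
        proof (rule ext)
          fix t
          show "trajectory U \<omega> t = restrict (relax c (trajectory S \<omega>)) {0..} t"
            using elim relax_restrict[of t c "\<lambda>t. S t \<omega>"] by (simp add: trajectory_def restrict_def)
        qed
        then show ?case by simp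
      qed
    qed (use measurable_compose[OF U m(1)] measurable_compose[OF S m(2)] in auto)
    also have "\<dots> = (\<integral>f. ?\<psi> f \<partial>law P S)" unfolding law_def by (rule integral_distr[OF S m(2), symmetric])
    finally show ?thesis .
  qed
  have Xm: "trajectory (X K) \<in> measurable M path_borel" and Ym: "trajectory Y \<in> measurable N path_borel" for K
    using law by (auto simp: converges_in_law_def)
  have "(\<lambda>K. \<integral>f. ?\<psi> f \<partial>law M (X K)) \<longlonglongrightarrow> (\<integral>f. ?\<psi> f \<partial>law N Y)"
    using law \<psi> \<psi>C unfolding converges_in_law_def by blast
  then show "(\<lambda>K. \<integral>f. \<phi> f \<partial>law M (Z K)) \<longlonglongrightarrow> (\<integral>f. \<phi> f \<partial>law N W)"
    unfolding key[OF trajectory_measurable[OF Z] Xm ZX] key[OF trajectory_measurable[OF W] Ym WY] .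
qed

section \<open>Fluctuations of the positions and the final assembly\<close>

context iid_spheres
begin

definition ZK :: "nat \<Rightarrow> real \<Rightarrow> 'w \<Rightarrow> real^'n" where
  "ZK K t \<omega> = (1 / sqrt (real K)) *\<^sub>R (\<Sum>k=1..K. \<Theta> k t \<omega> - (\<integral>\<omega>'. \<Theta> k t \<omega>' \<partial>M))"

lemma ZK_continuous: "continuous_process M (ZK K)"
proof -
  have T: "(\<forall>t\<ge>0. \<Theta> k t \<in> borel_measurable M) \<and> (\<forall>\<omega>\<in>space M. continuous_on {0..} (\<lambda>t. \<Theta> k t \<omega>))"
    "continuous_on {0..} (\<lambda>t. \<integral>\<omega>'. \<Theta> k t \<omega>' \<partial>M)" if "k \<in> {1..K}" for k
    using sphere_bm.\<Theta>_cont[OF sphere[of k]] sphere_bm.continuous_on_expectation_\<Theta>[OF sphere[of k]] that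
    by (simp_all add: continuous_process_def)
  show ?thesis
    unfolding continuous_process_def ZK_def[abs_def]
    using T by (auto intro!: continuous_on_scaleR continuous_on_sum continuous_on_const continuous_on_diff
        borel_measurable_scaleR borel_measurable_sum borel_measurable_const borel_measurable_diff)
qed

text \<open>Linearity of \<open>relax\<close> carries the relation for the centred position of each
  copy over to the normalized sum.\<close>

lemma AE_ZK: "AE \<omega> in M. \<forall>t\<ge>0. ZK K t \<omega> = relax drift (\<lambda>t. MK K t \<omega>) t"
proof -
  have "AE \<omega> in M. \<forall>t\<ge>0. \<Theta> k t \<omega> - (\<integral>\<omega>'. \<Theta> k t \<omega>' \<partial>M) = relax drift (\<lambda>t. I k t \<omega>) t" if "k \<ge> 1" for k
  proof -
    interpret S: sphere_bm M "F k" \<Theta>0 "B k" "I k" "\<Theta> k" by (rule sphere[OF that])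
    show ?thesis using S.AE_centred by (simp add: S.c_def drift_def)
  qed
  then have "AE \<omega> in M. \<forall>k\<in>{1..K}. \<forall>t\<ge>0. \<Theta> k t \<omega> - (\<integral>\<omega>'. \<Theta> k t \<omega>' \<partial>M) = relax drift (\<lambda>t. I k t \<omega>) t"
    by (intro AE_finite_allI) auto
  then show ?thesis
    using AE_space
  proof eventually_elim
    case (elim \<omega>)
    have Ic: "continuous_on {0..} (\<lambda>t. I k t \<omega>)" if "k \<in> {1..K}" for k
      using sphere_bm.I_cont[OF sphere[of k]] that elim by (simp add: continuous_process_def)
    show ?case
    proof (intro allI impI)
      fix t :: real assume "t \<ge> 0"
      then have "ZK K t \<omega> = (1 / sqrt (real K)) *\<^sub>R (\<Sum>k=1..K. relax drift (\<lambda>t. I k t \<omega>) t)"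
        unfolding ZK_def using elim(1) by (intro arg_cong[where f = "\<lambda>x. _ *\<^sub>R x"] sum.cong) auto
      also have "\<dots> = relax drift (\<lambda>t. MK K t \<omega>) t"
        unfolding MK_def by (rule relax_scaleR_sum[symmetric]) (use Ic in auto)
      finally show "ZK K t \<omega> = relax drift (\<lambda>t. MK K t \<omega>) t" .
    qed
  qed
qed

end

theorem theorem3p1:
  fixes M :: "'w measure" and F :: "nat \<Rightarrow> real \<Rightarrow> 'w measure"
    and \<Theta>0 :: "real^'n"
    and \<Theta> B I :: "nat \<Rightarrow> real \<Rightarrow> 'w \<Rightarrow> real^'n"
    and N :: "'v measure" and G :: "real \<Rightarrow> 'v measure"
    and \<beta> J :: "real \<Rightarrow> 'v \<Rightarrow> real"
    and B' L Minf :: "real \<Rightarrow> 'v \<Rightarrow> real^'n"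
  assumes dim: "CARD('n) \<ge> 2"
    and start: "\<Theta>0 \<in> sphere 0 1"
    and M: "prob_space M"
    and sphere_bm: "\<And>k. k \<ge> 1 \<Longrightarrow> sphere_brownian_motion M (F k) \<Theta>0 (B k) (I k) (\<Theta> k)"
    and indep: "prob_space.indep_vars M (\<lambda>_. path_borel)
                  (\<lambda>k. trajectory (\<lambda>t \<omega>. (\<Theta> k t \<omega>, B k t \<omega>))) {1..}"
    and ident: "\<And>k. k \<ge> 1 \<Longrightarrow>
                  law M (\<lambda>t \<omega>. (\<Theta> k t \<omega>, B k t \<omega>)) = law M (\<lambda>t \<omega>. (\<Theta> 1 t \<omega>, B 1 t \<omega>))"
    and N: "prob_space N"
    and beta: "brownian_motion N G UNIV \<beta>"
    and B': "brownian_motion N G {x. \<Theta>0 \<bullet> x = 0} B'"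
    and indep_beta_B': "prob_space.indep_set N
                  (sets (vimage_algebra (space N) (trajectory \<beta>) path_borel))
                  (sets (vimage_algebra (space N) (trajectory B') path_borel))"
    and J: "stochastic_integral N G (*\<^sub>R) (\<lambda>s _. sqrt (1 - exp (- real CARD('n) * s))) \<beta> J"
    and L: "stochastic_integral N G (*\<^sub>R)
              (\<lambda>s _. sqrt (1 + exp (- real CARD('n) * s) / (real CARD('n) - 1))) B' L"
    and Minf: "\<And>t \<omega>. Minf t \<omega> = sqrt (1 - 1 / real CARD('n)) *\<^sub>R (J t \<omega> *\<^sub>R \<Theta>0 + L t \<omega>)"
  shows "converges_in_law M (\<lambda>K t \<omega>. (1 / sqrt (real K)) *\<^sub>R (\<Sum>k=1..K. I k t \<omega>)) N Minf
    \<and> (\<forall>Q. stochastic_integral N G (*\<^sub>R) (\<lambda>s _. exp ((real CARD('n) - 1) / 2 * s)) Minf Q \<longrightarrow>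
         converges_in_law M
           (\<lambda>K t \<omega>. (1 / sqrt (real K)) *\<^sub>R (\<Sum>k=1..K. \<Theta> k t \<omega> - (\<integral>\<omega>'. \<Theta> k t \<omega>' \<partial>M)))
           N (\<lambda>t \<omega>. exp (- (real CARD('n) - 1) / 2 * t) *\<^sub>R Q t \<omega>))"
proof -
  have n\<Theta>: "norm \<Theta>0 = 1" using start by simp
  interpret A: iid_spheres M F \<Theta>0 \<Theta> B I
    by (intro iid_spheres.intro iid_spheres_axioms.intro M n\<Theta> sphere_bm indep ident)
  interpret C: limit_process N G \<Theta>0 \<beta> J B' L Minf
    by (intro limit_process.intro limit_process_axioms.intro N dim n\<Theta> beta B' indep_beta_B' J L Minf)
  have a: "converges_in_law M (\<lambda>K t \<omega>. (1 / sqrt (real K)) *\<^sub>R (\<Sum>k=1..K. I k t \<omega>)) N Minf"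
    by (rule martingale_convergence[OF A.iid_spheres_axioms C.limit_process_axioms])
  have c: "A.drift \<ge> 0" using dim by (simp add: A.drift_def)
  have b: "converges_in_law M
           (\<lambda>K t \<omega>. (1 / sqrt (real K)) *\<^sub>R (\<Sum>k=1..K. \<Theta> k t \<omega> - (\<integral>\<omega>'. \<Theta> k t \<omega>' \<partial>M)))
           N (\<lambda>t \<omega>. exp (- (real CARD('n) - 1) / 2 * t) *\<^sub>R Q t \<omega>)"
    if Q: "stochastic_integral N G (*\<^sub>R) (\<lambda>s _. exp ((real CARD('n) - 1) / 2 * s)) Minf Q" for Q
  proof -
    have e: "exp (- (real CARD('n) - 1) / 2 * t) = exp (- (A.drift * t))" for t
      by (rule arg_cong[where f = exp]) (simp add: A.drift_def field_simps)
    have Q': "stochastic_integral N G (*\<^sub>R) (\<lambda>s _. exp (A.drift * s)) Minf Q"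
      using Q by (simp add: A.drift_def)
    have W: "continuous_process N (\<lambda>t \<omega>. exp (- (A.drift * t)) *\<^sub>R Q t \<omega>)"
      using stochastic_integralD(5)[OF Q']
      by (auto simp: continuous_process_def intro!: continuous_on_scaleR continuous_intros borel_measurable_scaleR borel_measurable_const)
    have "converges_in_law M A.ZK N (\<lambda>t \<omega>. exp (- (A.drift * t)) *\<^sub>R Q t \<omega>)"
      by (rule converges_in_law_relax[OF a[folded A.MK_def[abs_def]] c A.ZK_continuous W A.AE_ZK
            C.stochastic_integral_exp[OF Q' C.Minf_0 c]])
    then show ?thesis by (simp only: A.ZK_def[abs_def] e)
  qed
  show ?thesis using a b by blast
qed

end
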